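(* Let $\Omega\subset\mathbb{R}^n$ ($n\ge2$) be a bounded domain and let $\phi\in\Phi_{\mathrm w}(\Omega)$ satisfy (A0), (aInc)$_p$, (aDec)$_q$ (constant $L$) and (A1-$s$) (constant $L_\omega$) with $1<p\le q$ and $s\in(1,n]$. Assume that $u\in W^{1,\phi}_{\mathrm{loc}}(\Omega)$ is a quasiminimizer with constant $Q$ and one of the following holds: \begin{enumerate} \item $s=n$ and $u\in BMO(\Omega)$; \item $s\in(n(1-\frac pq),n)$ and $u\in L^{s^*}(\Omega)$, $s^*=\frac{ns}{n-s}$. \end{enumerate} Then for every $\Omega'\Subset\Omega$ there exists $\gamma\in(0,1)$ depending only on $n,p,q,L,L_\omega,Q$ and $\Omega'$ such that $u\in C^{0,\gamma}(\Omega')$.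
   Context: For $\phi:\Omega\times[0,\infty)\to[0,\infty)$, $\gamma\in\mathbb{R}$, constant $L\ge1$: (aInc)$_\gamma$: $\phi(x,s)/s^\gamma\le L\phi(x,t)/t^\gamma$ for $0<s\le t$; (aDec)$_\gamma$: $\phi(x,t)/t^\gamma\le L\phi(x,s)/s^\gamma$ for $0<s\le t$; (A0): $L^{-1}\le\phi(x,1)\le L$. $\Phi_{\mathrm w}(\Omega)$: functions with $x\mapsto\phi(x,|f(x)|)$ measurable for measurable $f$, $t\mapsto\phi(x,t)$ increasing, $\phi(x,0)=\lim_{t\to0^+}\phi(x,t)=0$, $\lim_{t\to\infty}\phi(x,t)=\infty$, and (aInc)$_1$. (A1-$s$): there is $L_\omega>0$ such that for all $r\in(0,1]$, all balls $B_r$, $x,y\in B_r\cap\Omega$ and $t\ge0$ with $t^s\le|B_r|^{-1}$: $|\phi(x,t)-\phi(y,t)|\le L_\omega(\phi(y,t)+1)$. $L^\phi(\Omega)$ is the space of measurable $f$ with finite Luxemburg norm $\|f\|_{L^\phi}=\inf\{\lambda>0:\int_\Omega\phi(x,|f|/\lambda)dx\le1\}$; $W^{1,\phi}(\Omega)$ consists of $f\in W^{1,1}(\Omega)$ with $f,|Df|\in L^\phi(\Omega)$, and $W^{1,\phi}_{\mathrm{loc}}$ its local version. $u\in W^{1,\phi}_{\mathrm{loc}}(\Omega)$ is a quasiminimizer with constant $Q\ge1$ if $\int_{\operatorname{supp}(u-v)}\phi(x,|Du|)\,dx\le Q\int_{\operatorname{supp}(u-v)}\phi(x,|Dv|)\,dx$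 for every $v\in W^{1,\phi}_{\mathrm{loc}}(\Omega)$ with $\operatorname{supp}(u-v)\Subset\Omega$. *)

theory Defs
  imports "HOL-Analysis.Analysis"
begin

(* C^infinity functions on the whole space: a family D of iterated partial derivatives,
   D [] = f, and each D vs is (Frechet) differentiable with partials D (i # vs). *)
definition smooth_fun :: "('a::euclidean_space \<Rightarrow> real) \<Rightarrow> bool" where
  "smooth_fun f \<longleftrightarrow> (\<exists>D :: 'a list \<Rightarrow> 'a \<Rightarrow> real. D [] = f \<and>
     (\<forall>vs x. (D vs has_derivative (\<lambda>h. \<Sum>i\<in>Basis. (h \<bullet> i) * D (i # vs) x)) (at x)))"

(* test functions C_c^infinity(U) (extended by zero to the whole space) *)
definition test_fun :: "'a::euclidean_space set \<Rightarrow> ('a \<Rightarrow> real) \<Rightarrow> bool" where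
  "test_fun U \<psi> \<longleftrightarrow> smooth_fun \<psi> \<and> compact (closure {x. \<psi> x \<noteq> 0}) \<and> closure {x. \<psi> x \<noteq> 0} \<subseteq> U"

definition loc_integrable :: "'a::euclidean_space set \<Rightarrow> ('a \<Rightarrow> real) \<Rightarrow> bool" where
  "loc_integrable U f \<longleftrightarrow> (\<forall>K. compact K \<and> K \<subseteq> U \<longrightarrow> set_integrable lebesgue K f)"

definition weak_grad :: "'a::euclidean_space set \<Rightarrow> ('a \<Rightarrow> real) \<Rightarrow> ('a \<Rightarrow> 'a) \<Rightarrow> bool" where
  "weak_grad U f g \<longleftrightarrow> loc_integrable U f \<and> (\<forall>i\<in>Basis. loc_integrable U (\<lambda>x. g x \<bullet> i)) \<and>
     (\<forall>\<psi> i. test_fun U \<psi> \<and> i \<in> Basis \<longrightarrow>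
        (\<integral>x\<in>U. f x * frechet_derivative \<psi> (at x) i \<partial>lebesgue)
          = - (\<integral>x\<in>U. (g x \<bullet> i) * \<psi> x \<partial>lebesgue))"

definition modular :: "('a::euclidean_space \<Rightarrow> real \<Rightarrow> real) \<Rightarrow> 'a set \<Rightarrow> ('a \<Rightarrow> real) \<Rightarrow> ennreal" where
  "modular \<phi> U f = (\<integral>\<^sup>+x\<in>U. ennreal (\<phi> x \<bar>f x\<bar>) \<partial>lebesgue)"

(* f in L^phi(U): measurable with finite Luxemburg norm *)
definition in_Lphi :: "('a::euclidean_space \<Rightarrow> real \<Rightarrow> real) \<Rightarrow> 'a set \<Rightarrow> ('a \<Rightarrow> real) \<Rightarrow> bool" where
  "in_Lphi \<phi> U f \<longleftrightarrow> f \<in> borel_measurable (lebesgue_on U) \<and>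
     (\<exists>c>0. modular \<phi> U (\<lambda>x. f x / c) \<le> 1)"

definition in_W1phi :: "('a::euclidean_space \<Rightarrow> real \<Rightarrow> real) \<Rightarrow> 'a set \<Rightarrow> ('a \<Rightarrow> real) \<Rightarrow> bool" where
  "in_W1phi \<phi> U f \<longleftrightarrow> (\<exists>g. weak_grad U f g \<and> set_integrable lebesgue U f \<and>
     set_integrable lebesgue U (\<lambda>x. norm (g x)) \<and>
     in_Lphi \<phi> U f \<and> in_Lphi \<phi> U (\<lambda>x. norm (g x)))"

definition cpt_sub :: "'a::metric_space set \<Rightarrow> 'a set \<Rightarrow> bool" (infix "\<Subset>" 50) where
  "U \<Subset> V \<longleftrightarrow> compact (closure U) \<and> closure U \<subseteq> V"

definition in_W1phi_loc :: "('a::euclidean_space \<Rightarrow> real \<Rightarrow> real) \<Rightarrow> 'a set \<Rightarrow> ('a \<Rightarrow> real) \<Rightarrow> bool" where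
  "in_W1phi_loc \<phi> \<Omega> f \<longleftrightarrow> (\<forall>U. open U \<and> U \<Subset> \<Omega> \<longrightarrow> in_W1phi \<phi> U f)"

definition aInc :: "real \<Rightarrow> real \<Rightarrow> 'a set \<Rightarrow> ('a \<Rightarrow> real \<Rightarrow> real) \<Rightarrow> bool" where
  "aInc \<gamma> L \<Omega> \<phi> \<longleftrightarrow> (\<forall>x\<in>\<Omega>. \<forall>s t. 0 < s \<and> s \<le> t \<longrightarrow> \<phi> x s / s powr \<gamma> \<le> L * (\<phi> x t / t powr \<gamma>))"

definition aDec :: "real \<Rightarrow> real \<Rightarrow> 'a set \<Rightarrow> ('a \<Rightarrow> real \<Rightarrow> real) \<Rightarrow> bool" where
  "aDec \<gamma> L \<Omega> \<phi> \<longleftrightarrow> (\<forall>x\<in>\<Omega>. \<forall>s t. 0 < s \<and> s \<le> t \<longrightarrow> \<phi> x t / t powr \<gamma> \<le> L * (\<phi> x s / s powr \<gamma>))"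

definition A0 :: "real \<Rightarrow> 'a set \<Rightarrow> ('a \<Rightarrow> real \<Rightarrow> real) \<Rightarrow> bool" where
  "A0 L \<Omega> \<phi> \<longleftrightarrow> (\<forall>x\<in>\<Omega>. 1 / L \<le> \<phi> x 1 \<and> \<phi> x 1 \<le> L)"

definition Phi_w :: "'a::euclidean_space set \<Rightarrow> ('a \<Rightarrow> real \<Rightarrow> real) \<Rightarrow> bool" where
  "Phi_w \<Omega> \<phi> \<longleftrightarrow>
     (\<forall>x\<in>\<Omega>. \<forall>t\<ge>0. \<phi> x t \<ge> 0) \<and>
     (\<forall>f. f \<in> borel_measurable (lebesgue_on \<Omega>) \<longrightarrow>
          (\<lambda>x. \<phi> x \<bar>f x\<bar>) \<in> borel_measurable (lebesgue_on \<Omega>)) \<and>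
     (\<forall>x\<in>\<Omega>. mono_on {0..} (\<phi> x)) \<and>
     (\<forall>x\<in>\<Omega>. \<phi> x 0 = 0 \<and> (\<phi> x \<longlongrightarrow> 0) (at_right 0) \<and> filterlim (\<phi> x) at_top at_top) \<and>
     (\<exists>L\<ge>1. aInc 1 L \<Omega> \<phi>)"

definition A1s :: "real \<Rightarrow> real \<Rightarrow> 'a::euclidean_space set \<Rightarrow> ('a \<Rightarrow> real \<Rightarrow> real) \<Rightarrow> bool" where
  "A1s s L\<omega> \<Omega> \<phi> \<longleftrightarrow> L\<omega> > 0 \<and>
     (\<forall>r z x y t. 0 < r \<and> r \<le> 1 \<and> x \<in> ball z r \<inter> \<Omega> \<and> y \<in> ball z r \<inter> \<Omega> \<and> 0 \<le> t \<and>
        t powr s \<le> 1 / measure lebesgue (ball z r) \<longrightarrow>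
        \<bar>\<phi> x t - \<phi> y t\<bar> \<le> L\<omega> * (\<phi> y t + 1))"

definition quasiminimizer :: "('a::euclidean_space \<Rightarrow> real \<Rightarrow> real) \<Rightarrow> 'a set \<Rightarrow> real \<Rightarrow> ('a \<Rightarrow> real) \<Rightarrow> bool" where
  "quasiminimizer \<phi> \<Omega> Q u \<longleftrightarrow> in_W1phi_loc \<phi> \<Omega> u \<and>
     (\<forall>v gu gv. in_W1phi_loc \<phi> \<Omega> v \<and> closure {x\<in>\<Omega>. u x \<noteq> v x} \<Subset> \<Omega> \<and>
        weak_grad \<Omega> u gu \<and> weak_grad \<Omega> v gv \<longrightarrow>
        (\<integral>\<^sup>+x\<in>closure {x\<in>\<Omega>. u x \<noteq> v x}. ennreal (\<phi> x (norm (gu x))) \<partial>lebesgue)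
          \<le> ennreal Q * (\<integral>\<^sup>+x\<in>closure {x\<in>\<Omega>. u x \<noteq> v x}. ennreal (\<phi> x (norm (gv x))) \<partial>lebesgue))"

definition ball_avg :: "('a::euclidean_space \<Rightarrow> real) \<Rightarrow> 'a set \<Rightarrow> real" where
  "ball_avg f B = (\<integral>x\<in>B. f x \<partial>lebesgue) / measure lebesgue B"

definition BMO :: "'a::euclidean_space set \<Rightarrow> ('a \<Rightarrow> real) \<Rightarrow> bool" where
  "BMO \<Omega> u \<longleftrightarrow> loc_integrable \<Omega> u \<and>
     (\<exists>C. \<forall>z r. 0 < r \<and> ball z r \<subseteq> \<Omega> \<longrightarrow>
        ball_avg (\<lambda>x. \<bar>u x - ball_avg u (ball z r)\<bar>) (ball z r) \<le> C)"

definition in_Lp :: "real \<Rightarrow> 'a::euclidean_space set \<Rightarrow> ('a \<Rightarrow> real) \<Rightarrow> bool" where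
  "in_Lp r \<Omega> u \<longleftrightarrow> u \<in> borel_measurable (lebesgue_on \<Omega>) \<and>
     (\<integral>\<^sup>+x\<in>\<Omega>. ennreal (\<bar>u x\<bar> powr r) \<partial>lebesgue) < \<infinity>"

definition holder_on :: "real \<Rightarrow> 'a::euclidean_space set \<Rightarrow> ('a \<Rightarrow> real) \<Rightarrow> bool" where
  "holder_on \<gamma> U w \<longleftrightarrow> bounded (w ` U) \<and>
     (\<exists>C. \<forall>x\<in>U. \<forall>y\<in>U. \<bar>w x - w y\<bar> \<le> C * dist x y powr \<gamma>)"

end

theory Submission
  imports Defs
begin

text \<open>Membership of \<open>u\<close> in BMO or in \<open>L^{s*}\<close> bounds its mean oscillation on a ball of radius \<open>r\<close> by a multiple
  of \<open>r^{1-n/s}\<close>, hence the difference quotients that occur at scale \<open>r\<close> by a multiple of \<open>r^{-n/s}\<close>. This is exactly the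
  range in which (A1-s) makes \<open>\<phi>(x,t)\<close> comparable for different \<open>x\<close> in the ball, so that \<open>\<phi>\<close> may be
  treated there as if it did not depend on \<open>x\<close>. De Giorgi's method then applies. Comparing \<open>u\<close> with
  cut-off truncations and filling the hole gives a Caccioppoli inequality for \<open>(u-k)_+\<close>; a Poincare
  inequality for the same function, obtained by telescoping ball averages, closes an iteration that bounds
  \<open>u\<close> locally. Once \<open>u\<close> is bounded on a ball, either \<open>u\<close> or \<open>-u\<close> is below the midpoint of its range on
  half of the ball, a chain of truncations between the levels \<open>M - \<omega>/2^i\<close> makes one of the high level sets small, and the
  boundedness iteration turns this into a reduction of the oscillation by a fixed factor. The factor depends
  on an upper bound for the oscillation itself; after the oscillation has dropped below 1 it depends only on the data,
  and this gives the exponent.\<close>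

text \<open>The obstacle is that \<phi>(x,t) and \<phi>(y,t) are comparable only for 1 <= t <= K
  r^(-n/s), and that \<phi> is only almost monotone after division by powers. So convexity and
  Sobolev's inequality have to be replaced. Mean values are inserted into \<phi> only after the
  oscillation hypothesis has put them into the admissible range; values below 1 leave additive
  terms, which become measures of level sets. The gain in De Giorgi's iteration comes from the
  radius: Poincare's inequality is used on balls far smaller than the ball of the iteration. This is
  possible because the level set is too thin to fill half of any of them, and passing from the large
  to the small radius in the argument of \<phi> gains a small factor by (aInc). As the chain of
  levels needs difference quotients of size at least 1, one reduction step requires the oscillation
  to exceed a multiple of the radius; otherwise the oscillation is already of the order of the
  radius. The constants behind the exponent depend on n, p, q, L, L\<omega>, Q and the oscillation
  bound K, but not on s, and the exponent is taken at K = 1.\<close>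

text \<open>Notation for integrals over a set (\<open>nn\<close>, \<open>i\<close>) or the whole space (\<open>N\<close>, \<open>I\<close>) with respect to \<open>lborel\<close> (\<open>B\<close>)
 or \<open>lebesgue\<close> (\<open>L\<close>); the forms \<open>i\<close> and \<open>I\<close> take real integrands.\<close>

abbreviation "nnB A f \<equiv> \<integral>\<^sup>+x\<in>A. f x \<partial>lborel"
abbreviation "nnL A f \<equiv> \<integral>\<^sup>+x\<in>A. f x \<partial>lebesgue"
abbreviation "NB f \<equiv> nn_integral lborel f"
abbreviation "NL f \<equiv> nn_integral lebesgue f"
abbreviation "iB A f \<equiv> \<integral>\<^sup>+x\<in>A. ennreal (f x) \<partial>lborel"
abbreviation "iL A f \<equiv> \<integral>\<^sup>+x\<in>A. ennreal (f x) \<partial>lebesgue"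
abbreviation "IB f \<equiv> \<integral>\<^sup>+x. ennreal (f x) \<partial>lborel"
abbreviation "IL f \<equiv> \<integral>\<^sup>+x. ennreal (f x) \<partial>lebesgue"
abbreviation "LB f \<equiv> integral\<^sup>L lborel f"
abbreviation "LL f \<equiv> integral\<^sup>L lebesgue f"
abbreviation "vol A \<equiv> measure lborel A"
abbreviation "partials f D x \<equiv> (f has_derivative (%h. \<Sum>i\<in>Basis. (h \<bullet> i) * D i x)) (at x)"
abbreviation "dosc f B \<equiv> \<integral>\<^sup>+w\<in>B. (\<integral>\<^sup>+y\<in>B. ennreal \<bar>f y - f w\<bar> \<partial>lborel) \<partial>lborel"
abbreviation "dosc' f B \<equiv> \<integral>\<^sup>+y\<in>B. (\<integral>\<^sup>+w\<in>B. ennreal \<bar>f y - f w\<bar> \<partial>lborel) \<partial>lborel"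

section \<open>Smooth functions and mollifiers\<close>

text \<open>A class closed under some choice of partial derivatives certifies smoothness: iterating
  the choice along a list of directions yields the whole tower of derivatives at once.\<close>

lemma smooth_fun_coinduct:
 fixes f :: "'a::euclidean_space => real"
 assumes "f \<in> S"
  and "!!g. g \<in> S ==> \<exists>D. (\<forall>i\<in>Basis. D i \<in> S) \<and>
     (\<forall>x. partials g D x)"
 shows "smooth_fun f"
proof -
 have "\<forall>g\<in>S. \<exists>D. (\<forall>i\<in>Basis. D i \<in> S) \<and>
     (\<forall>x. partials g D x)"
  using assms(2) by blast
 from bchoice[OF this] obtain P where P: "!!g i. g \<in> S ==> i \<in> Basis ==> P g i \<in> S"
  "!!g x. g \<in> S ==> partials g (P g) x"
  by blast
 \<comment> \<open>Entries outside \<open>Basis\<close> are skipped, so that \<open>D vs\<close>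
   stays in \<open>S\<close> for every list.\<close>
 define D where "D vs = foldr (%i g. if i \<in> Basis then P g i else g) vs f" for vs
 have DS: "D vs \<in> S" for vs
  by (induction vs) (auto simp: D_def assms(1) P(1))
 show ?thesis
  unfolding smooth_fun_def
 proof (intro exI[of _ D] conjI allI)
  show "D [] = f" by (simp add: D_def)
  fix vs x
  have "D (i # vs) = P (D vs) i" if "i \<in> Basis" for i
   using that by (simp add: D_def)
  then show "partials (D vs) (%i. D (i # vs)) x"
   using P(2)[OF DS, of vs x] by (simp cong: sum.cong)
 qed
qed

lemma smooth_fun_partials:
 fixes f :: "'a::euclidean_space => real"
 assumes "smooth_fun f"
 obtains D where "!!i. smooth_fun (D i)"
  "!!x. partials f D x"
proof -
 obtain D where D: "D [] = f"
  "!!vs x. partials (D vs) (%i. D (i # vs)) x"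
  using assms unfolding smooth_fun_def by auto
 have "smooth_fun (D [i])" for i
  unfolding smooth_fun_def
 \<comment> \<open>The head of a list is the derivative taken last, so the tower above the
   \<open>i\<close>-th partial appends \<open>i\<close> at the end.\<close>
 proof (intro exI[of _ "%vs. D (vs @ [i])"] conjI allI)
  fix vs x
  show "(D (vs @ [i]) has_derivative (%h. \<Sum>j\<in>Basis. (h \<bullet> j) * D ((j # vs) @ [i]) x)) (at x)"
   using D(2)[of "vs @ [i]" x] by simp
 qed simp
 moreover have "partials f (%i. D [i]) x" for x
  using D(2)[of "[]" x] unfolding D(1) .
 ultimately show thesis by (rule that[of "%i. D [i]"])
qed

inductive_set fun_alg :: "('a::euclidean_space => real) set => ('a => real) set" for B where
 base: "f \<in> B ==> f \<in> fun_alg B"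
| add: "f \<in> fun_alg B ==> g \<in> fun_alg B ==> (%x. f x + g x) \<in> fun_alg B"
| mult: "f \<in> fun_alg B ==> g \<in> fun_alg B ==> (%x. f x * g x) \<in> fun_alg B"

text \<open>By the sum and Leibniz rules the generated algebra is closed under partials as soon as
  the partials of its generators lie in it.\<close>

lemma smooth_fun_alg:
 assumes "!!g. g \<in> B ==> \<exists>D. (\<forall>i\<in>Basis. D i \<in> fun_alg B) \<and>
     (\<forall>x. partials g D x)"
  and "f \<in> fun_alg B"
 shows "smooth_fun f"
 using assms(2)
proof (rule smooth_fun_coinduct)
 fix g assume "g \<in> fun_alg B"
 then show "\<exists>D. (\<forall>i\<in>Basis. D i \<in> fun_alg B) \<and>
     (\<forall>x. partials g D x)"
 proof induction
  case (base f) then show ?case using assms(1) by blast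
 next
  case (add f g)
  then obtain D E where DE: "\<forall>i\<in>Basis. D i \<in> fun_alg B" "\<forall>i\<in>Basis. E i \<in> fun_alg B"
   "!!x. partials f D x"
   "!!x. partials g E x" by auto
  show ?case
   by (rule exI[of _ "%i x. D i x + E i x"])
    (use DE in \<open>auto intro!: fun_alg.add has_derivative_eq_rhs[OF has_derivative_add] simp: distrib_left sum.distrib\<close>)
 next
  case (mult f g)
  then obtain D E where DE: "\<forall>i\<in>Basis. D i \<in> fun_alg B" "\<forall>i\<in>Basis. E i \<in> fun_alg B"
   "!!x. partials f D x"
   "!!x. partials g E x" by auto
  show ?case
   by (rule exI[of _ "%i x. f x * E i x + D i x * g x"])
    (use DE mult in \<open>auto intro!: fun_alg.add fun_alg.mult has_derivative_eq_rhs[OF has_derivative_mult]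
      simp: distrib_left sum.distrib sum_distrib_left sum_distrib_right mult_ac\<close>)
 qed
qed

lemma smooth_fun_const: "smooth_fun (%x::'a::euclidean_space. c::real)"
proof (rule smooth_fun_coinduct[where S="range (%c x. c)"])
 fix g :: "'a => real" assume "g \<in> range (%c x. c)"
 then show "\<exists>D. (\<forall>i\<in>Basis. D i \<in> range (%c x. c)) \<and>
     (\<forall>x. partials g D x)"
  by (intro exI[of _ "%i x. 0"]) auto
qed auto

lemma smooth_fun_add_mult:
 assumes "smooth_fun f" "smooth_fun g"
 shows smooth_fun_add: "smooth_fun (%x. f x + g x)"
  and smooth_fun_mult: "smooth_fun (%x. f x * g x)"
proof -
 have *: "h \<in> fun_alg (Collect smooth_fun) ==> smooth_fun h" for h :: "'a => real"
 proof (rule smooth_fun_alg)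
  fix g :: "'a => real" assume "g \<in> Collect smooth_fun"
  then obtain D where "!!i. smooth_fun (D i)"
   "!!x. partials g D x"
   using smooth_fun_partials by blast
  then show "\<exists>D. (\<forall>i\<in>Basis. D i \<in> fun_alg (Collect smooth_fun)) \<and>
     (\<forall>x. partials g D x)"
   by (intro exI[of _ D]) (auto intro: fun_alg.base)
 qed
 show "smooth_fun (%x. f x + g x)" "smooth_fun (%x. f x * g x)"
  by (rule *, rule fun_alg.add fun_alg.mult; rule fun_alg.base; simp add: assms)+
qed

lemma smooth_fun_affine:
 fixes f :: "'a::euclidean_space => real"
 assumes "smooth_fun f"
 shows "smooth_fun (%x. f (z + a *\<^sub>R x))"
proof -
 obtain D where D: "D [] = f"
  "!!vs x. partials (D vs) (%i. D (i # vs)) x"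
  using assms unfolding smooth_fun_def by auto
 show ?thesis unfolding smooth_fun_def
 proof (intro exI[of _ "%vs x. a ^ length vs * D vs (z + a *\<^sub>R x)"] conjI allI)
  fix vs x
  have "((%x. D vs (z + a *\<^sub>R x)) has_derivative
   (%h. \<Sum>i\<in>Basis. ((a *\<^sub>R h) \<bullet> i) * D (i # vs) (z + a *\<^sub>R x))) (at x)"
   by (rule has_derivative_compose[OF _ D(2)]) (auto intro!: derivative_eq_intros)
  from has_derivative_mult_right[OF this, of "a ^ length vs"]
  show "((%x. a ^ length vs * D vs (z + a *\<^sub>R x)) has_derivative
   (%h. \<Sum>i\<in>Basis. (h \<bullet> i) * (a ^ length (i # vs) * D (i # vs) (z + a *\<^sub>R x)))) (at x)"
   by (simp add: sum_distrib_left mult_ac)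
 qed (simp add: D)
qed

text \<open>The index \<open>k\<close> makes the family stable under differentiation up to linear
  combinations; \<open>k = 0\<close> is the classical flat function from which \<open>bump\<close>
  is built.\<close>

definition exp_inv :: "nat => real => real" where
 "exp_inv k t = (if t > 0 then exp (- (1 / t)) / t ^ k else 0)"

text \<open>A single term, of degree \<open>k + 2\<close>, of the exponential series at 1/t already
  gives the estimate. Quadratic decay is what makes the derivative at 0 exist and vanish.\<close>

lemma exp_inv_bound: "\<bar>exp_inv k t\<bar> <= fact (k + 2) * t\<^sup>2"
proof (cases "t > 0")
 case True
 have "(1/t) ^ (k+2) / fact (k+2) <= exp (1/t)"
 proof -
  have "(\<Sum>n\<in>{k+2}. (1/t) ^ n /\<^sub>R fact n) <= (\<Sum>n. (1/t) ^ n /\<^sub>R fact n)"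
   by (rule sum_le_suminf) (use True summable_exp_generic[of "1/t"] in auto)
  then show ?thesis by (simp add: exp_def field_simps)
 qed
 moreover define c where "c = (fact (k+2) :: real)"
 moreover define a where "a = t ^ (k+2)"
 ultimately have "1 / a / c <= exp (1/t)" "a > 0" "c > 0"
  using True by (auto simp: power_one_over simp del: fact_Suc)
 then have "exp (-(1/t)) <= c * a"
  by (simp add: exp_minus field_simps)
 then have "exp (-(1/t)) / t ^ k <= c * t\<^sup>2"
  using True by (simp add: field_simps power_add a_def power2_eq_square)
 then show ?thesis using True by (simp add: exp_inv_def c_def del: fact_Suc)
qed (simp add: exp_inv_def del: fact_Suc)

lemma exp_inv_deriv:
 "(exp_inv k has_real_derivative (- real k * exp_inv (k+1) t + exp_inv (k+2) t)) (at t)"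
proof (cases t "0::real" rule: linorder_cases)
 case less
 have "(exp_inv k has_real_derivative 0) (at t)"
  by (rule has_field_derivative_transform_within_open[where f="%_. 0" and S="{..<0}"])
   (use less in \<open>auto simp: exp_inv_def\<close>)
 then show ?thesis using less by (simp add: exp_inv_def)
next
 case equal
 have "(exp_inv k has_real_derivative 0) (at 0)"
  unfolding has_field_derivative_def has_derivative_at
 proof (intro conjI)
  show "bounded_linear ((*) (0::real))" by (rule bounded_linear_mult_right)
  have "((%h::real. fact (k+2) * \<bar>h\<bar>) \<longlongrightarrow> fact (k+2) * \<bar>0\<bar>) (at 0)"
   by (intro tendsto_intros)
  then have "((%h::real. fact (k+2) * \<bar>h\<bar>) \<longlongrightarrow> 0) (at 0)" by simp
  then show "(%h. norm (exp_inv k (0 + h) - exp_inv k 0 - 0 * h) / norm h) \<midarrow>0\<rightarrow> 0"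
  proof (rule Lim_null_comparison[rotated])
   show "\<forall>\<^sub>F x in at 0. norm (norm (exp_inv k (0 + x) - exp_inv k 0 - 0 * x) / norm x) <= fact (k + 2) * \<bar>x\<bar>"
   proof (rule eventuallyI)
    fix x :: real
    have "\<bar>exp_inv k x\<bar> <= fact (k+2) * \<bar>x\<bar> * \<bar>x\<bar>"
     using exp_inv_bound[of k x] by (simp add: power2_eq_square)
    then show "norm (norm (exp_inv k (0 + x) - exp_inv k 0 - 0 * x) / norm x) <= fact (k + 2) * \<bar>x\<bar>"
     by (cases "x = 0") (auto simp: exp_inv_def[of k 0] divide_le_eq)
   qed
  qed
 qed
 then show ?thesis using equal by (simp add: exp_inv_def)
next
 case greater
 have "((%t. exp (- (1 / t)) / t ^ k) has_real_derivative
  (- real k * exp_inv (k+1) t + exp_inv (k+2) t)) (at t)"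
  using greater
 proof (cases k)
  case 0 then show ?thesis using greater
   by (auto intro!: derivative_eq_intros simp: exp_inv_def field_simps power2_eq_square)
 next
  case (Suc m)
  show ?thesis unfolding Suc using greater
   by (auto intro!: derivative_eq_intros simp: exp_inv_def divide_simps simp del: power_Suc)
    (simp add: algebra_simps power2_eq_square)
 qed
 then show ?thesis
  by (rule has_field_derivative_transform_within_open[where S="{0<..}"])
   (use greater in \<open>auto simp: exp_inv_def\<close>)
qed

definition bump :: "'a::euclidean_space => real" where
 "bump x = exp_inv 0 (1 - x \<bullet> x)"

lemma smooth_bump: "smooth_fun (bump :: 'a::euclidean_space => real)"
proof (rule smooth_fun_alg)
 \<comment> \<open>Differentiating an exponential generator produces higher indices times a
   coordinate, hence constants and coordinates are generators too.\<close>
 define B :: "('a => real) set" where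
  "B = range (%c x. c) \<union> range (%i x. x \<bullet> i) \<union> range (%k x. exp_inv k (1 - x \<bullet> x))"
 show "bump \<in> fun_alg B" by (rule fun_alg.base) (auto simp: B_def bump_def[abs_def])
 have cB: "(%x. c) \<in> fun_alg B" for c by (rule fun_alg.base) (auto simp: B_def)
 have iB: "(%x. x \<bullet> i) \<in> fun_alg B" for i by (rule fun_alg.base) (auto simp: B_def)
 have eB: "(%x. exp_inv k (1 - x \<bullet> x)) \<in> fun_alg B" for k by (rule fun_alg.base) (auto simp: B_def)
 fix g assume "g \<in> B"
 then consider c where "g = (%x. c)" | i where "g = (%x. x \<bullet> i)"
  | k where "g = (%x. exp_inv k (1 - x \<bullet> x))" unfolding B_def by blast
 then show "\<exists>D. (\<forall>i\<in>Basis. D i \<in> fun_alg B) \<and>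
     (\<forall>x. partials g D x)"
 proof cases
  case 1 then show ?thesis by (intro exI[of _ "%i x. 0"]) (auto intro: cB)
 next
  case (2 j) then show ?thesis
   by (intro exI[of _ "%i x. j \<bullet> i"])
    (auto intro!: cB derivative_eq_intros simp: euclidean_inner[of _ j])
 next
  case (3 k)
  let ?D = "%i x. (2 * real k * exp_inv (k+1) (1 - x \<bullet> x) + (-2) * exp_inv (k+2) (1 - x \<bullet> x)) * (x \<bullet> i)"
  have "partials g ?D x" for x :: 'a
  proof -
   have "((%x. 1 - x \<bullet> x) has_derivative (%h. - 2 * (x \<bullet> h))) (at x)"
    by (auto intro!: derivative_eq_intros simp: inner_commute)
   from has_derivative_compose[OF this exp_inv_deriv[unfolded has_field_derivative_def]]
   show ?thesis unfolding 3
   proof (rule has_derivative_eq_rhs, intro ext)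
    fix h
    let ?c = "2 * real k * exp_inv (k+1) (1 - x \<bullet> x) + (-2) * exp_inv (k+2) (1 - x \<bullet> x)"
    have "(\<Sum>i\<in>Basis. (h \<bullet> i) * (?c * (x \<bullet> i))) = ?c * (x \<bullet> h)"
     by (subst euclidean_inner[of x h], subst sum_distrib_left) (rule sum.cong, auto)
    then show "(- real k * exp_inv (k + 1) (1 - x \<bullet> x) + exp_inv (k + 2) (1 - x \<bullet> x)) * (- 2 * (x \<bullet> h)) =
     (\<Sum>i\<in>Basis. (h \<bullet> i) * (?c * (x \<bullet> i)))"
     by (simp only:) (simp add: algebra_simps)
   qed
  qed
  then show ?thesis
   by (intro exI[of _ ?D] conjI ballI allI) (rule fun_alg.mult fun_alg.add cB eB iB | assumption)+
 qed
qed

lemma bump_nonneg: "bump x \<ge> 0" by (simp add: bump_def exp_inv_def)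
lemma bump_outside: "norm x \<ge> 1 ==> bump x = 0"
 using power_mono[of 1 "norm x" 2] by (auto simp: bump_def exp_inv_def dot_square_norm not_less)
lemma bump_pos: "norm x < 1 ==> bump x > 0"
 by (simp add: bump_def exp_inv_def dot_square_norm power_less_one_iff abs_square_less_1)

lemma smooth_fun_continuous: "smooth_fun f ==> continuous_on S f"
 by (rule smooth_fun_partials[of f])
  (auto intro!: continuous_at_imp_continuous_on intro: has_derivative_continuous)

lemma continuous_compact_support_integrable:
 fixes f :: "'a::euclidean_space => 'b::euclidean_space"
 assumes "continuous_on UNIV f" "!!x. norm x > R ==> f x = 0"
 shows "integrable lborel f"
proof -
 have "set_integrable lborel (cball 0 R) f"
  by (rule borel_integrable_compact[unfolded set_integrable_def[symmetric]])
   (use assms(1) in \<open>auto intro: continuous_on_subset\<close>)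
 moreover have "indicat_real (cball 0 R) x *\<^sub>R f x = f x" for x
  using assms(2)[of x] by (auto simp: indicator_def)
 ultimately show ?thesis by (simp add: set_integrable_def)
qed

lemma bump_measurable[measurable]: "bump \<in> borel_measurable borel"
 by (rule borel_measurable_continuous_onI[OF smooth_fun_continuous[OF smooth_bump]])

lemma bump_integral_pos: "integral\<^sup>L lborel (bump::'a::euclidean_space=>real) > 0"
proof -
 have c: "continuous_on UNIV (bump::'a=>real)" by (simp add: smooth_bump smooth_fun_continuous)
 have i: "integrable lborel (bump::'a=>real)"
  by (rule continuous_compact_support_integrable[OF c, of 1]) (simp add: bump_outside)
 have "integral\<^sup>L lborel (bump::'a=>real) \<noteq> 0"
 proof
  assume "integral\<^sup>L lborel (bump::'a=>real) = 0"
  then have "AE x in lborel. (bump (x::'a)) = 0"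
   using integral_nonneg_eq_0_iff_AE[OF i] by (auto simp: bump_nonneg)
  then have "AE x in lborel. x \<notin> ball (0::'a) 1"
   by eventually_elim (use bump_pos in fastforce)
  then have "emeasure lborel (ball (0::'a) 1) = 0"
   by (subst (asm) AE_iff_measurable[of "ball 0 1"]) auto
  then show False using unit_ball_vol_pos[of "real DIM('a)"]
   by (auto simp: emeasure_ball ennreal_eq_0_iff not_less dest: leD)
 qed
 moreover have "integral\<^sup>L lborel (bump::'a=>real) \<ge> 0"
  by (rule Bochner_Integration.integral_nonneg) (rule bump_nonneg)
 ultimately show ?thesis by simp
qed

definition kern :: "real => 'a::euclidean_space => real" where
 "kern e x = bump (x /\<^sub>R e) / (e ^ DIM('a) * integral\<^sup>L lborel (bump::'a=>real))"

lemma kern_nonneg: "e > 0 ==> kern e x \<ge> 0"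
 using bump_integral_pos by (simp add: kern_def bump_nonneg less_imp_le)

lemma kern_outside: "e > 0 ==> norm x \<ge> e ==> kern e x = 0"
 by (simp add: kern_def bump_outside field_simps)

lemma smooth_kern: "smooth_fun (kern e)"
proof -
 have "smooth_fun (%x. bump (0 + inverse e *\<^sub>R x) * inverse (e ^ DIM('a) * integral\<^sup>L lborel (bump::'a=>real)))"
  by (rule smooth_fun_mult[OF smooth_fun_affine[OF smooth_bump] smooth_fun_const])
 then show ?thesis by (simp add: kern_def[abs_def] divide_inverse)
qed

lemma lborel_integral_affine:
 fixes f :: "'a::euclidean_space => 'b::euclidean_space"
 assumes f: "f \<in> borel_measurable borel" and c: "c \<noteq> 0"
 shows "LB (%x. f x) = \<bar>c\<bar> ^ DIM('a) *\<^sub>R (LB (%x. f (t + c *\<^sub>R x)))"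
 using f by (subst lborel_affine[OF c, of t]) (simp add: integral_density integral_distr)

lemma lborel_nn_integral_affine:
 fixes f :: "'a::euclidean_space => ennreal"
 assumes f: "f \<in> borel_measurable borel" and c: "c \<noteq> 0"
 shows "NB (%x. f x) = ennreal (\<bar>c\<bar> ^ DIM('a)) * NB (%x. f (t + c *\<^sub>R x))"
 using f by (subst lborel_affine[OF c, of t]) (simp add: nn_integral_density nn_integral_distr nn_integral_cmult)

lemma kern_continuous: "continuous_on S (kern e)"
 using smooth_kern smooth_fun_continuous by blast

lemma kern_measurable[measurable]: "kern e \<in> borel_measurable borel"
 by (rule borel_measurable_continuous_onI) (rule kern_continuous)

lemma kern_integrable: "e > 0 ==> integrable lborel (kern e)"
 by (rule continuous_compact_support_integrable[OF kern_continuous, of e]) (simp add: kern_outside)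

lemma kern_integral:
 assumes "e > 0" shows "LB (%x. kern e (x::'a::euclidean_space)) = 1"
proof -
 have "LB (%x. bump (x::'a)) = \<bar>inverse e\<bar> ^ DIM('a) *\<^sub>R (LB (%x. bump (0 + inverse e *\<^sub>R (x::'a))))"
  by (rule lborel_integral_affine) (use assms in auto)
 moreover define J where "J = LB (%x. bump (x /\<^sub>R e :: 'a))"
 ultimately have "LB (%x. bump (x::'a)) * e ^ DIM('a) = J"
  using assms by (simp add: power_inverse)
 moreover have "LB (%x. kern e (x::'a)) = J / (e ^ DIM('a) * LB (%x. bump (x::'a)))"
  by (simp add: kern_def J_def)
 moreover have "LB (%x. bump (x::'a)) * e ^ DIM('a) > 0"
  using assms bump_integral_pos[where 'a='a] by simp
 ultimately show ?thesis by (simp add: mult.commute split: if_splits)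
qed

definition kern_const :: "'a::euclidean_space itself => real" where
 "kern_const _ = 1 / integral\<^sup>L lborel (bump::'a=>real)"

lemma kern_le:
 fixes x :: "'a::euclidean_space"
 assumes "e > 0" shows "kern e x <= kern_const TYPE('a) / e ^ DIM('a)"
proof -
 have "bump (x /\<^sub>R e) <= 1" by (simp add: bump_def exp_inv_def)
 then show ?thesis using assms bump_integral_pos[where 'a='a]
  by (simp add: kern_def kern_const_def field_simps)
qed

section \<open>Compactly supported continuously differentiable functions\<close>

text \<open>Once continuously differentiable functions, rather than smooth ones, because the class
  must survive composition with the C^1 functions in \<open>W_chain\<close>. The gradient is an
  argument of its own, so that function and gradient can be approximated separately.\<close>

definition C1c :: "('a::euclidean_space => real) => ('a => 'a) => bool" where
 "C1c F DF \<longleftrightarrow> (\<forall>x. (F has_derivative (%h. DF x \<bullet> h)) (at x)) \<and> continuous_on UNIV DF \<and>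
  (\<exists>R. \<forall>x. R < norm x --> F x = 0 \<and> DF x = 0)"

lemma C1cD:
 assumes "C1c F DF"
 shows "(F has_derivative (%h. DF x \<bullet> h)) (at x)" "continuous_on UNIV DF" "continuous_on UNIV F"
  "integrable lborel F" "integrable lborel DF" "F \<in> borel_measurable borel" "DF \<in> borel_measurable borel"
  "\<exists>R>0. \<forall>x. R < norm x --> F x = 0 \<and> DF x = 0"
proof -
 have a: "(F has_derivative (%h. DF x \<bullet> h)) (at x)" for x using assms by (auto simp: C1c_def)
 show "(F has_derivative (%h. DF x \<bullet> h)) (at x)" by fact
 show b: "continuous_on UNIV DF" using assms by (auto simp: C1c_def)
 show c: "continuous_on UNIV F"
  using a by (meson continuous_at_imp_continuous_on has_derivative_continuous)
 obtain R where R: "!!x. R < norm x ==> F x = 0 \<and> DF x = 0" using assms by (auto simp: C1c_def)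
 show "integrable lborel F" "integrable lborel DF"
  by (rule continuous_compact_support_integrable[of _ R]; use b c R in blast)+
 show "F \<in> borel_measurable borel" "DF \<in> borel_measurable borel"
  using b c by (auto intro: borel_measurable_continuous_onI)
 show "\<exists>R>0. \<forall>x. R < norm x --> F x = 0 \<and> DF x = 0"
  by (rule exI[of _ "max R 1"]) (use R in auto)
qed

lemma C1c_bounded:
 assumes "C1c F DF" shows "\<exists>B. \<forall>x. \<bar>F x\<bar> <= B \<and> norm (DF x) <= B"
proof -
 obtain R where R: "R > 0" "!!x. R < norm x ==> F x = 0 \<and> DF x = 0" using C1cD(8)[OF assms] by auto
 have "bounded (F ` cball 0 R)" "bounded (DF ` cball 0 R)"
  by (meson C1cD(2,3)[OF assms] compact_cball compact_continuous_image compact_imp_bounded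
    continuous_on_subset top_greatest)+
 then obtain B1 B2 where "\<forall>x\<in>cball 0 R. norm (F x) <= B1" "\<forall>x\<in>cball 0 R. norm (DF x) <= B2"
  unfolding bounded_iff by auto
 then have B: "!!x. norm x <= R ==> norm (F x) <= B1" "!!x. norm x <= R ==> norm (DF x) <= B2"
  by auto
 have "0 <= B1" "0 <= B2" using B[of 0] R(1) norm_ge_zero by (metis norm_zero order.trans less_imp_le)+
 then have "\<bar>F x\<bar> <= max B1 B2 \<and> norm (DF x) <= max B1 B2" for x
  using B[of x] R(2)[of x] by (cases "norm x <= R") auto
 then show ?thesis by blast
qed

lemma C1c_segment_bound:
 assumes "C1c F DF" shows "\<exists>B. \<forall>x y. \<bar>F x - F y\<bar> <= B * norm (x - y)"
proof -
 obtain B where B: "!!x. norm (DF x) <= B" using C1c_bounded[OF assms] by blast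
 have "norm (F x - F y) <= B * norm (x - y)" for x y
 proof (rule differentiable_bound[of UNIV F "%x h. DF x \<bullet> h"])
  fix x show "(F has_derivative (\<bullet>) (DF x)) (at x within UNIV)" using C1cD(1)[OF assms] by simp
  show "onorm ((\<bullet>) (DF x)) <= B"
  proof (rule onorm_le)
   fix h show "norm (DF x \<bullet> h) <= B * norm h"
    using Cauchy_Schwarz_ineq2[of "DF x" h] mult_right_mono[OF B[of x], of "norm h"] by simp
  qed
 qed auto
 then show ?thesis by auto
qed

text \<open>The gradient is uniformly continuous, and the mean value inequality is applied to
  \<open>F\<close> minus its linear part. Uniformity in \<open>x\<close> is what permits
  differentiation under an integral against a function that is only integrable.\<close>

lemma C1c_uniformly_differentiable:
 assumes "C1c F DF" "e > 0"
 shows "\<exists>d>0. \<forall>x h. norm h < d --> \<bar>F (x + h) - F x - DF x \<bullet> h\<bar> <= e * norm h"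
proof -
 obtain R where R: "R > 0" "!!x. R < norm x ==> F x = 0 \<and> DF x = 0" using C1cD(8)[OF assms(1)] by auto
 \<comment> \<open>The margin covers a base point of norm at most \<open>R + 1\<close> displaced by
   at most 1; farther out both gradients vanish.\<close>
 have uc: "uniformly_continuous_on (cball 0 (R+2)) DF"
  by (rule compact_uniformly_continuous) (use C1cD(2)[OF assms(1)] in \<open>auto intro: continuous_on_subset\<close>)
 obtain d0 where d0: "d0 > 0" "!!x y. x \<in> cball 0 (R+2) ==> y \<in> cball 0 (R+2) ==> dist y x < d0 ==> dist (DF y) (DF x) < e"
  using uc[unfolded uniformly_continuous_on_def, THEN spec, THEN mp, OF assms(2)] by blast
 define d where "d = min d0 1"
 have close: "norm (DF y - DF x) <= e" if "norm (y - x) < d" for x y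
 proof (cases "norm x <= R + 1")
  case True
  then have "norm y <= R + 2" using that norm_triangle_sub[of y x] by (simp add: d_def)
  then show ?thesis using d0(2)[of x y] True that by (auto simp: dist_norm d_def)
 next
  case False
  then have "norm y > R" using that norm_triangle_sub[of x y] by (simp add: d_def norm_minus_commute)
  then show ?thesis using R(2)[of x] R(2)[of y] False assms(2) by auto
 qed
 show ?thesis
 proof (intro exI[of _ d] conjI allI impI)
  show "d > 0" using d0 by (simp add: d_def)
  fix x h :: 'a assume h: "norm h < d"
  have "norm ((%z. F z - DF x \<bullet> z) (x+h) - (%z. F z - DF x \<bullet> z) x) <= e * norm (x + h - x)"
  proof (rule differentiable_bound[of "ball x d" "%z. F z - DF x \<bullet> z" "%y k. (DF y - DF x) \<bullet> k"])
   fix y assume y: "y \<in> ball x d"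
   show "((%z. F z - DF x \<bullet> z) has_derivative (\<bullet>) (DF y - DF x)) (at y within ball x d)"
    using has_derivative_at_withinI[OF C1cD(1)[OF assms(1)]]
    by (auto intro!: derivative_eq_intros simp: inner_diff_left)
   show "onorm ((\<bullet>) (DF y - DF x)) <= e"
   proof (rule onorm_le)
    fix k
    show "norm ((DF y - DF x) \<bullet> k) <= e * norm k"
     using Cauchy_Schwarz_ineq2[of "DF y - DF x" k] close[of y x] y
      mult_right_mono[of "norm (DF y - DF x)" e "norm k"]
     by (auto simp: dist_norm norm_minus_commute)
   qed
  qed (use h d0(1) in \<open>auto simp: dist_norm d_def\<close>)
  then show "\<bar>F (x + h) - F x - DF x \<bullet> h\<bar> <= e * norm h"
   by (simp add: inner_add_right algebra_simps)
 qed
qed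

lemma smooth_C1c:
 fixes f :: "'a::euclidean_space => real"
 assumes "smooth_fun f" "!!x. norm x > R ==> f x = 0"
 obtains D where "!!i. smooth_fun (D i)" "!!i x. i \<in> Basis ==> norm x > R ==> D i x = 0"
  "C1c f (%x. \<Sum>i\<in>Basis. D i x *\<^sub>R i)"
proof -
 obtain D where D: "!!i. smooth_fun (D i)"
  "!!x. partials f D x"
  using smooth_fun_partials[OF assms(1)] by blast
 have z: "D i x = 0" if "i \<in> Basis" "norm x > R" for i x
 proof -
  have "open {x::'a. norm x > R}" by (intro open_Collect_less continuous_intros)
  from has_derivative_transform_within_open[OF has_derivative_const this, of x 0 f]
  have "(f has_derivative (%h. 0)) (at x)"
   using that assms(2) by simp
  then have "(%h. \<Sum>i\<in>Basis. (h \<bullet> i) * D i x) = (%h. 0)"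
   using has_derivative_unique[OF D(2)[of x]] by simp
  from fun_cong[OF this, of i] have "(\<Sum>j\<in>Basis. (i \<bullet> j) * D j x) = 0" by simp
  moreover have "(\<Sum>j\<in>Basis. (i \<bullet> j) * D j x) = (\<Sum>j\<in>Basis. if j = i then D j x else 0)"
   by (rule sum.cong) (use that in \<open>auto simp: inner_Basis\<close>)
  ultimately show ?thesis using that by simp
 qed
 show thesis
 proof (rule that[OF D(1)])
  show "!!i x. i \<in> Basis ==> norm x > R ==> D i x = 0" by (rule z)
  show "C1c f (%x. \<Sum>i\<in>Basis. D i x *\<^sub>R i)"
   unfolding C1c_def
  proof (intro conjI allI exI[of _ R] impI)
   fix x
   have "(\<Sum>i\<in>Basis. (h \<bullet> i) * D i x) = (\<Sum>i\<in>Basis. D i x *\<^sub>R i) \<bullet> h" for h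
    by (subst inner_commute) (simp add: inner_sum_right mult.commute)
   then show "(f has_derivative (%h. (\<Sum>i\<in>Basis. D i x *\<^sub>R i) \<bullet> h)) (at x)"
    using D(2)[of x] by simp
  next
   show "continuous_on UNIV (%x. \<Sum>i\<in>Basis. D i x *\<^sub>R i)"
    by (intro continuous_intros smooth_fun_continuous D)
  qed (use assms(2) z in auto)
 qed
qed

section \<open>Approximation in the mean\<close>

lemma nn_integral_translate:
 fixes f :: "'a::euclidean_space => ennreal"
 assumes "f \<in> borel_measurable borel"
 shows "NB (%x. f (x + h)) = NB (%x. f x)"
 using lborel_nn_integral_affine[OF assms, of 1 h] by (simp add: add.commute)

lemma integral_translate:
 fixes f :: "'a::euclidean_space => 'b::euclidean_space"
 assumes "f \<in> borel_measurable borel"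
 shows "LB (%x. f (x + h)) = LB (%x. f x)"
 using lborel_integral_affine[OF assms, of 1 h] by (simp add: add.commute)

lemma integrable_translate:
 fixes f :: "'a::euclidean_space => 'b::euclidean_space"
 assumes "integrable lborel f"
 shows "integrable lborel (%x. f (x + h))"
proof -
 have [measurable]: "f \<in> borel_measurable borel" using assms by auto
 show ?thesis
  using assms nn_integral_translate[of "%x. ennreal (norm (f x))" h]
  by (auto simp: integrable_iff_bounded)
qed

lemma reflect_integral:
 fixes f :: "'a::euclidean_space => 'b::euclidean_space"
 assumes "f \<in> borel_measurable borel"
 shows "LB (%y. f (x - y)) = LB (%y. f y)"
 using lborel_integral_affine[OF assms, of "-1" x] by simp

lemma reflect_nn_integral:
 fixes f :: "'a::euclidean_space => ennreal"
 assumes "f \<in> borel_measurable borel"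
 shows "NB (%y. f (x - y)) = NB (%y. f y)"
 using lborel_nn_integral_affine[OF assms, of "-1" x] by simp

lemma reflect_integrable:
 fixes f :: "'a::euclidean_space => 'b::euclidean_space"
 assumes "integrable lborel f"
 shows "integrable lborel (%y. f (x - y))"
proof -
 have f[measurable]: "f \<in> borel_measurable borel" using assms by auto
 have "(%y. f (x - y)) \<in> borel_measurable borel"
  by (rule measurable_compose[OF _ f]) (intro borel_measurable_continuous_onI continuous_intros)
 then show ?thesis
  unfolding integrable_iff_bounded
 proof (intro conjI)
  have "IB (%y. norm (f (x - y))) = IB (%y. norm (f y))"
   by (rule reflect_nn_integral[of "%x. ennreal (norm (f x))" x]) measurable
  then show "IB (%y. norm (f (x - y))) < \<infinity>"
   using assms by (simp only: integrable_iff_bounded)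
 qed simp
qed

text \<open>Inner regularity of Lebesgue measure supplies a closed set; cutting it with large balls
  makes it compact, by continuity from above of the finite measure.\<close>

lemma compact_inner_approx:
 fixes A :: "'a::euclidean_space set"
 assumes A: "A \<in> sets borel" "emeasure lborel A < \<infinity>" and e: "0 < (e::real)"
 obtains K where "compact K" "K \<subseteq> A" "emeasure lborel (A - K) < ennreal e"
proof -
 obtain T where T: "closed T" "T \<subseteq> A" "emeasure lebesgue (A - T) < ennreal e"
 proof (rule sets_lebesgue_inner_closed[OF _ e])
  show "A \<in> sets lebesgue" using A by simp
 qed
 have *: "(%n::nat. emeasure lborel (A - T \<inter> cball 0 (real n))) \<longlonglongrightarrow> emeasure lborel (\<Inter>n. A - T \<inter> cball 0 (real n))"
 proof (rule Lim_emeasure_decseq)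
  show "range (%n. A - T \<inter> cball 0 (real n)) \<subseteq> sets lborel" using A T(1) by auto
  show "decseq (%n. A - T \<inter> cball 0 (real n))" by (auto simp: decseq_def)
  show "emeasure lborel (A - T \<inter> cball 0 (real n)) \<noteq> \<infinity>" for n
   using emeasure_mono[of "A - T \<inter> cball 0 (real n)" A lborel] A by (auto simp: less_top top_unique)
 qed
 have "(\<Inter>n. A - T \<inter> cball 0 (real n)) = A - T"
  using real_arch_simple by fastforce
 moreover have "emeasure lborel (A - T) < ennreal e" using T A by simp
 ultimately have "\<forall>\<^sub>F n in sequentially. emeasure lborel (A - T \<inter> cball 0 (real n)) < ennreal e"
  using * by (auto intro: order_tendstoD)
 then obtain n where "emeasure lborel (A - T \<inter> cball 0 (real n)) < ennreal e"
  by (meson eventually_sequentially order_refl)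
 moreover have "compact (T \<inter> cball 0 (real n))" using T(1) by (simp add: closed_Int_compact)
 ultimately show thesis using T(2) that by blast
qed

text \<open>For an indicator, squeeze the set between a compact \<open>K\<close> and an open
  \<open>U\<close>: a shift shorter than the distance from \<open>K\<close> to the complement of
  \<open>U\<close> changes the indicator only on \<open>U - K\<close> or on a translate of it. Sums
  and dominated limits follow by the triangle inequality.\<close>

lemma translation_continuous_L1:
 fixes f :: "'a::euclidean_space => 'b::euclidean_space"
 assumes "integrable lborel f"
 shows "\<forall>e>0. \<exists>d>0. \<forall>h. norm h < d --> (IB (%x. norm (f (x + h) - f x))) < ennreal e"
 using assms
proof (induction rule: integrable_induct)
 case (base A c)
 show ?case
 proof (intro allI impI)
  fix e :: real assume e: "e > 0"
  \<comment> \<open>The factor 4 accounts for the two pieces \<open>U - A\<close> and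
    \<open>A - K\<close>, each counted once itself and once translated.\<close>
  define e' where "e' = e / (4 * (norm c + 1))"
  have e': "e' > 0" using e by (auto simp: e'_def intro!: divide_pos_pos add_nonneg_pos)
  obtain K where K: "compact K" "K \<subseteq> A" "emeasure lborel (A - K) < ennreal e'"
   using compact_inner_approx[of A e'] base e' by auto
  obtain U where U: "open U" "A \<subseteq> U" "emeasure lborel (U - A) < ennreal e'"
   using outer_regular_lborel[of A e'] base e' by auto
  have mU: "U - K \<in> sets borel" using U K by (auto simp: compact_imp_closed)
  have "U - K = (U - A) \<union> (A - K)" using U K by auto
  then have "emeasure lborel (U - K) <= emeasure lborel (U - A) + emeasure lborel (A - K)"
   using emeasure_subadditive[of "U - A" lborel "A - K"] U K base by (auto simp: compact_imp_closed)
  also have "... <= ennreal e' + ennreal e'" using U K by (intro add_mono) auto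
  finally have UK: "emeasure lborel (U - K) <= ennreal (2 * e')" using e' by (simp flip: ennreal_plus)
  have "K \<inter> - U = {}" "closed (- U)" using U K by auto
  from separate_compact_closed[OF K(1) this(2,1)]
  obtain d where d: "d > 0" "!!x y. x \<in> K ==> y \<in> - U ==> d <= dist x y"
   by blast
  show "\<exists>d>0. \<forall>h. norm h < d -->
   (IB (%x. norm (indicat_real A (x + h) *\<^sub>R c - indicat_real A x *\<^sub>R c))) < ennreal e"
  proof (intro exI[of _ d] conjI d allI impI)
   fix h :: 'a assume h: "norm h < d"
   have "IB (%x. norm (indicat_real A (x + h) *\<^sub>R c - indicat_real A x *\<^sub>R c))
    <= NB (%x. ennreal (norm c) * (indicator (U - K) (x + h) + indicator (U - K) x))"
   proof (rule nn_integral_mono)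
    fix x :: 'a
    have "x + h \<in> U" if "x \<in> K" using d(2)[OF that, of "x + h"] h by (force simp: dist_norm)
    moreover have "x \<in> U" if "x + h \<in> K" using d(2)[OF that, of x] h by (force simp: dist_norm)
    ultimately show "ennreal (norm (indicat_real A (x + h) *\<^sub>R c - indicat_real A x *\<^sub>R c))
     <= ennreal (norm c) * (indicator (U - K) (x + h) + indicator (U - K) x)"
     using U(2) K(2) by (cases "x \<in> A"; cases "x + h \<in> A"; cases "x \<in> K"; cases "x + h \<in> K")
      (auto simp: indicator_def subset_iff distrib_left)
   qed
   also have "... = ennreal (norm c) * (NB (%x. indicator (U - K) (x + h)) + NB (%x. indicator (U - K) x))"
    using mU by (subst nn_integral_cmult) (auto simp: nn_integral_add)
   also have "... = ennreal (norm c) * (2 * emeasure lborel (U - K))"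
    using mU nn_integral_translate[of "indicator (U - K)" h] by (simp add: mult_2)
   also have "... <= ennreal (norm c) * (2 * ennreal (2 * e'))"
    by (intro mult_left_mono UK) auto
   also have "... = ennreal (norm c * (4 * e'))"
    using e' by (simp add: ennreal_mult)
   also have "... < ennreal e"
   proof (rule ennreal_lessI[OF e])
    have "norm c + 1 > 0" by (simp add: add_nonneg_pos)
    then have "norm c * (4 * e') = e * (norm c / (norm c + 1))"
     unfolding e'_def by (simp add: divide_simps)
    also have "... < e * 1" using e by (intro mult_strict_left_mono) (auto simp: divide_less_eq_1 add_nonneg_pos)
    finally show "norm c * (4 * e') < e" by simp
   qed
   finally show "IB (%x. norm (indicat_real A (x + h) *\<^sub>R c - indicat_real A x *\<^sub>R c)) < ennreal e" .
  qed
 qed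
next
 case (add f g)
 have [measurable]: "f \<in> borel_measurable borel" "g \<in> borel_measurable borel" using add by auto
 show ?case
 proof (intro allI impI)
  fix e :: real assume "e > 0"
  then have e2: "e / 2 > 0" by simp
  obtain d1 where d1: "d1 > 0" "!!h. norm h < d1 ==> (IB (%x. norm (f (x + h) - f x))) < ennreal (e/2)"
   using add.IH(1) e2 by blast
  obtain d2 where d2: "d2 > 0" "!!h. norm h < d2 ==> (IB (%x. norm (g (x + h) - g x))) < ennreal (e/2)"
   using add.IH(2) e2 by blast
  show "\<exists>d>0. \<forall>h. norm h < d --> (IB (%x. norm (f (x + h) + g (x + h) - (f x + g x)))) < ennreal e"
  proof (intro exI[of _ "min d1 d2"] conjI allI impI)
   fix h :: 'a assume h: "norm h < min d1 d2"
   have "IB (%x. norm (f (x + h) + g (x + h) - (f x + g x)))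
    <= NB (%x. ennreal (norm (f (x + h) - f x)) + ennreal (norm (g (x + h) - g x)))"
    by (intro nn_integral_mono) (auto simp flip: ennreal_plus intro!: ennreal_leI norm_diff_triangle_ineq)
   also have "... = IB (%x. norm (f (x + h) - f x)) + IB (%x. norm (g (x + h) - g x))"
    by (rule nn_integral_add) auto
   also have "... < ennreal (e/2) + ennreal (e/2)"
    using d1 d2 h by (intro add_strict_mono) auto
   finally show "IB (%x. norm (f (x + h) + g (x + h) - (f x + g x))) < ennreal e"
    using \<open>e > 0\<close> by (simp flip: ennreal_plus)
  qed (use d1 d2 in auto)
 qed
next
 case (lim f s)
 have [measurable]: "f \<in> borel_measurable borel" "!!i. s i \<in> borel_measurable borel" using lim by auto
 have lims: "!!x. (%i. s i x) \<longlonglongrightarrow> f x" "!!i x. norm (s i x) <= 2 * norm (f x)" "integrable lborel f"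
  using lim by auto
 have "(%i. IB (%x. norm (s i x - f x))) \<longlonglongrightarrow> 0"
 proof -
  have "(%i. IB (%x. norm (s i x - f x))) \<longlonglongrightarrow> (\<integral>\<^sup>+x. 0 \<partial>(lborel::'a measure))"
  proof (rule nn_integral_dominated_convergence[where w="%x. ennreal (3 * norm (f x))"])
   show "AE x in lborel. ennreal (norm (s j x - f x)) <= ennreal (3 * norm (f x))" for j
   proof (rule AE_I2, rule ennreal_leI)
    fix x show "norm (s j x - f x) <= 3 * norm (f x)"
     using norm_triangle_ineq4[of "s j x" "f x"] lims(2)[of j x] by simp
   qed
   show "IB (%x. 3 * norm (f x)) < \<infinity>"
    using lims(3) by (simp add: integrable_iff_bounded ennreal_mult nn_integral_cmult ennreal_mult_less_top)
   show "AE x in lborel. (%i. ennreal (norm (s i x - f x))) \<longlonglongrightarrow> 0"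
   proof (rule AE_I2)
    fix x
    have "(%i. norm (s i x - f x)) \<longlonglongrightarrow> 0"
     using lims(1)[of x] by (simp add: LIM_zero tendsto_norm_zero)
    then show "(%i. ennreal (norm (s i x - f x))) \<longlonglongrightarrow> 0"
     using tendsto_ennrealI by fastforce
   qed
  qed auto
  then show ?thesis by simp
 qed
 note small = this
 show ?case
 proof (intro allI impI)
  fix e :: real assume e: "e > 0"
  then have e3: "ennreal (e/3) > 0" by simp
  obtain i where i: "IB (%x. norm (s i x - f x)) < ennreal (e/3)"
   using order_tendstoD(2)[OF small e3] by (meson eventually_sequentially order_refl)
  obtain d where d: "d > 0" "!!h. norm h < d ==> (IB (%x. norm (s i (x + h) - s i x))) < ennreal (e/3)"
   using lim.IH[of i] e by (meson divide_pos_pos zero_less_numeral)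
  show "\<exists>d>0. \<forall>h. norm h < d --> (IB (%x. norm (f (x + h) - f x))) < ennreal e"
  proof (intro exI[of _ d] conjI allI impI d)
   fix h :: 'a assume h: "norm h < d"
   have "IB (%x. norm (f (x + h) - f x))
    <= NB (%x. (ennreal (norm (s i (x + h) - f (x + h))) + ennreal (norm (s i (x+h) - s i x))) + ennreal (norm (s i x - f x)))"
   proof (intro nn_integral_mono)
    fix x
    have "norm (f (x + h) - f x) <= norm (s i (x + h) - f (x + h)) + norm (s i (x+h) - s i x) + norm (s i x - f x)"
     using norm_triangle_ineq4[of "s i (x+h) - s i x + (s i x - f x)" "s i (x + h) - f (x + h)"]
      norm_triangle_ineq[of "s i (x+h) - s i x" "s i x - f x"] by (simp add: algebra_simps)
    then show "ennreal (norm (f (x + h) - f x)) <= (ennreal (norm (s i (x + h) - f (x + h))) + ennreal (norm (s i (x+h) - s i x))) + ennreal (norm (s i x - f x))"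
     by (simp flip: ennreal_plus add: ennreal_leI)
   qed
   also have "... = IB (%x. norm (s i (x + h) - f (x + h))) + IB (%x. norm (s i (x+h) - s i x))
    + IB (%x. norm (s i x - f x))"
    by (subst nn_integral_add; simp add: nn_integral_add)
   also have "IB (%x. norm (s i (x + h) - f (x + h))) = IB (%x. norm (s i x - f x))"
    by (rule nn_integral_translate[of "%x. ennreal (norm (s i x - f x))"]) simp
   also have "IB (%x. norm (s i x - f x)) + IB (%x. norm (s i (x+h) - s i x))
    + IB (%x. norm (s i x - f x)) < ennreal (e/3) + ennreal (e/3) + ennreal (e/3)"
    using i d(2)[OF h] by (intro add_strict_mono) auto
   finally show "IB (%x. norm (f (x + h) - f x)) < ennreal e"
    using e by (simp flip: ennreal_plus)
  qed
 qed
qed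

definition conv :: "('a::euclidean_space => real) => ('a => 'b::euclidean_space) => 'a => 'b" where
 "conv k f x = LB (%y. k (x - y) *\<^sub>R f y)"

lemma conv_alt:
 assumes [measurable]: "k \<in> borel_measurable borel" "f \<in> borel_measurable borel"
 shows "conv k f x = LB (%y. k y *\<^sub>R f (x - y))"
 using reflect_integral[of "%y. k y *\<^sub>R f (x - y)" x] by (simp add: conv_def)

lemma conv_measurable[measurable]:
 fixes f :: "'a::euclidean_space => 'b::euclidean_space"
 assumes [measurable]: "k \<in> borel_measurable borel" "f \<in> borel_measurable borel"
 shows "conv k f \<in> borel_measurable borel"
proof -
 have "(%x. LB (%y. k (x - y) *\<^sub>R f y)) \<in> borel_measurable lborel"
  by (intro lborel.borel_measurable_lebesgue_integral) measurable
 then show ?thesis by (simp add: conv_def[abs_def])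
qed

lemma conv_integrand_integrable:
 fixes f :: "'a::euclidean_space => 'b::euclidean_space"
 assumes "integrable lborel f" and k[measurable]: "k \<in> borel_measurable borel" and "!!x. \<bar>k x\<bar> <= B"
 shows "integrable lborel (%y. k (x - y) *\<^sub>R f y)"
proof (rule Bochner_Integration.integrable_bound[of _ "%y. B *\<^sub>R f y"])
 show "integrable lborel (%y. B *\<^sub>R f y)" using assms by simp
 have [measurable]: "f \<in> borel_measurable borel" using assms by auto
 show "(%y. k (x - y) *\<^sub>R f y) \<in> borel_measurable lborel" by measurable
 have "0 <= B" using assms(3)[of 0] by simp
 then show "AE y in lborel. norm (k (x - y) *\<^sub>R f y) <= norm (B *\<^sub>R f y)"
  using assms(3) by (auto intro!: mult_right_mono)
qed

text \<open>Fubini moves the norm inside, and the density averages translation errors over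
  \<open>norm h < e\<close>. Any bounded probability density with support in the ball is allowed, so
  the same estimate serves the mollifier \<open>kern\<close> and the ball mean
  \<open>ballk\<close>.\<close>

lemma conv_approx:
 fixes f :: "'a::euclidean_space => 'b::euclidean_space"
 assumes f: "integrable lborel f" and [measurable]: "k \<in> borel_measurable borel"
  and k: "!!x. 0 <= k x" "!!x. k x <= B" "!!x. norm x \<ge> e ==> k x = 0" "integrable lborel k" "LB (%x. k x) = 1"
  and d: "!!h. norm h < e ==> (IB (%x. norm (f (x + h) - f x))) <= d"
 shows "IB (%x. norm (conv k f x - f x)) <= d"
proof -
 have [measurable]: "f \<in> borel_measurable borel" using f by auto
 have nk: "IB (%y. k y) = 1"
  using k by (subst nn_integral_eq_integral) auto
 have i1: "integrable lborel (%y. k y *\<^sub>R f (x - y))" for x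
 proof -
  have "integrable lborel (%y. k (x - y) *\<^sub>R f y)"
   by (rule conv_integrand_integrable[OF f, of k B]) (use k in auto)
  then have "integrable lborel (%y. k (x - (x - y)) *\<^sub>R f (x - y))"
   by (rule reflect_integrable[of "%y. k (x - y) *\<^sub>R f y"])
  then show ?thesis by simp
 qed
 have "norm (conv k f x - f x) <= NB (%y. ennreal (k y) * ennreal (norm (f (x - y) - f x)))" for x
 proof -
  have "conv k f x - f x = LB (%y. k y *\<^sub>R f (x - y)) - (LB (%y. k y *\<^sub>R f x))"
   using k by (subst conv_alt) auto
  also have "... = LB (%y. k y *\<^sub>R f (x - y) - k y *\<^sub>R f x)"
   using i1 k by (subst Bochner_Integration.integral_diff) auto
  finally have "ennreal (norm (conv k f x - f x)) <= NB (%y. norm (k y *\<^sub>R f (x - y) - k y *\<^sub>R f x))"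
   using integral_norm_bound_ennreal[of lborel "%y. k y *\<^sub>R f (x - y) - k y *\<^sub>R f x"] i1 k by simp
  also have "... = NB (%y. ennreal (k y) * ennreal (norm (f (x - y) - f x)))"
   using k by (intro nn_integral_cong) (simp flip: scaleR_diff_right ennreal_mult)
  finally show ?thesis .
 qed
 then have "IB (%x. norm (conv k f x - f x)) <=
  NB (%x. NB (%y. ennreal (k y) * ennreal (norm (f (x - y) - f x))))"
  by (intro nn_integral_mono) auto
 also have "... = NB (%y. NB (%x. ennreal (k y) * ennreal (norm (f (x - y) - f x))))"
  by (rule lborel_pair.Fubini') measurable
 also have "... <= (\<integral>\<^sup>+y. ennreal (k y) * d \<partial>(lborel::'a measure))"
 proof (rule nn_integral_mono, goal_cases)
  case (1 y)
  show ?case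
  proof (cases "norm y < e")
   case True
   then show ?thesis using d[of "- y"] by (subst nn_integral_cmult) (auto intro!: mult_left_mono)
  qed (use k(3) in auto)
 qed
 also have "... = d" using nk by (simp add: nn_integral_multc)
 finally show ?thesis .
qed

lemma conv_has_derivative:
 fixes f :: "'a::euclidean_space => real"
 assumes f: "integrable lborel f" and k: "C1c k Dk"
 shows "(conv k f has_derivative (%h. (LB (%y. f y *\<^sub>R Dk (x - y))) \<bullet> h)) (at x)"
proof -
 obtain B where B: "!!x. \<bar>k x\<bar> <= B" "!!x. norm (Dk x) <= B" using C1c_bounded[OF k] by auto
 have [measurable]: "k \<in> borel_measurable borel" "Dk \<in> borel_measurable borel" "f \<in> borel_measurable borel"
  using C1cD(6,7)[OF k] f by auto
 have i1: "integrable lborel (%y. k (x - y) * f y)" for x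
  using conv_integrand_integrable[OF f, of k B] B(1) by simp
 have i2: "integrable lborel (%y. f y *\<^sub>R Dk (x - y))" for x
 proof (rule Bochner_Integration.integrable_bound[of _ "%y. B * f y"])
  show "integrable lborel (%y. B * f y)" using f by simp
  have "0 <= B" using B(1)[of 0] by simp
  then show "AE y in lborel. norm (f y *\<^sub>R Dk (x - y)) <= norm (B * f y)"
   by (auto simp: abs_mult mult.commute[of B] intro!: mult_left_mono B(2))
 qed simp
 define I where "I = LB (%y. \<bar>f y\<bar>)"
 have I0: "I \<ge> 0" by (simp add: I_def)
 show ?thesis
  unfolding has_derivative_at_alt
 proof (intro conjI allI impI)
  show "bounded_linear ((\<bullet>) (LB (%y. f y *\<^sub>R Dk (x - y))))" by (rule bounded_linear_inner_right)
  fix e :: real assume "e > 0"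
  define e' where "e' = e / (I + 1)"
  have e': "e' > 0" "e' * I <= e"
   using \<open>e > 0\<close> I0 by (auto simp: e'_def field_simps)
  obtain d where d: "d > 0" "!!x h. norm h < d ==> \<bar>k (x + h) - k x - Dk x \<bullet> h\<bar> <= e' * norm h"
   using C1c_uniformly_differentiable[OF k e'(1)] by blast
  show "\<exists>d>0. \<forall>y. norm (y - x) < d -->
   norm (conv k f y - conv k f x - (LB (%y. f y *\<^sub>R Dk (x - y))) \<bullet> (y - x)) <= e * norm (y - x)"
  proof (intro exI[of _ d] conjI d allI impI)
   fix z assume z: "norm (z - x) < d"
   define h where "h = z - x"
   have "conv k f z - conv k f x - (LB (%y. f y *\<^sub>R Dk (x - y))) \<bullet> h
    = LB (%y. k (z - y) * f y) - (LB (%y. k (x - y) * f y)) - (LB (%y. (f y *\<^sub>R Dk (x - y)) \<bullet> h))"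
    using integral_inner_left[of h lborel "%y. f y *\<^sub>R Dk (x - y)"] i2[of x] by (simp add: conv_def)
   also have "... = LB (%y. (k (z - y) * f y - k (x - y) * f y) - (f y *\<^sub>R Dk (x - y)) \<bullet> h)"
    using i1 integrable_inner_left[of h lborel "%y. f y *\<^sub>R Dk (x - y)"] i2[of x]
    by (subst Bochner_Integration.integral_diff; simp)+
   finally have "norm (conv k f z - conv k f x - (LB (%y. f y *\<^sub>R Dk (x - y))) \<bullet> h)
    <= LB (%y. norm ((k (z - y) * f y - k (x - y) * f y) - (f y *\<^sub>R Dk (x - y)) \<bullet> h))"
    by (simp only: integral_norm_bound)
   also have "... <= LB (%y. \<bar>f y\<bar> * (e' * norm h))"
   proof (rule integral_mono)
    show "integrable lborel (%y. norm ((k (z - y) * f y - k (x - y) * f y) - (f y *\<^sub>R Dk (x - y)) \<bullet> h))"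
     using i1 integrable_inner_left[of h lborel "%y. f y *\<^sub>R Dk (x - y)"] i2[of x]
     by (intro integrable_norm Bochner_Integration.integrable_diff) auto
    show "integrable lborel (%y. \<bar>f y\<bar> * (e' * norm h))" using f by simp
    fix y
    have "(k (z - y) * f y - k (x - y) * f y) - (f y *\<^sub>R Dk (x - y)) \<bullet> h
     = f y * (k ((x - y) + h) - k (x - y) - Dk (x - y) \<bullet> h)"
     by (simp add: h_def algebra_simps)
    also have "norm ... <= \<bar>f y\<bar> * (e' * norm h)"
     using d(2)[of h "x - y"] z by (auto simp: abs_mult h_def intro!: mult_left_mono)
    finally show "norm ((k (z - y) * f y - k (x - y) * f y) - (f y *\<^sub>R Dk (x - y)) \<bullet> h) <= \<bar>f y\<bar> * (e' * norm h)" .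
   qed
   also have "... = (e' * I) * norm h" by (simp add: I_def)
   also have "... <= e * norm h" by (intro mult_right_mono e') auto
   finally show "norm (conv k f z - conv k f x - (LB (%y. f y *\<^sub>R Dk (x - y))) \<bullet> (z - x)) <= e * norm (z - x)"
    by (simp add: h_def)
  qed
 qed
qed

text \<open>Derivatives fall on the kernel, so the convolutions of \<open>f\<close> with all smooth
  kernels supported in one ball form a class closed under partials.\<close>

lemma smooth_conv:
 fixes f :: "'a::euclidean_space => real"
 assumes f: "integrable lborel f" and k: "smooth_fun k" "!!x. norm x > R ==> k x = 0"
 shows "smooth_fun (conv k f)"
proof (rule smooth_fun_coinduct[where S="{conv k f |k. smooth_fun k \<and> (\<forall>x. norm x > R --> k x = 0)}"])
 show "conv k f \<in> {conv k f |k. smooth_fun k \<and> (\<forall>x. norm x > R --> k x = 0)}" using k by auto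
 fix g assume "g \<in> {conv k f |k. smooth_fun k \<and> (\<forall>x. norm x > R --> k x = 0)}"
 then obtain k where k: "g = conv k f" "smooth_fun k" "!!x. norm x > R ==> k x = 0" by auto
 obtain D where D: "!!i. smooth_fun (D i)" "!!i x. i \<in> Basis ==> norm x > R ==> D i x = 0"
  "C1c k (%x. \<Sum>i\<in>Basis. D i x *\<^sub>R i)"
  using smooth_C1c[OF k(2,3)] by blast
 have "LB (%y. f y *\<^sub>R (\<Sum>i\<in>Basis. D i (x - y) *\<^sub>R i)) \<bullet> h = (\<Sum>i\<in>Basis. (h \<bullet> i) * conv (D i) f x)" for x h
 proof -
  have i: "integrable lborel (%y. D i (x - y) *\<^sub>R f y)" if ib: "i \<in> Basis" for i
  proof -
   obtain E where "C1c (D i) E" by (rule smooth_C1c[OF D(1)[of i] D(2)[OF ib]])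
   then show ?thesis using C1c_bounded[of "D i" E] C1cD(6)[of "D i" E] conv_integrand_integrable[OF f, of "D i"] by metis
  qed
  have "LB (%y. f y *\<^sub>R (\<Sum>i\<in>Basis. D i (x - y) *\<^sub>R i)) = (\<Sum>i\<in>Basis. (LB (%y. (D i (x - y) *\<^sub>R f y) *\<^sub>R i)))"
   by (subst Bochner_Integration.integral_sum[symmetric])
    (use i in \<open>auto simp: scaleR_sum_right mult.commute\<close>)
  also have "... = (\<Sum>i\<in>Basis. conv (D i) f x *\<^sub>R i)"
   by (rule sum.cong) (use i in \<open>auto simp: conv_def\<close>)
  finally have eq: "LB (%y. f y *\<^sub>R (\<Sum>i\<in>Basis. D i (x - y) *\<^sub>R i)) = (\<Sum>i\<in>Basis. conv (D i) f x *\<^sub>R i)" .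
  show ?thesis unfolding eq by (subst inner_commute) (simp add: inner_sum_right mult.commute)
 qed
 then have "!!x. (g has_derivative (%h. \<Sum>i\<in>Basis. (h \<bullet> i) * conv (D i) f x)) (at x)"
  using conv_has_derivative[OF f D(3)] by (simp add: k(1))
 then show "\<exists>D. (\<forall>i\<in>Basis. D i \<in> {conv k f |k. smooth_fun k \<and> (\<forall>x. norm x > R --> k x = 0)}) \<and>
     (\<forall>x. (g has_derivative (%h. \<Sum>i\<in>Basis. (h \<bullet> i) * D i x)) (at x))"
  using D by (intro exI[of _ "%i. conv (D i) f"]) auto
qed

lemma conv_outside:
 assumes "!!x. norm x \<ge> e ==> k x = 0" "!!x. R < norm x ==> f x = 0" "norm x > R + e"
 shows "conv k f x = 0"
proof -
 have "k (x - y) *\<^sub>R f y = 0" for y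
 proof (cases "norm y > R")
  case False
  then have "norm (x - y) \<ge> e" using assms(3) norm_triangle_ineq2[of x y] by simp
  then show ?thesis using assms(1) by simp
 qed (simp add: assms(2))
 then show ?thesis unfolding conv_def by (simp only: Bochner_Integration.integral_zero)
qed

section \<open>The Sobolev space of the whole space\<close>

text \<open>Extended values keep the triangle inequality free of integrability; in
  \<open>ball_rep_AE\<close> integrability is even deduced from a finite distance.\<close>

definition L1d :: "('a::euclidean_space => 'b::euclidean_space) => ('a => 'b) => ennreal" where
 "L1d f g = IB (%x. norm (f x - g x))"

lemma L1d_triangle:
 assumes [measurable]: "f \<in> borel_measurable borel" "g \<in> borel_measurable borel" "h \<in> borel_measurable borel"
 shows "L1d f h <= L1d f g + L1d g h"
proof -
 have "L1d f h <= NB (%x. ennreal (norm (f x - g x)) + ennreal (norm (g x - h x)))"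
  unfolding L1d_def
  by (intro nn_integral_mono)
   (auto simp flip: ennreal_plus intro!: ennreal_leI order_trans[OF _ norm_triangle_ineq])
 also have "... = L1d f g + L1d g h"
  unfolding L1d_def by (rule nn_integral_add) auto
 finally show ?thesis .
qed

lemma L1d_add:
 assumes [measurable]: "f \<in> borel_measurable borel" "g \<in> borel_measurable borel"
  "f' \<in> borel_measurable borel" "g' \<in> borel_measurable borel"
 shows "L1d (%x. f x + g x) (%x. f' x + g' x) <= L1d f f' + L1d g g'"
proof -
 have "L1d (%x. f x + g x) (%x. f' x + g' x)
  <= NB (%x. ennreal (norm (f x - f' x)) + ennreal (norm (g x - g' x)))"
  unfolding L1d_def
  by (intro nn_integral_mono)
   (auto simp flip: ennreal_plus intro!: ennreal_leI norm_diff_triangle_ineq)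
 also have "... = L1d f f' + L1d g g'"
  unfolding L1d_def by (rule nn_integral_add) auto
 finally show ?thesis .
qed

lemma L1d_mono:
 assumes [measurable]: "f \<in> borel_measurable borel" "g \<in> borel_measurable borel"
  and "!!x. norm (f' x - g' x) <= B * norm (f x - g x)" "B \<ge> 0"
 shows "L1d f' g' <= ennreal B * L1d f g"
proof -
 have "L1d f' g' <= NB (%x. ennreal B * ennreal (norm (f x - g x)))"
  unfolding L1d_def using assms(3,4) by (intro nn_integral_mono) (auto simp flip: ennreal_mult intro!: ennreal_leI)
 then show ?thesis by (simp add: nn_integral_cmult L1d_def)
qed

lemma L1d_AE_subseq:
 fixes f :: "nat => 'a::euclidean_space => 'b::euclidean_space"
 assumes i: "!!k. integrable lborel (f k)" "integrable lborel g" and l: "(%k. L1d (f k) g) \<longlonglongrightarrow> 0"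
 shows "\<exists>r::nat=>nat. strict_mono r \<and> (AE x in lborel. (%k. f (r k) x) \<longlonglongrightarrow> g x)"
proof -
 have i': "!!k. integrable lborel (%x. f k x - g x)" using i by auto
 have "L1d (f k) g = ennreal (LB (%x. norm (f k x - g x)))" for k
  unfolding L1d_def by (rule nn_integral_eq_integral) (use i' in auto)
 then have "(%k. LB (%x. norm (f k x - g x))) \<longlonglongrightarrow> 0"
  using l by (simp add: tendsto_ennreal_iff[of _ _ 0, simplified])
 from tendsto_L1_AE_subseq[OF i' this] obtain r :: "nat => nat" where "strict_mono r"
  "AE x in lborel. (%k. f (r k) x - g x) \<longlonglongrightarrow> 0" by auto
 then show ?thesis by (intro exI[of _ r]) (auto simp: LIM_zero_iff)
qed

text \<open>The Sobolev space W^{1,1} of the whole space as the closure of \<open>C1c\<close> in the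
  graph norm, with \<open>g\<close> as the gradient. Calculus rules are checked for
  \<open>C1c\<close> pairs and passed to the limit; the link with \<open>weak_grad\<close> is made
  by \<open>weak_grad_borel_integral\<close> and \<open>W_weak_grad\<close>.\<close>

definition W :: "('a::euclidean_space => real) => ('a => 'a) => bool" where
 "W f g \<longleftrightarrow> integrable lborel f \<and> integrable lborel g \<and>
  (\<forall>e>0. \<exists>F DF. C1c F DF \<and> L1d F f < ennreal e \<and> L1d DF g < ennreal e)"

lemma W_integrable: "W f g ==> integrable lborel f" "W f g ==> integrable lborel g"
 by (auto simp: W_def)

lemma W_measurable: "W f g ==> f \<in> borel_measurable borel" "W f g ==> g \<in> borel_measurable borel"
 by (auto simp: W_def)

lemma C1c_W: "C1c F DF ==> W F DF"
 unfolding W_def using C1cD(4,5) by (auto intro!: exI[of _ F] exI[of _ DF] simp: L1d_def)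

lemma W_closed:
 assumes i: "integrable lborel f" "integrable lborel g"
  and a: "!!e. e > 0 ==> \<exists>f' g'. W f' g' \<and> L1d f' f < ennreal e \<and> L1d g' g < ennreal e"
 shows "W f g"
 unfolding W_def
proof (intro conjI i allI impI)
 have [measurable]: "f \<in> borel_measurable borel" "g \<in> borel_measurable borel" using i by auto
 fix e :: real assume e: "e > 0"
 obtain f' g' where w: "W f' g'" "L1d f' f < ennreal (e/2)" "L1d g' g < ennreal (e/2)" using a[of "e/2"] e by auto
 obtain F DF where F: "C1c F DF" "L1d F f' < ennreal (e/2)" "L1d DF g' < ennreal (e/2)"
  using w(1) e unfolding W_def by (meson half_gt_zero)
 note [measurable] = W_measurable[OF w(1)] C1cD(6,7)[OF F(1)]
 have "L1d F f <= L1d F f' + L1d f' f" by (rule L1d_triangle) measurable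
 also have "... < ennreal (e/2) + ennreal (e/2)" by (intro add_strict_mono F w)
 finally have 1: "L1d F f < ennreal e" using e by (simp flip: ennreal_plus)
 have "L1d DF g <= L1d DF g' + L1d g' g" by (rule L1d_triangle) measurable
 also have "... < ennreal (e/2) + ennreal (e/2)" by (intro add_strict_mono F w)
 finally have 2: "L1d DF g < ennreal e" using e by (simp flip: ennreal_plus)
 show "\<exists>F DF. C1c F DF \<and> L1d F f < ennreal e \<and> L1d DF g < ennreal e" using F(1) 1 2 by blast
qed

lemma W_closed_seq:
 assumes i: "integrable lborel f" "integrable lborel g"
  and w: "!!k::nat. W (f' k) (g' k)" and l: "(%k. L1d (f' k) f) \<longlonglongrightarrow> 0" "(%k. L1d (g' k) g) \<longlonglongrightarrow> 0"
 shows "W f g"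
proof (rule W_closed[OF i])
 fix e :: real assume "e > 0"
 then have "\<forall>\<^sub>F k in sequentially. L1d (f' k) f < ennreal e \<and> L1d (g' k) g < ennreal e"
  using l by (intro eventually_conj) (auto intro: order_tendstoD)
 then have "\<exists>k. L1d (f' k) f < ennreal e \<and> L1d (g' k) g < ennreal e"
  by (rule eventually_happens'[OF sequentially_bot])
 then obtain k where "L1d (f' k) f < ennreal e \<and> L1d (g' k) g < ennreal e" ..
 then show "\<exists>f' g'. W f' g' \<and> L1d f' f < ennreal e \<and> L1d g' g < ennreal e" using w by blast
qed

lemma W_seq:
 assumes "W f g"
 obtains F DF where "!!k::nat. C1c (F k) (DF k)" "(%k. L1d (F k) f) \<longlonglongrightarrow> 0" "(%k. L1d (DF k) g) \<longlonglongrightarrow> 0"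
  "AE x in lborel. (%k. F k x) \<longlonglongrightarrow> f x"
proof -
 have "\<forall>k::nat. \<exists>F DF. C1c F DF \<and> L1d F f < ennreal (1 / Suc k) \<and> L1d DF g < ennreal (1 / Suc k)"
  using assms unfolding W_def by simp
 then obtain F DF where F: "!!k. C1c (F k) (DF k)" "!!k. L1d (F k) f < ennreal (1 / Suc k)" "!!k. L1d (DF k) g < ennreal (1 / Suc k)"
  by metis
 have z: "(%k. ennreal (1 / Suc k)) \<longlonglongrightarrow> 0"
  using tendsto_ennrealI[OF LIMSEQ_Suc[OF lim_1_over_n[where 'a=real]]] by simp
 have l: "(%k. L1d (F k) f) \<longlonglongrightarrow> 0" "(%k. L1d (DF k) g) \<longlonglongrightarrow> 0"
  by (rule tendsto_sandwich[OF _ _ tendsto_const z]; use F in \<open>auto intro!: less_imp_le eventuallyI\<close>)+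
 obtain r :: "nat => nat" where r: "strict_mono r" "AE x in lborel. (%k. F (r k) x) \<longlonglongrightarrow> f x"
  using L1d_AE_subseq[OF C1cD(4)[OF F(1)] W_integrable(1)[OF assms] l(1)] by auto
 show thesis
  using that[of "%k. F (r k)" "%k. DF (r k)"] F(1) r LIMSEQ_subseq_LIMSEQ[OF l(1) r(1)] LIMSEQ_subseq_LIMSEQ[OF l(2) r(1)]
  by (simp add: o_def)
qed

lemma C1c_add: "C1c F DF ==> C1c G DG ==> C1c (%x. F x + G x) (%x. DF x + DG x)"
proof -
 assume F: "C1c F DF" and G: "C1c G DG"
 obtain R where R: "!!x. R < norm x ==> F x = 0 \<and> DF x = 0" using C1cD(8)[OF F] by auto
 obtain S where S: "!!x. S < norm x ==> G x = 0 \<and> DG x = 0" using C1cD(8)[OF G] by auto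
 show ?thesis unfolding C1c_def
 proof (intro conjI allI exI[of _ "max R S"])
  show "((%x. F x + G x) has_derivative (%h. (DF x + DG x) \<bullet> h)) (at x)" for x
   using has_derivative_add[OF C1cD(1)[OF F] C1cD(1)[OF G]] by (simp add: inner_add_left)
 qed (use R S C1cD(2)[OF F] C1cD(2)[OF G] in \<open>auto intro: continuous_on_add\<close>)
qed

lemma C1c_mult_gen:
 assumes F: "C1c F DF" and e: "!!x. (\<eta> has_derivative (%h. D\<eta> x \<bullet> h)) (at x)" "continuous_on UNIV D\<eta>"
 shows "C1c (%x. \<eta> x * F x) (%x. \<eta> x *\<^sub>R DF x + F x *\<^sub>R D\<eta> x)"
proof -
 obtain R where R: "!!x. R < norm x ==> F x = 0 \<and> DF x = 0" using C1cD(8)[OF F] by auto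
 have c: "continuous_on UNIV \<eta>" using e(1) by (meson continuous_at_imp_continuous_on has_derivative_continuous)
 show ?thesis unfolding C1c_def
 proof (intro conjI allI exI[of _ R])
  show "((%x. \<eta> x * F x) has_derivative (%h. (\<eta> x *\<^sub>R DF x + F x *\<^sub>R D\<eta> x) \<bullet> h)) (at x)" for x
   using has_derivative_mult[OF e(1) C1cD(1)[OF F]] by (simp add: inner_add_left mult.commute)
  show "continuous_on UNIV (%x. \<eta> x *\<^sub>R DF x + F x *\<^sub>R D\<eta> x)"
   by (intro continuous_intros c e C1cD(2,3)[OF F])
 qed (use R in auto)
qed

lemma W_add:
 assumes "W f g" "W f' g'"
 shows "W (%x. f x + f' x) (%x. g x + g' x)"
proof (rule W_closed)
 note [measurable] = W_measurable[OF assms(1)] W_measurable[OF assms(2)]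
 show "integrable lborel (%x. f x + f' x)" "integrable lborel (%x. g x + g' x)"
  using W_integrable[OF assms(1)] W_integrable[OF assms(2)] by auto
 fix e :: real assume e: "e > 0"
 obtain F DF where F: "C1c F DF" "L1d F f < ennreal (e/2)" "L1d DF g < ennreal (e/2)"
  using assms(1) e unfolding W_def by (meson half_gt_zero)
 obtain G DG where G: "C1c G DG" "L1d G f' < ennreal (e/2)" "L1d DG g' < ennreal (e/2)"
  using assms(2) e unfolding W_def by (meson half_gt_zero)
 note [measurable] = C1cD(6,7)[OF F(1)] C1cD(6,7)[OF G(1)]
 have "L1d (%x. F x + G x) (%x. f x + f' x) <= L1d F f + L1d G f'" by (rule L1d_add) measurable
 also have "... < ennreal (e/2) + ennreal (e/2)" by (intro add_strict_mono F G)
 finally have 1: "L1d (%x. F x + G x) (%x. f x + f' x) < ennreal e" using e by (simp flip: ennreal_plus)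
 have "L1d (%x. DF x + DG x) (%x. g x + g' x) <= L1d DF g + L1d DG g'" by (rule L1d_add) measurable
 also have "... < ennreal (e/2) + ennreal (e/2)" by (intro add_strict_mono F G)
 finally have 2: "L1d (%x. DF x + DG x) (%x. g x + g' x) < ennreal e" using e by (simp flip: ennreal_plus)
 show "\<exists>F DF. W F DF \<and> L1d F (%x. f x + f' x) < ennreal e \<and> L1d DF (%x. g x + g' x) < ennreal e"
  using C1c_W[OF C1c_add[OF F(1) G(1)]] 1 2 by blast
qed

lemma W_mult:
 assumes w: "W f g" and e: "!!x. (\<eta> has_derivative (%h. D\<eta> x \<bullet> h)) (at x)" "continuous_on UNIV D\<eta>"
  and B: "!!x. \<bar>\<eta> x\<bar> <= B" "!!x. norm (D\<eta> x) <= B"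
 shows "W (%x. \<eta> x * f x) (%x. \<eta> x *\<^sub>R g x + f x *\<^sub>R D\<eta> x)"
proof -
 have B0: "B \<ge> 0" using B(1)[of 0] by simp
 have c: "continuous_on UNIV \<eta>" using e(1) by (meson continuous_at_imp_continuous_on has_derivative_continuous)
 have [measurable]: "\<eta> \<in> borel_measurable borel" "D\<eta> \<in> borel_measurable borel"
  using c e(2) by (auto intro: borel_measurable_continuous_onI)
 note [measurable] = W_measurable[OF w]
 obtain F DF where F: "!!k::nat. C1c (F k) (DF k)" "(%k. L1d (F k) f) \<longlonglongrightarrow> 0" "(%k. L1d (DF k) g) \<longlonglongrightarrow> 0"
  by (rule W_seq[OF w], rule that)
 note [measurable] = C1cD(6,7)[OF F(1)]
 have i: "integrable lborel (%x. \<eta> x * f x)"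
  by (rule Bochner_Integration.integrable_bound[of _ "%x. B * f x"])
   (use W_integrable[OF w] B in \<open>auto simp: abs_mult B0 intro!: mult_right_mono\<close>)
 have i2: "integrable lborel (%x. \<eta> x *\<^sub>R g x)"
  by (rule Bochner_Integration.integrable_bound[of _ "%x. B *\<^sub>R g x"])
   (use W_integrable[OF w] B in \<open>auto simp: B0 intro!: mult_right_mono\<close>)
 have i3: "integrable lborel (%x. f x *\<^sub>R D\<eta> x)"
  by (rule Bochner_Integration.integrable_bound[of _ "%x. B * f x"])
   (use W_integrable[OF w] B in \<open>auto simp: abs_mult B0 mult.commute[of B] intro!: mult_left_mono\<close>)
 have b1: "L1d (%x. \<eta> x * F k x) (%x. \<eta> x * f x) <= ennreal B * L1d (F k) f" for k
  by (rule L1d_mono) (use B B0 in \<open>auto simp flip: right_diff_distrib simp: abs_mult intro!: mult_right_mono\<close>)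
 have b2: "L1d (%x. \<eta> x *\<^sub>R DF k x + F k x *\<^sub>R D\<eta> x) (%x. \<eta> x *\<^sub>R g x + f x *\<^sub>R D\<eta> x)
  <= ennreal B * L1d (DF k) g + ennreal B * L1d (F k) f" for k
 proof -
  have "L1d (%x. \<eta> x *\<^sub>R DF k x) (%x. \<eta> x *\<^sub>R g x) <= ennreal B * L1d (DF k) g"
   by (rule L1d_mono) (use B B0 in \<open>auto simp flip: scaleR_diff_right intro!: mult_right_mono\<close>)
  moreover have "L1d (%x. F k x *\<^sub>R D\<eta> x) (%x. f x *\<^sub>R D\<eta> x) <= ennreal B * L1d (F k) f"
   by (rule L1d_mono) (use B B0 in \<open>auto simp flip: scaleR_diff_left simp: mult.commute[of B] intro!: mult_left_mono\<close>)
  ultimately show ?thesis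
   by (intro order_trans[OF L1d_add] add_mono) auto
 qed
 have l1: "(%k. ennreal B * L1d (F k) f) \<longlonglongrightarrow> 0"
  using ennreal_tendsto_cmult[of "ennreal B", OF _ F(2)] by simp
 have l2: "(%k. ennreal B * L1d (DF k) g) \<longlonglongrightarrow> 0"
  using ennreal_tendsto_cmult[of "ennreal B", OF _ F(3)] by simp
 have l3: "(%k. ennreal B * L1d (DF k) g + ennreal B * L1d (F k) f) \<longlonglongrightarrow> 0"
  using tendsto_add[OF l2 l1] by simp
 show ?thesis
 proof (rule W_closed_seq)
  show "W (%x. \<eta> x * F k x) (%x. \<eta> x *\<^sub>R DF k x + F k x *\<^sub>R D\<eta> x)" for k
   by (intro C1c_W C1c_mult_gen F e)
  show "(%k. L1d (%x. \<eta> x * F k x) (%x. \<eta> x * f x)) \<longlonglongrightarrow> 0"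
   by (rule tendsto_sandwich[OF _ _ tendsto_const l1]) (auto intro!: eventuallyI b1)
  show "(%k. L1d (%x. \<eta> x *\<^sub>R DF k x + F k x *\<^sub>R D\<eta> x) (%x. \<eta> x *\<^sub>R g x + f x *\<^sub>R D\<eta> x)) \<longlonglongrightarrow> 0"
   by (rule tendsto_sandwich[OF _ _ tendsto_const l3]) (auto intro!: eventuallyI b2)
 qed (use i i2 i3 in auto)
qed

lemma W_cmult: "W f g ==> W (%x. c * f x) (%x. c *\<^sub>R g x)"
 using W_mult[of f g "%_. c" "%_. 0" "\<bar>c\<bar>"] by simp

lemma W_diff: "W f g ==> W f' g' ==> W (%x. f x - f' x) (%x. g x - g' x)"
 using W_add[OF _ W_cmult[of f' g' "-1"], of f g] by simp

lemma L1d_DCT: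
 fixes f :: "nat => 'a::euclidean_space => 'b::euclidean_space"
 assumes [measurable]: "!!k. f k \<in> borel_measurable borel" "g \<in> borel_measurable borel"
  and w: "integrable lborel (w :: 'a => real)" and "!!k x. norm (f k x - g x) <= w x"
  and l: "AE x in lborel. (%k. f k x) \<longlonglongrightarrow> g x"
 shows "(%k. L1d (f k) g) \<longlonglongrightarrow> 0"
proof -
 have "(%k. L1d (f k) g) \<longlonglongrightarrow> (\<integral>\<^sup>+x. 0 \<partial>(lborel::'a measure))"
  unfolding L1d_def
 proof (rule nn_integral_dominated_convergence[where w="%x. ennreal (w x)"])
  show "IB (%x. w x) < \<infinity>"
  proof -
   have "0 <= w x" for x using order_trans[OF norm_ge_zero assms(4)[of 0 x]] .
   then show ?thesis using w by (subst nn_integral_eq_integral) auto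
  qed
  show "AE x in lborel. (%k. ennreal (norm (f k x - g x))) \<longlonglongrightarrow> 0"
   using l
  proof eventually_elim
   case (elim x)
   then have "(%k. norm (f k x - g x)) \<longlonglongrightarrow> 0" by (simp add: LIM_zero tendsto_norm_zero)
   from tendsto_ennrealI[OF this] show ?case by simp
  qed
 qed (use assms(4) w in \<open>auto intro: ennreal_leI\<close>)
 then show ?thesis by simp
qed

text \<open>The error of the gradient splits into a part with \<open>DF k - g\<close>, controlled by
  the bound of \<open>H'\<close>, and a part with \<open>H' (F k x) - H' (f x)\<close> times
  \<open>g x\<close>, which vanishes by dominated convergence because \<open>W_seq\<close> also
  converges almost everywhere.\<close>

lemma W_chain:
 assumes w: "W f g" and H: "!!t. (H has_real_derivative H' t) (at t)" "continuous_on UNIV H'"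
  "!!t. \<bar>H' t\<bar> <= B" "H 0 = 0"
 shows "W (%x. H (f x)) (%x. H' (f x) *\<^sub>R g x)"
proof -
 note [measurable] = W_measurable[OF w]
 have B0: "B \<ge> 0" using H(3)[of 0] by simp
 have lip: "\<bar>H s - H t\<bar> <= B * \<bar>s - t\<bar>" for s t
 proof -
  have "norm (H s - H t) <= B * norm (s - t)"
   by (rule field_differentiable_bound[of UNIV]) (use H in \<open>auto intro: has_field_derivative_at_within\<close>)
  then show ?thesis by simp
 qed
 have [measurable]: "H' \<in> borel_measurable borel" "H \<in> borel_measurable borel"
  using H(2) by (auto intro!: borel_measurable_continuous_onI DERIV_continuous_on[OF has_field_derivative_at_within[OF H(1)]])
 obtain F DF where F: "!!k::nat. C1c (F k) (DF k)" "(%k. L1d (F k) f) \<longlonglongrightarrow> 0" "(%k. L1d (DF k) g) \<longlonglongrightarrow> 0"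
  "AE x in lborel. (%k. F k x) \<longlonglongrightarrow> f x"
  by (rule W_seq[OF w], rule that)
 note [measurable] = C1cD(6,7)[OF F(1)]
 have C: "C1c (%x. H (F k x)) (%x. H' (F k x) *\<^sub>R DF k x)" for k
 proof -
  obtain R where R: "!!x. R < norm x ==> F k x = 0 \<and> DF k x = 0" using C1cD(8)[OF F(1)[of k]] by auto
  show ?thesis unfolding C1c_def
  proof (intro conjI allI exI[of _ R])
   fix x
   show "((%x. H (F k x)) has_derivative (%h. (H' (F k x) *\<^sub>R DF k x) \<bullet> h)) (at x)"
    using has_derivative_compose[OF C1cD(1)[OF F(1)[of k]] H(1)[unfolded has_field_derivative_def], of x] by simp
  next
   show "continuous_on UNIV (%x. H' (F k x) *\<^sub>R DF k x)"
    by (intro continuous_intros continuous_on_compose2[OF H(2)] C1cD(2,3)[OF F(1)]) auto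
  qed (use R H(4) in auto)
 qed
 have i1: "integrable lborel (%x. H (f x))"
  by (rule Bochner_Integration.integrable_bound[of _ "%x. B * f x"])
   (use W_integrable[OF w] lip[of _ 0] B0 H(4) in \<open>auto simp: abs_mult\<close>)
 have i2: "integrable lborel (%x. H' (f x) *\<^sub>R g x)"
  by (rule Bochner_Integration.integrable_bound[of _ "%x. B *\<^sub>R g x"])
   (use W_integrable[OF w] H B0 in \<open>auto intro!: mult_right_mono\<close>)
 have l1: "(%k. ennreal B * L1d (F k) f) \<longlonglongrightarrow> 0"
  using ennreal_tendsto_cmult[of "ennreal B", OF _ F(2)] by simp
 have l2: "(%k. ennreal B * L1d (DF k) g) \<longlonglongrightarrow> 0"
  using ennreal_tendsto_cmult[of "ennreal B", OF _ F(3)] by simp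
 have l3: "(%k. L1d (%x. H' (F k x) *\<^sub>R g x) (%x. H' (f x) *\<^sub>R g x)) \<longlonglongrightarrow> 0"
 proof (rule L1d_DCT[where w="%x. (2 * B) * norm (g x)"])
  show "integrable lborel (%x. 2 * B * norm (g x))" using W_integrable[OF w] by simp
  show "AE x in lborel. (%k. H' (F k x) *\<^sub>R g x) \<longlonglongrightarrow> H' (f x) *\<^sub>R g x"
   using F(4) by eventually_elim (intro tendsto_intros continuous_on_tendsto_compose[OF H(2)], auto)
  fix k x
  have "\<bar>H' (F k x) - H' (f x)\<bar> <= 2 * B" using H(3)[of "F k x"] H(3)[of "f x"] by simp
  then show "norm (H' (F k x) *\<^sub>R g x - H' (f x) *\<^sub>R g x) <= 2 * B * norm (g x)"
   by (simp flip: scaleR_diff_left add: mult_right_mono)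
 qed measurable
 have l4: "(%k. ennreal B * L1d (DF k) g + L1d (%x. H' (F k x) *\<^sub>R g x) (%x. H' (f x) *\<^sub>R g x)) \<longlonglongrightarrow> 0"
  using tendsto_add[OF l2 l3] by simp
 show ?thesis
 proof (rule W_closed_seq[OF i1 i2 C1c_W[OF C]])
  have "L1d (%x. H (F k x)) (%x. H (f x)) <= ennreal B * L1d (F k) f" for k
   by (rule L1d_mono) (use lip B0 in auto)
  then show "(%k. L1d (%x. H (F k x)) (%x. H (f x))) \<longlonglongrightarrow> 0"
   by (intro tendsto_sandwich[OF _ _ tendsto_const l1]) (auto intro!: eventuallyI)
  have "L1d (%x. H' (F k x) *\<^sub>R DF k x) (%x. H' (f x) *\<^sub>R g x)
   <= ennreal B * L1d (DF k) g + L1d (%x. H' (F k x) *\<^sub>R g x) (%x. H' (f x) *\<^sub>R g x)" for k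
  proof -
   have "L1d (%x. H' (F k x) *\<^sub>R DF k x) (%x. H' (F k x) *\<^sub>R g x) <= ennreal B * L1d (DF k) g"
    by (rule L1d_mono) (use H(3) B0 in \<open>auto simp flip: scaleR_diff_right intro!: mult_right_mono\<close>)
   note 1 = add_right_mono[OF this, of "L1d (%x. H' (F k x) *\<^sub>R g x) (%x. H' (f x) *\<^sub>R g x)"]
   have "L1d (%x. H' (F k x) *\<^sub>R DF k x) (%x. H' (f x) *\<^sub>R g x) <=
    L1d (%x. H' (F k x) *\<^sub>R DF k x) (%x. H' (F k x) *\<^sub>R g x) + L1d (%x. H' (F k x) *\<^sub>R g x) (%x. H' (f x) *\<^sub>R g x)"
    by (rule L1d_triangle) measurable
   from order_trans[OF this 1] show ?thesis .
  qed
  then show "(%k. L1d (%x. H' (F k x) *\<^sub>R DF k x) (%x. H' (f x) *\<^sub>R g x)) \<longlonglongrightarrow> 0"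
   by (intro tendsto_sandwich[OF _ _ tendsto_const l4]) (auto intro!: eventuallyI)
 qed
qed

text \<open>Squaring removes the corner of the positive part; the square root regularisation in
  \<open>W_pos\<close> is then continuously differentiable.\<close>

lemma pos_part_square_deriv: "((%t::real. (max t 0)\<^sup>2) has_real_derivative 2 * max t 0) (at t)"
 unfolding has_field_derivative_def has_derivative_at_alt
proof (intro conjI allI impI)
 show "bounded_linear ((*) (2 * max t 0))" by (rule bounded_linear_mult_right)
 fix e :: real assume "e > 0"
 have key: "\<bar>(max y 0)\<^sup>2 - (max t 0)\<^sup>2 - 2 * max t 0 * (y - t)\<bar> <= (y - t)\<^sup>2" for y
 proof -
  have "(max y 0)\<^sup>2 - (max t 0)\<^sup>2 - 2 * max t 0 * (y - t) <= (y - t)\<^sup>2 \<and>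
   0 <= (max y 0)\<^sup>2 - (max t 0)\<^sup>2 - 2 * max t 0 * (y - t)"
  proof (cases "y > 0"; cases "t > 0")
   assume "y > 0" "\<not> t > 0"
   then show "(max y 0)\<^sup>2 - (max t 0)\<^sup>2 - 2 * max t 0 * (y - t) <= (y - t)\<^sup>2 \<and>
    0 <= (max y 0)\<^sup>2 - (max t 0)\<^sup>2 - 2 * max t 0 * (y - t)"
    using power_mono[of y "y - t" 2] by simp
  next
   assume "\<not> y > 0" "t > 0"
   then show "(max y 0)\<^sup>2 - (max t 0)\<^sup>2 - 2 * max t 0 * (y - t) <= (y - t)\<^sup>2 \<and>
    0 <= (max y 0)\<^sup>2 - (max t 0)\<^sup>2 - 2 * max t 0 * (y - t)"
    using mult_nonneg_nonpos[of t y] zero_le_power2[of y] zero_le_power2[of t]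
    by (simp add: power2_eq_square algebra_simps)
  qed (use zero_le_power2[of "y - t"] in \<open>auto simp: power2_eq_square algebra_simps max_def\<close>)
  then show ?thesis by simp
 qed
 show "\<exists>d>0. \<forall>y. norm (y - t) < d --> norm ((max y 0)\<^sup>2 - (max t 0)\<^sup>2 - 2 * max t 0 * (y - t)) <= e * norm (y - t)"
 proof (intro exI[of _ e] conjI allI impI)
  fix y assume "norm (y - t) < e"
  then have "(y - t)\<^sup>2 <= e * \<bar>y - t\<bar>"
   by (metis abs_ge_zero less_imp_le mult_right_mono power2_abs power2_eq_square real_norm_def)
  then show "norm ((max y 0)\<^sup>2 - (max t 0)\<^sup>2 - 2 * max t 0 * (y - t)) <= e * norm (y - t)"
   using key[of y] by simp
 qed (rule \<open>e > 0\<close>)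
qed

lemma W_pos:
 assumes w: "W f g" and c: "c \<ge> 0"
 shows "W (%x. max (f x - c) 0) (%x. if f x > c then g x else 0)"
proof -
 note [measurable] = W_measurable[OF w]
 define d where "d k = 1 / real (Suc k)" for k
 have d0: "d k > 0" for k by (simp add: d_def)
 have dl: "d \<longlonglongrightarrow> 0" unfolding d_def by (rule LIMSEQ_Suc[OF lim_1_over_n])
 \<comment> \<open>A smoothed positive part lying between 0 and \<open>max (t - c) 0\<close>. Its
   derivative tends to 1 for \<open>t > c\<close> and to 0 otherwise, which fixes the gradient on
   \<open>f x = c\<close> as zero. For \<open>c \<ge> 0\<close> it vanishes at 0, as
   \<open>W_chain\<close> requires.\<close>
 define H where "H k t = sqrt ((max (t - c) 0)\<^sup>2 + (d k)\<^sup>2) - d k" for k t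
 define H' where "H' k t = max (t - c) 0 / sqrt ((max (t - c) 0)\<^sup>2 + (d k)\<^sup>2)" for k t
 have sp: "sqrt ((max (t - c) 0)\<^sup>2 + (d k)\<^sup>2) > 0" for t k using d0[of k] by (simp add: add_nonneg_pos)
 have HD: "(H k has_real_derivative H' k t) (at t)" for k t
  unfolding H_def[abs_def] H'_def
  using sp[of t k] d0[of k]
  by (auto intro!: derivative_eq_intros DERIV_chain2[OF pos_part_square_deriv, THEN DERIV_cong] simp: field_simps add_nonneg_pos)
 have Hc: "continuous_on UNIV (H' k)" for k
  unfolding H'_def[abs_def] using sp[of _ k] by (intro continuous_intros) (metis less_irrefl)
 have Hb: "\<bar>H' k t\<bar> <= 1" for k t
 proof -
  have "max (t - c) 0 <= sqrt ((max (t - c) 0)\<^sup>2 + (d k)\<^sup>2)" by (rule real_le_rsqrt) simp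
  then show ?thesis using sp[of t k] by (simp add: H'_def divide_le_eq_1)
 qed
 have H0: "H k 0 = 0" for k using d0[of k] c by (simp add: H_def)
 have Hp: "0 <= H k t" "H k t <= max (t - c) 0" for k t
 proof -
  show "0 <= H k t" using real_le_rsqrt[of "d k" "(max (t - c) 0)\<^sup>2 + (d k)\<^sup>2"] by (simp add: H_def)
  show "H k t <= max (t - c) 0"
  proof -
   have "sqrt ((max (t - c) 0)\<^sup>2 + (d k)\<^sup>2) <= max (t - c) 0 + d k"
    by (rule real_le_lsqrt) (use d0[of k] in \<open>auto simp: power2_sum\<close>)
   then show ?thesis by (simp add: H_def)
  qed
 qed
 have Hl: "(%k. H k t) \<longlonglongrightarrow> max (t - c) 0" for t
 proof -
  have "(%k. H k t) \<longlonglongrightarrow> sqrt ((max (t - c) 0)\<^sup>2 + 0\<^sup>2) - 0"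
   unfolding H_def by (intro tendsto_intros dl)
  then show ?thesis by simp
 qed
 have H'l: "(%k. H' k t) \<longlonglongrightarrow> (if t > c then 1 else 0)" for t
 proof (cases "t > c")
  case True
  have "(%k. H' k t) \<longlonglongrightarrow> max (t - c) 0 / sqrt ((max (t - c) 0)\<^sup>2 + 0\<^sup>2)"
   unfolding H'_def using True by (intro tendsto_intros dl) auto
  then show ?thesis using True by simp
 qed (simp add: H'_def)
 have [measurable]: "H k \<in> borel_measurable borel" "H' k \<in> borel_measurable borel" for k
  using Hc HD by (auto intro!: borel_measurable_continuous_onI DERIV_continuous_on[OF has_field_derivative_at_within[OF HD]])
 show ?thesis
 proof (rule W_closed_seq)
  show "W (%x. H k (f x)) (%x. H' k (f x) *\<^sub>R g x)" for k
   by (rule W_chain[OF w HD Hc Hb H0])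
  show "integrable lborel (%x. max (f x - c) 0)"
   by (rule Bochner_Integration.integrable_bound[OF W_integrable(1)[OF w]]) (use c in auto)
  show "integrable lborel (%x. if f x > c then g x else 0)"
   by (rule Bochner_Integration.integrable_bound[OF W_integrable(2)[OF w]]) auto
  show "(%k. L1d (%x. H k (f x)) (%x. max (f x - c) 0)) \<longlonglongrightarrow> 0"
  proof (rule L1d_DCT[where w="%x. \<bar>f x\<bar>"])
   show "norm (H k (f x) - max (f x - c) 0) <= \<bar>f x\<bar>" for k x using Hp[of k "f x"] c by auto
  qed (use W_integrable[OF w] Hl in auto)
  show "(%k. L1d (%x. H' k (f x) *\<^sub>R g x) (%x. if f x > c then g x else 0)) \<longlonglongrightarrow> 0"
  proof (rule L1d_DCT[where w="%x. 2 * norm (g x)"])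
   fix k x
   have e: "(if f x > c then g x else 0) = (if f x > c then 1 else 0) *\<^sub>R g x" by simp
   have "\<bar>H' k (f x) - (if f x > c then 1 else 0)\<bar> <= 2" using Hb[of k "f x"] by auto
   then show "norm (H' k (f x) *\<^sub>R g x - (if f x > c then g x else 0)) <= 2 * norm (g x)"
    unfolding e by (simp flip: scaleR_diff_left add: mult_right_mono)
  next
   have "(%k. H' k (f x) *\<^sub>R g x) \<longlonglongrightarrow> (if f x > c then 1 else 0) *\<^sub>R g x" for x
    by (intro tendsto_intros H'l)
   then show "AE x in lborel. (%k. H' k (f x) *\<^sub>R g x) \<longlonglongrightarrow> (if f x > c then g x else 0)"
    by (intro AE_I2) (smt (verit, ccfv_SIG) scaleR_one scaleR_zero_left)
  qed (use W_integrable[OF w] in auto)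
 qed
qed

text \<open>The integral of \<open>F\<close> does not change under translation, so every difference
  quotient integrates to 0; uniform differentiability transfers this to \<open>DF\<close>.\<close>

lemma C1c_integral_zero:
 assumes "C1c F DF" shows "LB (%x. DF x) = 0"
proof -
 obtain R where R: "R > 0" "!!x. R < norm x ==> F x = 0 \<and> DF x = 0" using C1cD(8)[OF assms] by auto
 note [measurable] = C1cD(6,7)[OF assms]
 have Z: "LB (%x. DF x) \<bullet> i = 0" if i: "i \<in> Basis" for i
 proof (rule ccontr)
  define M where "M = vol (cball (0::'a) (R+1))"
  assume "LB (%x. DF x) \<bullet> i \<noteq> 0"
  \<comment> \<open>So small that \<open>e\<close> times the volume \<open>M\<close> of the region
    where the difference can be nonzero stays below the supposed nonzero component.\<close>
  define e where "e = \<bar>(LB (%x. DF x)) \<bullet> i\<bar> / (M + 1)"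
  have M: "M \<ge> 0" by (simp add: M_def)
  have e: "e > 0" using \<open>_ \<noteq> 0\<close> M by (simp add: e_def)
  obtain d where d: "d > 0" "!!x h. norm h < d ==> \<bar>F (x + h) - F x - DF x \<bullet> h\<bar> <= e * norm h"
   using C1c_uniformly_differentiable[OF assms e] by blast
  define t where "t = min (d / 2) 1"
  have t: "t > 0" "t < d" "t <= 1" using d by (auto simp: t_def)
  have iF: "integrable lborel (%x. F (x + t *\<^sub>R i))" "integrable lborel F" "integrable lborel DF"
   using C1cD(4,5)[OF assms] integrable_translate by auto
  have "LB (%x. F (x + t *\<^sub>R i) - F x - DF x \<bullet> (t *\<^sub>R i))
   = LB (%x. F (x + t *\<^sub>R i)) - (LB (%x. F x)) - (LB (%x. DF x \<bullet> (t *\<^sub>R i)))"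
   using iF by (subst Bochner_Integration.integral_diff; simp)+
  also have "... = - (t * (LB (%x. DF x) \<bullet> i))"
   using iF integral_translate[of F "t *\<^sub>R i"] integral_inner_left[of "i" lborel DF] by simp
  finally have "t * \<bar>(LB (%x. DF x)) \<bullet> i\<bar> = norm (LB (%x. F (x + t *\<^sub>R i) - F x - DF x \<bullet> (t *\<^sub>R i)))"
   using t by (simp add: abs_mult)
  also have "... <= LB (%x. norm (F (x + t *\<^sub>R i) - F x - DF x \<bullet> (t *\<^sub>R i)))"
   by (rule integral_norm_bound)
  also have "... <= LB (%x. (e * t) * indicator (cball (0::'a) (R+1)) x)"
  proof (rule Bochner_Integration.integral_mono)
   fix x :: 'a
   show "norm (F (x + t *\<^sub>R i) - F x - DF x \<bullet> (t *\<^sub>R i)) <= e * t * indicator (cball 0 (R+1)) x"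
   proof (cases "x \<in> cball 0 (R+1)")
    case True
    then show ?thesis using d(2)[of "t *\<^sub>R i" x] t i by simp
   next
    case False
    have "norm (x + t *\<^sub>R i) > R" using False norm_triangle_ineq4[of "x + t *\<^sub>R i" "t *\<^sub>R i"] t i by simp
    then show ?thesis using R(2)[of "x + t *\<^sub>R i"] R(2)[of x] False by simp
   qed
  qed (use iF emeasure_lborel_cball_finite[of "0::'a" "R+1"] in \<open>auto intro!: Bochner_Integration.integrable_diff integrable_norm simp: integrable_indicator_iff\<close>)
  also have "... = e * t * M" by (simp add: M_def)
  finally have "\<bar>(LB (%x. DF x)) \<bullet> i\<bar> <= e * M" using t by (simp add: mult.left_commute mult.commute)
  also have "... < e * (M + 1)" using e by simp
  also have "... = \<bar>(LB (%x. DF x)) \<bullet> i\<bar>" using M by (simp add: e_def)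
  finally show False by simp
 qed
 show ?thesis by (rule euclidean_eqI) (simp only: Z inner_zero_left)
qed

text \<open>The product with the test function is again in \<open>W\<close>, and gradients of
  \<open>W\<close> pairs have integral zero as limits of such gradients.\<close>

lemma W_by_parts:
 assumes w: "W f g" and p: "C1c \<psi> D\<psi>"
 shows "LB (%x. f x *\<^sub>R D\<psi> x) = - (LB (%x. \<psi> x *\<^sub>R g x))"
proof -
 obtain B where B: "!!x. \<bar>\<psi> x\<bar> <= B" "!!x. norm (D\<psi> x) <= B" using C1c_bounded[OF p] by auto
 have W0: "LB (%x. g x) = 0" if w: "W f g" for f :: "'a => real" and g
 proof -
  obtain F DF where F: "!!k::nat. C1c (F k) (DF k)" "(%k. L1d (DF k) g) \<longlonglongrightarrow> 0"
   by (rule W_seq[OF w], rule that)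
  have "ennreal (norm (LB (%x. g x))) <= L1d (DF k) g" for k
  proof -
   have i: "integrable lborel (%x. DF k x - g x)" using C1cD(5)[OF F(1)] W_integrable[OF w] by auto
   have "LB (%x. DF k x - g x) = - (LB (%x. g x))"
    using C1cD(5)[OF F(1)[of k]] W_integrable[OF w] C1c_integral_zero[OF F(1)[of k]] by simp
   then show ?thesis using integral_norm_bound_ennreal[OF i] by (simp add: L1d_def)
  qed
  then have "ennreal (norm (LB (%x. g x))) <= 0"
   by (intro LIMSEQ_le_const[OF F(2)]) auto
  then show ?thesis by (simp add: ennreal_eq_0_iff)
 qed
 note wm = W_mult[OF w C1cD(1)[OF p] C1cD(2)[OF p] B]
 have 0: "LB (%x. \<psi> x *\<^sub>R g x + f x *\<^sub>R D\<psi> x) = 0" by (rule W0[OF wm])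
 note [measurable] = W_measurable[OF w] C1cD(6,7)[OF p]
 have B0: "0 <= B" using B(1)[of 0] by simp
 have i2: "integrable lborel (%x. \<psi> x *\<^sub>R g x)"
  by (rule Bochner_Integration.integrable_bound[of _ "%x. B *\<^sub>R g x"])
   (use W_integrable[OF w] B in \<open>auto simp: B0 intro!: mult_right_mono\<close>)
 have i3: "integrable lborel (%x. f x *\<^sub>R D\<psi> x)"
  by (rule Bochner_Integration.integrable_bound[of _ "%x. B * f x"])
   (use W_integrable[OF w] B in \<open>auto simp: abs_mult B0 mult.commute[of B] intro!: mult_left_mono\<close>)
 show ?thesis using 0 i2 i3 by (simp add: add_eq_0_iff)
qed

lemma conv_kern_approx:
 fixes g :: "'a::euclidean_space => 'b::euclidean_space"
 assumes i: "integrable lborel g"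
 shows "\<forall>e>0. \<exists>d>0. \<forall>d'. 0 < d' \<and> d' <= d --> L1d (conv (kern d') g) g <= ennreal e"
proof (intro allI impI)
 fix e :: real assume "e > 0"
 then obtain d where d: "d > 0" "!!h. norm h < d ==> (IB (%x. norm (g (x + h) - g x))) < ennreal e"
  using translation_continuous_L1[OF i] by blast
 show "\<exists>d>0. \<forall>d'. 0 < d' \<and> d' <= d --> L1d (conv (kern d') g) g <= ennreal e"
  unfolding L1d_def
 proof (intro exI[of _ d] conjI d allI impI)
  fix d' assume d': "0 < d' \<and> d' <= d"
  then have d0: "d' > 0" by simp
  show "IB (%x. norm (conv (kern d') g x - g x)) <= ennreal e"
  proof (rule conv_approx[OF i, where e=d'])
   show "kern d' x \<ge> 0" "kern d' x <= kern_const TYPE('a) / d' ^ DIM('a)" for x :: 'a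
    by (rule kern_nonneg[OF d0] kern_le[OF d0])+
   show "d' <= norm x ==> kern d' x = 0" for x :: 'a by (rule kern_outside[OF d0])
   show "IB (%x. norm (g (x + h) - g x)) <= ennreal e" if "norm h < d'" for h
    by (rule less_imp_le, rule d(2)) (use that d' in linarith)
  qed (rule kern_measurable kern_integrable[OF d0] kern_integral[OF d0])+
 qed
qed

text \<open>Testing against translated kernels shows that every mollification of \<open>g\<close>
  vanishes, and the mollifications converge to \<open>g\<close>. This gives uniqueness of
  gradients.\<close>

lemma W_zero:
 assumes w: "W f g" and z: "AE x in lborel. f x = 0"
 shows "AE x in lborel. g x = 0"
proof -
 note i = W_integrable(2)[OF w]
 have [measurable]: "g \<in> borel_measurable borel" using i by auto
 have c0: "conv (kern d) g x = 0" if d: "d > 0" for d x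
 proof -
  have s: "smooth_fun (%y. kern d (x + (-1) *\<^sub>R y))" by (rule smooth_fun_affine[OF smooth_kern])
  have s0: "kern d (x + (-1) *\<^sub>R y) = 0" if "norm y > norm x + d" for y
   by (rule kern_outside[OF d]) (use norm_triangle_ineq2[of y x] that in \<open>simp add: norm_minus_commute\<close>)
  obtain D where D: "C1c (%y. kern d (x + (-1) *\<^sub>R y)) (%x. \<Sum>i\<in>Basis. D i x *\<^sub>R i)"
   by (rule smooth_C1c[OF s s0])
  have "LB (%y. f y *\<^sub>R (\<Sum>i\<in>Basis. D i y *\<^sub>R i)) = (\<integral>y. 0 \<partial>(lborel::'a measure))"
   by (rule integral_cong_AE) (use z W_measurable[OF w] C1cD(7)[OF D] in auto)
  with W_by_parts[OF w D] show ?thesis by (simp add: conv_def)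
 qed
 have "L1d (%x. 0) g <= ennreal e" if e: "e > 0" for e
 proof -
  obtain d where d: "d > 0" "L1d (conv (kern d) g) g <= ennreal e"
   using conv_kern_approx[OF i] e by (meson order_refl)
  then show ?thesis using c0[OF d(1)] by (simp add: L1d_def)
 qed
 then have "L1d (%x. 0) g <= 0" by - (rule ennreal_le_epsilon, auto)
 then have "AE x in lborel. ennreal (norm (g x)) = 0"
  unfolding L1d_def by (subst nn_integral_0_iff_AE[symmetric]) auto
 then show ?thesis by eventually_elim (simp add: ennreal_eq_0_iff)
qed

section \<open>Poincare's inequality on balls\<close>

lemma segment_integral_bound:
 assumes F: "C1c F DF"
 shows "ennreal \<bar>F (y + h) - F y\<bar> <= NB (%t. indicator {0..1} t * ennreal (norm h * norm (DF (y + t *\<^sub>R h))))"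
proof -
 have d: "((%t. F (y + t *\<^sub>R h)) has_vector_derivative (DF (y + t *\<^sub>R h) \<bullet> h)) (at t within {0..1})" for t :: real
 proof -
  have "((%t. y + t *\<^sub>R h) has_derivative (%s. s *\<^sub>R h)) (at t within {0..1})"
   by (auto intro!: derivative_eq_intros)
  from has_derivative_compose[OF this C1cD(1)[OF F]]
  show ?thesis by (simp add: has_vector_derivative_def mult.commute)
 qed
 have c: "continuous_on {0..1} (%t. DF (y + t *\<^sub>R h) \<bullet> h)"
  by (intro continuous_intros continuous_on_compose2[OF C1cD(2)[OF F]]) auto
 have b: "has_bochner_integral lborel (%t. indicator {0..1} t *\<^sub>R (DF (y + t *\<^sub>R h) \<bullet> h)) (F (y + 1 *\<^sub>R h) - F (y + 0 *\<^sub>R h))"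
  by (rule has_bochner_integral_FTC_Icc[OF _ d c]) simp
 then have i: "integrable lborel (%t. indicator {0..1} t *\<^sub>R (DF (y + t *\<^sub>R h) \<bullet> h))"
  and e: "F (y + h) - F y = LB (%t. indicator {0..1} t *\<^sub>R (DF (y + t *\<^sub>R h) \<bullet> h))"
  by (auto simp: has_bochner_integral_iff)
 have "ennreal \<bar>F (y + h) - F y\<bar> <= IB (%t. norm (indicator {0..1} t *\<^sub>R (DF (y + t *\<^sub>R h) \<bullet> h)))"
  using integral_norm_bound_ennreal[OF i] unfolding e by simp
 also have "... <= NB (%t. indicator {0..1} t * ennreal (norm h * norm (DF (y + t *\<^sub>R h))))"
  by (intro nn_integral_mono)
   (auto simp: indicator_def intro!: ennreal_leI order_trans[OF Cauchy_Schwarz_ineq2] simp: mult.commute)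
 finally show ?thesis .
qed

text \<open>Substitute \<open>w = y + h\<close> and integrate along the segment, which stays in the
  convex ball. For fixed \<open>h\<close> and \<open>t\<close> a translation turns the inner
  integral into that of the gradient; \<open>h\<close> ranges over the ball of radius
  \<open>2 * r\<close>, the origin of that volume. The double integral avoids any mean value on the
  left.\<close>

lemma C1c_ball_poincare:
 fixes z :: "'a::euclidean_space"
 assumes F: "C1c F DF" and r: "r > 0"
 defines "B \<equiv> ball z r"
 shows "dosc' F B
  <= ennreal (2 * r * vol (ball (0::'a) (2 * r))) * iB B (%x. norm (DF x))"
proof -
 note [measurable] = C1cD(6,7)[OF F]
 have [measurable]: "B \<in> sets borel" by (simp add: B_def)
 define J where "J = iB B (%x. norm (DF x))"
 have conv: "y + t *\<^sub>R h \<in> B" if "y \<in> B" "y + h \<in> B" "t \<in> {0..1}" for y h and t :: real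
 proof -
  have "(1 - t) *\<^sub>R y + t *\<^sub>R (y + h) \<in> B"
   using that by (intro convexD) (auto simp: B_def)
  then show ?thesis by (simp add: algebra_simps)
 qed
 have inner: "NB (%y. indicator B y * (indicator B (y + h) * ennreal \<bar>F (y + h) - F y\<bar>)) <= indicator (ball 0 (2*r)) h * (ennreal (2 * r) * J)" for h
 proof (cases "norm h < 2 * r")
  case False
  have *: "indicator B y * (indicator B (y + h) * ennreal \<bar>F (y + h) - F y\<bar>) = 0" for y
  proof -
   have "\<not> (y \<in> B \<and> y + h \<in> B)"
   proof
    assume "y \<in> B \<and> y + h \<in> B"
    then have "norm (z - y) + norm (z - (y + h)) < r + r" by (auto simp: B_def dist_norm)
    then show False using False norm_triangle_ineq4[of "z - y" "z - (y + h)"] by simp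
   qed
   then show ?thesis by (auto simp: indicator_def)
  qed
  show ?thesis unfolding * by simp
 next
  case True
  have "NB (%y. indicator B y * (indicator B (y + h) * ennreal \<bar>F (y + h) - F y\<bar>))
   <= NB (%y. NB (%t. indicator {0..1} t * (ennreal (norm h) * (ennreal (norm (DF (y + t *\<^sub>R h))) * indicator B (y + t *\<^sub>R h)))))"
  proof (rule nn_integral_mono)
   fix y
   show "indicator B y * (indicator B (y + h) * ennreal \<bar>F (y + h) - F y\<bar>)
    <= NB (%t. indicator {0..1} t * (ennreal (norm h) * (ennreal (norm (DF (y + t *\<^sub>R h))) * indicator B (y + t *\<^sub>R h))))"
   proof (cases "y \<in> B \<and> y + h \<in> B")
    case True
    have "NB (%t. indicator {0..1} t * ennreal (norm h * norm (DF (y + t *\<^sub>R h))))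
     = NB (%t. indicator {0..1} t * (ennreal (norm h) * (ennreal (norm (DF (y + t *\<^sub>R h))) * indicator B (y + t *\<^sub>R h))))"
     by (rule nn_integral_cong) (use conv True in \<open>auto simp: indicator_def ennreal_mult\<close>)
    then show ?thesis using True segment_integral_bound[OF F, of y h] by simp
   qed (auto simp: indicator_def)
  qed
  also have "... = NB (%t. NB (%y. indicator {0..1} t * (ennreal (norm h) * (ennreal (norm (DF (y + t *\<^sub>R h))) * indicator B (y + t *\<^sub>R h)))))"
   by (rule lborel_pair.Fubini') measurable
  also have "... = NB (%t. indicator {0..1} (t::real) * (ennreal (norm h) * J))"
  proof (rule nn_integral_cong)
   fix t :: real
   have "NB (%y. ennreal (norm (DF (y + t *\<^sub>R h))) * indicator B (y + t *\<^sub>R h)) = J"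
    unfolding J_def by (rule nn_integral_translate[of "%y. ennreal (norm (DF y)) * indicator B y"]) measurable
   then show "NB (%y. indicator {0..1} t * (ennreal (norm h) * (ennreal (norm (DF (y + t *\<^sub>R h))) * indicator B (y + t *\<^sub>R h))))
    = indicator {0..1} t * (ennreal (norm h) * J)"
    by (simp add: nn_integral_cmult)
  qed
  also have "... = ennreal (norm h) * J" by (simp add: nn_integral_multc)
  also have "... <= ennreal (2 * r) * J" using True by (intro mult_right_mono ennreal_leI) auto
  finally show ?thesis using True by simp
 qed
 have "dosc' F B
  = NB (%y. NB (%h. indicator B y * (indicator B (y + h) * ennreal \<bar>F (y + h) - F y\<bar>)))"
 proof (rule nn_integral_cong)
  fix y
  have "iB B (%w. \<bar>F y - F w\<bar>) = NB (%h. ennreal \<bar>F y - F (h + y)\<bar> * indicator B (h + y))"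
   by (rule nn_integral_translate[symmetric, of "%w. ennreal \<bar>F y - F w\<bar> * indicator B w"]) measurable
  then show "iB B (%w. \<bar>F y - F w\<bar>) * indicator B y
   = NB (%h. indicator B y * (indicator B (y + h) * ennreal \<bar>F (y + h) - F y\<bar>))"
   by (subst nn_integral_cmult) (auto simp: mult.commute abs_minus_commute add.commute)
 qed
 also have "... = NB (%h. NB (%y. indicator B y * (indicator B (y + h) * ennreal \<bar>F (y + h) - F y\<bar>)))"
  by (rule lborel_pair.Fubini') measurable
 also have "... <= (\<integral>\<^sup>+h. indicator (ball 0 (2*r)) h * (ennreal (2 * r) * J) \<partial>(lborel::'a measure))"
  by (intro nn_integral_mono inner)
 also have "... = emeasure lborel (ball (0::'a) (2*r)) * (ennreal (2 * r) * J)"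
  by (subst nn_integral_multc) (auto intro: borel_measurable_indicator)
 also have "emeasure lborel (ball (0::'a) (2*r)) = ennreal (vol (ball (0::'a) (2 * r)))"
  using emeasure_lborel_ball_finite[of "0::'a" "2*r"] by (intro emeasure_eq_ennreal_measure) auto
 finally show ?thesis using r by (simp add: J_def ennreal_mult mult_ac)
qed

lemma ball_poincare:
 fixes z :: "'a::euclidean_space"
 assumes w: "W f g" and r: "r > 0"
 defines "B \<equiv> ball z r"
 shows "dosc' f B
  <= ennreal (2 * r * vol (ball (0::'a) (2 * r))) * iB B (%x. norm (g x))"
proof -
 note [measurable] = W_measurable[OF w]
 have [measurable]: "B \<in> sets borel" by (simp add: B_def)
 define C where "C = 2 * r * vol (ball (0::'a) (2 * r))"
 define J where "J = iB B (%x. norm (g x))"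
 define M where "M = vol B"
 have M: "emeasure lborel B = ennreal M"
  using emeasure_lborel_ball_finite[of z r] unfolding M_def B_def by (intro emeasure_eq_ennreal_measure) auto
 have C0: "C \<ge> 0" "M \<ge> 0" using r by (auto simp: C_def M_def)
 have "dosc' f B <= ennreal C * J + ennreal e" if e: "e > 0" for e
 proof -
  \<comment> \<open>The total error is \<open>d * (2 * M + C)\<close>: the function is replaced once
    in each variable, the gradient once.\<close>
  define d where "d = e / (2 * M + C + 1)"
  have d: "d > 0" using e C0 by (simp add: d_def add_nonneg_pos)
  obtain F DF where F: "C1c F DF" "L1d F f < ennreal d" "L1d DF g < ennreal d"
   using w d unfolding W_def by meson
  note [measurable] = C1cD(6,7)[OF F(1)]
  have fin: "iB B (%y. \<bar>f y - F y\<bar>) <= ennreal d"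
  proof -
   have "iB B (%y. \<bar>f y - F y\<bar>) <= L1d F f"
    unfolding L1d_def by (intro nn_integral_mono) (auto simp: indicator_def abs_minus_commute)
   then show ?thesis using F(2) by simp
  qed
  have "iB B (%w. \<bar>f y - f w\<bar>) <=
   ennreal \<bar>f y - F y\<bar> * ennreal M + iB B (%w. \<bar>F y - F w\<bar>) + ennreal d" for y
  proof -
   have "iB B (%w. \<bar>f y - f w\<bar>) <=
    NB (%w. ennreal \<bar>f y - F y\<bar> * indicator B w + ennreal \<bar>F y - F w\<bar> * indicator B w + ennreal \<bar>f w - F w\<bar> * indicator B w)"
   proof (rule nn_integral_mono, goal_cases)
    case (1 w)
    have "ennreal \<bar>f y - f w\<bar> <= ennreal (\<bar>f y - F y\<bar> + \<bar>F y - F w\<bar> + \<bar>f w - F w\<bar>)" by (intro ennreal_leI) simp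
    then show ?case
     by (auto simp: indicator_def)
   qed
   also have "... = ennreal \<bar>f y - F y\<bar> * ennreal M + iB B (%w. \<bar>F y - F w\<bar>) + iB B (%w. \<bar>f w - F w\<bar>)"
    by (simp add: nn_integral_add nn_integral_cmult M)
   also have "... <= ennreal \<bar>f y - F y\<bar> * ennreal M + iB B (%w. \<bar>F y - F w\<bar>) + ennreal d"
    by (intro add_left_mono fin)
   finally show ?thesis .
  qed
  then have "dosc' f B
   <= nnB B (%y. ennreal \<bar>f y - F y\<bar> * ennreal M + iB B (%w. \<bar>F y - F w\<bar>) + ennreal d)"
   by (intro nn_integral_mono mult_right_mono) auto
  also have "... = NB (%y. (ennreal \<bar>f y - F y\<bar> * indicator B y) * ennreal M + iB B (%w. \<bar>F y - F w\<bar>) * indicator B y + ennreal d * indicator B y)"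
   by (intro nn_integral_cong) (auto simp: indicator_def)
  also have "... = iB B (%y. \<bar>f y - F y\<bar>) * ennreal M + dosc' F B + ennreal d * ennreal M"
   by (simp add: nn_integral_add nn_integral_multc nn_integral_cmult M)
  also have "... <= ennreal d * ennreal M + ennreal C * (J + ennreal d) + ennreal d * ennreal M"
  proof (intro add_mono mult_right_mono fin order_refl)
   have "iB B (%x. norm (DF x)) <= NB (%x. ennreal (norm (g x)) * indicator B x + ennreal (norm (DF x - g x)))"
   proof (rule nn_integral_mono, goal_cases)
    case (1 x)
    have "ennreal (norm (DF x)) <= ennreal (norm (g x) + norm (DF x - g x))"
     by (intro ennreal_leI) (simp add: norm_triangle_sub)
    then show ?case
     by (auto simp: indicator_def)
   qed
   also have "... = J + L1d DF g" by (simp add: nn_integral_add J_def L1d_def)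
   also have "... <= J + ennreal d" by (intro add_left_mono less_imp_le F)
   finally have "iB B (%x. norm (DF x)) <= J + ennreal d" .
   then show "dosc' F B <= ennreal C * (J + ennreal d)"
    using C1c_ball_poincare[OF F(1) r, of z] unfolding C_def B_def
    by (meson mult_left_mono order_trans zero_le)
  qed auto
  also have "... = ennreal C * J + (ennreal d * ennreal M + ennreal C * ennreal d + ennreal d * ennreal M)"
   by (simp add: distrib_left add_ac)
  also have "ennreal d * ennreal M + ennreal C * ennreal d + ennreal d * ennreal M = ennreal (d * (2 * M + C))"
   using d C0 by (simp flip: ennreal_mult ennreal_plus) (simp add: algebra_simps)
  also have "... <= ennreal e" using e C0 by (intro ennreal_leI) (simp add: d_def divide_simps add_nonneg_pos)
  finally show ?thesis by (simp add: add_left_mono)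
 qed
 then have "dosc' f B <= ennreal C * J"
  by - (rule ennreal_le_epsilon, auto)
 then show ?thesis by (simp add: C_def J_def)
qed

section \<open>Cut-off functions with quantitative gradient bounds\<close>

definition bump_grad :: "'a::euclidean_space => 'a" where
 "bump_grad = (SOME D. C1c bump D)"

lemma C1c_bump: "C1c (bump :: 'a::euclidean_space => real) bump_grad"
proof -
 obtain D where "C1c (bump :: 'a => real) (%x. \<Sum>i\<in>Basis. D i x *\<^sub>R i)"
  by (rule smooth_C1c[OF smooth_bump, of 1]) (auto intro!: bump_outside that)
 then show ?thesis unfolding bump_grad_def by (rule someI[of "C1c bump"])
qed

definition kern_grad :: "real => 'a::euclidean_space => 'a" where
 "kern_grad e x = (kern_const TYPE('a) / e ^ (DIM('a) + 1)) *\<^sub>R bump_grad (x /\<^sub>R e)"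

definition grad_const :: "'a::euclidean_space itself => real" where
 "grad_const _ = (SOME C. C > 0 \<and> (\<forall>x::'a. kern_const TYPE('a) * norm (bump_grad x) <= C))"

lemma kern_const_pos: "kern_const TYPE('a::euclidean_space) > 0"
 using bump_integral_pos by (simp add: kern_const_def)

lemma grad_const: "grad_const TYPE('a::euclidean_space) > 0" "kern_const TYPE('a) * norm (bump_grad (x::'a)) <= grad_const TYPE('a)"
proof -
 obtain B where B: "!!x::'a. norm (bump_grad x) <= B" using C1c_bounded[OF C1c_bump] by blast
 have "kern_const TYPE('a) * norm (bump_grad x) <= kern_const TYPE('a) * B + 1" for x :: 'a
  using mult_left_mono[OF B[of x] less_imp_le[OF kern_const_pos[where 'a='a]]] by linarith
 moreover have "B \<ge> 0" using order_trans[OF norm_ge_zero B] .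
 then have "kern_const TYPE('a) * B + 1 > 0" using kern_const_pos[where 'a='a] by (simp add: add_nonneg_pos)
 ultimately have "\<exists>C>0. \<forall>x::'a. kern_const TYPE('a) * norm (bump_grad x) <= C" by blast
 from someI_ex[OF this[unfolded Bex_def]] show "grad_const TYPE('a) > 0" "kern_const TYPE('a) * norm (bump_grad x) <= grad_const TYPE('a)"
  unfolding grad_const_def by auto
qed

lemma bump_grad_outside: "norm x > 1 ==> bump_grad (x::'a::euclidean_space) = 0"
proof -
 assume x: "norm x > 1"
 have "open {x::'a. norm x > 1}" by (intro open_Collect_less continuous_intros)
 from has_derivative_transform_within_open[OF has_derivative_const this, of x 0 bump]
 have "(bump has_derivative (%h. 0)) (at x)" using x bump_outside by force
 then have "(%h. bump_grad x \<bullet> h) = (%h. 0)" using has_derivative_unique[OF C1cD(1)[OF C1c_bump]] by blast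
 from fun_cong[OF this, of "bump_grad x"] show ?thesis by simp
qed

lemma C1c_kern:
 assumes e: "e > 0" shows "C1c (kern e :: 'a::euclidean_space => real) (kern_grad e)"
 unfolding C1c_def
proof (intro conjI allI exI[of _ e] impI)
 fix x :: 'a
 have "((%x::'a. x /\<^sub>R e) has_derivative (%h. h /\<^sub>R e)) (at x)"
  by (auto intro!: derivative_eq_intros)
 from has_derivative_mult_right[OF has_derivative_compose[OF this C1cD(1)[OF C1c_bump]], of "kern_const TYPE('a) / e ^ DIM('a)"]
 show "(kern e has_derivative (\<bullet>) (kern_grad e x)) (at x)"
  using e by (simp add: kern_def[abs_def] kern_grad_def kern_const_def divide_inverse mult_ac inner_scaleR_left[abs_def])
next
 show "continuous_on UNIV (kern_grad e :: 'a => 'a)"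
  unfolding kern_grad_def[abs_def]
  by (intro continuous_intros continuous_on_compose2[OF C1cD(2)[OF C1c_bump]]) auto
next
 fix x :: 'a assume "e < norm x"
 then show "kern e x = 0" "kern_grad e x = 0"
  using e kern_outside[of e x] bump_grad_outside[of "x /\<^sub>R e"] by (auto simp: kern_grad_def field_simps)
qed

lemma kern_grad_le:
 assumes e: "e > 0" shows "norm (kern_grad e (x::'a::euclidean_space)) <= grad_const TYPE('a) / e ^ (DIM('a) + 1)"
 using grad_const(2)[of "x /\<^sub>R e"] e kern_const_pos[where 'a='a] by (simp add: kern_grad_def divide_simps)

lemma inner_fun_eqD: "(%h. a \<bullet> h) = (%h. b \<bullet> h) ==> a = (b::'a::euclidean_space)"
 by (metis inner_commute vector_eq_rdot)

lemma conv_C1c: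
 fixes f :: "'a::euclidean_space => real"
 assumes f: "integrable lborel f" "!!x. R < norm x ==> f x = 0"
  and k: "smooth_fun k" "C1c k Dk" "!!x. norm x \<ge> e ==> k x = 0"
 shows "C1c (conv k f) (%x. LB (%y. f y *\<^sub>R Dk (x - y)))"
proof -
 have s: "smooth_fun (conv k f)" by (rule smooth_conv[OF f(1) k(1), of e]) (use k(3) in auto)
 have z: "conv k f x = 0" if "norm x > R + e" for x
  by (rule conv_outside[of e k R]) (use k f that in auto)
 obtain D where D: "C1c (conv k f) (%x. \<Sum>i\<in>Basis. D i x *\<^sub>R i)"
  by (rule smooth_C1c[OF s z])
 have "(\<Sum>i\<in>Basis. D i x *\<^sub>R i) = LB (%y. f y *\<^sub>R Dk (x - y))" for x
  by (rule inner_fun_eqD, rule has_derivative_unique[OF C1cD(1)[OF D] conv_has_derivative[OF f(1) k(2)]])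
 then show ?thesis using D by simp
qed

lemma kern_grad_outside: "e > 0 ==> norm x > e ==> kern_grad e x = 0"
 using bump_grad_outside[of "x /\<^sub>R e"] by (simp add: kern_grad_def field_simps)

text \<open>The kernel gradient has size of order \<open>1 / e ^ (DIM('a) + 1)\<close> on a ball
  whose volume is of order \<open>e ^ DIM('a)\<close>; their product gives the factor
  \<open>1 / e\<close>, whatever the set \<open>S\<close> is.\<close>

lemma mollified_indicator:
 fixes S :: "'a::euclidean_space set"
 assumes S: "compact S" and e: "e > 0"
 defines "\<eta> \<equiv> conv (kern e) (indicat_real S)"
 obtains D\<eta> where "smooth_fun \<eta>" "C1c \<eta> D\<eta>" "!!x. 0 <= \<eta> x" "!!x. \<eta> x <= 1"
  "!!x. ball x e \<subseteq> S ==> \<eta> x = 1" "!!x. ball x e \<inter> S = {} ==> \<eta> x = 0"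
  "!!x. norm (D\<eta> x) <= grad_const TYPE('a) * unit_ball_vol (real DIM('a)) / e"
proof -
 have [measurable]: "S \<in> sets borel" using S by (simp add: compact_imp_closed)
 obtain R where R: "S \<subseteq> ball 0 R" using S compact_imp_bounded bounded_subset_ballD by blast
 have iS: "integrable lborel (indicat_real S)"
  using emeasure_bounded_finite[OF compact_imp_bounded[OF S]] by (auto simp: integrable_indicator_iff)
 have zS: "indicat_real S x = 0" if "R < norm x" for x using R that by (auto simp: indicator_def)
 define D where "D x = LB (%y. indicat_real S y *\<^sub>R kern_grad e (x - y))" for x
 have sm: "smooth_fun \<eta>" unfolding \<eta>_def
  by (rule smooth_conv[OF iS smooth_kern, of e]) (auto intro!: kern_outside[OF e])
 have C: "C1c \<eta> D"
  unfolding \<eta>_def D_def[abs_def]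
  by (rule conv_C1c[where R=R and e=e, OF iS zS smooth_kern C1c_kern[OF e] kern_outside[OF e]])
 have ik: "integrable lborel (%y. kern e (x - y))" for x :: 'a
  by (rule reflect_integrable[OF kern_integrable[OF e]])
 have ikS: "integrable lborel (%y. kern e (x - y) * indicat_real S y)" for x :: 'a
  by (rule Bochner_Integration.integrable_bound[OF ik[of x]]) (auto simp: indicator_def)
 have tot: "LB (%y. kern e (x - y)) = 1" for x :: 'a
  using reflect_integral[of "kern e" x] kern_integral[OF e] by simp
 have nn: "0 <= \<eta> x" for x
  unfolding \<eta>_def conv_def by (rule Bochner_Integration.integral_nonneg) (use kern_nonneg[OF e] in \<open>auto simp: indicator_def\<close>)
 have le1: "\<eta> x <= 1" for x
 proof -
  have "\<eta> x <= LB (%y. kern e (x - y))"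
   unfolding \<eta>_def conv_def
   by (rule Bochner_Integration.integral_mono) (use ik ikS kern_nonneg[OF e] in \<open>auto simp: indicator_def\<close>)
  then show ?thesis by (simp add: tot)
 qed
 have one: "\<eta> x = 1" if "ball x e \<subseteq> S" for x
 proof -
  have "kern e (x - y) * indicat_real S y = kern e (x - y)" for y
   using that kern_outside[OF e, of "x - y"] by (cases "norm (x - y) < e") (auto simp: dist_norm subset_iff indicator_def)
  then show ?thesis unfolding \<eta>_def conv_def real_scaleR_def using tot[of x] by (simp only:)
 qed
 have zero: "\<eta> x = 0" if "ball x e \<inter> S = {}" for x
 proof -
  have "kern e (x - y) * indicat_real S y = 0" for y
   using that kern_outside[OF e, of "x - y"] by (cases "norm (x - y) < e") (auto simp: dist_norm indicator_def)
  then show ?thesis unfolding \<eta>_def conv_def real_scaleR_def by (simp only: Bochner_Integration.integral_zero)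
 qed
 have gb: "norm (D x) <= grad_const TYPE('a) * unit_ball_vol (real DIM('a)) / e" for x
 proof -
  define G where "G = grad_const TYPE('a) / e ^ (DIM('a) + 1)"
  have G: "G \<ge> 0" using grad_const(1)[where 'a='a] e by (simp add: G_def)
  have "norm (D x) <= LB (%y. G * indicator (cball x e) y)"
   unfolding D_def
  proof (rule Bochner_Integration.integral_norm_bound_integral)
   have [measurable]: "kern_grad e \<in> borel_measurable borel" using C1cD(7)[OF C1c_kern[OF e]] .
   have "integrable lborel (%y. kern_grad e (x - y))"
    by (rule reflect_integrable[OF C1cD(5)[OF C1c_kern[OF e]]])
   then show "integrable lborel (%y. indicat_real S y *\<^sub>R kern_grad e (x - y))"
    by (rule Bochner_Integration.integrable_bound) (auto simp: indicator_def)
   show "integrable lborel (%y. G * indicator (cball x e) y)"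
    using emeasure_lborel_cball_finite[of x e] by (auto simp: integrable_indicator_iff)
   fix y
   show "norm (indicat_real S y *\<^sub>R kern_grad e (x - y)) <= G * indicator (cball x e) y"
   proof (cases "norm (x - y) <= e")
    case True
    then show ?thesis using kern_grad_le[OF e, of "x - y"] G by (auto simp: indicator_def G_def dist_norm)
   next
    case False
    then have "kern_grad e (x - y) = 0" by (intro kern_grad_outside e) simp
    then show ?thesis using G by (simp add: indicator_def)
   qed
  qed
  also have "... = G * (unit_ball_vol (real DIM('a)) * e ^ DIM('a))"
   using e by (simp add: content_cball)
  also have "... = grad_const TYPE('a) * unit_ball_vol (real DIM('a)) / e" using e by (simp add: G_def)
  finally show ?thesis .
 qed
 show thesis by (rule that[OF sm C nn le1 one zero gb])
qed

definition cut_const :: "'a::euclidean_space itself => real" where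
 "cut_const _ = 2 * grad_const TYPE('a) * unit_ball_vol (real DIM('a))"

lemma ball_cutoff:
 fixes z :: "'a::euclidean_space"
 assumes r: "0 < r" "r < R"
 obtains \<eta> D\<eta> where "smooth_fun \<eta>" "C1c \<eta> D\<eta>" "!!x. 0 <= \<eta> x" "!!x. \<eta> x <= 1"
  "!!x. dist z x <= r ==> \<eta> x = 1" "!!x. dist z x \<ge> R ==> \<eta> x = 0"
  "!!x. norm (D\<eta> x) <= cut_const TYPE('a) / (R - r)"
proof -
 \<comment> \<open>Mollifying the ball of the middle radius at half the width leaves the value 1 up
   to \<open>r\<close> and 0 from \<open>R\<close> on; this is the factor 2 in
   \<open>cut_const\<close>.\<close>
 define e where "e = (R - r) / 2"
 have e: "e > 0" using r by (simp add: e_def)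
 let ?\<eta> = "conv (kern e) (indicat_real (cball z (r + e)))"
 obtain D\<eta> where D: "smooth_fun ?\<eta>" "C1c ?\<eta> D\<eta>" "!!x. 0 <= ?\<eta> x" "!!x. ?\<eta> x <= 1"
  "!!x. ball x e \<subseteq> cball z (r + e) ==> ?\<eta> x = 1" "!!x. ball x e \<inter> cball z (r + e) = {} ==> ?\<eta> x = 0"
  "!!x. norm (D\<eta> x) <= grad_const TYPE('a) * unit_ball_vol (real DIM('a)) / e"
  by (rule mollified_indicator[OF compact_cball e, of z "r + e"], rule that)
 have 1: "?\<eta> x = 1" if "dist z x <= r" for x
 proof (rule D(5), rule subsetI)
  fix y assume "y \<in> ball x e"
  then show "y \<in> cball z (r + e)" using that dist_triangle[of z y x] by simp
 qed
 have 2: "?\<eta> x = 0" if "dist z x \<ge> R" for x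
 proof (rule D(6), rule ccontr)
  assume "ball x e \<inter> cball z (r + e) \<noteq> {}"
  then obtain y where "dist x y < e" "dist z y <= r + e" by auto
  then show False using that dist_triangle[of z x y] by (simp add: e_def dist_commute field_simps)
 qed
 have 3: "norm (D\<eta> x) <= cut_const TYPE('a) / (R - r)" for x
  using D(7)[of x] by (simp add: cut_const_def e_def mult_ac)
 show thesis by (rule that[OF D(1-4) 1 2 3])
qed

lemma sums_cball_iff:
 fixes w :: "'a::euclidean_space"
 shows "w \<in> (\<Union>x\<in>K. \<Union>y\<in>cball 0 e. {x + y}) \<longleftrightarrow> (\<exists>x\<in>K. dist x w <= e)"
proof
 assume "\<exists>x\<in>K. dist x w <= e"
 then obtain x where "x \<in> K" "dist x w <= e" by blast
 then have "x \<in> K" "w - x \<in> cball 0 e" "w = x + (w - x)"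
  by (auto simp: dist_norm norm_minus_commute)
 then show "w \<in> (\<Union>x\<in>K. \<Union>y\<in>cball 0 e. {x + y})" by blast
next
 assume "w \<in> (\<Union>x\<in>K. \<Union>y\<in>cball 0 e. {x + y})"
 then obtain x y where "x \<in> K" "norm y <= e" "w = x + y" by auto
 then show "\<exists>x\<in>K. dist x w <= e" by (intro bexI[of _ x]) (auto simp: dist_norm)
qed

lemma compact_cutoff:
 fixes K :: "'a::euclidean_space set"
 assumes K: "compact K" "open U" "K \<subseteq> U"
 obtains \<eta> D\<eta> where "test_fun U \<eta>" "C1c \<eta> D\<eta>" "!!x. 0 <= \<eta> x" "!!x. \<eta> x <= 1" "!!x. x \<in> K ==> \<eta> x = 1"
proof -
 have "K \<inter> - U = {}" "closed (- U)" using K by auto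
 from separate_compact_closed[OF K(1) this(2,1)]
 obtain d where d: "d > 0" "!!x y. x \<in> K ==> y \<in> - U ==> d <= dist x y" by blast
 \<comment> \<open>One \<open>e\<close> is spent on thickening \<open>K\<close>, one on mollifying,
   and one remains as distance to the complement of \<open>U\<close>.\<close>
 define e where "e = d / 3"
 have e: "e > 0" using d by (simp add: e_def)
 define S where "S = (\<Union>x\<in>K. \<Union>y\<in>cball 0 e. {x + y})"
 have cS: "compact S" unfolding S_def by (rule compact_sums'[OF K(1) compact_cball])
 have S_iff: "w \<in> S \<longleftrightarrow> (\<exists>x\<in>K. dist x w <= e)" for w
  unfolding S_def by (rule sums_cball_iff)
 let ?\<eta> = "conv (kern e) (indicat_real S)"
 obtain D\<eta> where D: "smooth_fun ?\<eta>" "C1c ?\<eta> D\<eta>" "!!x. 0 <= ?\<eta> x" "!!x. ?\<eta> x <= 1"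
  "!!x. ball x e \<subseteq> S ==> ?\<eta> x = 1" "!!x. ball x e \<inter> S = {} ==> ?\<eta> x = 0"
  by (rule mollified_indicator[OF cS e], rule that)
 define T where "T = (\<Union>x\<in>K. \<Union>y\<in>cball 0 (2 * e). {x + y})"
 have cT: "compact T" unfolding T_def by (rule compact_sums'[OF K(1) compact_cball])
 have T_iff: "w \<in> T \<longleftrightarrow> (\<exists>x\<in>K. dist x w <= 2 * e)" for w
  unfolding T_def by (rule sums_cball_iff)
 have "{x. ?\<eta> x \<noteq> 0} \<subseteq> T"
 proof
  fix x assume "x \<in> {x. ?\<eta> x \<noteq> 0}"
  then have "ball x e \<inter> S \<noteq> {}" using D(6) by auto
  then obtain y k where "dist x y < e" "k \<in> K" "dist k y <= e" using S_iff by auto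
  then have "dist k x <= 2 * e" using dist_triangle[of k x y] by (simp add: dist_commute)
  then show "x \<in> T" using T_iff \<open>k \<in> K\<close> by blast
 qed
 then have cl: "closure {x. ?\<eta> x \<noteq> 0} \<subseteq> T" using cT by (simp add: closure_minimal compact_imp_closed)
 have TU: "T \<subseteq> U"
 proof
  fix w assume "w \<in> T"
  then obtain x where x: "x \<in> K" "dist x w <= 2 * e" using T_iff by auto
  then show "w \<in> U" using d(2)[of x w] e d(1) by (force simp: e_def)
 qed
 have tf: "test_fun U ?\<eta>" unfolding test_fun_def
  using D(1) cl TU compact_Int_closed[OF cT, of "closure {x. ?\<eta> x \<noteq> 0}"] by (auto simp: inf.absorb2)
 have 1: "?\<eta> x = 1" if "x \<in> K" for x
  by (rule D(5)) (use that S_iff in fastforce)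
 show thesis by (rule that[OF tf D(2-4) 1])
qed

section \<open>Weak gradients\<close>

text \<open>The notions of the theorem integrate with respect to \<open>lebesgue\<close>, while
  Fubini and translations are used on \<open>lborel\<close>. A Borel representative with the same
  integrals against Borel functions bridges the two.\<close>

lemma lebesgue_borel_rep:
 fixes f :: "'a::euclidean_space => real"
 assumes "integrable lebesgue f"
 obtains f' where "integrable lborel f'" "AE x in lborel. f x = f' x"
  "!!B. B \<in> borel_measurable borel ==> (LL (%x. f x * B x)) = LB (%x. f' x * B x)"
proof -
 have m: "f \<in> borel_measurable lebesgue" using assms by auto
 obtain f' where f': "f' \<in> borel_measurable lborel" "AE x in lborel. f x = f' x"
  using completion_ex_borel_measurable_real[OF m] by auto
 then have ae: "AE x in lebesgue. f x = f' x" by (simp add: AE_completion)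
 have m': "f' \<in> borel_measurable lebesgue" using f'(1) by (simp add: measurable_completion)
 have "integrable lebesgue f'" using integrable_cong_AE[OF m m' ae] assms by simp
 then have i: "integrable lborel f'" using f'(1) by (simp add: integrable_completion)
 have "LL (%x. f x * B x) = LB (%x. f' x * B x)" if B: "B \<in> borel_measurable borel" for B
 proof -
  have Bl: "B \<in> borel_measurable lebesgue" using B by (auto intro: measurable_completion)
  have "LL (%x. f x * B x) = LL (%x. f' x * B x)"
  proof (rule integral_cong_AE)
   show "AE x in lebesgue. f x * B x = f' x * B x" using ae by eventually_elim simp
  qed (use m m' Bl in \<open>auto intro!: borel_measurable_times\<close>)
  also have "... = LB (%x. f' x * B x)"
   using f'(1) B by (intro integral_completion) auto
  finally show ?thesis .
 qed
 then show thesis using that[OF i f'(2)] by blast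
qed

lemma test_fun_bounded: "test_fun U \<psi> ==> \<exists>R. \<forall>x. norm x > R --> \<psi> x = 0"
 unfolding test_fun_def using bounded_subset_ballD[OF compact_imp_bounded, of "closure {x. \<psi> x \<noteq> 0}" 0]
  closure_subset by (metis (mono_tags, lifting) dist_0_norm mem_Collect_eq mem_ball not_less_iff_gr_or_eq subset_iff)

lemma test_fun_C1c:
 assumes "test_fun U \<psi>" shows "\<exists>D. C1c \<psi> D"
proof -
 obtain R where R: "!!x. norm x > R ==> \<psi> x = 0" using test_fun_bounded[OF assms] by blast
 have s: "smooth_fun \<psi>" using assms by (simp add: test_fun_def)
 show ?thesis by (rule smooth_C1c[OF s R]) blast+
qed

lemma test_fun_mult:
 assumes "test_fun U \<eta>" "smooth_fun \<psi>" shows "test_fun U (%x. \<eta> x * \<psi> x)"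
proof -
 have s: "closure {x. \<eta> x * \<psi> x \<noteq> 0} \<subseteq> closure {x. \<eta> x \<noteq> 0}" by (rule closure_mono) auto
 have c: "compact (closure {x. \<eta> x \<noteq> 0})" using assms(1) by (simp add: test_fun_def)
 have "compact (closure {x. \<eta> x * \<psi> x \<noteq> 0})"
  using compact_Int_closed[OF c, of "closure {x. \<eta> x * \<psi> x \<noteq> 0}"] s by (simp add: inf.absorb2)
 then show ?thesis using assms s unfolding test_fun_def by (auto intro: smooth_fun_mult)
qed

lemma C1c_frechet: "C1c \<psi> D ==> frechet_derivative \<psi> (at x) i = D x \<bullet> i"
 using frechet_derivative_at[OF C1cD(1), of \<psi> D x] by metis

lemma test_fun_support:
 assumes "C1c \<psi> D" "x \<notin> closure {x. \<psi> x \<noteq> 0}"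
 shows "\<psi> x = 0" "D x = 0"
proof -
 have z: "\<psi> y = 0" if "y \<notin> closure {x. \<psi> x \<noteq> 0}" for y
  using that closure_subset[of "{x. \<psi> x \<noteq> 0}"] by auto
 show "\<psi> x = 0" using z assms(2) .
 have xC: "x \<in> - closure {x. \<psi> x \<noteq> 0}" using assms(2) by blast
 have "open (- closure {x. \<psi> x \<noteq> 0})" by (rule open_Compl[OF closed_closure])
 moreover have "0 = \<psi> y" if "y \<in> - closure {x. \<psi> x \<noteq> 0}" for y by (rule z[symmetric]) (rule ComplD[OF that])
 ultimately have "(\<psi> has_derivative (%h. 0)) (at x)"
  by (rule has_derivative_transform_within_open[OF has_derivative_const _ xC])
 then have "(%h. D x \<bullet> h) = (%h. 0 \<bullet> h)" using has_derivative_unique[OF C1cD(1)[OF assms(1)]] by fastforce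
 then show "D x = 0" by (rule inner_fun_eqD)
qed

lemma test_fun_set_integral:
 assumes p: "test_fun U \<psi>" "C1c \<psi> D"
 shows "(\<integral>x\<in>U. u x * frechet_derivative \<psi> (at x) i \<partial>lebesgue) = LL (%x. u x * (D x \<bullet> i))"
  "(\<integral>x\<in>U. v x * \<psi> x \<partial>lebesgue) = LL (%x. v x * \<psi> x)"
proof -
 have z: "\<psi> x = 0" "D x = 0" if "x \<notin> U" for x
  using test_fun_support[OF p(2), of x] that p(1) by (auto simp: test_fun_def)
 have *: "indicator U x *\<^sub>R (u x * frechet_derivative \<psi> (at x) i) = u x * (D x \<bullet> i)"
  "indicator U x *\<^sub>R (v x * \<psi> x) = v x * \<psi> x" for x
  using z[of x] by (cases "x \<in> U"; simp add: C1c_frechet[OF p(2)])+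
 show "(\<integral>x\<in>U. u x * frechet_derivative \<psi> (at x) i \<partial>lebesgue) = LL (%x. u x * (D x \<bullet> i))"
  "(\<integral>x\<in>U. v x * \<psi> x \<partial>lebesgue) = LL (%x. v x * \<psi> x)"
  unfolding set_lebesgue_integral_def * by simp_all
qed

lemma weak_grad_test:
 assumes w: "weak_grad U u g" and p: "test_fun U \<psi>" "C1c \<psi> D" and i: "i \<in> Basis"
 shows "integrable lebesgue (%x. u x * (D x \<bullet> i))" "integrable lebesgue (%x. (g x \<bullet> i) * \<psi> x)"
  "LL (%x. u x * (D x \<bullet> i)) = - (LL (%x. (g x \<bullet> i) * \<psi> x))"
proof -
 define K where "K = closure {x. \<psi> x \<noteq> 0}"
 have K: "compact K" "K \<subseteq> U" using p(1) by (auto simp: test_fun_def K_def)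
 have z: "\<psi> x = 0" if "x \<notin> K" for x
  using that unfolding K_def by (rule test_fun_support(1)[OF p(2)])
 have zD: "D x = 0" if "x \<notin> K" for x
  using that unfolding K_def by (rule test_fun_support(2)[OF p(2)])
 obtain B where B: "!!x. \<bar>\<psi> x\<bar> <= B" "!!x. norm (D x) <= B" using C1c_bounded[OF p(2)] by auto
 have B0: "B \<ge> 0" using B(1)[of 0] by simp
 have m: "\<psi> \<in> borel_measurable lebesgue" "(%x. D x \<bullet> i) \<in> borel_measurable lebesgue"
  using C1cD(6,7)[OF p(2)] by (auto intro!: measurable_completion)
 have iu: "integrable lebesgue (%x. indicator K x *\<^sub>R u x)" "integrable lebesgue (%x. indicator K x *\<^sub>R (g x \<bullet> i))"
  using w i K unfolding weak_grad_def loc_integrable_def set_integrable_def by blast+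
 have e1: "u x * (D x \<bullet> i) = (indicator K x *\<^sub>R u x) * (D x \<bullet> i)" for x using zD[of x] by (cases "x \<in> K") auto
 have e2: "(g x \<bullet> i) * \<psi> x = (indicator K x *\<^sub>R (g x \<bullet> i)) * \<psi> x" for x using z[of x] by (cases "x \<in> K") auto
 have bD: "\<bar>D x \<bullet> i\<bar> <= B" for x using Cauchy_Schwarz_ineq2[of "D x" i] B(2)[of x] i by simp
 show "integrable lebesgue (%x. u x * (D x \<bullet> i))" unfolding e1
  by (rule Bochner_Integration.integrable_bound[of _ "%x. B * (indicator K x *\<^sub>R u x)"])
   (use iu(1) m bD B0 in \<open>auto simp: abs_mult mult.commute[of B] intro!: mult_left_mono borel_measurable_times\<close>)
 show "integrable lebesgue (%x. (g x \<bullet> i) * \<psi> x)" unfolding e2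
  by (rule Bochner_Integration.integrable_bound[of _ "%x. B * (indicator K x *\<^sub>R (g x \<bullet> i))"])
   (use iu(2) m B B0 in \<open>auto simp: abs_mult mult.commute[of B] intro!: mult_left_mono borel_measurable_times\<close>)
 have "(\<integral>x\<in>U. u x * frechet_derivative \<psi> (at x) i \<partial>lebesgue) = - (\<integral>x\<in>U. (g x \<bullet> i) * \<psi> x \<partial>lebesgue)"
  using w p(1) i unfolding weak_grad_def by blast
 then show "LL (%x. u x * (D x \<bullet> i)) = - (LL (%x. (g x \<bullet> i) * \<psi> x))"
  by (simp only: test_fun_set_integral[OF p])
qed

text \<open>Mollify the product of \<open>\<eta>\<close> and \<open>u\<close>. The gradient falls on
  the kernel, and testing the weak gradient with \<open>\<eta>\<close> times the kernel turns it
  into the mollification of the product-rule gradient. Both mollifications converge in mean, so the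
  pair lies in \<open>W\<close>.\<close>

lemma weak_grad_borel_integral:
 assumes w: "weak_grad U u g" and e: "test_fun U \<eta>" "C1c \<eta> D\<eta>"
 obtains F G where "W F G" "AE x in lborel. F x = \<eta> x * u x"
  "AE x in lborel. G x = \<eta> x *\<^sub>R g x + u x *\<^sub>R D\<eta> x"
proof -
 have iu: "integrable lebesgue (%x. \<eta> x * u x)"
 proof -
  define K where "K = closure {x. \<eta> x \<noteq> 0}"
  have K: "compact K" "K \<subseteq> U" using e(1) by (auto simp: test_fun_def K_def)
  have z: "\<eta> x = 0" if "x \<notin> K" for x using that closure_subset[of "{x. \<eta> x \<noteq> 0}"] by (auto simp: K_def)
  obtain B where B: "!!x. \<bar>\<eta> x\<bar> <= B" using C1c_bounded[OF e(2)] by auto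
  have B0: "B \<ge> 0" using B[of 0] by simp
  have m: "\<eta> \<in> borel_measurable lebesgue" using C1cD(6)[OF e(2)] by (auto intro!: measurable_completion)
  have iu: "integrable lebesgue (%x. indicator K x *\<^sub>R u x)"
   using w K unfolding weak_grad_def loc_integrable_def set_integrable_def by blast
  have e1: "\<eta> x * u x = \<eta> x * (indicator K x *\<^sub>R u x)" for x using z[of x] by (cases "x \<in> K") auto
  show ?thesis unfolding e1
   by (rule Bochner_Integration.integrable_bound[of _ "%x. B * (indicator K x *\<^sub>R u x)"])
    (use iu m B B0 in \<open>auto simp: abs_mult intro!: mult_right_mono borel_measurable_times\<close>)
 qed
 obtain F where F: "integrable lborel F" "AE x in lborel. \<eta> x * u x = F x"
  "!!B. B \<in> borel_measurable borel ==> (LL (%x. \<eta> x * u x * B x)) = LB (%x. F x * B x)"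
  by (rule lebesgue_borel_rep[OF iu], rule that)
 define P where "P i G \<longleftrightarrow> integrable lborel G \<and> (AE x in lborel. (g x \<bullet> i) * \<eta> x + u x * (D\<eta> x \<bullet> i) = G x) \<and>
  (\<forall>B. B \<in> borel_measurable borel --> (LL (%x. ((g x \<bullet> i) * \<eta> x + u x * (D\<eta> x \<bullet> i)) * B x)) = LB (%x. G x * B x))" for i G
 have ex: "\<exists>G. P i G" if i: "i \<in> Basis" for i
 proof -
  have "integrable lebesgue (%x. (g x \<bullet> i) * \<eta> x + u x * (D\<eta> x \<bullet> i))"
   using weak_grad_test(1,2)[OF w e i] by auto
  then show ?thesis unfolding P_def by (rule lebesgue_borel_rep) blast
 qed
 define Gi where "Gi i = (SOME G. P i G)" for i
 have "P i (Gi i)" if "i \<in> Basis" for i unfolding Gi_def by (rule someI_ex[OF ex[OF that]])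
 then have Gi: "!!i. i \<in> Basis ==> integrable lborel (Gi i)"
  "!!i. i \<in> Basis ==> AE x in lborel. (g x \<bullet> i) * \<eta> x + u x * (D\<eta> x \<bullet> i) = Gi i x"
  "!!i B. i \<in> Basis ==> B \<in> borel_measurable borel ==>
   (LL (%x. ((g x \<bullet> i) * \<eta> x + u x * (D\<eta> x \<bullet> i)) * B x)) = LB (%x. Gi i x * B x)"
  unfolding P_def by blast+
 define G where "G x = (\<Sum>i\<in>Basis. Gi i x *\<^sub>R i)" for x
 have iG: "integrable lborel G" unfolding G_def using Gi(1) by auto
 have aeG: "AE x in lborel. G x = \<eta> x *\<^sub>R g x + u x *\<^sub>R D\<eta> x"
 proof -
  have "AE x in lborel. \<forall>i\<in>Basis. (g x \<bullet> i) * \<eta> x + u x * (D\<eta> x \<bullet> i) = Gi i x"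
   using Gi(2) by (subst AE_ball_countable) (auto intro: countable_finite)
  then show ?thesis
  proof eventually_elim
   case (elim x)
   have "G x = (\<Sum>i\<in>Basis. ((\<eta> x *\<^sub>R g x + u x *\<^sub>R D\<eta> x) \<bullet> i) *\<^sub>R i)"
    unfolding G_def by (rule sum.cong) (use elim in \<open>auto simp: inner_add_left mult.commute\<close>)
   then show ?case by (simp add: euclidean_representation)
  qed
 qed
 obtain R where R: "!!x. norm x > R ==> \<eta> x = 0" using test_fun_bounded[OF e(1)] by blast
 \<comment> \<open>\<open>F\<close> vanishes outside the ball only almost everywhere; the cut makes
   its support literally bounded, so that mollifications are in \<open>C1c\<close>.\<close>
 define F' where "F' x = indicator (cball 0 R) x * F x" for x
 have iF': "integrable lborel F'" unfolding F'_def
  by (rule Bochner_Integration.integrable_bound[OF F(1)]) (use F(1) in \<open>auto simp: indicator_def\<close>)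
 have aeF': "AE x in lborel. F' x = \<eta> x * u x"
  using F(2)
 proof eventually_elim
  case (elim x) then show ?case using R[of x] by (cases "norm x <= R") (auto simp: F'_def indicator_def)
 qed
 have zF': "F' x = 0" if "R < norm x" for x using that by (simp add: F'_def indicator_def)
 have F'B: "LB (%x. F' x * B x) = LL (%x. \<eta> x * u x * B x)" if B: "B \<in> borel_measurable borel" for B
 proof -
  have "LB (%x. F' x * B x) = LB (%x. F x * B x)"
  proof (rule integral_cong_AE)
   show "AE x in lborel. F' x * B x = F x * B x" using aeF' F(2) by eventually_elim simp
  qed (use iF' F(1) B in auto)
  then show ?thesis using F(3)[OF B] by simp
 qed
 have grad: "LB (%y. F' y *\<^sub>R kern_grad d (x - y)) = conv (kern d) G x" if d: "d > 0" for d x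
 proof (rule euclidean_eqI)
  fix i :: 'a assume i: "i \<in> Basis"
  note kC = C1c_kern[OF d]
  have [measurable]: "kern_grad d \<in> borel_measurable borel" using C1cD(7)[OF kC] .
  \<comment> \<open>Multiplication by \<open>\<eta>\<close> makes the kernel an admissible test
    function on \<open>U\<close> for every centre \<open>x\<close>, even near the boundary.\<close>
  define \<psi> where "\<psi> y = \<eta> y * kern d (x + (-1) *\<^sub>R y)" for y
  have ps: "test_fun U \<psi>" unfolding \<psi>_def[abs_def]
   by (rule test_fun_mult[OF e(1) smooth_fun_affine[OF smooth_kern]])
  have kd: "((%y. kern d (x + (-1) *\<^sub>R y)) has_derivative (%h. (- kern_grad d (x + (-1) *\<^sub>R y)) \<bullet> h)) (at y)" for y
  proof -
   have "((%y. x + (-1) *\<^sub>R y) has_derivative (%h. - h)) (at y)"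
    by (auto intro!: derivative_eq_intros)
   from has_derivative_compose[OF this C1cD(1)[OF kC]] show ?thesis by simp
  qed
  have kc: "continuous_on UNIV (%y. - kern_grad d (x + (-1) *\<^sub>R y))"
   by (intro continuous_intros continuous_on_compose2[OF C1cD(2)[OF kC]]) auto
  have pC: "C1c \<psi> (%y. kern d (x + (-1) *\<^sub>R y) *\<^sub>R D\<eta> y + \<eta> y *\<^sub>R (- kern_grad d (x + (-1) *\<^sub>R y)))"
   using C1c_mult_gen[OF e(2) kd kc] unfolding \<psi>_def[abs_def] by (simp add: mult.commute)
  note t = weak_grad_test[OF w ps pC i]
  have ia: "integrable lebesgue (%y. (u y * (D\<eta> y \<bullet> i)) * kern d (x - y))"
   "integrable lebesgue (%y. (\<eta> y * u y) * (kern_grad d (x - y) \<bullet> i))"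
  proof -
   have mk: "(%y. kern d (x - y)) \<in> borel_measurable lebesgue" "(%y. kern_grad d (x - y) \<bullet> i) \<in> borel_measurable lebesgue"
    by (auto intro!: measurable_completion)
   obtain B where B: "!!x::'a. \<bar>kern d x\<bar> <= B" "!!x::'a. norm (kern_grad d x) <= B" using C1c_bounded[OF kC] by auto
   have B0: "B \<ge> 0" using B(1)[of 0] by simp
   have bi: "\<bar>kern_grad d y \<bullet> i\<bar> <= B" for y using Cauchy_Schwarz_ineq2[of "kern_grad d y" i] B(2)[of y] i by simp
   show "integrable lebesgue (%y. (u y * (D\<eta> y \<bullet> i)) * kern d (x - y))"
    by (rule Bochner_Integration.integrable_bound[of _ "%y. B * (u y * (D\<eta> y \<bullet> i))"])
     (use weak_grad_test(1)[OF w e i] mk B B0 in \<open>auto simp: abs_mult mult.commute[of B] intro!: mult_left_mono borel_measurable_times[OF _ mk(1)]\<close>)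
   show "integrable lebesgue (%y. (\<eta> y * u y) * (kern_grad d (x - y) \<bullet> i))"
    by (rule Bochner_Integration.integrable_bound[of _ "%y. B * (\<eta> y * u y)"])
     (use iu mk bi B0 in \<open>auto simp: abs_mult mult.commute[of B] intro!: mult_left_mono borel_measurable_times[OF _ mk(2)]\<close>)
  qed
  have "LL (%y. u y * ((kern d (x + (-1) *\<^sub>R y) *\<^sub>R D\<eta> y + \<eta> y *\<^sub>R (- kern_grad d (x + (-1) *\<^sub>R y))) \<bullet> i))
   = LL (%y. (u y * (D\<eta> y \<bullet> i)) * kern d (x - y) - (\<eta> y * u y) * (kern_grad d (x - y) \<bullet> i))"
   by (rule Bochner_Integration.integral_cong) (auto simp: inner_add_left inner_diff_left algebra_simps)
  also have "... = LL (%y. (u y * (D\<eta> y \<bullet> i)) * kern d (x - y)) - (LL (%y. (\<eta> y * u y) * (kern_grad d (x - y) \<bullet> i)))"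
   by (rule Bochner_Integration.integral_diff[OF ia])
  finally have eq1: "LL (%y. (\<eta> y * u y) * (kern_grad d (x - y) \<bullet> i))
   = LL (%y. (u y * (D\<eta> y \<bullet> i)) * kern d (x - y)) + LL (%y. (g y \<bullet> i) * \<psi> y)"
   using t(3) by simp
  also have "... = LL (%y. (u y * (D\<eta> y \<bullet> i)) * kern d (x - y) + (g y \<bullet> i) * \<psi> y)"
   by (rule Bochner_Integration.integral_add[symmetric, OF ia(1) t(2)])
  also have "... = LL (%y. ((g y \<bullet> i) * \<eta> y + u y * (D\<eta> y \<bullet> i)) * kern d (x - y))"
   by (rule Bochner_Integration.integral_cong) (auto simp: \<psi>_def algebra_simps)
  also have "... = LB (%y. Gi i y * kern d (x - y))" by (rule Gi(3)[OF i]) measurable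
  finally have main: "LB (%y. F' y * (kern_grad d (x - y) \<bullet> i)) = LB (%y. Gi i y * kern d (x - y))"
   by (subst F'B) auto
  have i1: "integrable lborel (%y. F' y *\<^sub>R kern_grad d (x - y))"
  proof -
   obtain B where B: "!!x::'a. norm (kern_grad d x) <= B" using C1c_bounded[OF kC] by auto
   have B0: "B \<ge> 0" using order_trans[OF norm_ge_zero B] .
   show ?thesis
    by (rule Bochner_Integration.integrable_bound[of _ "%y. B * F' y"])
     (use iF' B B0 in \<open>auto simp: abs_mult mult.commute[of B] intro!: mult_left_mono\<close>)
  qed
  have i2: "integrable lborel (%y. kern d (x - y) *\<^sub>R G y)"
   using C1c_bounded[OF kC] conv_integrand_integrable[OF iG kern_measurable] by metis
  have Gii: "G y \<bullet> i = Gi i y" for y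
   unfolding G_def using i by (simp add: inner_sum_left inner_Basis if_distrib cong: if_cong)
  show "LB (%y. F' y *\<^sub>R kern_grad d (x - y)) \<bullet> i = conv (kern d) G x \<bullet> i"
   unfolding conv_def
   using integral_inner_left[of i lborel, OF i1] integral_inner_left[of i lborel, OF i2] main
   by (simp add: Gii mult.commute)
 qed
 have "W F' G"
 proof (rule W_closed[OF iF' iG])
  fix e :: real assume e: "e > 0"
  then have e2: "e / 2 > 0" "ennreal (e / 2) < ennreal e" by (auto intro: ennreal_lessI)
  obtain d1 where d1: "d1 > 0" "\<forall>d. 0 < d \<and> d <= d1 --> L1d (conv (kern d) F') F' <= ennreal (e/2)"
   using conv_kern_approx[OF iF'] e2 by meson
  obtain d2 where d2: "d2 > 0" "\<forall>d. 0 < d \<and> d <= d2 --> L1d (conv (kern d) G) G <= ennreal (e/2)"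
   using conv_kern_approx[OF iG] e2 by meson
  define d where "d = min d1 d2"
  have d: "d > 0" "d <= d1" "d <= d2" using d1 d2 by (auto simp: d_def)
  have "C1c (conv (kern d) F') (%x. LB (%y. F' y *\<^sub>R kern_grad d (x - y)))"
   by (rule conv_C1c[where R=R and e=d, OF iF' zF' smooth_kern C1c_kern[OF d(1)] kern_outside[OF d(1)]])
  then have "C1c (conv (kern d) F') (conv (kern d) G)" using grad[OF d(1)] by simp
  then show "\<exists>f' g'. W f' g' \<and> L1d f' F' < ennreal e \<and> L1d g' G < ennreal e"
   using C1c_W d1(2)[rule_format, OF conjI[OF d(1,2)]] d2(2)[rule_format, OF conjI[OF d(1,3)]] e2 by (meson order_le_less_trans)
 qed
 then show thesis using that aeF' aeG by blast
qed

lemma lebesgue_measurable_AE: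
 fixes f g :: "'a::euclidean_space => 'b::topological_space"
 assumes f: "f \<in> borel_measurable lebesgue" and ae: "AE x in lebesgue. f x = g x"
 shows "g \<in> borel_measurable lebesgue"
proof (rule measurableI)
 fix A :: "'b set" assume "A \<in> sets borel"
 then have A: "f -` A \<inter> space lebesgue \<in> sets lebesgue" using f by (rule measurable_sets[rotated])
 show "g -` A \<inter> space lebesgue \<in> sets lebesgue"
  by (rule completion.in_sets_AE[OF _ A]) (use ae in \<open>auto elim!: eventually_mono\<close>)
qed auto

text \<open>With one cut-off equal to 1 on \<open>K\<close>, both gradients produce \<open>W\<close>
  pairs of the same function, so \<open>W_zero\<close> applies to the difference.\<close>

lemma weak_grad_unique_on_compact:
 assumes w: "weak_grad U u g" "weak_grad U u g'" and K: "compact K" "K \<subseteq> U" "open U"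
 shows "AE x in lborel. x \<in> K --> g x = g' x"
proof -
 obtain \<eta> D where e: "test_fun U \<eta>" "C1c \<eta> D" "!!x. 0 <= \<eta> x" "!!x. \<eta> x <= 1" "!!x. x \<in> K ==> \<eta> x = 1"
  by (rule compact_cutoff[OF K(1,3,2)], rule that)
 obtain F G where 1: "W F G" "AE x in lborel. F x = \<eta> x * u x" "AE x in lborel. G x = \<eta> x *\<^sub>R g x + u x *\<^sub>R D x"
  by (rule weak_grad_borel_integral[OF w(1) e(1,2)], rule that)
 obtain F' G' where 2: "W F' G'" "AE x in lborel. F' x = \<eta> x * u x" "AE x in lborel. G' x = \<eta> x *\<^sub>R g' x + u x *\<^sub>R D x"
  by (rule weak_grad_borel_integral[OF w(2) e(1,2)], rule that)
 have "AE x in lborel. F x - F' x = 0" using 1(2) 2(2) by eventually_elim simp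
 from W_zero[OF W_diff[OF 1(1) 2(1)] this] have "AE x in lborel. G x - G' x = 0" .
 then show ?thesis using 1(3) 2(3) by eventually_elim (auto simp: e(5))
qed

lemma weak_grad_unique:
 assumes w: "weak_grad U u g" "weak_grad U u g'" and U: "open U"
 shows "AE x in lborel. x \<in> U --> g x = g' x"
proof -
 obtain C :: "nat => 'a set" where C: "!!n. compact (C n)" "!!n. C n \<subseteq> U" "\<Union>(range C) = U"
  by (rule open_Union_compact_subsets[OF U], rule that)
 have "AE x in lborel. \<forall>n. x \<in> C n --> g x = g' x"
  by (subst AE_all_countable) (intro allI weak_grad_unique_on_compact[OF w C(1,2) U])
 then show ?thesis by eventually_elim (use C(3) in auto)
qed

lemma loc_integrable_subset: "loc_integrable U f ==> V \<subseteq> U ==> loc_integrable V f"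
 unfolding loc_integrable_def by auto

lemma weak_gradI:
 assumes "loc_integrable U u" "!!i. i \<in> Basis ==> loc_integrable U (%x. g x \<bullet> i)"
  and "!!\<psi> D i. test_fun U \<psi> ==> C1c \<psi> D ==> i \<in> Basis ==>
   (LL (%x. u x * (D x \<bullet> i))) = - (LL (%x. (g x \<bullet> i) * \<psi> x))"
 shows "weak_grad U u g"
 unfolding weak_grad_def
proof (intro conjI ballI allI impI assms(1,2))
 fix \<psi> and i :: 'a assume a: "test_fun U \<psi> \<and> i \<in> Basis"
 then obtain D where D: "C1c \<psi> D" using test_fun_C1c by blast
 show "(\<integral>x\<in>U. u x * frechet_derivative \<psi> (at x) i \<partial>lebesgue) = - (\<integral>x\<in>U. (g x \<bullet> i) * \<psi> x \<partial>lebesgue)"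
  using assms(3)[OF _ D] a by (simp add: test_fun_set_integral[OF _ D])
qed

lemma test_fun_subset: "test_fun V \<psi> ==> V \<subseteq> U ==> test_fun U \<psi>"
 unfolding test_fun_def by auto

lemma weak_grad_subset:
 assumes w: "weak_grad U u g" and V: "V \<subseteq> U"
 shows "weak_grad V u g"
proof (rule weak_gradI)
 show "loc_integrable V u" "!!i. i \<in> Basis ==> loc_integrable V (%x. g x \<bullet> i)"
  using w V loc_integrable_subset unfolding weak_grad_def by blast+
 fix \<psi> D and i :: 'a assume "test_fun V \<psi>" "C1c \<psi> D" "i \<in> Basis"
 then show "LL (%x. u x * (D x \<bullet> i)) = - (LL (%x. (g x \<bullet> i) * \<psi> x))"
  using weak_grad_test(3)[OF w] test_fun_subset[OF _ V] by blast
qed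

lemma lborel_integrable_loc:
 fixes f :: "'a::euclidean_space => real"
 assumes "integrable lborel f" shows "loc_integrable U f"
 unfolding loc_integrable_def set_integrable_def
proof (intro allI impI)
 fix K :: "'a set" assume K: "compact K \<and> K \<subseteq> U"
 have [measurable]: "K \<in> sets borel" "f \<in> borel_measurable borel" using K assms by (auto simp: compact_imp_closed)
 have "integrable lborel (%x. indicator K x *\<^sub>R f x)"
  by (rule Bochner_Integration.integrable_bound[OF assms]) (auto simp: indicator_def)
 then show "integrable lebesgue (%x. indicator K x *\<^sub>R f x)"
  by (subst integrable_completion) auto
qed

lemma W_weak_grad:
 assumes w: "W F G" shows "weak_grad U F G"
proof (rule weak_gradI)
 note [measurable] = W_measurable[OF w]
 show "loc_integrable U F" by (rule lborel_integrable_loc[OF W_integrable(1)[OF w]])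
 show "loc_integrable U (%x. G x \<bullet> i)" for i
  by (rule lborel_integrable_loc) (use W_integrable(2)[OF w] in auto)
 fix \<psi> D and i :: 'a assume p: "test_fun U \<psi>" "C1c \<psi> D" "i \<in> Basis"
 note [measurable] = C1cD(6,7)[OF p(2)]
 obtain B where B: "!!x. \<bar>\<psi> x\<bar> <= B" "!!x. norm (D x) <= B" using C1c_bounded[OF p(2)] by auto
 have B0: "0 <= B" using B(1)[of 0] by simp
 have i2: "integrable lborel (%x. \<psi> x *\<^sub>R G x)"
  by (rule Bochner_Integration.integrable_bound[of _ "%x. B *\<^sub>R G x"])
   (use W_integrable[OF w] B in \<open>auto simp: B0 intro!: mult_right_mono\<close>)
 have i3: "integrable lborel (%x. F x *\<^sub>R D x)"
  by (rule Bochner_Integration.integrable_bound[of _ "%x. B * F x"])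
   (use W_integrable[OF w] B in \<open>auto simp: abs_mult B0 mult.commute[of B] intro!: mult_left_mono\<close>)
 have "LB (%x. F x *\<^sub>R D x) \<bullet> i = - (LB (%x. \<psi> x *\<^sub>R G x) \<bullet> i)"
  using W_by_parts[OF w p(2)] by simp
 then have "LB (%x. F x * (D x \<bullet> i)) = - (LB (%x. (G x \<bullet> i) * \<psi> x))"
  using integral_inner_left[of i lborel, OF i2] integral_inner_left[of i lborel, OF i3] by (simp add: mult.commute)
 then show "LL (%x. F x * (D x \<bullet> i)) = - (LL (%x. (G x \<bullet> i) * \<psi> x))"
  by (subst (1 2) integral_completion) auto
qed

lemma weak_grad_diff:
 assumes w: "weak_grad U u g" "weak_grad U v h"
 shows "weak_grad U (%x. u x - v x) (%x. g x - h x)"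
proof (rule weak_gradI)
 have *: "loc_integrable U (%x. f x - f' x)" if "loc_integrable U f" "loc_integrable U f'" for f f' :: "'a => real"
  using that unfolding loc_integrable_def by (auto intro: set_integral_diff(1))
 show "loc_integrable U (%x. u x - v x)" using w by (intro *) (auto simp: weak_grad_def)
 show "loc_integrable U (%x. (g x - h x) \<bullet> i)" if "i \<in> Basis" for i
  unfolding inner_diff_left by (intro *) (use w that in \<open>auto simp: weak_grad_def\<close>)
 fix \<psi> D and i :: 'a assume p: "test_fun U \<psi>" "C1c \<psi> D" "i \<in> Basis"
 note a = weak_grad_test[OF w(1) p] and b = weak_grad_test[OF w(2) p]
 have "LL (%x. (u x - v x) * (D x \<bullet> i)) = LL (%x. u x * (D x \<bullet> i)) - (LL (%x. v x * (D x \<bullet> i)))"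
  unfolding left_diff_distrib by (rule Bochner_Integration.integral_diff[OF a(1) b(1)])
 moreover have "LL (%x. ((g x - h x) \<bullet> i) * \<psi> x) = LL (%x. (g x \<bullet> i) * \<psi> x) - (LL (%x. (h x \<bullet> i) * \<psi> x))"
  unfolding left_diff_distrib inner_diff_left by (rule Bochner_Integration.integral_diff[OF a(2) b(2)])
 ultimately show "LL (%x. (u x - v x) * (D x \<bullet> i)) = - (LL (%x. ((g x - h x) \<bullet> i) * \<psi> x))"
  using a(3) b(3) by simp
qed

lemma set_integrable_lebesgue_cong_AE:
 fixes f g :: "'a::euclidean_space => real"
 assumes f: "set_integrable lebesgue U f" and ae: "AE x in lborel. x \<in> U --> f x = g x"
 shows "set_integrable lebesgue U g"
proof -
 have ae': "AE x in lebesgue. indicator U x *\<^sub>R f x = indicator U x *\<^sub>R g x"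
  by (rule AE_completion) (use ae in \<open>auto elim!: eventually_mono simp: indicator_def\<close>)
 have m: "(%x. indicator U x *\<^sub>R f x) \<in> borel_measurable lebesgue"
  using f unfolding set_integrable_def by auto
 show ?thesis
  using integrable_cong_AE[OF m lebesgue_measurable_AE[OF m ae'] ae'] f
  unfolding set_integrable_def by simp
qed

lemma in_Lphi_cong_AE:
 assumes U: "U \<in> sets lebesgue" and f: "in_Lphi \<phi> U f" and ae: "AE x in lborel. x \<in> U --> f x = g x"
 shows "in_Lphi \<phi> U g"
proof -
 have ae': "AE x in lebesgue. indicator U x *\<^sub>R f x = indicator U x *\<^sub>R g x"
  by (rule AE_completion) (use ae in \<open>auto elim!: eventually_mono simp: indicator_def\<close>)
 have m: "(%x. indicator U x *\<^sub>R f x) \<in> borel_measurable lebesgue"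
  using f U unfolding in_Lphi_def by (subst borel_measurable_restrict_space_iff[symmetric]) auto
 have "g \<in> borel_measurable (lebesgue_on U)"
  using lebesgue_measurable_AE[OF m ae'] U by (subst borel_measurable_restrict_space_iff) auto
 moreover have "modular \<phi> U (%x. f x / c) = modular \<phi> U (%x. g x / c)" for c
  unfolding modular_def
  by (rule nn_integral_cong_AE, rule AE_completion) (use ae in \<open>auto elim!: eventually_mono simp: indicator_def\<close>)
 ultimately show ?thesis using f by (simp add: in_Lphi_def)
qed

text \<open>The local space provides a separate gradient on every compactly contained open set. By
  uniqueness these agree almost everywhere on overlaps, and countably many exceptional null sets
  suffice along a compact exhaustion.\<close>

lemma W1phi_loc_gradient:
 fixes \<Omega> :: "'a::euclidean_space set"
 assumes O: "open \<Omega>" and u: "in_W1phi_loc \<phi> \<Omega> u"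
 obtains gu where "weak_grad \<Omega> u gu"
  "!!U. open U ==> U \<Subset> \<Omega> ==> set_integrable lebesgue U u \<and> set_integrable lebesgue U (%x. norm (gu x)) \<and>
   in_Lphi \<phi> U u \<and> in_Lphi \<phi> U (%x. norm (gu x))"
proof -
 obtain C :: "nat => 'a set" where C: "!!n. compact (C n)" "!!n. C n \<subseteq> \<Omega>"
  "!!n. C n \<subseteq> interior (C (Suc n))" "\<Union>(range C) = \<Omega>" "!!K. compact K ==> K \<subseteq> \<Omega> ==> \<exists>N. \<forall>n\<ge>N. K \<subseteq> C n"
  by (rule open_Union_compact_subsets[OF O], rule that)
 define U where "U n = interior (C (Suc n))" for n
 have U: "open (U n)" "U n \<Subset> \<Omega>" "C n \<subseteq> U n" for n
 proof -
  show "open (U n)" "C n \<subseteq> U n" using C(3) by (auto simp: U_def)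
  have c: "closure (U n) \<subseteq> C (Suc n)" unfolding U_def
   using C(1) by (simp add: closure_minimal compact_imp_closed interior_subset)
  then have "compact (closure (U n))" using compact_Int_closed[OF C(1)[of "Suc n"], of "closure (U n)"] by (simp add: inf.absorb2)
  then show "U n \<Subset> \<Omega>" using c C(2) by (auto simp: cpt_sub_def)
 qed
 have "\<exists>g. weak_grad V u g \<and> set_integrable lebesgue V u \<and> set_integrable lebesgue V (%x. norm (g x)) \<and>
   in_Lphi \<phi> V u \<and> in_Lphi \<phi> V (%x. norm (g x))" if "open V" "V \<Subset> \<Omega>" for V
  using u that unfolding in_W1phi_loc_def in_W1phi_def by blast
 then obtain g where g: "!!V. open V ==> V \<Subset> \<Omega> ==> weak_grad V u (g V) \<and> set_integrable lebesgue V u \<and>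
   set_integrable lebesgue V (%x. norm (g V x)) \<and> in_Lphi \<phi> V u \<and> in_Lphi \<phi> V (%x. norm (g V x))"
  by metis
 \<comment> \<open>At each point the gradient belonging to the first member of the exhaustion that
   contains the point is used.\<close>
 define gu where "gu x = g (U (LEAST n. x \<in> U n)) x" for x
 have gV: "AE x in lborel. x \<in> V --> g V x = gu x" if V: "open V" "V \<Subset> \<Omega>" for V
 proof -
  have "AE x in lborel. x \<in> V \<inter> U n --> g V x = g (U n) x" for n
   by (rule weak_grad_unique) (use g[OF V] g[OF U(1,2)] V(1) U(1) in \<open>auto intro: weak_grad_subset\<close>)
  then have "AE x in lborel. \<forall>n. x \<in> V \<inter> U n --> g V x = g (U n) x" by (simp add: AE_all_countable)
  then show ?thesis
  proof eventually_elim
   case (elim x)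
   show ?case
   proof
    assume x: "x \<in> V"
    then have "x \<in> \<Omega>" using V(2) closure_subset by (auto simp: cpt_sub_def)
    then obtain n where "x \<in> U n" using C(4) U(3) by blast
    then have "x \<in> U (LEAST n. x \<in> U n)" by (rule LeastI)
    then show "g V x = gu x" using elim x unfolding gu_def by blast
   qed
  qed
 qed
 have sV: "set_integrable lebesgue V u \<and> set_integrable lebesgue V (%x. norm (gu x)) \<and>
   in_Lphi \<phi> V u \<and> in_Lphi \<phi> V (%x. norm (gu x))" if V: "open V" "V \<Subset> \<Omega>" for V
 proof -
  have ae: "AE x in lborel. x \<in> V --> norm (g V x) = norm (gu x)"
   using gV[OF V] by eventually_elim auto
  show ?thesis using g[OF V] set_integrable_lebesgue_cong_AE[OF _ ae] in_Lphi_cong_AE[OF _ _ ae] V(1) by auto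
 qed
 have "weak_grad \<Omega> u gu"
 proof (rule weak_gradI)
  show "loc_integrable \<Omega> u" unfolding loc_integrable_def
  proof (intro allI impI)
   fix K assume "compact K \<and> K \<subseteq> \<Omega>"
   then obtain n where "K \<subseteq> U n" using C(5)[of K] U(3) by blast
   then show "set_integrable lebesgue K u"
    using g[OF U(1,2)[of n]] \<open>compact K \<and> K \<subseteq> \<Omega>\<close> by (auto intro!: set_integrable_subset[of _ "U n"] simp: compact_imp_closed)
  qed
  fix i :: 'a assume i: "i \<in> Basis"
  show "loc_integrable \<Omega> (%x. gu x \<bullet> i)" unfolding loc_integrable_def
  proof (intro allI impI)
   fix K assume K: "compact K \<and> K \<subseteq> \<Omega>"
   then obtain n where n: "K \<subseteq> U n" using C(5)[of K] U(3) by blast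
   have "set_integrable lebesgue K (%x. g (U n) x \<bullet> i)"
    using g[OF U(1,2)[of n]] n K i unfolding weak_grad_def loc_integrable_def by blast
   then show "set_integrable lebesgue K (%x. gu x \<bullet> i)"
    by (rule set_integrable_lebesgue_cong_AE) (use gV[OF U(1,2)[of n]] n in \<open>auto elim!: eventually_mono\<close>)
  qed
 next
  fix \<psi> D and i :: 'a assume p: "test_fun \<Omega> \<psi>" "C1c \<psi> D" "i \<in> Basis"
  obtain n where n: "closure {x. \<psi> x \<noteq> 0} \<subseteq> U n"
   using C(5)[of "closure {x. \<psi> x \<noteq> 0}"] U(3) p(1) unfolding test_fun_def by blast
  have p': "test_fun (U n) \<psi>" using p(1) n by (auto simp: test_fun_def)
  note w = conjunct1[OF g[OF U(1,2)[of n]]]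
  note t = weak_grad_test[OF w p' p(2,3)]
  have ae: "AE x in lebesgue. (g (U n) x \<bullet> i) * \<psi> x = (gu x \<bullet> i) * \<psi> x"
  proof (rule AE_completion)
   show "AE x in lborel. (g (U n) x \<bullet> i) * \<psi> x = (gu x \<bullet> i) * \<psi> x"
    using gV[OF U(1,2)[of n]]
   proof eventually_elim
    case (elim x)
    then show ?case using test_fun_support(1)[OF p(2), of x] n by (cases "x \<in> U n") auto
   qed
  qed
  have m: "(%x. (g (U n) x \<bullet> i) * \<psi> x) \<in> borel_measurable lebesgue" using t(2) by auto
  have "LL (%x. (g (U n) x \<bullet> i) * \<psi> x) = LL (%x. (gu x \<bullet> i) * \<psi> x)"
   by (rule integral_cong_AE[OF m lebesgue_measurable_AE[OF m ae] ae])
  then show "LL (%x. u x * (D x \<bullet> i)) = - (LL (%x. (gu x \<bullet> i) * \<psi> x))"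
   using t(3) by simp
 qed
 then show thesis using sV that by blast
qed

section \<open>Growth functions\<close>

locale phi_growth =
 fixes \<phi> :: "'a::euclidean_space => real => real" and \<Omega> :: "'a set" and p q L :: real
 assumes open_Omega: "open \<Omega>" and Phi: "Phi_w \<Omega> \<phi>" and A0: "A0 L \<Omega> \<phi>"
  and aInc: "aInc p L \<Omega> \<phi>" and aDec: "aDec q L \<Omega> \<phi>"
  and p1: "1 < p" and pq: "p <= q" and L1: "1 <= L"
begin

text \<open>Evenness in \<open>t\<close> and the value 0 outside the domain make nonnegativity,
  monotonicity and the growth estimates valid without side conditions on \<open>x\<close> or on the
  sign of \<open>t\<close>.\<close>

definition ph :: "'a => real => real" where
 "ph x t = (if x \<in> \<Omega> then \<phi> x \<bar>t\<bar> else 0)"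

abbreviation "phL A v \<equiv> iL A (%x. ph x (norm (v x)))"

lemma ph_nonneg [simp]: "0 <= ph x t"
 using Phi by (auto simp: ph_def Phi_w_def)

lemma ph_zero [simp]: "ph x 0 = 0"
 using Phi by (auto simp: ph_def Phi_w_def)

lemma ph_abs [simp]: "ph x \<bar>t\<bar> = ph x t"
 by (simp add: ph_def)

lemma ph_mono: "\<bar>s\<bar> <= \<bar>t\<bar> ==> ph x s <= ph x t"
 using Phi by (auto simp: ph_def Phi_w_def mono_on_def)

lemma ph_inc:
 assumes "0 <= c" "c <= 1" shows "ph x (c * t) <= L * c powr p * ph x t"
proof (cases "x \<in> \<Omega> \<and> c \<noteq> 0 \<and> t \<noteq> 0")
 case True
 then have "0 < c * \<bar>t\<bar>" "c * \<bar>t\<bar> <= \<bar>t\<bar>" using assms by (auto simp: mult_le_cancel_right1)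
 then have "\<phi> x (c * \<bar>t\<bar>) / (c * \<bar>t\<bar>) powr p <= L * (\<phi> x \<bar>t\<bar> / \<bar>t\<bar> powr p)"
  using aInc True unfolding aInc_def by blast
 then have "\<phi> x (c * \<bar>t\<bar>) <= L * (\<phi> x \<bar>t\<bar> / \<bar>t\<bar> powr p) * (c * \<bar>t\<bar>) powr p"
  using True assms by (simp add: divide_le_eq)
 also have "... = L * c powr p * \<phi> x \<bar>t\<bar>" using True assms by (simp add: powr_mult)
 finally show ?thesis using True assms by (simp add: ph_def abs_mult)
next
 case False
 then show ?thesis using L1 by (auto simp: ph_def) (use Phi in \<open>auto simp: Phi_w_def\<close>)
qed

lemma ph_inc1:
 assumes "0 <= c" "c <= 1" shows "ph x (c * t) <= L * c * ph x t"
proof -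
 have "c powr p <= c powr 1" using powr_mono'[of 1 p c] assms p1 by simp
 then have "L * c powr p * ph x t <= L * c * ph x t"
  using assms L1 by (intro mult_right_mono mult_left_mono) auto
 then show ?thesis using ph_inc[OF assms] by (meson order_trans)
qed

lemma ph_dec:
 assumes "1 <= c" shows "ph x (c * t) <= L * c powr q * ph x t"
proof (cases "x \<in> \<Omega> \<and> t \<noteq> 0")
 case True
 then have "0 < \<bar>t\<bar>" "\<bar>t\<bar> <= c * \<bar>t\<bar>" using assms by (auto simp: mult_le_cancel_right1)
 then have "\<phi> x (c * \<bar>t\<bar>) / (c * \<bar>t\<bar>) powr q <= L * (\<phi> x \<bar>t\<bar> / \<bar>t\<bar> powr q)"
  using aDec True unfolding aDec_def by blast
 then have "\<phi> x (c * \<bar>t\<bar>) <= L * (\<phi> x \<bar>t\<bar> / \<bar>t\<bar> powr q) * (c * \<bar>t\<bar>) powr q"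
  using True assms by (simp add: divide_le_eq)
 also have "... = L * c powr q * \<phi> x \<bar>t\<bar>" using True assms by (simp add: powr_mult)
 finally show ?thesis using True assms by (simp add: ph_def abs_mult)
next
 case False
 then show ?thesis using L1 by (auto simp: ph_def) (use Phi in \<open>auto simp: Phi_w_def\<close>)
qed

lemma ph_dec_bound:
 assumes "1 <= c" "\<bar>s\<bar> <= c * \<bar>t\<bar>" shows "ph x s <= L * c powr q * ph x t"
proof -
 have "ph x s <= ph x (c * t)" by (rule ph_mono) (use assms in \<open>simp add: abs_mult\<close>)
 then show ?thesis using ph_dec[OF assms(1), of x t] by simp
qed

text \<open>The larger of the two arguments is at least half of the sum in absolute value. This
  quasi-subadditivity stands in for convexity.\<close>

lemma ph_add: "ph x (a + b) <= L * 2 powr q * (ph x a + ph x b)"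
proof -
 have "ph x (a + b) <= L * 2 powr q * ph x (max \<bar>a\<bar> \<bar>b\<bar>)" by (rule ph_dec_bound) auto
 also have "ph x (max \<bar>a\<bar> \<bar>b\<bar>) <= ph x a + ph x b" by (auto simp: max_def)
 finally show ?thesis using L1 by (simp add: mult_left_mono)
qed

lemma ph_norm_add:
 fixes v w :: "'b::real_normed_vector"
 shows "ph x (norm (v + w)) <= L * 2 powr q * (ph x (norm v) + ph x (norm w))"
 by (rule order_trans[OF ph_mono ph_add]) (simp add: norm_triangle_ineq)

lemma ph_norm_diff:
 fixes v w :: "'b::real_normed_vector"
 shows "ph x (norm (v - w)) <= L * 2 powr q * (ph x (norm v) + ph x (norm w))"
 by (rule order_trans[OF ph_mono ph_add]) (simp add: norm_triangle_ineq4)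

lemma ph_one: "x \<in> \<Omega> ==> 1 / L <= ph x 1" "ph x 1 <= L"
 using A0 L1 by (auto simp: ph_def A0_def)

lemma ph_ge: "x \<in> \<Omega> ==> 1 <= \<bar>t\<bar> ==> 1 / L <= ph x t"
 using ph_one(1)[of x] ph_mono[of 1 t x] by simp

lemma ph_le_const:
 assumes "\<bar>t\<bar> <= c" "1 <= c" shows "ph x t <= L * c powr q * L"
proof -
 have "ph x t <= L * c powr q * ph x 1" by (rule ph_dec_bound) (use assms in auto)
 also have "... <= L * c powr q * L" using L1 by (intro mult_left_mono ph_one) auto
 finally show ?thesis .
qed

lemma ph_measurable:
 assumes "f \<in> borel_measurable (lebesgue_on \<Omega>)"
 shows "(%x. ph x (f x)) \<in> borel_measurable lebesgue"
proof -
 have "(%x. \<phi> x \<bar>f x\<bar>) \<in> borel_measurable (lebesgue_on \<Omega>)" using Phi assms unfolding Phi_w_def by blast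
 moreover have "(%x. indicator \<Omega> x *\<^sub>R \<phi> x \<bar>f x\<bar>) = (%x. ph x (f x))" by (auto simp: ph_def indicator_def)
 ultimately show ?thesis
  using borel_measurable_restrict_space_iff[of \<Omega> lebesgue "%x. \<phi> x \<bar>f x\<bar>"] open_Omega by simp
qed

lemma ph_measurable_borel [measurable]:
 "f \<in> borel_measurable borel ==> (%x. ph x (f x)) \<in> borel_measurable lebesgue"
 by (rule ph_measurable) (auto intro!: measurable_restrict_space1 measurable_completion)

lemma ph_modular:
 assumes "U \<subseteq> \<Omega>" shows "modular \<phi> U f = iL U (%x. ph x (f x))"
 unfolding modular_def by (rule nn_integral_cong) (use assms in \<open>auto simp: ph_def indicator_def\<close>)

text \<open>(aDec) lets \<open>\<phi>\<close> grow by at most a constant factor under scaling, and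
  (aInc) with \<open>p > 1\<close> makes it small under division. Hence a finite Luxemburg norm and
  a finite modular mean the same.\<close>

lemma in_Lphi_iff:
 assumes U: "open U" "U \<subseteq> \<Omega>"
 shows "in_Lphi \<phi> U f \<longleftrightarrow> f \<in> borel_measurable (lebesgue_on U) \<and> (iL U (%x. ph x (f x))) < \<infinity>"
proof -
 have m: "(%x. ennreal (ph x (f x / c)) * indicator U x) \<in> borel_measurable lebesgue"
  if f: "f \<in> borel_measurable (lebesgue_on U)" for c
 proof -
  have "(%x. indicator U x *\<^sub>R f x) \<in> borel_measurable lebesgue"
   using f U by (subst borel_measurable_restrict_space_iff[symmetric]) auto
  then have "(%x. ph x ((indicator U x *\<^sub>R f x) / c)) \<in> borel_measurable lebesgue"
   by (intro ph_measurable measurable_restrict_space1) auto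
  then have "(%x. ennreal (ph x ((indicator U x *\<^sub>R f x) / c))) \<in> borel_measurable lebesgue"
   by measurable
  moreover have "ennreal (ph x ((indicator U x *\<^sub>R f x) / c)) = ennreal (ph x (f x / c)) * indicator U x" for x
   by (auto simp: indicator_def)
  ultimately show ?thesis by (simp only:)
 qed
 show ?thesis
 proof (intro iffI conjI)
  assume a: "in_Lphi \<phi> U f"
  then show fm: "f \<in> borel_measurable (lebesgue_on U)" by (simp add: in_Lphi_def)
  obtain c where c: "c > 0" "modular \<phi> U (%x. f x / c) <= 1" using a by (auto simp: in_Lphi_def)
  define d where "d = max c 1"
  have "iL U (%x. ph x (f x)) <= NL (%x. ennreal (L * d powr q) * (ennreal (ph x (f x / c)) * indicator U x))"
  proof (rule nn_integral_mono, goal_cases)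
   case (1 x)
   have "ph x (f x) <= L * d powr q * ph x (f x / c)"
    by (rule ph_dec_bound) (use c in \<open>auto simp: d_def max_def field_simps mult_left_le_one_le\<close>)
   then have "ennreal (ph x (f x)) <= ennreal (L * d powr q) * ennreal (ph x (f x / c))"
    using L1 by (simp flip: ennreal_mult add: ennreal_leI)
   then show ?case
    by (auto simp: indicator_def)
  qed
  also have "... = ennreal (L * d powr q) * modular \<phi> U (%x. f x / c)"
   using m[OF fm, of c] U(2) by (simp add: nn_integral_cmult ph_modular)
  also have "... <= ennreal (L * d powr q) * 1" by (intro mult_left_mono c) auto
  also have "... < \<infinity>" by simp
  finally show "iL U (%x. ph x (f x)) < \<infinity>" .
 next
  assume a: "f \<in> borel_measurable (lebesgue_on U) \<and> (iL U (%x. ph x (f x))) < \<infinity>"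
  then obtain I where I: "iL U (%x. ph x (f x)) = ennreal I" "I \<ge> 0"
   by (metis infinity_ennreal_def less_top_ennreal)
  \<comment> \<open>By \<open>ph_inc1\<close> division by \<open>c\<close> multiplies the modular by
    at most \<open>L / c\<close>, which brings it below 1.\<close>
  define c where "c = max 1 (L * I)"
  have c: "c \<ge> 1" "L * I <= c" by (auto simp: c_def)
  have "modular \<phi> U (%x. f x / c) <= NL (%x. ennreal (L / c) * (ennreal (ph x (f x / 1)) * indicator U x))"
   unfolding ph_modular[OF U(2)]
  proof (rule nn_integral_mono, goal_cases)
   case (1 x)
   have "ph x (1 / c * f x) <= L * (1 / c) * ph x (f x)" by (rule ph_inc1) (use c in auto)
   then have "ennreal (ph x (f x / c)) <= ennreal (L / c) * ennreal (ph x (f x))"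
    using L1 c by (simp flip: ennreal_mult add: ennreal_leI)
   then show ?case
    by (auto simp: indicator_def)
  qed
  also have "... = ennreal (L / c) * ennreal I"
   using m[OF conjunct1[OF a], of 1] by (simp add: nn_integral_cmult I)
  also have "... = ennreal (L / c * I)" using c I L1 by (intro ennreal_mult[symmetric]) auto
  also have "... <= ennreal 1" using c by (intro ennreal_leI) (simp add: divide_simps)
  finally have "modular \<phi> U (%x. f x / c) <= 1" by simp
  then show "in_Lphi \<phi> U f" unfolding in_Lphi_def using a c by (intro conjI exI[of _ c]) auto
 qed
qed

end

section \<open>Comparison of the growth function at nearby points\<close>

locale phi_A1 = phi_growth +
 fixes s L\<omega> :: real
 assumes A1: "A1s s L\<omega> \<Omega> \<phi>" and s1: "1 < s" and sn: "s <= real DIM('a)"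
begin

text \<open>The power pays, by (aDec), for scaling \<open>t\<close> into the range of (A1-s); the
  last factor absorbs the additive 1 of (A1-s). The parameter \<open>s\<close> does not occur, so it
  stays out of the Hoelder exponent.\<close>

definition cmp_const :: "real => real" where
 "cmp_const K = L * (K * max 1 (unit_ball_vol (real DIM('a)))) powr q * (1 + L\<omega> + L\<omega> * L)"

lemma Lw_pos: "L\<omega> > 0" using A1 by (simp add: A1s_def)

lemma cmp_const_ge1: "1 <= K ==> 1 <= cmp_const K"
proof -
 assume K: "1 <= K"
 have "1 <= K * max 1 (unit_ball_vol (real DIM('a)))" using mult_mono[of 1 K 1 "max 1 (unit_ball_vol (real DIM('a)))"] K by simp
 then have "1 <= (K * max 1 (unit_ball_vol (real DIM('a)))) powr q" using p1 pq by (intro ge_one_powr_ge_zero) auto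
 then have "1 * 1 * 1 <= L * (K * max 1 (unit_ball_vol (real DIM('a)))) powr q * (1 + L\<omega> + L\<omega> * L)"
  using Lw_pos L1 by (intro mult_mono) auto
 then show ?thesis by (simp add: cmp_const_def)
qed

text \<open>Dividing \<open>t\<close> by \<open>K\<close> and by the larger of 1 and the volume of
  the unit ball reaches the range of (A1-s). The additive 1 there is at most
  \<open>L * ph y t\<close> by (A0), since \<open>1 <= t\<close>, and becomes
  multiplicative.\<close>

lemma ph_compare:
 assumes K: "1 <= K" and r: "0 < r" "r <= 1" and x: "x \<in> ball z r" and y: "y \<in> ball z r" "y \<in> \<Omega>"
  and t: "1 <= t" "t <= K * r powr (- (real DIM('a) / s))"
 shows "ph x t <= cmp_const K * ph y t"
proof (cases "x \<in> \<Omega>")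
 case True
 define \<omega> where "\<omega> = unit_ball_vol (real DIM('a))"
 define c where "c = max 1 \<omega>"
 have w0: "\<omega> > 0" by (simp add: \<omega>_def)
 have c: "c \<ge> 1" "c \<ge> \<omega>" by (auto simp: c_def)
 have Kc: "1 <= K * c" using mult_mono[of 1 K 1 c] K c by simp
 define \<tau> where "\<tau> = t / (K * c)"
 have \<tau>0: "\<tau> > 0" using t Kc by (simp add: \<tau>_def)
 have tK: "t = (K * c) * \<tau>" using K c by (simp add: \<tau>_def)
 have "\<tau> <= r powr (- (real DIM('a) / s)) / c"
  using t(2) K c by (simp add: \<tau>_def field_simps)
 then have "\<tau> powr s <= (r powr (- (real DIM('a) / s)) / c) powr s"
  using \<tau>0 s1 by (intro powr_mono2) auto
 also have "... = r powr (- real DIM('a)) / c powr s"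
  using r c s1 by (simp add: powr_divide powr_powr)
 also have "... <= r powr (- real DIM('a)) / \<omega>"
 proof (rule divide_left_mono)
  have "c powr 1 <= c powr s" using c s1 by (intro powr_mono) auto
  then show "\<omega> <= c powr s" using c by simp
 qed (use w0 c in auto)
 also have "... = 1 / measure lebesgue (ball z r)"
  using r by (simp add: content_ball \<omega>_def powr_minus powr_realpow field_simps)
 finally have "\<bar>\<phi> x \<tau> - \<phi> y \<tau>\<bar> <= L\<omega> * (\<phi> y \<tau> + 1)"
  using A1 r x y True \<tau>0 unfolding A1s_def by auto
 then have 1: "ph x \<tau> <= (1 + L\<omega>) * ph y \<tau> + L\<omega>"
  using True y \<tau>0 by (simp add: ph_def algebra_simps abs_le_iff)
 have 2: "ph y \<tau> <= ph y t" by (rule ph_mono) (use K c Kc \<tau>0 in \<open>auto simp: tK abs_mult\<close>)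
 have 3: "1 <= L * ph y t" using ph_ge[OF y(2), of t] t L1 by (simp add: field_simps)
 have "ph x \<tau> <= (1 + L\<omega>) * ph y t + L\<omega> * (L * ph y t)"
 proof -
  have "(1 + L\<omega>) * ph y \<tau> <= (1 + L\<omega>) * ph y t" by (rule mult_left_mono[OF 2]) (use Lw_pos in simp)
  moreover have "L\<omega> * 1 <= L\<omega> * (L * ph y t)" by (rule mult_left_mono[OF 3]) (use Lw_pos in simp)
  ultimately show ?thesis using 1 by linarith
 qed
 then have 4: "ph x \<tau> <= (1 + L\<omega> + L\<omega> * L) * ph y t" by (simp add: algebra_simps)
 have "ph x t <= L * (K * c) powr q * ph x \<tau>" unfolding tK by (rule ph_dec[OF Kc])
 also have "... <= L * (K * c) powr q * ((1 + L\<omega> + L\<omega> * L) * ph y t)"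
  using L1 by (intro mult_left_mono 4) auto
 finally show ?thesis by (simp add: cmp_const_def c_def \<omega>_def mult.assoc)
next
 case False
 then have "ph x t = 0" by (simp add: ph_def)
 moreover have "0 <= cmp_const K * ph y t" using cmp_const_ge1[OF K] by (intro mult_nonneg_nonneg) auto
 ultimately show ?thesis by simp
qed

definition jen_const :: "real => real => real" where
 "jen_const K C = 2 * L * L * (2 * C) powr q * cmp_const K"

lemma jen_const_nonneg: "1 <= K ==> 0 <= jen_const K C"
 using cmp_const_ge1[of K] L1 by (simp add: jen_const_def)

text \<open>A substitute for Jensen's inequality: although \<open>\<phi>\<close> is neither convex nor independent of \<open>x\<close>,
 (A1-s) makes its values comparable on the ball as long as the argument is at most of the order of
 the radius to the power \<open>-n/s\<close>.\<close>

lemma ph_jensen: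
 fixes h :: "'a => real"
 assumes K: "1 <= K" and C: "1 <= C" and r: "0 < r" "r <= 1" and B: "ball x r \<subseteq> \<Omega>"
  and h[measurable]: "h \<in> borel_measurable borel" "!!y. 0 <= h y"
  and t: "0 <= t" "t <= K * r powr (- (real DIM('a) / s))"
  and avg: "ennreal (t * vol (ball x r)) <= ennreal C * iL (ball x r) (%y. h y)"
 shows "ennreal (ph x t * vol (ball x r)) <=
  ennreal (L * vol (ball x r)) + ennreal (jen_const K C) * iL (ball x r) (%y. ph y (h y))"
proof (cases "t <= 1")
 case True
 then have "ph x t <= L" using ph_mono[of t 1 x] ph_one(2)[of x] t by simp
 then have "ennreal (ph x t * vol (ball x r)) <= ennreal (L * vol (ball x r))"
  by (intro ennreal_leI mult_right_mono) auto
 then show ?thesis by (rule order_trans) simp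
next
 case False
 define m where "m = vol (ball x r)"
 have m: "m > 0" using r by (simp add: m_def content_ball_pos)
 have xO: "x \<in> \<Omega>" using B r by auto
 define I where "I = iL (ball x r) (%y. ph y (h y))"
 define P where "P = ph x t"
 have P: "P > 0" using ph_ge[OF xO, of t] False L1 by (simp add: P_def) (metis less_le_trans zero_less_divide_1_iff zero_less_one)
 define \<Lambda> where "\<Lambda> = cmp_const K"
 have \<Lambda>: "\<Lambda> \<ge> 1" using cmp_const_ge1[OF K] by (simp add: \<Lambda>_def)
 \<comment> \<open>Values of \<open>h\<close> up to \<open>a\<close> contribute at most half of the
   mean that \<open>avg\<close> prescribes, so the other half must come from larger values.\<close>
 define a where "a = t / (2 * C)"
 have a: "a > 0" using False C by (simp add: a_def)
 define D where "D = a * L * L * (2 * C) powr q * \<Lambda> / P"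
 have D: "D \<ge> 0" using a L1 \<Lambda> P by (simp add: D_def)
 \<comment> \<open>Above \<open>a\<close> the function \<phi>(y,.) grows at least linearly, with
   slope bounded below by \<phi>(x,t)/a up to constants: (aInc) between \<open>a\<close> and
   \<open>h y\<close>, (aDec) between \<open>a\<close> and \<open>t\<close>, and comparison from
   \<open>y\<close> to \<open>x\<close>. This affine bound replaces a supporting line of a convex
   function.\<close>
 have pt: "h y <= a + D * ph y (h y)" if y: "y \<in> ball x r" for y
 proof (cases "h y <= a")
  case True then show ?thesis using D by (simp add: add_increasing2)
 next
  case False
  have yO: "y \<in> \<Omega>" using y B by auto
  have "P <= \<Lambda> * ph y t" unfolding P_def \<Lambda>_def
   by (rule ph_compare[OF K r, of x x]) (use y yO r t \<open>\<not> t <= 1\<close> in auto)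
  also have "ph y t <= L * (2 * C) powr q * ph y a"
   by (rule ph_dec_bound) (use C t in \<open>auto simp: a_def\<close>)
  finally have 1: "P <= \<Lambda> * (L * (2 * C) powr q * ph y a)" using \<Lambda> by (simp add: mult_left_mono)
  have "ph y (a / h y * h y) <= L * (a / h y) * ph y (h y)" by (rule ph_inc1) (use False a in auto)
  then have 2: "ph y a <= L * (a / h y) * ph y (h y)" using False a by simp
  have "P <= \<Lambda> * (L * (2 * C) powr q * (L * (a / h y) * ph y (h y)))"
   using 1 \<Lambda> L1 by (elim order_trans) (intro mult_left_mono 2, auto)
  then have "P * h y <= \<Lambda> * (L * (2 * C) powr q * (L * a * ph y (h y)))"
   using False a by (simp add: field_simps)
  then have "h y <= D * ph y (h y)" using P by (simp add: D_def field_simps)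
  then show ?thesis using a by simp
 qed
 have [measurable]: "ball x r \<in> sets lebesgue" "(%y. ph y (h y)) \<in> borel_measurable lebesgue"
  by (simp, rule ph_measurable_borel[OF h(1)])
 show ?thesis
 proof (cases "I = \<infinity>")
  case True
  have "jen_const K C > 0" using L1 C \<Lambda> by (simp add: jen_const_def \<Lambda>_def)
  then show ?thesis using True by (simp add: I_def[symmetric] ennreal_mult_top)
 next
  case False
  then obtain J where J: "I = ennreal J" "J \<ge> 0" by (metis ennreal_cases infinity_ennreal_def)
  have "iL (ball x r) (%y. h y) <= NL (%y. ennreal a * indicator (ball x r) y + ennreal D * (ennreal (ph y (h y)) * indicator (ball x r) y))"
  proof (rule nn_integral_mono, goal_cases)
   case (1 y)
   show ?case
   proof (cases "y \<in> ball x r")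
    case True
    have "ennreal (h y) <= ennreal (a + D * ph y (h y))" by (rule ennreal_leI[OF pt[OF True]])
    also have "... = ennreal a + ennreal D * ennreal (ph y (h y))" using a D by (simp add: ennreal_mult)
    finally show ?thesis using True by simp
   qed simp
  qed
  also have "... = NL (%y. ennreal a * indicator (ball x r) y) + NL (%y. ennreal D * (ennreal (ph y (h y)) * indicator (ball x r) y))"
   by (rule nn_integral_add) measurable
  also have "... = ennreal a * ennreal m + ennreal D * I"
  proof -
   have "emeasure lebesgue (ball x r) = ennreal m"
    using emeasure_lborel_ball_finite[of x r] unfolding m_def by (simp add: emeasure_eq_ennreal_measure)
   then show ?thesis by (simp add: nn_integral_cmult I_def)
  qed
  also have "... = ennreal (a * m + D * J)" using a m D J by (simp add: ennreal_mult)
  finally have "ennreal (t * m) <= ennreal C * ennreal (a * m + D * J)"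
   using avg C by (elim order_trans[OF _ mult_left_mono, rotated 1]) (auto simp: m_def)
  then have "t * m <= C * (a * m + D * J)"
  proof -
   have "ennreal C * ennreal (a * m + D * J) = ennreal (C * (a * m + D * J))"
    by (rule ennreal_mult[symmetric]) (use C a m D J in auto)
   then show ?thesis using \<open>ennreal (t * m) <= _\<close> C a m D J by (simp only:) (subst (asm) ennreal_le_iff, auto)
  qed
  then have "t * m <= 2 * C * D * J" using C by (simp add: a_def field_simps)
  also have "... = t * (L * L * (2 * C) powr q * \<Lambda> * J) / P" using C by (simp add: D_def a_def)
  finally have "P * m <= L * L * (2 * C) powr q * \<Lambda> * J"
   using P t \<open>\<not> t <= 1\<close> by (simp add: field_simps)
  also have "... <= jen_const K C * J"
   unfolding jen_const_def \<Lambda>_def[symmetric] using J L1 \<Lambda> by (intro mult_right_mono) auto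
  finally have "ennreal (P * m) <= ennreal (jen_const K C) * I"
   using J jen_const_nonneg[OF K, of C] by (simp add: ennreal_leI flip: ennreal_mult)
  then show ?thesis by (simp add: P_def m_def I_def add_increasing)
 qed
qed

end

section \<open>Ball means, mollified gradients and quasiminimality on positivity sets\<close>

lemma nn_integral_vanishing:
 fixes h :: "'a => ennreal" and B :: "nat => 'a set"
 assumes [measurable]: "h \<in> borel_measurable M" "!!k. B k \<in> sets M" and fin: "(\<integral>\<^sup>+x. h x \<partial>M) < \<infinity>"
  and v: "AE x in M. eventually (%k. x \<notin> B k) sequentially"
 shows "(%k. \<integral>\<^sup>+x\<in>B k. h x \<partial>M) \<longlonglongrightarrow> 0"
proof -
 have "(%k. \<integral>\<^sup>+x\<in>B k. h x \<partial>M) \<longlonglongrightarrow> (\<integral>\<^sup>+x. 0 \<partial>M)"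
 proof (rule nn_integral_dominated_convergence[where w=h])
  show "AE x in M. (%k. h x * indicator (B k) x) \<longlonglongrightarrow> 0"
   using v
  proof eventually_elim
   case (elim x)
   then have "eventually (%k. h x * indicator (B k) x = 0) sequentially"
    by eventually_elim simp
   then show ?case by (rule tendsto_eventually)
  qed
  show "AE x in M. h x * indicator (B k) x <= h x" for k
   by (rule AE_I2) (auto simp: indicator_def)
 qed (use fin in auto)
 then show ?thesis by simp
qed

lemma conv_kern_LIMSEQ:
 fixes g :: "'a::euclidean_space => 'b::euclidean_space"
 assumes i: "integrable lborel g" and E: "!!k::nat. 0 < E k" "E \<longlonglongrightarrow> 0"
 shows "(%k. L1d (conv (kern (E k)) g) g) \<longlonglongrightarrow> 0"
proof (rule order_tendstoI)
 fix a :: ennreal assume "0 < a"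
 then obtain e where e: "0 < e" "ennreal e < a"
  by (metis ennreal_less_zero_iff dense ennreal_cases not_less_zero order_less_trans less_top top.not_eq_extremum)
 obtain d where d: "d > 0" "\<forall>d'. 0 < d' \<and> d' <= d --> L1d (conv (kern d') g) g <= ennreal e"
  using conv_kern_approx[OF i] e(1) by meson
 have "\<forall>\<^sub>F k in sequentially. E k < d" using order_tendstoD(2)[OF E(2) d(1)] .
 then show "\<forall>\<^sub>F k in sequentially. L1d (conv (kern (E k)) g) g < a"
 proof eventually_elim
  case (elim k)
  then show ?case using d(2)[rule_format, of "E k"] E(1)[of k] e(2) by (meson le_less_trans less_imp_le)
 qed
qed auto

text \<open>Written as a convolution kernel, so that the mean over the ball around \<open>x\<close>
  is \<open>conv (ballk r) f x\<close> and the convergence results for convolutions apply.\<close>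

definition ballk :: "real => 'a::euclidean_space => real" where
 "ballk r x = indicator (ball 0 r) x / vol (ball (0::'a) r)"

lemma measure_ball_translate: "vol (ball (x::'a::euclidean_space) r) = vol (ball (0::'a) r)"
 by (cases "r \<ge> 0") (auto simp: content_ball ball_empty not_le less_imp_le)

lemma ballk_measurable [measurable]: "ballk r \<in> borel_measurable borel"
 unfolding ballk_def[abs_def]
 by (intro borel_measurable_divide borel_measurable_indicator borel_measurable_const) auto

lemma ballk_avg:
 fixes P :: "'a::euclidean_space => real"
 assumes P: "integrable lborel P" "!!y. 0 <= P y" and r: "0 < r"
 shows "ennreal (conv (ballk r) P x * vol (ball x r)) = iB (ball x r) (%y. P y)"
  "0 <= conv (ballk r) P x"
proof -
 have m: "vol (ball (0::'a) r) > 0" using r by (simp add: content_ball_pos)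
 have [measurable]: "P \<in> borel_measurable borel" using P by auto
 have e: "ballk r (x - y) * P y = (indicator (ball x r) y * P y) / vol (ball (0::'a) r)" for y
  by (auto simp: ballk_def indicator_def dist_norm norm_minus_commute)
 have i: "integrable lborel (%y. indicator (ball x r) y * P y)"
  by (rule Bochner_Integration.integrable_bound[OF P(1)]) (auto simp: indicator_def)
 have c: "conv (ballk r) P x * vol (ball x r) = LB (%y. indicator (ball x r) y * P y)"
  using m by (simp add: conv_def e measure_ball_translate[of x])
 have "iB (ball x r) (%y. P y) = IB (%y. indicator (ball x r) y * P y)"
  by (rule nn_integral_cong) (auto simp: indicator_def)
 also have "... = ennreal (LB (%y. indicator (ball x r) y * P y))"
  by (rule nn_integral_eq_integral[OF i]) (use P(2) in auto)
 finally show "ennreal (conv (ballk r) P x * vol (ball x r)) = iB (ball x r) (%y. P y)"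
  by (simp add: c)
 show "0 <= conv (ballk r) P x"
  unfolding conv_def by (rule Bochner_Integration.integral_nonneg) (use P(2) m in \<open>auto simp: e\<close>)
qed

lemma conv_ballk_LIMSEQ:
 fixes g :: "'a::euclidean_space => real"
 assumes i: "integrable lborel g" and E: "!!k::nat. 0 < E k" "E \<longlonglongrightarrow> 0"
 shows "(%k. L1d (conv (ballk (E k)) g) g) \<longlonglongrightarrow> 0"
proof (rule order_tendstoI)
 fix a :: ennreal assume "0 < a"
 then obtain e where e: "0 < e" "ennreal e < a"
  by (metis ennreal_less_zero_iff dense ennreal_cases not_less_zero order_less_trans less_top top.not_eq_extremum)
 obtain d where d: "d > 0" "!!h. norm h < d ==> (IB (%x. norm (g (x + h) - g x))) < ennreal e"
  using translation_continuous_L1[OF i] e(1) by meson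
 have "\<forall>\<^sub>F k in sequentially. E k < d" using order_tendstoD(2)[OF E(2) d(1)] .
 then show "\<forall>\<^sub>F k in sequentially. L1d (conv (ballk (E k)) g) g < a"
 proof eventually_elim
  case (elim k)
  define m where "m = vol (ball (0::'a) (E k))"
  have m: "m > 0" using E(1)[of k] by (simp add: m_def content_ball_pos)
  have ii: "integrable lborel (indicat_real (ball (0::'a) (E k)))"
   using emeasure_lborel_ball_finite[of "0::'a" "E k"] by (simp add: integrable_indicator_iff)
  have "L1d (conv (ballk (E k)) g) g <= ennreal e"
   unfolding L1d_def
  proof (rule conv_approx[OF i, where e="E k"])
   show "0 <= ballk (E k) x" "ballk (E k) x <= 1 / m" for x :: 'a
    using m by (auto simp: ballk_def indicator_def m_def)
   show "E k <= norm x ==> ballk (E k) x = 0" for x :: 'a by (auto simp: ballk_def indicator_def)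
   show "integrable lborel (ballk (E k) :: 'a => real)" unfolding ballk_def[abs_def] using ii by simp
   show "(\<integral>x. ballk (E k) x \<partial>(lborel::'a measure)) = 1" using m by (simp add: ballk_def m_def)
   show "IB (%x. norm (g (x + h) - g x)) <= ennreal e" if "norm h < E k" for h
    by (rule less_imp_le, rule d(2)) (use that elim in linarith)
  qed (rule ballk_measurable)
  then show ?case using e(2) by (rule le_less_trans)
 qed
qed auto

lemma W_conv_grad:
 assumes w: "W f g" and d: "d > 0"
 shows "LB (%y. f y *\<^sub>R kern_grad d (x - y)) = conv (kern d) g x"
proof -
 note kC = C1c_kern[OF d]
 have kd: "((%y. kern d (x - y)) has_derivative (%h. (- kern_grad d (x - y)) \<bullet> h)) (at y)" for y
 proof -
  have "((%y. x - y) has_derivative (%h. - h)) (at y)" by (auto intro!: derivative_eq_intros)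
  from has_derivative_compose[OF this C1cD(1)[OF kC]] show ?thesis by simp
 qed
 have p: "C1c (%y. kern d (x - y)) (%y. - kern_grad d (x - y))"
  unfolding C1c_def
 proof (intro conjI allI kd exI[of _ "norm x + d"] impI)
  show "continuous_on UNIV (%y. - kern_grad d (x - y))"
   by (intro continuous_intros continuous_on_compose2[OF C1cD(2)[OF kC]]) auto
  fix y :: 'a assume "norm x + d < norm y"
  then have n: "norm (x - y) > d" using norm_triangle_ineq2[of y x] by (simp add: norm_minus_commute)
  then show "kern d (x - y) = 0" "- kern_grad d (x - y) = 0"
   using kern_outside[OF d, of "x - y"] kern_grad_outside[OF d n] by auto
 qed
 show ?thesis using W_by_parts[OF w p] by (simp add: conv_def)
qed

lemma W_conv_C1c:
 assumes w: "W f g" and z: "!!x. R < norm x ==> f x = 0" and d: "d > 0"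
 shows "C1c (conv (kern d) f) (conv (kern d) g)"
 using conv_C1c[where R=R and e=d, OF W_integrable(1)[OF w] z smooth_kern C1c_kern[OF d] kern_outside[OF d]]
 by (simp add: W_conv_grad[OF w d])

text \<open>The kernel is at most a constant divided by the volume of its ball, so the bound has a
  constant independent of \<open>d\<close>. This is the premise \<open>avg\<close> of
  \<open>ph_jensen\<close> for mollified gradients.\<close>

lemma norm_conv_kern_le:
 fixes g :: "'a::euclidean_space => 'b::euclidean_space"
 assumes i: "integrable lborel g" and d: "d > 0"
 shows "ennreal (norm (conv (kern d) g x) * vol (ball x d)) <=
  ennreal (kern_const TYPE('a) * unit_ball_vol (real DIM('a))) * iB (ball x d) (%y. norm (g y))"
proof -
 have [measurable]: "g \<in> borel_measurable borel" "ball x d \<in> sets borel" using i by auto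
 define c where "c = kern_const TYPE('a) / d ^ DIM('a)"
 have c: "c \<ge> 0" using kern_const_pos[where 'a='a] d by (simp add: c_def)
 have kb: "\<bar>kern d z\<bar> <= c" for z :: 'a using kern_nonneg[OF d, of z] kern_le[OF d, of z] by (simp add: c_def)
 have i2: "integrable lborel (%y. kern d (x - y) *\<^sub>R g y)"
  by (rule conv_integrand_integrable[OF i kern_measurable kb])
 have "ennreal (norm (conv (kern d) g x)) <= NB (%y. norm (kern d (x - y) *\<^sub>R g y))"
  unfolding conv_def by (rule integral_norm_bound_ennreal[OF i2])
 also have "... <= NB (%y. ennreal c * (ennreal (norm (g y)) * indicator (ball x d) y))"
 proof (rule nn_integral_mono, goal_cases)
  case (1 y)
  show ?case
  proof (cases "y \<in> ball x d")
   case True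
   then show ?thesis using kb[of "x - y"] c by (simp flip: ennreal_mult add: ennreal_leI mult_right_mono)
  next
   case False
   then show ?thesis using kern_outside[OF d, of "x - y"] by (simp add: dist_norm)
  qed
 qed
 also have "... = ennreal c * iB (ball x d) (%y. norm (g y))" by (rule nn_integral_cmult) measurable
 finally have "ennreal (norm (conv (kern d) g x)) * ennreal (vol (ball x d))
  <= ennreal c * iB (ball x d) (%y. norm (g y)) * ennreal (vol (ball x d))"
  by (rule mult_right_mono) simp
 also have "... = ennreal (c * vol (ball x d)) * iB (ball x d) (%y. norm (g y))"
  using c by (simp add: ennreal_mult mult_ac)
 also have "c * vol (ball x d) = kern_const TYPE('a) * unit_ball_vol (real DIM('a))"
  using d by (simp add: c_def content_ball)
 finally show ?thesis by (simp add: ennreal_mult)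
qed

text \<open>Quasiminimality in the language of \<open>W\<close>: the competitor is
  \<open>U - F\<close>, and only bounded \<open>F\<close> of compact support in \<open>V\<close> and
  finite energy occur. \<open>U\<close> and \<open>G\<close> are Borel representatives of the
  cut-off solution.\<close>

locale local_qm = phi_A1 +
 fixes U :: "'a => real" and G :: "'a => 'a" and V :: "'a set" and Q :: real
 assumes UG: "W U G" and V: "open V" "V \<subseteq> \<Omega>" and Q1: "1 <= Q"
  and finU: "iL V (%x. ph x (U x)) < \<infinity>"
  and finG: "phL V G < \<infinity>"
  and qm: "!!F H K. W F H ==> compact K ==> K \<subseteq> V ==> (!!x. x \<notin> K ==> F x = 0) ==>
   (\<exists>M. \<forall>x. \<bar>F x\<bar> <= M) ==> (IL (%x. ph x (norm (H x)))) < \<infinity> ==>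
   (phL (closure {x. F x \<noteq> 0}) G)
    <= ennreal Q * phL (closure {x. F x \<noteq> 0}) (%x. G x - H x)"
begin

lemma UG_measurable [measurable]: "U \<in> borel_measurable borel" "G \<in> borel_measurable borel"
 using W_measurable[OF UG] by auto

lemma lebesgue_borel_sets [measurable]: "A \<in> sets borel ==> A \<in> sets lebesgue"
 by simp

lemma lebesgue_indicator_measurable:
 fixes h :: "'a => ennreal"
 assumes "h \<in> borel_measurable lebesgue" "A \<in> sets borel"
 shows "(%x. h x * indicator A x) \<in> borel_measurable lebesgue"
proof -
 have "A \<in> sets lebesgue" using assms(2) by simp
 then show ?thesis by (intro borel_measurable_times_ennreal borel_measurable_indicator assms(1))
qed

definition D2 :: real where "D2 = L * 2 powr q"

lemma D2_ge1: "D2 \<ge> 1"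
proof -
 have "1 <= (2::real) powr q" using p1 pq by (intro ge_one_powr_ge_zero) auto
 then show ?thesis using L1 mult_mono[of 1 L 1 "2 powr q"] by (simp add: D2_def)
qed

text \<open>The quasiminimality inequality is stated on the closure of the set where the competitor differs
 from \<open>u\<close>, which may be much larger than the set itself. Truncating \<open>f\<close> by a continuous mollification
 makes the excess set shrink to \<open>{0 < f <= 2\<epsilon>}\<close>.\<close>

lemma quasimin_positivity_set:
 assumes w: "W f g" and f0: "!!x. 0 <= f x" and K: "compact K" "K \<subseteq> V" and z: "!!x. x \<notin> K ==> f x = 0"
  and gz: "!!x. f x = 0 ==> g x = 0"
  and fin: "IL (%x. ph x (norm (g x))) < \<infinity>"
  and M: "1 <= M" "0 < e0" "!!e x. 0 < e ==> e <= e0 ==> norm (conv (kern e) g x) <= M * e powr (- (real DIM('a) / s))"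
 shows "iL {x. f x > 0} (%x. ph x (norm (G x)))
  <= ennreal Q * iL {x. f x > 0} (%x. ph x (norm (G x - g x)))"
proof -
 note [measurable] = W_measurable[OF w]
 have mK[measurable]: "K \<in> sets borel" using K by (simp add: compact_imp_closed)
 have phG[measurable]: "(%x. ph x (norm (G x))) \<in> borel_measurable lebesgue" by (rule ph_measurable_borel) measurable
 have phg[measurable]: "(%x. ph x (norm (g x))) \<in> borel_measurable lebesgue" by (rule ph_measurable_borel) measurable
 have phGg[measurable]: "(%x. ph x (norm (G x - g x))) \<in> borel_measurable lebesgue" by (rule ph_measurable_borel) measurable
 obtain R where R: "K \<subseteq> ball 0 R" using K compact_imp_bounded bounded_subset_ballD by blast
 have zR: "f x = 0" if "R < norm x" for x
  by (rule z) (use R that in \<open>force simp: subset_iff\<close>)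
 have "K \<inter> - V = {}" "closed (- V)" using K V by auto
 from separate_compact_closed[OF K(1) this(2,1)]
 obtain d0 where d0: "d0 > 0" "!!x y. x \<in> K ==> y \<in> - V ==> d0 <= dist x y" by blast
 \<comment> \<open>Scales at which the kernel bound holds, the balls around points of
   \<open>K\<close> stay in \<open>V\<close>, and (A1-s) may be used. A subsequence then gives
   pointwise convergence.\<close>
 define E0 where "E0 k = min (min e0 d0) 1 / real (Suc k)" for k
 have E0: "0 < E0 k" "E0 k <= e0" "E0 k <= d0" "E0 k <= 1" for k
 proof -
  define \<mu> where "\<mu> = min (min e0 d0) 1"
  have \<mu>: "0 < \<mu>" using M d0 by (auto simp: \<mu>_def)
  then have "\<mu> / real (Suc k) <= \<mu> / 1" by (intro divide_left_mono) auto
  then have "0 < E0 k" "E0 k <= min (min e0 d0) 1" using \<mu> by (auto simp: E0_def \<mu>_def)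
  then show "0 < E0 k" "E0 k <= e0" "E0 k <= d0" "E0 k <= 1" by auto
 qed
 have E0l: "E0 \<longlonglongrightarrow> 0"
  using tendsto_mult[OF tendsto_const[of "min (min e0 d0) 1"] LIMSEQ_Suc[OF lim_1_over_n[where 'a=real]]]
  by (simp add: E0_def[abs_def])
 have cC0: "C1c (conv (kern (E0 k)) f) (conv (kern (E0 k)) g)" for k by (rule W_conv_C1c[OF w zR E0(1)])
 obtain r :: "nat => nat" where r: "strict_mono r" "AE x in lborel. (%k. conv (kern (E0 (r k))) f x) \<longlonglongrightarrow> f x"
  using L1d_AE_subseq[OF C1cD(4)[OF cC0] W_integrable(1)[OF w] conv_kern_LIMSEQ[OF W_integrable(1)[OF w] E0(1) E0l]] by auto
 define E where "E k = E0 (r k)" for k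
 have E: "0 < E k" "E k <= e0" "E k <= d0" "E k <= 1" for k using E0 by (auto simp: E_def)
 have El: "E \<longlonglongrightarrow> 0" using LIMSEQ_subseq_LIMSEQ[OF E0l r(1)] by (simp add: E_def[abs_def] o_def)
 define c where "c k = conv (kern (E k)) f" for k
 define Dc where "Dc k = conv (kern (E k)) g" for k
 have cC: "C1c (c k) (Dc k)" for k unfolding c_def Dc_def by (rule W_conv_C1c[OF w zR E(1)])
 note [measurable] = C1cD(6,7)[OF cC]
 have cl: "AE x in lborel. (%k. c k x) \<longlonglongrightarrow> f x" using r(2) by (simp add: c_def E_def)
 have "integrable lebesgue (%x. ph x (norm (g x)))"
  using fin by (intro integrableI_bounded) auto
 from lebesgue_borel_rep[OF this] obtain P' where P': "integrable lborel P'" "AE x in lborel. ph x (norm (g x)) = P' x" by metis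
 \<comment> \<open>A Borel representative of the energy density of \<open>g\<close> that is
   nonnegative everywhere, so that its ball means make sense without exceptional points.\<close>
 define P where "P x = \<bar>P' x\<bar>" for x
 have P: "integrable lborel P" "!!x. 0 <= P x" "AE x in lborel. ph x (norm (g x)) = P x"
 proof -
  show "integrable lborel P" unfolding P_def using P'(1) by (rule integrable_abs)
  show "AE x in lborel. ph x (norm (g x)) = P x"
   using P'(2) by eventually_elim (metis P_def abs_of_nonneg ph_nonneg)
 qed (simp add: P_def)
 have [measurable]: "P \<in> borel_measurable borel" using P by auto
 define A where "A k = conv (ballk (E k)) P" for k
 have [measurable]: "A k \<in> borel_measurable borel" for k unfolding A_def by measurable
 have A0: "0 <= A k x" for k x unfolding A_def by (rule ballk_avg(2)[OF P(1,2) E(1)])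
 have Al: "(%k. L1d (A k) P) \<longlonglongrightarrow> 0" unfolding A_def by (rule conv_ballk_LIMSEQ[OF P(1) E(1) El])
 define C where "C = max 1 (kern_const TYPE('a) * unit_ball_vol (real DIM('a)))"
 define J where "J = jen_const M C"
 have J: "J \<ge> 0" unfolding J_def by (rule jen_const_nonneg[OF M(1)])
 have bVO: "ball x (E k) \<subseteq> \<Omega>" if "x \<in> K" for x k
 proof
  fix y assume "y \<in> ball x (E k)"
  then have "dist x y < d0" using E(3)[of k] by simp
  then have "y \<in> V" using d0(2)[OF that, of y] by force
  then show "y \<in> \<Omega>" using V by auto
 qed
 \<comment> \<open>The substitute for Jensen bounds the energy of the mollified gradient by ball
   means of \<open>P\<close>, which converge to \<open>P\<close> in mean. Thus these energies do not
   concentrate on sets shrinking to nothing.\<close>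
 have phDc: "ph x (norm (Dc k x)) <= L + J * A k x" if x: "x \<in> K" for x k
 proof -
  define m where "m = vol (ball x (E k))"
  have m: "m > 0" using E(1)[of k] by (simp add: m_def content_ball_pos)
  have "ennreal (ph x (norm (Dc k x)) * m) <= ennreal (L * m) + ennreal J * iL (ball x (E k)) (%y. ph y (norm (g y)))"
   unfolding J_def m_def
  proof (rule ph_jensen[OF M(1) _ E(1) E(4) bVO[OF x]])
   show "norm (Dc k x) <= M * E k powr (- (real DIM('a) / s))" unfolding Dc_def by (rule M(3)[OF E(1,2)])
   have "ennreal (norm (Dc k x) * vol (ball x (E k))) <=
    ennreal (kern_const TYPE('a) * unit_ball_vol (real DIM('a))) * iB (ball x (E k)) (%y. norm (g y))"
    unfolding Dc_def by (rule norm_conv_kern_le[OF W_integrable(2)[OF w] E(1)])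
   also have "... <= ennreal C * iB (ball x (E k)) (%y. norm (g y))"
    by (intro mult_right_mono ennreal_leI) (auto simp: C_def)
   finally show "ennreal (norm (Dc k x) * vol (ball x (E k))) <= ennreal C * iL (ball x (E k)) (%y. norm (g y))"
    by (simp add: nn_integral_completion)
  qed (auto simp: C_def)
  also have "iL (ball x (E k)) (%y. ph y (norm (g y))) = iB (ball x (E k)) (%y. P y)"
   unfolding nn_integral_completion by (rule nn_integral_cong_AE) (use P(3) in \<open>auto elim!: eventually_mono\<close>)
  also have "... = ennreal (A k x * m)" unfolding A_def m_def by (rule ballk_avg(1)[OF P(1,2) E(1), symmetric])
  also have "ennreal (L * m) + ennreal J * ennreal (A k x * m) = ennreal ((L + J * A k x) * m)"
   using L1 m J A0[of k x] by (simp add: ennreal_mult distrib_right flip: ennreal_plus) (simp add: ennreal_mult[symmetric] mult_ac flip: ennreal_plus)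
  finally show ?thesis using m J A0[of k x] L1 by (simp add: ennreal_le_iff)
 qed
 define C3 where "C3 = D2 * D2 * (L + J)"
 have D2: "D2 \<ge> 1" by (rule D2_ge1)
 have C3: "C3 \<ge> D2" "C3 \<ge> D2 * D2 * L" "C3 \<ge> D2 * D2 * J" "C3 \<ge> 1"
 proof -
  have "1 <= D2 * (L + J)" using mult_mono[of 1 D2 1 "L + J"] D2 L1 J by simp
  then have "D2 * 1 <= D2 * (D2 * (L + J))" using D2 by (intro mult_left_mono) auto
  then show "C3 \<ge> D2" by (simp add: C3_def mult.assoc)
  then show "C3 \<ge> 1" using D2 by simp
  show "C3 \<ge> D2 * D2 * L" "C3 \<ge> D2 * D2 * J" unfolding C3_def using D2 L1 J by (auto intro!: mult_left_mono)
 qed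
 \<comment> \<open>The integrable majorant for all energies that can arise on exceptional
   sets.\<close>
 define h0 where "h0 x = indicator K x * ennreal (ph x (norm (G x)) + 1 + P x)" for x
 have h0m[measurable]: "h0 \<in> borel_measurable lebesgue"
 proof -
  have [measurable]: "P \<in> borel_measurable lebesgue" by (rule measurable_completion) simp
  show ?thesis unfolding h0_def[abs_def] by measurable
 qed
 have finh0: "NL (%x. h0 x) < \<infinity>"
 proof -
  have [measurable]: "P \<in> borel_measurable lebesgue" by (rule measurable_completion) simp
  have "NL (%x. h0 x) = NL (%x. ennreal (ph x (norm (G x))) * indicator K x + indicator K x + ennreal (P x) * indicator K x)"
   by (rule nn_integral_cong) (use P(2) in \<open>auto simp: h0_def indicator_def\<close>)
  also have "... = phL K G + emeasure lebesgue K + iL K (%x. P x)"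
   by (simp add: nn_integral_add)
  also have "... <= phL V G + emeasure lborel K + IB (%x. P x)"
  proof (intro add_mono)
   show "phL K G <= phL V G"
    by (rule nn_integral_mono) (use K(2) in \<open>auto simp: indicator_def\<close>)
   show "iL K (%x. P x) <= IB (%x. P x)"
    unfolding nn_integral_completion by (rule nn_integral_mono) (auto simp: indicator_def)
  qed simp
  also have "... < \<infinity>"
   using finG emeasure_bounded_finite[OF compact_imp_bounded[OF K(1)]] P(1,2)
   by (auto simp: integrable_iff_bounded ennreal_add_less_top)
  finally show ?thesis .
 qed
 define X where "X \<epsilon> = iL {x. f x > 2 * \<epsilon>} (%x. ph x (norm (G x)))" for \<epsilon>
 define Y where "Y \<epsilon> = nnL {x. 0 < f x \<and> f x <= 2 * \<epsilon>} (%x. h0 x)" for \<epsilon>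
 define Z where "Z = iL {x. f x > 0} (%x. ph x (norm (G x - g x)))"
 have clL: "AE x in lebesgue. (%k. c k x) \<longlonglongrightarrow> f x" by (rule AE_completion[OF cl])
 have step: "X \<epsilon> <= ennreal Q * (Z + ennreal C3 * Y \<epsilon>)" if \<epsilon>: "\<epsilon> > 0" for \<epsilon>
 proof -
  \<comment> \<open>\<open>N k\<close> collects points, away from
    \<open>0 < f x <= 2 * \<epsilon>\<close>, where the truncation may spoil the competitor;
    \<open>T k\<close> collects points of \<open>f x > 2 * \<epsilon>\<close> missed by it. Almost
    every point leaves both sets, since there \<open>c k x\<close> tends to
    \<open>f x\<close>.\<close>
  define N where "N k = {x\<in>K. \<epsilon> <= c k x \<and> (f x = 0 \<or> f x \<ge> 2 * c k x - 2 * \<epsilon>)} - {x. 0 < f x \<and> f x <= 2 * \<epsilon>}" for k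
  define T where "T k = {x\<in>K. f x > 2 * \<epsilon> \<and> c k x <= \<epsilon>}" for k
  have mN[measurable]: "N k \<in> sets borel" for k
  proof -
   have "{x. \<epsilon> <= c k x} \<in> sets borel" "{x. f x = 0} \<in> sets borel" "{x. 2 * c k x - 2 * \<epsilon> <= f x} \<in> sets borel"
    "{x. 0 < f x \<and> f x <= 2 * \<epsilon>} \<in> sets borel" by measurable
   then have "K \<inter> {x. \<epsilon> <= c k x} \<inter> ({x. f x = 0} \<union> {x. 2 * c k x - 2 * \<epsilon> <= f x}) - {x. 0 < f x \<and> f x <= 2 * \<epsilon>} \<in> sets borel"
    using mK by blast
   also have "K \<inter> {x. \<epsilon> <= c k x} \<inter> ({x. f x = 0} \<union> {x. 2 * c k x - 2 * \<epsilon> <= f x}) - {x. 0 < f x \<and> f x <= 2 * \<epsilon>} = N k"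
    unfolding N_def by blast
   finally show ?thesis .
  qed
  have mT[measurable]: "T k \<in> sets borel" for k
  proof -
   have "{x. 2 * \<epsilon> < f x \<and> c k x <= \<epsilon>} \<in> sets borel" by measurable
   then have "K \<inter> {x. 2 * \<epsilon> < f x \<and> c k x <= \<epsilon>} \<in> sets borel" using mK by blast
   also have "K \<inter> {x. 2 * \<epsilon> < f x \<and> c k x <= \<epsilon>} = T k" unfolding T_def by blast
   finally show ?thesis .
  qed
  have vN: "(%k. nnL (N k) (%x. h0 x)) \<longlonglongrightarrow> 0"
  proof (rule nn_integral_vanishing[OF h0m _ finh0])
   show "AE x in lebesgue. \<forall>\<^sub>F k in sequentially. x \<notin> N k"
    using clL
   proof eventually_elim
    case (elim x)
    show ?case
    proof (cases "f x = 0")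
     case True
     then have "\<forall>\<^sub>F k in sequentially. c k x < \<epsilon>" using order_tendstoD(2)[OF elim, of \<epsilon>] \<epsilon> by simp
     then show ?thesis by eventually_elim (auto simp: N_def)
    next
     case False
     show ?thesis
     proof (cases "f x <= 2 * \<epsilon>")
      case True
      then show ?thesis using False f0[of x] by (auto simp: N_def less_le)
     next
      case F2: False
      then have "f x / 2 + \<epsilon> < f x" by simp
      from order_tendstoD(1)[OF elim this] show ?thesis
       by eventually_elim (use False in \<open>auto simp: N_def\<close>)
     qed
    qed
   qed
  qed simp
  have vT: "(%k. nnL (T k) (%x. h0 x)) \<longlonglongrightarrow> 0"
  proof (rule nn_integral_vanishing[OF h0m _ finh0])
   show "AE x in lebesgue. \<forall>\<^sub>F k in sequentially. x \<notin> T k"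
    using clL
   proof eventually_elim
    case (elim x)
    show ?case
    proof (cases "f x > 2 * \<epsilon>")
     case True
     then have "\<epsilon> < f x" using \<epsilon> by simp
     from order_tendstoD(1)[OF elim this] show ?thesis by eventually_elim (auto simp: T_def)
    qed (simp add: T_def)
   qed
  qed simp
  have "X \<epsilon> <= ennreal Q * (Z + ennreal C3 * (Y \<epsilon> + nnL (N k) (%x. h0 x) + L1d (A k) P)) + nnL (T k) (%x. h0 x)" for k
  proof -
   \<comment> \<open>Continuity of \<open>c k\<close> keeps even the closure of the set where the
     competitor differs inside \<open>\<epsilon> <= c k x\<close>. The slope 2 matters: where
     \<open>f x > 2 * \<epsilon>\<close>, the limit \<open>2 * f x - 2 * \<epsilon>\<close> exceeds
     \<open>f x\<close>, so eventually the truncation does nothing.\<close>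
   define b where "b x = max (2 * c k x - 2 * \<epsilon>) 0" for x
   define Db where "Db x = (if 2 * c k x > 2 * \<epsilon> then 2 *\<^sub>R Dc k x else 0)" for x
   have Wb: "W b Db" unfolding b_def[abs_def] Db_def[abs_def]
    by (rule W_pos[OF W_cmult[OF C1c_W[OF cC]]]) (use \<epsilon> in simp)
   define F where "F x = f x - max (f x - b x - 0) 0" for x
   define H where "H x = g x - (if f x - b x > 0 then g x - Db x else 0)" for x
   have WF: "W F H" unfolding F_def[abs_def] H_def[abs_def]
    by (rule W_diff[OF w W_pos[OF W_diff[OF w Wb] order_refl]])
   note [measurable] = W_measurable[OF WF] W_measurable[OF Wb]
   have Fmin: "F x = min (f x) (b x)" for x by (auto simp: F_def)
   have b0: "b x \<ge> 0" for x by (simp add: b_def)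
   have Fz: "F x = 0" if "x \<notin> K" for x using z[OF that] b0[of x] by (simp add: Fmin)
   obtain B where B: "!!x. \<bar>c k x\<bar> <= B" "!!x. norm (Dc k x) <= B" using C1c_bounded[OF cC[of k]] by auto
   have Fb: "\<exists>M. \<forall>x. \<bar>F x\<bar> <= M"
   proof (intro exI allI)
    fix x show "\<bar>F x\<bar> <= 2 * B" using f0[of x] b0[of x] B(1)[of x] \<epsilon> by (auto simp: Fmin b_def)
   qed
   have fH: "IL (%x. ph x (norm (H x))) < \<infinity>"
   proof -
    define cc where "cc = L * (max 1 (2 * B)) powr q * L"
    have "IL (%x. ph x (norm (H x))) <= NL (%x. ennreal (ph x (norm (g x))) + ennreal cc * indicator K x)"
    proof (rule nn_integral_mono, goal_cases)
     case (1 x)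
     show ?case
     proof (cases "f x - b x > 0")
      case True
      then have "x \<in> K" using z[of x] b0[of x] by force
      have "norm (Db x) <= 2 * B" using B(2)[of x] order_trans[OF norm_ge_zero B(2)[of x]] by (simp add: Db_def)
      then have "ph x (norm (H x)) <= cc" unfolding cc_def using True by (intro ph_le_const) (auto simp: H_def)
      then show ?thesis using \<open>x \<in> K\<close> by (simp add: add_increasing ennreal_leI)
     qed (simp add: H_def)
    qed
    also have "... = IL (%x. ph x (norm (g x))) + ennreal cc * emeasure lebesgue K"
     by (simp add: nn_integral_add nn_integral_cmult)
    also have "... < \<infinity>" using fin emeasure_bounded_finite[OF compact_imp_bounded[OF K(1)]]
     by (simp add: ennreal_add_less_top ennreal_mult_less_top)
    finally show ?thesis .
   qed
   define S where "S = closure {x. F x \<noteq> 0}"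
   have Sm[measurable]: "S \<in> sets borel" by (simp add: S_def)
   have SK: "S \<subseteq> K \<inter> {x. \<epsilon> <= c k x}" unfolding S_def
   proof (rule closure_minimal)
    show "{x. F x \<noteq> 0} \<subseteq> K \<inter> {x. \<epsilon> <= c k x}"
    proof
     fix x assume "x \<in> {x. F x \<noteq> 0}"
     then have "F x \<noteq> 0" by simp
     then have "x \<in> K" "b x \<noteq> 0" using Fz[of x] f0[of x] by (auto simp: Fmin)
     then show "x \<in> K \<inter> {x. \<epsilon> <= c k x}" by (auto simp: b_def max_def split: if_splits)
    qed
    show "closed (K \<inter> {x. \<epsilon> <= c k x})"
     using K(1) C1cD(3)[OF cC[of k]] by (intro closed_Int closed_Collect_le) (auto simp: compact_imp_closed)
   qed
   have main: "phL S G <= ennreal Q * phL S (%x. G x - H x)"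
    unfolding S_def by (rule qm[OF WF K Fz Fb fH])
   have pt: "ennreal (ph x (norm (G x - H x))) * indicator S x <=
    ennreal (ph x (norm (G x - g x))) * indicator {x. f x > 0} x +
    ennreal C3 * (h0 x * indicator {x. 0 < f x \<and> f x <= 2 * \<epsilon>} x + h0 x * indicator (N k) x + ennreal (norm (A k x - P x)))" for x
   proof (cases "x \<in> S")
    case False then show ?thesis by simp
   next
    case True
    then have xK: "x \<in> K" and ck: "\<epsilon> <= c k x" using SK by auto
    \<comment> \<open>Points where \<open>f\<close> vanishes or is cut by \<open>b\<close>: their
      energy is charged to the majorant on exceptional sets, up to the mean error of
      \<open>A k\<close>.\<close>
    have bad: ?thesis if bd: "f x = 0 \<or> f x \<ge> 2 * c k x - 2 * \<epsilon>" and
     le: "ph x (norm (G x - H x)) <= C3 * (ph x (norm (G x)) + 1 + A k x)"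
    proof -
     have "ph x (norm (G x)) + 1 + A k x <= (ph x (norm (G x)) + 1 + P x) + norm (A k x - P x)" by simp
     then have "ph x (norm (G x - H x)) <= C3 * ((ph x (norm (G x)) + 1 + P x) + norm (A k x - P x))"
      using le C3 by (meson mult_left_mono order_trans zero_le_one)
     then have "ennreal (ph x (norm (G x - H x))) <= ennreal C3 * (ennreal (ph x (norm (G x)) + 1 + P x) + ennreal (norm (A k x - P x)))"
      using C3 P(2)[of x] by (simp flip: ennreal_mult ennreal_plus add: ennreal_leI)
     also have "ennreal (ph x (norm (G x)) + 1 + P x) = h0 x" using xK by (simp add: h0_def)
     also have "h0 x + ennreal (norm (A k x - P x)) <= h0 x * indicator {x. 0 < f x \<and> f x <= 2 * \<epsilon>} x + h0 x * indicator (N k) x + ennreal (norm (A k x - P x))"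
     proof (cases "0 < f x \<and> f x <= 2 * \<epsilon>")
      case False
      then have "x \<in> N k" using bd xK ck by (auto simp: N_def)
      then show ?thesis by simp
     qed simp
     finally show ?thesis using True by (simp add: add_increasing mult_left_mono)
    qed
    show ?thesis
    proof (cases "f x - b x > 0")
     case fb: True
     have "norm (Db x) <= \<bar>2 * norm (Dc k x)\<bar>" by (simp add: Db_def)
     then have "ph x (norm (Db x)) <= L * 2 powr q * ph x (norm (Dc k x))" by (intro ph_dec_bound) auto
     also have "... <= D2 * (L + J * A k x)" unfolding D2_def using phDc[OF xK, of k] L1 by (intro mult_left_mono) auto
     finally have db: "ph x (norm (Db x)) <= D2 * (L + J * A k x)" .
     have "ph x (norm (G x - H x)) <= D2 * (ph x (norm (G x)) + ph x (norm (Db x)))"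
      using ph_norm_diff[of x "G x" "Db x"] fb by (simp add: H_def D2_def)
     also have "... <= D2 * (ph x (norm (G x)) + D2 * (L + J * A k x))"
      using db D2 by (intro mult_left_mono add_left_mono) auto
     also have "... = D2 * ph x (norm (G x)) + D2 * D2 * L + D2 * D2 * J * A k x" by (simp add: algebra_simps)
     also have "... <= C3 * ph x (norm (G x)) + C3 * 1 + C3 * A k x"
      using C3 A0[of k x] by (intro add_mono mult_right_mono) auto
     finally have "ph x (norm (G x - H x)) <= C3 * (ph x (norm (G x)) + 1 + A k x)" by (simp add: algebra_simps)
     moreover have "f x \<ge> 2 * c k x - 2 * \<epsilon>" using fb by (auto simp: b_def)
     ultimately show ?thesis by (intro bad) auto
    next
     case fb: False
     then have Hg: "H x = g x" by (simp add: H_def)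
     show ?thesis
     proof (cases "f x = 0")
      case True
      then have "H x = 0" using Hg gz by simp
      moreover have "1 * (ph x (norm (G x)) + 0) <= C3 * (ph x (norm (G x)) + (1 + A k x))"
       using C3 A0[of k x] by (intro mult_mono add_mono) auto
      ultimately show ?thesis using True by (intro bad) (auto simp: add.assoc)
     next
      case False
      then have "f x > 0" using f0[of x] by simp
      then show ?thesis using \<open>x \<in> S\<close> Hg by simp
     qed
    qed
   qed
   have "phL S (%x. G x - H x) <= NL (%x. ennreal (ph x (norm (G x - g x))) * indicator {x. f x > 0} x +
    ennreal C3 * (h0 x * indicator {x. 0 < f x \<and> f x <= 2 * \<epsilon>} x + h0 x * indicator (N k) x + ennreal (norm (A k x - P x))))"
    by (rule nn_integral_mono[OF pt])
   also have "... = Z + ennreal C3 * (Y \<epsilon> + nnL (N k) (%x. h0 x) + L1d (A k) P)"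
   proof -
    have d: "(%x. ennreal (norm (A k x - P x))) \<in> borel_measurable lebesgue"
     by (rule measurable_completion) measurable
    have s: "{x. f x > 0} \<in> sets borel" "{x. 0 < f x \<and> f x <= 2 * \<epsilon>} \<in> sets borel" by measurable
    note m = lebesgue_indicator_measurable[OF _ s(1)] lebesgue_indicator_measurable[OF h0m s(2)] lebesgue_indicator_measurable[OF h0m mN]
    have m1: "(%x. ennreal (ph x (norm (G x - g x))) * indicator {x. f x > 0} x) \<in> borel_measurable lebesgue"
     by (rule m(1)) measurable
    have "NL (%x. h0 x * indicator {x. 0 < f x \<and> f x <= 2 * \<epsilon>} x + h0 x * indicator (N k) x + ennreal (norm (A k x - P x)))
     = NL (%x. h0 x * indicator {x. 0 < f x \<and> f x <= 2 * \<epsilon>} x) + NL (%x. h0 x * indicator (N k) x) + IL (%x. norm (A k x - P x))"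
     by (simp only: nn_integral_add[OF borel_measurable_add[OF m(2,3)] d] nn_integral_add[OF m(2,3)])
    moreover have "(%x. ennreal C3 * (h0 x * indicator {x. 0 < f x \<and> f x <= 2 * \<epsilon>} x + h0 x * indicator (N k) x + ennreal (norm (A k x - P x)))) \<in> borel_measurable lebesgue"
    proof -
     show ?thesis by (intro borel_measurable_times_ennreal borel_measurable_const borel_measurable_add m(2,3) d)
    qed
    ultimately have e0: "NL (%x. h0 x * indicator {x. 0 < f x \<and> f x <= 2 * \<epsilon>} x + h0 x * indicator (N k) x + ennreal (norm (A k x - P x)))
     = NL (%x. h0 x * indicator {x. 0 < f x \<and> f x <= 2 * \<epsilon>} x) + NL (%x. h0 x * indicator (N k) x) + IL (%x. norm (A k x - P x))"
     and m2: "(%x. ennreal C3 * (h0 x * indicator {x. 0 < f x \<and> f x <= 2 * \<epsilon>} x + h0 x * indicator (N k) x + ennreal (norm (A k x - P x)))) \<in> borel_measurable lebesgue"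
     by blast+
    note e = e0 nn_integral_add[OF m1 m2]
     nn_integral_cmult[OF borel_measurable_add[OF borel_measurable_add[OF m(2,3)] d]]
    have "L1d (A k) P = IL (%x. norm (A k x - P x))" by (simp add: L1d_def nn_integral_completion)
    then show ?thesis unfolding Z_def Y_def by (simp only: e)
   qed
   finally have 1: "phL S G <= ennreal Q * (Z + ennreal C3 * (Y \<epsilon> + nnL (N k) (%x. h0 x) + L1d (A k) P))"
    using main by (meson mult_left_mono order_trans zero_le)
   have "X \<epsilon> <= NL (%x. ennreal (ph x (norm (G x))) * indicator S x + h0 x * indicator (T k) x)"
    unfolding X_def
   proof (rule nn_integral_mono, goal_cases)
    case (1 x)
    show ?case
    proof (cases "f x > 2 * \<epsilon>")
     case True
     then have xK: "x \<in> K" using z[of x] \<epsilon> by force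
     show ?thesis
     proof (cases "c k x <= \<epsilon>")
      case c: True
      then have "x \<in> T k" using True xK by (simp add: T_def)
      moreover have "ennreal (ph x (norm (G x))) <= h0 x" using xK P(2)[of x] by (simp add: h0_def ennreal_leI)
      ultimately show ?thesis using True by (simp add: add_increasing)
     next
      case False
      then have "F x \<noteq> 0" using True \<epsilon> by (simp add: Fmin b_def min_def)
      then have "x \<in> S" using closure_subset[of "{x. F x \<noteq> 0}"] unfolding S_def by auto
      then show ?thesis using True by simp
     qed
    qed simp
   qed
   also have "... = phL S G + nnL (T k) (%x. h0 x)"
    by (rule nn_integral_add) measurable
   finally show ?thesis using 1 by (meson add_right_mono order_trans)
  qed
  moreover have "(%k. ennreal Q * (Z + ennreal C3 * (Y \<epsilon> + nnL (N k) (%x. h0 x) + L1d (A k) P)) + nnL (T k) (%x. h0 x))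
   \<longlonglongrightarrow> ennreal Q * (Z + ennreal C3 * (Y \<epsilon> + 0 + 0)) + 0"
   by (intro tendsto_add tendsto_const ennreal_tendsto_cmult vN vT Al) auto
  ultimately have "X \<epsilon> <= ennreal Q * (Z + ennreal C3 * (Y \<epsilon> + 0 + 0)) + 0"
   by (intro LIMSEQ_le_const) auto
  then show ?thesis by simp
 qed
 \<comment> \<open>The remaining error lives on \<open>0 < f x <= 2 * ee k\<close>, a family of sets
   with empty limit.\<close>
 define ee where "ee k = 1 / real (Suc k)" for k
 have ee: "ee k > 0" for k by (simp add: ee_def)
 have eel: "ee \<longlonglongrightarrow> 0" unfolding ee_def by (rule LIMSEQ_Suc[OF lim_1_over_n])
 have Yl: "(%k. Y (ee k)) \<longlonglongrightarrow> 0"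
  unfolding Y_def
 proof (rule nn_integral_vanishing[OF h0m _ finh0])
  show "AE x in lebesgue. \<forall>\<^sub>F k in sequentially. x \<notin> {x. 0 < f x \<and> f x <= 2 * ee k}"
  proof (rule AE_I2)
   fix x
   show "\<forall>\<^sub>F k in sequentially. x \<notin> {x. 0 < f x \<and> f x <= 2 * ee k}"
   proof (cases "f x > 0")
    case True
    then have "0 < f x / 2" by simp
    from order_tendstoD(2)[OF eel this] show ?thesis by eventually_elim auto
   qed simp
  qed
  show "{x. 0 < f x \<and> f x <= 2 * ee k} \<in> sets lebesgue" for k
   by (rule lebesgue_borel_sets) measurable
 qed
 have "iL {x. f x > 0} (%x. ph x (norm (G x))) <= ennreal Q * (Z + ennreal C3 * Y (ee k)) + Y (ee k)" for k
 proof -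
  have [measurable]: "{x. f x > 2 * ee k} \<in> sets borel" "{x. 0 < f x \<and> f x <= 2 * ee k} \<in> sets borel" by measurable
  have "iL {x. f x > 0} (%x. ph x (norm (G x))) <=
   NL (%x. ennreal (ph x (norm (G x))) * indicator {x. f x > 2 * ee k} x + h0 x * indicator {x. 0 < f x \<and> f x <= 2 * ee k} x)"
  proof (rule nn_integral_mono, goal_cases)
   case (1 x)
   show ?case
   proof (cases "f x > 0")
    case True
    then have xK: "x \<in> K" using z[of x] by force
    have "ennreal (ph x (norm (G x))) <= h0 x" using xK P(2)[of x] by (simp add: h0_def ennreal_leI)
    then show ?thesis using True by (cases "f x > 2 * ee k") auto
   qed simp
  qed
  also have "... = X (ee k) + Y (ee k)" unfolding X_def Y_def
   by (rule nn_integral_add; rule lebesgue_indicator_measurable) measurable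
  also have "... <= ennreal Q * (Z + ennreal C3 * Y (ee k)) + Y (ee k)" by (intro add_right_mono step ee)
  finally show ?thesis .
 qed
 moreover have "(%k. ennreal Q * (Z + ennreal C3 * Y (ee k)) + Y (ee k)) \<longlonglongrightarrow> ennreal Q * (Z + ennreal C3 * 0) + 0"
  by (intro tendsto_add tendsto_const ennreal_tendsto_cmult Yl) auto
 ultimately have "iL {x. f x > 0} (%x. ph x (norm (G x))) <= ennreal Q * (Z + ennreal C3 * 0) + 0"
  by (intro LIMSEQ_le_const) auto
 then show ?thesis by (simp add: Z_def)
qed

end

section \<open>Caccioppoli inequality\<close>

text \<open>The gradient of the kernel has integral 0, so \<open>f\<close> may be replaced by
  \<open>f - f w\<close> for any \<open>w\<close>; averaging over \<open>w\<close> in the ball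
  leaves the double oscillation.\<close>

lemma conv_grad_osc:
 fixes f :: "'a::euclidean_space => real"
 assumes w: "W f g" and e: "e > 0" and \<Theta>: "0 <= \<Theta>"
  and osc: "dosc f (ball x (2 * e))
   <= ennreal (\<Theta> * (vol (ball x (2 * e)))\<^sup>2)"
 shows "norm (conv (kern e) g x) <= grad_const TYPE('a) * unit_ball_vol (real DIM('a)) * 2 ^ DIM('a) / e * \<Theta>"
proof -
 note [measurable] = W_measurable[OF w] C1cD(7)[OF C1c_kern[OF e]]
 define B where "B = ball x (2 * e)"
 define m where "m = vol B"
 have m: "m > 0" using e by (simp add: m_def B_def content_ball_pos)
 have Bm[measurable]: "B \<in> sets borel" by (simp add: B_def)
 have eB: "emeasure lborel B = ennreal m"
  using emeasure_lborel_ball_finite[of x "2 * e"] unfolding m_def B_def by (intro emeasure_eq_ennreal_measure) auto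
 define Gc where "Gc = grad_const TYPE('a) / e ^ (DIM('a) + 1)"
 have Gc: "Gc > 0" using grad_const(1)[where 'a='a] e by (simp add: Gc_def)
 define v where "v = conv (kern e) g x"
 have ik: "integrable lborel (%y. kern_grad e (x - y))"
  by (rule reflect_integrable[OF C1cD(5)[OF C1c_kern[OF e]]])
 have zk: "LB (%y. kern_grad e (x - y)) = 0"
  using reflect_integral[of "kern_grad e" x] C1c_integral_zero[OF C1c_kern[OF e]] by simp
 have ifk: "integrable lborel (%y. f y *\<^sub>R kern_grad e (x - y))"
 proof (rule Bochner_Integration.integrable_bound[of _ "%y. Gc * f y"])
  show "integrable lborel (%y. Gc * f y)" using W_integrable(1)[OF w] by simp
  show "AE y in lborel. norm (f y *\<^sub>R kern_grad e (x - y)) <= norm (Gc * f y)"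
  proof (rule AE_I2)
   fix y
   have "norm (kern_grad e (x - y)) <= Gc" unfolding Gc_def by (rule kern_grad_le[OF e])
   then show "norm (f y *\<^sub>R kern_grad e (x - y)) <= norm (Gc * f y)"
    using Gc by (simp add: abs_mult mult.commute[of Gc] mult_left_mono)
  qed
 qed measurable
 have pt: "ennreal (norm v) <= ennreal Gc * iB B (%y. \<bar>f y - f w\<bar>)" for w
 proof -
  have iw: "integrable lborel (%y. f y *\<^sub>R kern_grad e (x - y) - f w *\<^sub>R kern_grad e (x - y))"
   using ifk ik by auto
  have "v = LB (%y. f y *\<^sub>R kern_grad e (x - y) - f w *\<^sub>R kern_grad e (x - y))"
   using ifk ik zk W_conv_grad[OF \<open>W f g\<close> e, of x] by (simp add: v_def)
  then have "ennreal (norm v) <= NB (%y. norm (f y *\<^sub>R kern_grad e (x - y) - f w *\<^sub>R kern_grad e (x - y)))"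
   using integral_norm_bound_ennreal[OF iw] by simp
  also have "... <= NB (%y. ennreal Gc * (ennreal \<bar>f y - f w\<bar> * indicator B y))"
  proof (rule nn_integral_mono, goal_cases)
   case (1 y)
   show ?case
   proof (cases "y \<in> B")
    case True
    have "norm (f y *\<^sub>R kern_grad e (x - y) - f w *\<^sub>R kern_grad e (x - y)) = \<bar>f y - f w\<bar> * norm (kern_grad e (x - y))"
     by (simp flip: scaleR_diff_left)
    also have "... <= \<bar>f y - f w\<bar> * Gc" unfolding Gc_def by (intro mult_left_mono kern_grad_le[OF e]) auto
    finally show ?thesis using True Gc by (simp flip: ennreal_mult add: ennreal_leI mult.commute)
   next
    case False
    then have "norm (x - y) > e" using e by (simp add: B_def dist_norm)
    from kern_grad_outside[OF e this] show ?thesis by simp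
   qed
  qed
  also have "... = ennreal Gc * iB B (%y. \<bar>f y - f w\<bar>)" by (rule nn_integral_cmult) measurable
  finally show ?thesis .
 qed
 have "ennreal (norm v * m) = NB (%w. ennreal (norm v) * indicator B w)"
  using m by (simp add: nn_integral_cmult eB ennreal_mult)
 also have "... <= NB (%w. ennreal Gc * (iB B (%y. \<bar>f y - f w\<bar>) * indicator B w))"
  by (rule nn_integral_mono) (use pt in \<open>auto simp: indicator_def\<close>)
 also have "... = ennreal Gc * dosc f B"
  by (rule nn_integral_cmult) measurable
 also have "... <= ennreal Gc * ennreal (\<Theta> * m\<^sup>2)"
  using osc by (intro mult_left_mono) (auto simp: B_def m_def)
 also have "... = ennreal (Gc * (\<Theta> * m\<^sup>2))" using Gc \<Theta> by (intro ennreal_mult[symmetric]) auto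
 finally have "norm v * m <= Gc * (\<Theta> * m\<^sup>2)" using Gc \<Theta> by (subst (asm) ennreal_le_iff) auto
 then have "norm v <= Gc * m * \<Theta>" using m by (simp add: power2_eq_square field_simps)
 also have "Gc * m = grad_const TYPE('a) * unit_ball_vol (real DIM('a)) * 2 ^ DIM('a) / e"
  using e by (simp add: Gc_def m_def B_def content_ball power_mult_distrib)
 finally show ?thesis by (simp add: v_def)
qed

text \<open>Chooses the gradient to vanish where \<open>f\<close> does, the premise
  \<open>gz\<close> of \<open>quasimin_positivity_set\<close>.\<close>

lemma W_restrict_positive:
 assumes "W f g" "!!x. 0 <= f x"
 shows "W f (%x. if f x > 0 then g x else 0)"
 using W_pos[OF assms(1), of 0] assms(2) by (simp add: max_absorb1)

text \<open>For \<open>k < 0\<close> the function (U - k)_+ is not integrable over the whole space,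
  and \<open>W_pos\<close> cannot be applied to it. There the product with \<open>\<eta>\<close> is
  rewritten through U, the cut-off itself and (-U + k)_+, each admissible.\<close>

lemma W_cutoff_pos_part:
 fixes k :: real
 assumes w: "W U G" and e: "C1c \<eta> D\<eta>" "!!x. 0 <= \<eta> x"
 shows "W (%x. \<eta> x * max (U x - k) 0)
  (%x. if \<eta> x * max (U x - k) 0 > 0 then \<eta> x *\<^sub>R G x + (U x - k) *\<^sub>R D\<eta> x else 0)"
proof -
 obtain B where B: "!!x. \<bar>\<eta> x\<bar> <= B" "!!x. norm (D\<eta> x) <= B" using C1c_bounded[OF e(1)] by auto
 note [measurable] = W_measurable[OF w] C1cD(6,7)[OF e(1)]
 have "\<exists>g. W (%x. \<eta> x * max (U x - k) 0) g \<and> (\<forall>x. \<eta> x * max (U x - k) 0 > 0 --> g x = \<eta> x *\<^sub>R G x + (U x - k) *\<^sub>R D\<eta> x)"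
 proof (cases "k \<ge> 0")
  case True
  show ?thesis
  proof (intro exI conjI allI impI)
   show "W (%x. \<eta> x * max (U x - k) 0) (%x. \<eta> x *\<^sub>R (if U x > k then G x else 0) + max (U x - k) 0 *\<^sub>R D\<eta> x)"
    by (rule W_mult[OF W_pos[OF w True] C1cD(1,2)[OF e(1)] B])
   fix x assume "\<eta> x * max (U x - k) 0 > 0"
   then have "U x > k" by (auto simp: max_def split: if_splits)
   then show "\<eta> x *\<^sub>R (if U x > k then G x else 0) + max (U x - k) 0 *\<^sub>R D\<eta> x = \<eta> x *\<^sub>R G x + (U x - k) *\<^sub>R D\<eta> x"
    by simp
  qed
 next
  case False
  have nU: "W (%x. - U x) (%x. - G x)" using W_cmult[OF w, of "-1"] by simp
  have "W (%x. max (- U x - (- k)) 0) (%x. if - U x > - k then - G x else 0)"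
   by (rule W_pos[OF nU]) (use False in simp)
  note 1 = W_mult[OF this C1cD(1,2)[OF e(1)] B]
  note 2 = W_mult[OF w C1cD(1,2)[OF e(1)] B]
  note 3 = W_cmult[OF C1c_W[OF e(1)], of "-k"]
  have eq: "\<eta> x * U x + (- k) * \<eta> x + \<eta> x * max (- U x - (- k)) 0 = \<eta> x * max (U x - k) 0" for x
   by (simp add: max_def algebra_simps)
  show ?thesis
  proof (intro exI conjI allI impI)
   show "W (%x. \<eta> x * max (U x - k) 0) (%x. (\<eta> x *\<^sub>R G x + U x *\<^sub>R D\<eta> x) + (- k) *\<^sub>R D\<eta> x +
    (\<eta> x *\<^sub>R (if - U x > - k then - G x else 0) + max (- U x - (- k)) 0 *\<^sub>R D\<eta> x))"
    using W_add[OF W_add[OF 2 3] 1] unfolding eq .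
   fix x assume "\<eta> x * max (U x - k) 0 > 0"
   then have "U x > k" by (auto simp: max_def split: if_splits)
   then show "(\<eta> x *\<^sub>R G x + U x *\<^sub>R D\<eta> x) + (- k) *\<^sub>R D\<eta> x +
    (\<eta> x *\<^sub>R (if - U x > - k then - G x else 0) + max (- U x - (- k)) 0 *\<^sub>R D\<eta> x) = \<eta> x *\<^sub>R G x + (U x - k) *\<^sub>R D\<eta> x"
    by (simp add: max_def algebra_simps)
  qed
 qed
 then obtain g where g: "W (%x. \<eta> x * max (U x - k) 0) g"
  "!!x. \<eta> x * max (U x - k) 0 > 0 ==> g x = \<eta> x *\<^sub>R G x + (U x - k) *\<^sub>R D\<eta> x" by blast
 have "W (%x. \<eta> x * max (U x - k) 0) (%x. if \<eta> x * max (U x - k) 0 > 0 then g x else 0)"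
  by (rule W_restrict_positive[OF g(1)]) (use e(2) in auto)
 moreover have "(%x. if \<eta> x * max (U x - k) 0 > 0 then g x else 0) =
  (%x. if \<eta> x * max (U x - k) 0 > 0 then \<eta> x *\<^sub>R G x + (U x - k) *\<^sub>R D\<eta> x else 0)"
  by (intro ext if_cong refl g(2))
 ultimately show ?thesis by simp
qed

text \<open>\<open>osc1\<close> and \<open>avg1\<close> are the common form in which BMO and the
  Lebesgue space enter. The mean may grow by one power of the radius more than the oscillation,
  because it appears only multiplied by a radius, through the Lipschitz constant of a
  cut-off.\<close>

locale local_qm_osc = local_qm +
 fixes K\<^sub>1 \<rho>\<^sub>0 :: real
 assumes K1: "1 <= K\<^sub>1" and rho0: "0 < \<rho>\<^sub>0" "\<rho>\<^sub>0 <= 1"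
  and osc1: "!!x \<rho>. 0 < \<rho> ==> \<rho> <= \<rho>\<^sub>0 ==> ball x \<rho> \<subseteq> V ==>
   dosc U (ball x \<rho>)
    <= ennreal (K\<^sub>1 * \<rho> powr (1 - real DIM('a) / s) * (vol (ball x \<rho>))\<^sup>2)"
  and avg1: "!!x \<rho>. 0 < \<rho> ==> \<rho> <= \<rho>\<^sub>0 ==> ball x \<rho> \<subseteq> V ==>
   (iB (ball x \<rho>) (%w. \<bar>U w\<bar>)) <= ennreal (K\<^sub>1 * \<rho> powr (- (real DIM('a) / s)) * vol (ball x \<rho>))"
begin

declare lebesgue_borel_sets [measurable del]

definition lev :: "'a => real => real => 'a set" where
 "lev z t k = {x \<in> ball z t. k < U x}"

abbreviation "phU A k c \<equiv> iL A (%x. ph x ((U x - k) / c))"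

lemma lev_measurable [measurable]: "lev z t k \<in> sets borel"
proof -
 have "lev z t k = ball z t \<inter> {x. k < U x}" by (auto simp: lev_def)
 moreover have "{x. k < U x} \<in> sets borel" by measurable
 ultimately show ?thesis by auto
qed

lemma phG_measurable: "(%x. ennreal (ph x (norm (G x)))) \<in> borel_measurable lebesgue"
 by (intro measurable_compose[OF ph_measurable_borel measurable_ennreal]) measurable

lemma phU_measurable: "(%x. ennreal (ph x ((U x - k) / c))) \<in> borel_measurable lebesgue"
 by (intro measurable_compose[OF ph_measurable_borel measurable_ennreal]) measurable

lemma energy_finite: "phL A G < \<infinity>" if "A \<subseteq> V"
proof -
 have "phL A G <= phL V G"
  by (rule nn_integral_mono) (use that in \<open>auto simp: indicator_def\<close>)
 then show ?thesis using finG by (rule le_less_trans)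
qed

lemma phU_finite:
 assumes A: "bounded A" "A \<subseteq> V" "A \<in> sets borel" and c: "c > 0"
 shows "phU A k c < \<infinity>"
proof -
 define d where "d = max 1 (1 / c)"
 define C where "C = L * d powr q * (L * 2 powr q)"
 have C: "C \<ge> 0" using L1 by (simp add: C_def)
 define k' where "k' = L * (max 1 \<bar>k\<bar>) powr q * L"
 have k': "k' \<ge> 0" using L1 by (simp add: k'_def)
 have mU: "(%x. ennreal (ph x (U x)) * indicator A x) \<in> borel_measurable lebesgue"
  by (intro lebesgue_indicator_measurable A(3) measurable_compose[OF ph_measurable_borel measurable_ennreal]) measurable
 have "phU A k c <= NL (%x. ennreal C * (ennreal (ph x (U x)) * indicator A x) + ennreal (C * k') * indicator A x)"
 proof (rule nn_integral_mono, goal_cases)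
  case (1 x)
  have "ph x ((U x - k) / c) <= L * d powr q * ph x (U x - k)"
   by (rule ph_dec_bound) (use c in \<open>auto simp: d_def abs_mult divide_inverse mult.commute intro!: mult_right_mono\<close>)
  also have "ph x (U x - k) <= L * 2 powr q * (ph x (U x) + ph x k)"
   using ph_add[of x "U x" "- k"] ph_abs[of x "- k"] by simp
  also have "ph x k <= k'" unfolding k'_def by (rule ph_le_const) auto
  finally have "ph x ((U x - k) / c) <= C * (ph x (U x) + k')" using L1 by (simp add: C_def mult.assoc mult_left_mono)
  then have "ennreal (ph x ((U x - k) / c)) <= ennreal C * ennreal (ph x (U x)) + ennreal (C * k')"
   using C k' by (simp flip: ennreal_mult ennreal_plus add: ennreal_leI distrib_left)
  then show ?case
   by (auto simp: indicator_def)
 qed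
 also have "... = ennreal C * iL A (%x. ph x (U x)) + ennreal (C * k') * emeasure lebesgue A"
 proof -
  have "(%x. ennreal (C * k') * indicator A x) \<in> borel_measurable lebesgue"
   using A(3) by (intro borel_measurable_times_ennreal borel_measurable_const borel_measurable_indicator) simp
  note nn_integral_add[OF borel_measurable_times_ennreal[OF borel_measurable_const mU] this, of "ennreal C"]
  then show ?thesis using A(3) by (simp only: nn_integral_cmult[OF mU]) (simp add: nn_integral_cmult_indicator)
 qed
 also have "... < \<infinity>"
 proof -
  have "iL A (%x. ph x (U x)) <= iL V (%x. ph x (U x))"
   by (rule nn_integral_mono) (use A in \<open>auto simp: indicator_def\<close>)
  then have "iL A (%x. ph x (U x)) < \<infinity>" using finU by (rule le_less_trans)
  moreover have "emeasure lebesgue A < \<infinity>" using emeasure_bounded_finite[OF A(1)] A(3) by simp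
  ultimately show ?thesis by (simp add: ennreal_mult_less_top ennreal_add_less_top)
 qed
 finally show ?thesis .
qed

lemma ns: "1 <= real DIM('a) / s"
 using s1 sn by simp

text \<open>Supplies the kernel premise of \<open>quasimin_positivity_set\<close>. The oscillation
  of the cut-off positive part is that of \<open>U\<close> plus the oscillation of
  \<open>\<eta>\<close> times a mean of \<open>U\<close>, and \<open>conv_grad_osc\<close> divides
  by the radius.\<close>

lemma cutoff_kernel_bound:
 assumes c: "cball z t \<subseteq> V" "t > 0" and e: "C1c \<eta> D\<eta>" "!!x. 0 <= \<eta> x" "!!x. \<eta> x <= 1" "!!x. t <= dist z x ==> \<eta> x = 0"
  and w: "W (%x. \<eta> x * max (U x - k) 0) g"
 shows "\<exists>M e0. 1 <= M \<and> 0 < e0 \<and> (\<forall>e x. 0 < e \<and> e <= e0 --> norm (conv (kern e) g x) <= M * e powr (- (real DIM('a) / s)))"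
proof -
 have "cball z t \<inter> - V = {}" "closed (- V)" using c V by auto
 from separate_compact_closed[OF compact_cball this(2,1)]
 obtain d0 where d0: "d0 > 0" "!!x y. x \<in> cball z t ==> y \<in> - V ==> d0 <= dist x y" by blast
 \<comment> \<open>A ball of radius \<open>2 * e0\<close> that meets \<open>cball z t\<close> lies
   within distance \<open>4 * e0 <= d0\<close> of it, hence in \<open>V\<close>; a ball that misses
   it sees the zero function.\<close>
 define e0 where "e0 = min \<rho>\<^sub>0 (d0 / 2) / 2"
 have e0: "e0 > 0" "2 * e0 <= \<rho>\<^sub>0" "4 * e0 <= d0" using d0 rho0 by (auto simp: e0_def)
 obtain Be where Be: "!!x y. \<bar>\<eta> x - \<eta> y\<bar> <= Be * norm (x - y)" using C1c_segment_bound[OF e(1)] by blast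
 define B where "B = max 0 Be"
 have B: "B \<ge> 0" "\<bar>\<eta> x - \<eta> y\<bar> <= B * norm (x - y)" for x y
 proof -
  have "Be * norm (x - y) <= B * norm (x - y)" by (intro mult_right_mono) (auto simp: B_def)
  then show "\<bar>\<eta> x - \<eta> y\<bar> <= B * norm (x - y)" using Be[of x y] by linarith
 qed (simp add: B_def)
 define f where "f x = \<eta> x * max (U x - k) 0" for x
 define N where "N = K\<^sub>1 + 2 * B * (K\<^sub>1 + \<bar>k\<bar>)"
 have N: "N \<ge> 1" using K1 B(1) by (auto simp: N_def intro!: add_increasing2)
 define \<gamma> where "\<gamma> = real DIM('a) / s"
 have \<gamma>: "\<gamma> \<ge> 1" using ns by (simp add: \<gamma>_def)
 have [measurable]: "\<eta> \<in> borel_measurable borel" by (rule C1cD(6)[OF e(1)])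
 have fm[measurable]: "f \<in> borel_measurable borel" unfolding f_def by measurable
 have osc: "dosc f (ball x (2 * r))
   <= ennreal (N * (2 * r) powr (1 - \<gamma>) * (vol (ball x (2 * r)))\<^sup>2)" if r: "0 < r" "r <= e0" for x r
 proof (cases "ball x (2 * r) \<inter> cball z t = {}")
  case True
  then have fz: "f y = 0" if "y \<in> ball x (2 * r)" for y 
  proof -
   have "y \<notin> cball z t" using True that by blast
   then show ?thesis using e(4)[of y] by (simp add: f_def)
  qed
  have "dosc f (ball x (2 * r)) = (\<integral>\<^sup>+w. 0 \<partial>(lborel :: 'a measure))"
  proof (rule nn_integral_cong, goal_cases)
   case (1 w)
   show ?case
   proof (cases "w \<in> ball x (2 * r)")
    case w: True
    have "iB (ball x (2 * r)) (%y. \<bar>f y - f w\<bar>) = (\<integral>\<^sup>+y. 0 \<partial>(lborel :: 'a measure))"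
     by (rule nn_integral_cong) (use fz w in \<open>auto simp: indicator_def\<close>)
    then show ?thesis by simp
   qed simp
  qed
  then show ?thesis by simp
 next
  case False
  define \<rho> where "\<rho> = 2 * r"
  have \<rho>: "0 < \<rho>" "\<rho> <= \<rho>\<^sub>0" "\<rho> <= 1" using r e0 rho0 by (auto simp: \<rho>_def)
  define Bx where "Bx = ball x \<rho>"
  define m where "m = vol Bx"
  have Bxm[measurable]: "Bx \<in> sets borel" by (simp add: Bx_def)
  have eB: "emeasure lborel Bx = ennreal m"
   using emeasure_lborel_ball_finite[of x \<rho>] unfolding m_def Bx_def by (intro emeasure_eq_ennreal_measure) auto
  have BV: "Bx \<subseteq> V"
  proof
   fix y assume "y \<in> Bx"
   obtain y0 where y0: "y0 \<in> ball x \<rho>" "y0 \<in> cball z t" using False by (auto simp: \<rho>_def)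
   have "dist y0 y < 4 * r" using y0(1) \<open>y \<in> Bx\<close> dist_triangle[of y0 y x] by (auto simp: Bx_def \<rho>_def dist_commute)
   then show "y \<in> V" using d0(2)[OF y0(2), of y] r e0 by force
  qed
  have pt: "ennreal \<bar>f y - f w\<bar> <= ennreal \<bar>U y - U w\<bar> + ennreal (2 * \<rho> * B) * (ennreal \<bar>U w\<bar> + ennreal \<bar>k\<bar>)" if "y \<in> Bx" "w \<in> Bx" for y w
  proof -
   have d: "norm (y - w) <= 2 * \<rho>" using that dist_triangle[of y w x] by (auto simp: Bx_def dist_norm norm_minus_commute)
   have "f y - f w = \<eta> y * (max (U y - k) 0 - max (U w - k) 0) + max (U w - k) 0 * (\<eta> y - \<eta> w)"
    by (simp add: f_def algebra_simps)
   then have "\<bar>f y - f w\<bar> <= \<bar>\<eta> y\<bar> * \<bar>max (U y - k) 0 - max (U w - k) 0\<bar> + \<bar>max (U w - k) 0\<bar> * \<bar>\<eta> y - \<eta> w\<bar>"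
    by (metis abs_mult abs_triangle_ineq)
   also have "... <= 1 * \<bar>U y - U w\<bar> + (\<bar>U w\<bar> + \<bar>k\<bar>) * (B * (2 * \<rho>))"
   proof (intro add_mono mult_mono)
    show "\<bar>\<eta> y - \<eta> w\<bar> <= B * (2 * \<rho>)" using B(2)[of y w] mult_left_mono[OF d B(1)] by linarith
   qed (use e(2,3)[of y] in auto)
   finally have "\<bar>f y - f w\<bar> <= \<bar>U y - U w\<bar> + (2 * \<rho> * B) * (\<bar>U w\<bar> + \<bar>k\<bar>)" by (simp add: mult_ac)
   then have "ennreal \<bar>f y - f w\<bar> <= ennreal (\<bar>U y - U w\<bar> + (2 * \<rho> * B) * (\<bar>U w\<bar> + \<bar>k\<bar>))" by (rule ennreal_leI)
   also have "... = ennreal \<bar>U y - U w\<bar> + ennreal (2 * \<rho> * B) * (ennreal \<bar>U w\<bar> + ennreal \<bar>k\<bar>)"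
    using \<rho> B(1) by (simp add: ennreal_mult)
   finally show ?thesis .
  qed
  have "dosc f Bx <=
   NB (%w. (iB Bx (%y. \<bar>U y - U w\<bar>)) * indicator Bx w + ennreal (2 * \<rho> * B * m) * (ennreal \<bar>U w\<bar> * indicator Bx w + ennreal \<bar>k\<bar> * indicator Bx w))"
  proof (rule nn_integral_mono)
   fix w
   show "iB Bx (%y. \<bar>f y - f w\<bar>) * indicator Bx w <=
    iB Bx (%y. \<bar>U y - U w\<bar>) * indicator Bx w + ennreal (2 * \<rho> * B * m) * (ennreal \<bar>U w\<bar> * indicator Bx w + ennreal \<bar>k\<bar> * indicator Bx w)"
   proof (cases "w \<in> Bx")
    case w: True
    have "iB Bx (%y. \<bar>f y - f w\<bar>) <= NB (%y. ennreal \<bar>U y - U w\<bar> * indicator Bx y + (ennreal (2 * \<rho> * B) * (ennreal \<bar>U w\<bar> + ennreal \<bar>k\<bar>)) * indicator Bx y)"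
    proof (rule nn_integral_mono, goal_cases)
     case (1 y)
     show ?case
      using pt[OF _ w, of y] by (cases "y \<in> Bx") auto
    qed
    also have "... = iB Bx (%y. \<bar>U y - U w\<bar>) + (ennreal (2 * \<rho> * B) * (ennreal \<bar>U w\<bar> + ennreal \<bar>k\<bar>)) * ennreal m"
     by (subst nn_integral_add) (auto simp: nn_integral_cmult eB)
    also have "(ennreal (2 * \<rho> * B) * (ennreal \<bar>U w\<bar> + ennreal \<bar>k\<bar>)) * ennreal m = ennreal (2 * \<rho> * B * m) * (ennreal \<bar>U w\<bar> + ennreal \<bar>k\<bar>)"
    proof -
     have "ennreal (2 * \<rho> * B * m) = ennreal (2 * \<rho> * B) * ennreal m"
      by (rule ennreal_mult) (use \<rho> B(1) in \<open>auto simp: m_def\<close>)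
     then show ?thesis by (simp only: mult_ac)
    qed
    finally show ?thesis using w by simp
   qed simp
  qed
  also have "... = dosc U Bx + ennreal (2 * \<rho> * B * m) * (iB Bx (%w. \<bar>U w\<bar>) + ennreal \<bar>k\<bar> * ennreal m)"
   by (simp add: nn_integral_add nn_integral_cmult eB)
  also have "... <= ennreal (K\<^sub>1 * \<rho> powr (1 - \<gamma>) * m\<^sup>2) + ennreal (2 * \<rho> * B * m) * (ennreal (K\<^sub>1 * \<rho> powr (- \<gamma>) * m) + ennreal \<bar>k\<bar> * ennreal m)"
   unfolding m_def Bx_def \<gamma>_def
   by (intro add_mono mult_left_mono osc1[OF \<rho>(1,2)] avg1[OF \<rho>(1,2)] order_refl) (use BV in \<open>auto simp: Bx_def\<close>)
  also have "... = ennreal (K\<^sub>1 * \<rho> powr (1 - \<gamma>) * m\<^sup>2 + (2 * \<rho> * B * m) * (K\<^sub>1 * \<rho> powr (- \<gamma>) * m + \<bar>k\<bar> * m))"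
   using K1 \<rho> B(1) by (simp add: ennreal_mult m_def)
  also have "... <= ennreal (N * \<rho> powr (1 - \<gamma>) * m\<^sup>2)"
  proof (rule ennreal_leI)
   have 1: "\<rho> * \<rho> powr (- \<gamma>) = \<rho> powr (1 - \<gamma>)" using \<rho> by (simp add: powr_diff powr_minus field_simps)
   have "1 <= \<rho> powr (- \<gamma>)" using \<rho> \<gamma> powr_mono'[of "- \<gamma>" 0 \<rho>] by simp
   then have 2: "\<rho> * \<bar>k\<bar> <= \<rho> powr (1 - \<gamma>) * \<bar>k\<bar>" using \<rho> by (simp flip: 1 add: mult_right_mono)
   have "(2 * \<rho> * B * m) * (K\<^sub>1 * \<rho> powr (- \<gamma>) * m + \<bar>k\<bar> * m) = 2 * B * m\<^sup>2 * (K\<^sub>1 * (\<rho> * \<rho> powr (- \<gamma>)) + \<rho> * \<bar>k\<bar>)"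
    by (simp add: power2_eq_square algebra_simps)
   also have "... <= 2 * B * m\<^sup>2 * (K\<^sub>1 * \<rho> powr (1 - \<gamma>) + \<rho> powr (1 - \<gamma>) * \<bar>k\<bar>)"
    unfolding 1 using B(1) by (intro mult_left_mono add_left_mono 2) auto
   finally show "K\<^sub>1 * \<rho> powr (1 - \<gamma>) * m\<^sup>2 + (2 * \<rho> * B * m) * (K\<^sub>1 * \<rho> powr (- \<gamma>) * m + \<bar>k\<bar> * m) <= N * \<rho> powr (1 - \<gamma>) * m\<^sup>2"
    by (simp add: N_def algebra_simps)
  qed
  finally show ?thesis by (simp add: Bx_def m_def \<rho>_def)
 qed
 define c1 where "c1 = grad_const TYPE('a) * unit_ball_vol (real DIM('a)) * 2 ^ DIM('a)"
 have c1: "c1 \<ge> 0" using grad_const(1)[where 'a='a] by (simp add: c1_def)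
 define M where "M = max 1 (c1 * N * 2 powr (1 - \<gamma>))"
 have "norm (conv (kern r) g x) <= M * r powr (- \<gamma>)" if r: "0 < r" "r <= e0" for r x
 proof -
  have "norm (conv (kern r) g x) <= c1 / r * (N * (2 * r) powr (1 - \<gamma>))"
   unfolding c1_def by (rule conv_grad_osc[OF w[folded f_def] r(1) _ osc[OF r]]) (use N in simp)
  also have "(2 * r) powr (1 - \<gamma>) = 2 powr (1 - \<gamma>) * (r * r powr (- \<gamma>))"
   using r by (simp add: powr_mult powr_diff powr_minus field_simps)
  also have "c1 / r * (N * (2 powr (1 - \<gamma>) * (r * r powr (- \<gamma>)))) = (c1 * N * 2 powr (1 - \<gamma>)) * r powr (- \<gamma>)"
   using r by simp
  also have "... <= M * r powr (- \<gamma>)" by (intro mult_right_mono) (auto simp: M_def)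
  finally show ?thesis .
 qed
 then show ?thesis using e0(1) unfolding \<gamma>_def by (intro exI[of _ M] exI[of _ e0]) (auto simp: M_def)
qed

definition fill_const :: real where "fill_const = Q * D2"
definition cut_pow :: real where "cut_pow = L * (max 1 (cut_const TYPE('a))) powr q"

lemma fill_const_ge1: "1 <= fill_const"
 using mult_mono[of 1 Q 1 D2] Q1 D2_ge1 by (simp add: fill_const_def)

lemma cut_pow_ge1: "1 <= cut_pow"
proof -
 have "1 <= (max 1 (cut_const TYPE('a))) powr q" using p1 pq by (intro ge_one_powr_ge_zero) auto
 then show ?thesis using mult_mono[of 1 L 1 "(max 1 (cut_const TYPE('a))) powr q"] L1 by (simp add: cut_pow_def)
qed

lemma lev_subset: "lev z t k \<subseteq> ball z t" "t <= t' ==> lev z t k \<subseteq> lev z t' k"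
 by (auto simp: lev_def)

text \<open>Where the cut-off is 1, the competitor U - f equals \<open>k\<close> on the level set
  and has no energy. So the energy of the competitor consists of the energy on the outer shell and
  the term with the gradient of the cut-off.\<close>

lemma caccioppoli_step:
 assumes t: "0 < t" "t < t'" and c: "cball z t' \<subseteq> V"
 shows "ennreal (1 + fill_const) * phL (lev z t k) G <=
  ennreal fill_const * phL (lev z t' k) G +
  ennreal (fill_const * cut_pow) * phU (lev z t' k) k (t' - t)"
proof -
 define \<delta> where "\<delta> = t' - t"
 have \<delta>: "\<delta> > 0" using t by (simp add: \<delta>_def)
 obtain \<eta> D\<eta> where e: "smooth_fun \<eta>" "C1c \<eta> D\<eta>" "!!x. 0 <= \<eta> x" "!!x. \<eta> x <= 1"
  "!!x. dist z x <= t ==> \<eta> x = 1" "!!x. dist z x \<ge> t' ==> \<eta> x = 0"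
  "!!x. norm (D\<eta> x) <= cut_const TYPE('a) / (t' - t)"
  by (rule ball_cutoff[OF t, of z], rule that)
 define f where "f x = \<eta> x * max (U x - k) 0" for x
 define g where "g x = (if f x > 0 then \<eta> x *\<^sub>R G x + (U x - k) *\<^sub>R D\<eta> x else 0)" for x
 have w: "W f g" unfolding f_def[abs_def] g_def[abs_def] by (rule W_cutoff_pos_part[OF UG e(2,3)])
 define \<psi> where "\<psi> x = ph x ((U x - k) / \<delta>)" for x
 have cD: "ph x (norm ((U x - k) *\<^sub>R D\<eta> x)) <= cut_pow * \<psi> x" for x
  unfolding cut_pow_def \<psi>_def
 proof (rule ph_dec_bound)
  have "norm (D\<eta> x) <= max 1 (cut_const TYPE('a)) / \<delta>"
   using e(7)[of x] divide_right_mono[of "cut_const TYPE('a)" "max 1 (cut_const TYPE('a))" \<delta>] \<delta> by (simp add: \<delta>_def)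
  then have "\<bar>U x - k\<bar> * norm (D\<eta> x) <= \<bar>U x - k\<bar> * (max 1 (cut_const TYPE('a)) / \<delta>)" by (rule mult_left_mono) simp
  then show "\<bar>norm ((U x - k) *\<^sub>R D\<eta> x)\<bar> <= max 1 (cut_const TYPE('a)) * \<bar>(U x - k) / \<delta>\<bar>"
   using \<delta> by (simp add: mult.commute)
 qed simp
 have scl: "ph x (norm (c *\<^sub>R G x)) <= ph x (norm (G x))" if "0 <= c" "c <= 1" for c x
  by (rule ph_mono) (use that in \<open>simp add: mult_left_le_one_le\<close>)
 have f0: "0 <= f x" for x using e(3)[of x] by (simp add: f_def)
 have fpos: "x \<in> lev z t' k" if "f x > 0" for x
 proof -
  have "\<eta> x \<noteq> 0" "U x > k" using that by (auto simp: f_def max_def split: if_splits)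
  then show ?thesis using e(6)[of x] by (auto simp: lev_def not_le[symmetric])
 qed
 have posf: "f x > 0" if "x \<in> lev z t k" for x using that e(5)[of x] by (auto simp: lev_def f_def)
 have mG: "(%x. ennreal (ph x (norm (G x))) * indicator (lev z t'' k) x) \<in> borel_measurable lebesgue" for t''
  by (rule lebesgue_indicator_measurable[OF phG_measurable lev_measurable])
 have m\<psi>: "(%x. ennreal (\<psi> x) * indicator (lev z t' k) x) \<in> borel_measurable lebesgue"
  unfolding \<psi>_def by (rule lebesgue_indicator_measurable[OF phU_measurable lev_measurable])
 have lV: "lev z t' k \<subseteq> V" using lev_subset(1) c by fastforce
 have bl: "bounded (lev z t' k)" by (rule bounded_subset[OF bounded_ball lev_subset(1)])
 have fin\<psi>: "iL (lev z t' k) (%x. \<psi> x) < \<infinity>"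
  unfolding \<psi>_def by (rule phU_finite[OF bl lV lev_measurable \<delta>])
 have fin: "IL (%x. ph x (norm (g x))) < \<infinity>"
 proof -
  have "IL (%x. ph x (norm (g x))) <=
   NL (%x. ennreal D2 * (ennreal (ph x (norm (G x))) * indicator (lev z t' k) x) + ennreal (D2 * cut_pow) * (ennreal (\<psi> x) * indicator (lev z t' k) x))"
  proof (rule nn_integral_mono, goal_cases)
   case (1 x)
   show ?case
   proof (cases "f x > 0")
    case True
    have "ph x (norm (g x)) <= D2 * (ph x (norm (\<eta> x *\<^sub>R G x)) + ph x (norm ((U x - k) *\<^sub>R D\<eta> x)))"
     using True by (simp add: g_def D2_def ph_norm_add del: norm_scaleR)
    also have "... <= D2 * (ph x (norm (G x)) + cut_pow * \<psi> x)"
     using D2_ge1 by (intro mult_left_mono add_mono scl e cD) auto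
    also have "... = D2 * ph x (norm (G x)) + (D2 * cut_pow) * \<psi> x" by (simp add: algebra_simps)
    finally have "ennreal (ph x (norm (g x))) <= ennreal (D2 * ph x (norm (G x)) + (D2 * cut_pow) * \<psi> x)" by (rule ennreal_leI)
    also have "... = ennreal D2 * ennreal (ph x (norm (G x))) + ennreal (D2 * cut_pow) * ennreal (\<psi> x)"
     using D2_ge1 cut_pow_ge1 by (simp add: ennreal_mult \<psi>_def)
    finally show ?thesis using fpos[OF True] by simp
   qed (simp add: g_def)
  qed
  also have "... = ennreal D2 * phL (lev z t' k) G + ennreal (D2 * cut_pow) * iL (lev z t' k) (%x. \<psi> x)"
   using mG m\<psi> by (simp add: nn_integral_add nn_integral_cmult)
  also have "... < \<infinity>" using fin\<psi> energy_finite[OF lV] by (simp add: ennreal_add_less_top ennreal_mult_less_top)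
  finally show ?thesis .
 qed
 obtain M e0 where M: "1 <= M" "0 < e0" "\<forall>e x. 0 < e \<and> e <= e0 --> norm (conv (kern e) g x) <= M * e powr (- (real DIM('a) / s))"
  using cutoff_kernel_bound[OF c _ e(2,3,4,6) w[unfolded f_def[abs_def]]] t by auto
 have qo: "iL {x. f x > 0} (%x. ph x (norm (G x)))
  <= ennreal Q * iL {x. f x > 0} (%x. ph x (norm (G x - g x)))"
 proof (rule quasimin_positivity_set[OF w f0 compact_cball c _ _ fin M(1,2)])
  show "x \<notin> cball z t' ==> f x = 0" for x using e(6)[of x] by (simp add: f_def)
  show "f x = 0 ==> g x = 0" for x by (simp add: g_def)
  show "0 < e ==> e <= e0 ==> norm (conv (kern e) g x) <= M * e powr (- (real DIM('a) / s))" for e x using M(3) by blast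
 qed
 define a where "a t'' = phL (lev z t'' k) G" for t''
 define b where "b = phL (lev z t' k - lev z t k) G"
 define Y where "Y = iL (lev z t' k) (%x. \<psi> x)"
 have mb: "(%x. ennreal (ph x (norm (G x))) * indicator (lev z t' k - lev z t k) x) \<in> borel_measurable lebesgue"
  by (rule lebesgue_indicator_measurable[OF phG_measurable]) (intro sets.Diff lev_measurable)
 have split: "b + a t = a t'"
  unfolding a_def b_def
  by (subst nn_integral_add[symmetric, OF mb mG], rule nn_integral_cong)
   (use lev_subset(2)[of t t' z k] t in \<open>auto simp: indicator_def\<close>)
 have "a t <= iL {x. f x > 0} (%x. ph x (norm (G x)))"
  unfolding a_def by (rule nn_integral_mono) (use posf in \<open>auto simp: indicator_def\<close>)
 also note qo
 also have "iL {x. f x > 0} (%x. ph x (norm (G x - g x))) <=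
  NL (%x. ennreal D2 * (ennreal (ph x (norm (G x))) * indicator (lev z t' k - lev z t k) x) + ennreal (D2 * cut_pow) * (ennreal (\<psi> x) * indicator (lev z t' k) x))"
 proof (rule nn_integral_mono)
  fix x
  show "ennreal (ph x (norm (G x - g x))) * indicator {x. f x > 0} x <=
   ennreal D2 * (ennreal (ph x (norm (G x))) * indicator (lev z t' k - lev z t k) x) + ennreal (D2 * cut_pow) * (ennreal (\<psi> x) * indicator (lev z t' k) x)"
  proof (cases "f x > 0")
   case True
   have ggx: "G x - g x = (1 - \<eta> x) *\<^sub>R G x - (U x - k) *\<^sub>R D\<eta> x" using True by (simp add: g_def algebra_simps)
   have "ph x (norm (G x - g x)) <= D2 * (ph x (norm ((1 - \<eta> x) *\<^sub>R G x)) + ph x (norm ((U x - k) *\<^sub>R D\<eta> x)))"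
    unfolding ggx D2_def by (rule ph_norm_diff)
   also have "... <= D2 * (ph x (norm (G x)) * indicator (- lev z t k) x + cut_pow * \<psi> x)"
   proof (intro mult_left_mono add_mono cD)
    show "ph x (norm ((1 - \<eta> x) *\<^sub>R G x)) <= ph x (norm (G x)) * indicator (- lev z t k) x"
    proof (cases "x \<in> lev z t k")
     case True
     then show ?thesis using e(5)[of x] by (simp add: lev_def)
    next
     case False
     then show ?thesis using scl[of "1 - \<eta> x" x] e(3,4)[of x] by (simp del: norm_scaleR)
    qed
   qed (use D2_ge1 in auto)
   also have "... = D2 * (ph x (norm (G x)) * indicator (- lev z t k) x) + (D2 * cut_pow) * \<psi> x" by (simp add: algebra_simps)
   finally have "ennreal (ph x (norm (G x - g x))) <= ennreal (D2 * (ph x (norm (G x)) * indicator (- lev z t k) x) + (D2 * cut_pow) * \<psi> x)" by (rule ennreal_leI)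
   also have "... = ennreal D2 * ennreal (ph x (norm (G x)) * indicator (- lev z t k) x) + ennreal (D2 * cut_pow) * ennreal (\<psi> x)"
    using D2_ge1 cut_pow_ge1 by (simp add: ennreal_mult \<psi>_def)
   finally show ?thesis using True fpos[OF True] by (cases "x \<in> lev z t k") auto
  qed simp
 qed
 also have "... = ennreal D2 * b + ennreal (D2 * cut_pow) * Y"
  using mb m\<psi> unfolding b_def Y_def by (simp add: nn_integral_add nn_integral_cmult)
 finally have 1: "a t <= ennreal Q * (ennreal D2 * b + ennreal (D2 * cut_pow) * Y)" by (simp add: mult_left_mono)
 have "ennreal Q * (ennreal D2 * b + ennreal (D2 * cut_pow) * Y) = ennreal fill_const * b + ennreal (fill_const * cut_pow) * Y"
  using Q1 D2_ge1 cut_pow_ge1 by (simp add: fill_const_def ennreal_mult distrib_left mult_ac)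
 with 1 have "a t <= ennreal fill_const * b + ennreal (fill_const * cut_pow) * Y" by simp
 \<comment> \<open>Hole filling: the shell energy \<open>b\<close> together with the added inner
   energy makes up the energy on the larger ball.\<close>
 then have "a t + ennreal fill_const * a t <= ennreal fill_const * b + ennreal (fill_const * cut_pow) * Y + ennreal fill_const * a t"
  by (rule add_right_mono)
 also have "... = ennreal fill_const * (b + a t) + ennreal (fill_const * cut_pow) * Y" by (simp add: distrib_left add_ac)
 also have "a t + ennreal fill_const * a t = ennreal (1 + fill_const) * a t"
  using fill_const_ge1 by (simp add: distrib_right)
 finally show ?thesis unfolding split by (simp add: a_def Y_def \<psi>_def \<delta>_def)
qed

definition hole_ratio :: real where "hole_ratio = fill_const / (1 + fill_const)"
text \<open>Chosen so that its q-th power is the square root of \<open>hole_ratio\<close>: if the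
  gaps of the radii shrink with this ratio, the cost grows like \<theta>^(-i/2), and the
  hole-filling factor \<theta>^i wins.\<close>

definition radius_ratio :: real where "radius_ratio = hole_ratio powr (1 / (2 * q))"
definition cac_const :: real where
 "cac_const = cut_pow * L * (1 - radius_ratio) powr (- q) / (1 - sqrt hole_ratio)"

lemma hole_ratio: "0 < hole_ratio" "hole_ratio < 1"
 using fill_const_ge1 by (auto simp: hole_ratio_def)

lemma radius_ratio: "0 < radius_ratio" "radius_ratio < 1" "radius_ratio powr q = sqrt hole_ratio"
proof -
 have q: "q > 0" using p1 pq by simp
 show "0 < radius_ratio" using hole_ratio by (simp add: radius_ratio_def)
 show "radius_ratio < 1" using powr_less_mono2[of "1 / (2 * q)" hole_ratio 1] hole_ratio q by (simp add: radius_ratio_def)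
 show "radius_ratio powr q = sqrt hole_ratio" using hole_ratio q by (simp add: radius_ratio_def powr_powr powr_half_sqrt)
qed

lemma cac_const_nonneg: "0 <= cac_const"
 using cut_pow_ge1 L1 hole_ratio by (simp add: cac_const_def)

lemma caccioppoli:
 assumes t: "0 < \<rho>" "\<rho> < R" and c: "cball z R \<subseteq> V"
 shows "phL (lev z \<rho> k) G <=
  ennreal cac_const * phU (lev z R k) k (R - \<rho>)"
proof -
 define \<kappa> \<mu> \<theta> where "\<kappa> = radius_ratio" and "\<mu> = sqrt hole_ratio" and "\<theta> = hole_ratio"
 have l: "0 < \<kappa>" "\<kappa> < 1" "\<kappa> powr q = \<mu>" using radius_ratio by (auto simp: \<kappa>_def \<mu>_def)
 have m: "0 < \<mu>" "\<mu> < 1" "\<mu> * \<mu> = \<theta>" using hole_ratio by (auto simp: \<mu>_def \<theta>_def)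
 define a where "a t = enn2real (phL (lev z t k) G)" for t
 have lV: "lev z t k \<subseteq> V" if "t <= R" for t using lev_subset(1)[of z t k] c that by fastforce
 have ea: "phL (lev z t k) G = ennreal (a t)" if "t <= R" for t
  unfolding a_def using energy_finite[OF lV[OF that]] by simp
 have a0: "0 <= a t" for t by (simp add: a_def)
 have aR: "a t <= a R" if "t <= R" for t
 proof -
  have "ennreal (a t) <= ennreal (a R)"
   unfolding ea[OF that, symmetric] ea[OF order_refl, symmetric]
   by (rule nn_integral_mono) (use lev_subset(2)[OF that, of z k] in \<open>auto simp: indicator_def\<close>)
  then show ?thesis using a0 by simp
 qed
 define D where "D = enn2real (phU (lev z R k) k (R - \<rho>))"
 have bl: "bounded (lev z t k)" for t by (rule bounded_subset[OF bounded_ball lev_subset(1)])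
 have eD: "phU (lev z R k) k (R - \<rho>) = ennreal D"
  unfolding D_def using phU_finite[OF bl lV[OF order_refl] lev_measurable, of "R - \<rho>" k] t by simp
 have D0: "0 <= D" by (simp add: D_def)
 \<comment> \<open>\<open>T 0 = \<rho>\<close>, the radii increase towards \<open>R\<close>, and the
   gaps are geometric with ratio \<open>\<kappa>\<close>.\<close>
 define T where "T i = R - (R - \<rho>) * \<kappa> ^ i" for i :: nat
 have li: "0 < \<kappa> ^ i" "\<kappa> ^ i <= 1" for i using l by (auto simp: power_le_one)
 have T: "0 < T i" "T i < R" "T i < T (Suc i)" "T (Suc i) - T i = (R - \<rho>) * ((1 - \<kappa>) * \<kappa> ^ i)" for i
 proof -
  have "(R - \<rho>) * \<kappa> ^ i <= (R - \<rho>) * 1" using t li[of i] by (intro mult_left_mono) auto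
  also have "(R - \<rho>) * 1 < R" using t by simp
  finally show "0 < T i" by (simp add: T_def)
  show "T i < R" using t li[of i] by (simp add: T_def)
  show e: "T (Suc i) - T i = (R - \<rho>) * ((1 - \<kappa>) * \<kappa> ^ i)" by (simp add: T_def algebra_simps)
  have "0 < (R - \<rho>) * ((1 - \<kappa>) * \<kappa> ^ i)" using t l li[of i] by (intro mult_pos_pos) auto
  then show "T i < T (Suc i)" using e by simp
 qed
 define s1 where "s1 = cut_pow * L * (1 - \<kappa>) powr (- q)"
 have s10: "0 <= s1" using cut_pow_ge1 L1 by (simp add: s1_def)
 have step: "a (T i) <= \<theta> * a (T (Suc i)) + s1 / \<mu> ^ i * D" for i
 proof -
  define X where "X = L * ((1 - \<kappa>) * \<kappa> ^ i) powr (- q) * D"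
  have X0: "0 <= X" using L1 D0 by (simp add: X_def)
  have cT: "cball z (T (Suc i)) \<subseteq> V" using T(2)[of "Suc i"] c by (meson less_imp_le order_trans subset_cball)
  have "iL (lev z (T (Suc i)) k) (%x. ph x ((U x - k) / (T (Suc i) - T i))) <=
   NL (%x. ennreal (L * ((1 - \<kappa>) * \<kappa> ^ i) powr (- q)) * (ennreal (ph x ((U x - k) / (R - \<rho>))) * indicator (lev z R k) x))"
  proof (rule nn_integral_mono)
   fix x
   define c where "c = 1 / ((1 - \<kappa>) * \<kappa> ^ i)"
   have "(1 - \<kappa>) * \<kappa> ^ i <= 1 * 1" using l li[of i] by (intro mult_mono) auto
   then have c: "1 <= c" using l li[of i] by (simp add: c_def)
   have "ph x ((U x - k) / (T (Suc i) - T i)) = ph x (c * ((U x - k) / (R - \<rho>)))"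
    by (simp add: T(4) c_def mult.commute)
   also have "... <= L * c powr q * ph x ((U x - k) / (R - \<rho>))" by (rule ph_dec[OF c])
   also have "c powr q = ((1 - \<kappa>) * \<kappa> ^ i) powr (- q)"
   proof -
    have "c powr q = 1 powr q / ((1 - \<kappa>) * \<kappa> ^ i) powr q"
     unfolding c_def by (rule powr_divide)
    then show ?thesis by (simp add: powr_minus divide_inverse)
   qed
   finally have "ennreal (ph x ((U x - k) / (T (Suc i) - T i))) <= ennreal (L * ((1 - \<kappa>) * \<kappa> ^ i) powr (- q)) * ennreal (ph x ((U x - k) / (R - \<rho>)))"
    using L1 by (simp flip: ennreal_mult add: ennreal_leI)
   then show "ennreal (ph x ((U x - k) / (T (Suc i) - T i))) * indicator (lev z (T (Suc i)) k) x <=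
    ennreal (L * ((1 - \<kappa>) * \<kappa> ^ i) powr (- q)) * (ennreal (ph x ((U x - k) / (R - \<rho>))) * indicator (lev z R k) x)"
    using lev_subset(2)[of "T (Suc i)" R z k] T(2)[of "Suc i"] by (auto simp: indicator_def)
  qed
  also have "... = ennreal (L * ((1 - \<kappa>) * \<kappa> ^ i) powr (- q)) * ennreal D"
   unfolding eD[symmetric] by (rule nn_integral_cmult[OF lebesgue_indicator_measurable[OF phU_measurable lev_measurable]])
  also have "... = ennreal X" unfolding X_def using L1 D0 by (intro ennreal_mult[symmetric]) auto
  finally have Y: "iL (lev z (T (Suc i)) k) (%x. ph x ((U x - k) / (T (Suc i) - T i))) <= ennreal X" .
  have C: "fill_const \<ge> 1" "cut_pow \<ge> 1" using fill_const_ge1 cut_pow_ge1 by auto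
  have "ennreal ((1 + fill_const) * a (T i)) = ennreal (1 + fill_const) * ennreal (a (T i))"
   using C a0 by (intro ennreal_mult) auto
  also have "... <= ennreal fill_const * ennreal (a (T (Suc i))) + ennreal (fill_const * cut_pow) * ennreal X"
   using caccioppoli_step[OF T(1,3) cT, of k] Y unfolding ea[OF less_imp_le[OF T(2)]]
   by (meson add_left_mono mult_left_mono order_trans zero_le)
  also have "... = ennreal (fill_const * a (T (Suc i)) + fill_const * cut_pow * X)"
   using C a0 X0 by (simp add: ennreal_mult)
  finally have "(1 + fill_const) * a (T i) <= fill_const * a (T (Suc i)) + fill_const * cut_pow * X"
   using C a0 X0 by (subst (asm) ennreal_le_iff) auto
  then have "a (T i) <= (fill_const * a (T (Suc i)) + fill_const * cut_pow * X) / (1 + fill_const)"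
   using C by (simp add: field_simps)
  also have "... = \<theta> * a (T (Suc i)) + \<theta> * (cut_pow * X)" by (simp add: \<theta>_def hole_ratio_def add_divide_distrib)
  also have "\<theta> * (cut_pow * X) <= 1 * (cut_pow * X)" using hole_ratio C X0 by (intro mult_right_mono) (auto simp: \<theta>_def)
  also have "1 * (cut_pow * X) = s1 / \<mu> ^ i * D"
  proof -
   have "(\<kappa> ^ i) powr (- q) = 1 / \<mu> ^ i"
   proof -
    have "(\<kappa> ^ i) powr q = (\<kappa> powr q) ^ i" using l(1) by (simp add: powr_powr mult.commute flip: powr_realpow)
    then show ?thesis by (simp add: powr_minus l(3) divide_inverse)
   qed
   then show ?thesis using l li[of i] by (simp add: X_def s1_def powr_mult)
  qed
  finally show ?thesis by simp
 qed
 define S where "S = s1 / (1 - \<mu>)"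
 \<comment> \<open>The coefficient telescopes: step \<open>N\<close> adds
   \<open>S * (\<mu> ^ N - \<mu> ^ Suc N)\<close>.\<close>
 have ind: "a \<rho> <= \<theta> ^ N * a (T N) + S * (1 - \<mu> ^ N) * D" for N
 proof (induction N)
  case 0
  then show ?case by (simp add: T_def)
 next
  case (Suc N)
  have "\<theta> ^ N * a (T N) <= \<theta> ^ N * (\<theta> * a (T (Suc N)) + s1 / \<mu> ^ N * D)"
   using hole_ratio by (intro mult_left_mono step) (auto simp: \<theta>_def)
  also have "... = \<theta> ^ Suc N * a (T (Suc N)) + \<mu> ^ N * s1 * D"
   using m(1) by (simp add: m(3)[symmetric] power_mult_distrib field_simps)
  also have "\<mu> ^ N * s1 * D = S * (\<mu> ^ N - \<mu> ^ Suc N) * D" using m by (simp add: S_def field_simps)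
  finally show ?case using Suc by (simp add: algebra_simps)
 qed
 have "a \<rho> <= \<theta> ^ N * a R + S * D" for N
 proof -
  have "\<theta> ^ N * a (T N) <= \<theta> ^ N * a R" using hole_ratio aR[of "T N"] T(2)[of N] by (intro mult_left_mono) (auto simp: \<theta>_def)
  moreover have "S * (1 - \<mu> ^ N) * D <= S * 1 * D" using m s10 D0 by (intro mult_right_mono mult_left_mono) (auto simp: S_def)
  ultimately show ?thesis using ind[of N] by simp
 qed
 moreover have "(%N. \<theta> ^ N * a R + S * D) \<longlonglongrightarrow> 0 * a R + S * D"
  using hole_ratio by (intro tendsto_intros LIMSEQ_realpow_zero) (auto simp: \<theta>_def)
 ultimately have "a \<rho> <= 0 * a R + S * D" by (intro LIMSEQ_le_const) auto
 then have "a \<rho> <= cac_const * D" by (simp add: S_def s1_def cac_const_def \<kappa>_def \<mu>_def)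
 then show ?thesis using cac_const_nonneg D0 t unfolding eD ea[OF less_imp_le[OF t(2)]]
  by (simp flip: ennreal_mult add: ennreal_leI)
qed

end

section \<open>Local boundedness\<close>

lemma ballk_avg_diff:
 fixes f :: "'a::euclidean_space => real"
 assumes f: "integrable lborel f" and r: "0 < r"
 shows "ennreal (\<bar>conv (ballk r) f x - c\<bar> * vol (ball x r)) <= iB (ball x r) (%y. \<bar>f y - c\<bar>)"
proof -
 define m where "m = vol (ball (0::'a) r)"
 have m: "m > 0" using r by (simp add: m_def content_ball_pos)
 have [measurable]: "f \<in> borel_measurable borel" using f by auto
 have i1: "integrable lborel (%y. indicator (ball x r) y * f y)"
  by (rule Bochner_Integration.integrable_bound[OF f]) (auto simp: indicator_def)
 have i2: "integrable lborel (%y. indicator (ball x r) y * c)"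
  using emeasure_lborel_ball_finite[of x r] by (auto simp: integrable_indicator_iff)
 have e: "ballk r (x - y) * f y = (indicator (ball x r) y * f y) / m" for y
  by (auto simp: ballk_def indicator_def dist_norm norm_minus_commute m_def)
 have "conv (ballk r) f x * m = LB (%y. indicator (ball x r) y * f y)"
  using m by (simp add: conv_def e)
 moreover have "c * m = LB (%y. indicator (ball x r) y * c)"
  by (simp add: m_def measure_ball_translate[of x])
 ultimately have "(conv (ballk r) f x - c) * m = LB (%y. indicator (ball x r) y * f y - indicator (ball x r) y * c)"
  using i1 i2 by (simp add: left_diff_distrib)
 then have "ennreal (\<bar>conv (ballk r) f x - c\<bar> * m) = ennreal (norm (LB (%y. indicator (ball x r) y * f y - indicator (ball x r) y * c)))"
  using m by (metis abs_mult abs_of_pos real_norm_def)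
 also have "... <= NB (%y. norm (indicator (ball x r) y * f y - indicator (ball x r) y * c))"
  by (rule integral_norm_bound_ennreal) (use i1 i2 in auto)
 also have "... = iB (ball x r) (%y. \<bar>f y - c\<bar>)"
  by (rule nn_integral_cong) (auto simp: indicator_def)
 finally show ?thesis by (simp add: m_def measure_ball_translate[of x])
qed

lemma emeasure_ball_eq: "emeasure lborel (ball (x::'a::euclidean_space) r) = ennreal (vol (ball x r))"
 using emeasure_lborel_ball_finite[of x r] by (intro emeasure_eq_ennreal_measure) auto

text \<open>Restrict one variable of the double integral to the small ball: for fixed
  \<open>w\<close> the other variable yields the distance of \<open>f w\<close> from the large mean.
  The factor is the ratio of the two volumes.\<close>

lemma ball_avg_halving:
 fixes f :: "'a::euclidean_space => real"
 assumes f: "integrable lborel f" and r: "0 < r" and \<Delta>: "0 <= \<Delta>"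
  and osc: "dosc f (ball x r)
   <= ennreal (\<Delta> * (vol (ball x r))\<^sup>2)"
 shows "\<bar>conv (ballk (r / 2)) f x - conv (ballk r) f x\<bar> <= 2 ^ DIM('a) * \<Delta>"
proof -
 have [measurable]: "f \<in> borel_measurable borel" using f by auto
 define B B' where "B = ball x r" and "B' = ball x (r / 2)"
 define m m' where "m = vol B" and "m' = vol B'"
 have m: "m > 0" "m' > 0" using r by (auto simp: m_def m'_def B_def B'_def content_ball_pos)
 have mm: "m = 2 ^ DIM('a) * m'" using r by (simp add: m_def m'_def B_def B'_def content_ball power_divide)
 have Bm[measurable]: "B \<in> sets borel" "B' \<in> sets borel" by (auto simp: B_def B'_def)
 define a where "a = conv (ballk r) f x"
 have "ennreal (\<bar>conv (ballk (r / 2)) f x - a\<bar> * m' * m) = ennreal m * ennreal (\<bar>conv (ballk (r / 2)) f x - a\<bar> * m')"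
  using m by (simp add: mult.commute flip: ennreal_mult)
 also have "... <= ennreal m * iB B' (%w. \<bar>f w - a\<bar>)"
  unfolding m'_def B'_def by (intro mult_left_mono ballk_avg_diff[OF f]) (use r in auto)
 also have "... = NB (%w. ennreal m * (ennreal \<bar>f w - a\<bar> * indicator B' w))"
  by (rule nn_integral_cmult[symmetric]) measurable
 also have "... <= dosc f B"
 proof (rule nn_integral_mono, goal_cases)
  case (1 w)
  have "ennreal m * ennreal \<bar>f w - a\<bar> = ennreal (\<bar>a - f w\<bar> * m)"
   using m by (simp add: abs_minus_commute mult.commute flip: ennreal_mult)
  also have "... <= iB B (%y. \<bar>f y - f w\<bar>)"
   unfolding m_def B_def a_def by (rule ballk_avg_diff[OF f r])
  finally show ?case
   using r by (auto simp: indicator_def B_def B'_def)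
 qed
 also have "... <= ennreal (\<Delta> * m\<^sup>2)" using osc by (simp add: B_def m_def)
 finally have "\<bar>conv (ballk (r / 2)) f x - a\<bar> * m' * m <= \<Delta> * m\<^sup>2"
  using \<Delta> by (subst (asm) ennreal_le_iff) auto
 then have "\<bar>conv (ballk (r / 2)) f x - a\<bar> * m' * m <= (2 ^ DIM('a) * \<Delta>) * m' * m"
  by (simp add: mm power2_eq_square mult_ac)
 then show ?thesis using m by (simp add: a_def)
qed

text \<open>Restrict one variable of the double integral to the zero set of \<open>f\<close>, which
  fills at least half of the ball; there the inner integral is that of \<open>f\<close>
  itself.\<close>

lemma ball_avg_half_zero:
 fixes f :: "'a::euclidean_space => real"
 assumes f: "integrable lborel f" and f0: "!!y. 0 <= f y" and r: "0 < r" and \<Delta>: "0 <= \<Delta>"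
  and osc: "dosc f (ball x r)
   <= ennreal (\<Delta> * (vol (ball x r))\<^sup>2)"
  and half: "2 * emeasure lborel {y\<in>ball x r. f y \<noteq> 0} <= emeasure lborel (ball x r)"
 shows "conv (ballk r) f x <= 2 * \<Delta>"
proof -
 have [measurable]: "f \<in> borel_measurable borel" using f by auto
 define B where "B = ball x r"
 define m where "m = vol B"
 have m: "m > 0" using r by (auto simp: m_def B_def content_ball_pos)
 have Bm[measurable]: "B \<in> sets borel" by (auto simp: B_def)
 have fz: "{y. f y = 0} \<in> sets borel" by measurable
 define Z N where "Z = B \<inter> {y. f y = 0}" and "N = B - {y. f y = 0}"
 have ZN[measurable]: "Z \<in> sets borel" "N \<in> sets borel" using fz Bm by (auto simp: Z_def N_def)
 have eB: "emeasure lborel B = ennreal m" by (simp add: B_def m_def emeasure_ball_eq)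
 have N: "N = {y\<in>ball x r. f y \<noteq> 0}" by (auto simp: N_def B_def)
 have sub: "emeasure lborel Z <= emeasure lborel B" "emeasure lborel N <= emeasure lborel B"
  by (intro emeasure_mono; auto simp: Z_def N_def)+
 obtain mz where mz: "emeasure lborel Z = ennreal mz" "0 <= mz" using sub(1) eB by (metis ennreal_cases ennreal_less_top leD less_top top.extremum_strict)
 obtain mn where mn: "emeasure lborel N = ennreal mn" "0 <= mn" using sub(2) eB by (metis ennreal_cases ennreal_less_top leD less_top top.extremum_strict)
 have "emeasure lborel Z + emeasure lborel N = emeasure lborel (Z \<union> N)"
  by (rule plus_emeasure) (auto simp: Z_def N_def)
 also have "Z \<union> N = B" by (auto simp: Z_def N_def)
 finally have s: "mz + mn = m" using mz mn m unfolding eB by (simp flip: ennreal_plus)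
 have "2 * ennreal mn <= ennreal m" using half mn unfolding N[symmetric] eB[symmetric] B_def by simp
 then have "2 * mn <= m" using mn m by (simp add: ennreal_mult''[of mn 2, symmetric] ennreal_mult'[of 2 mn, symmetric] flip: ennreal_numeral)
 then have mz2: "m <= 2 * mz" using s by simp
 define a where "a = conv (ballk r) f x"
 have a0: "0 <= a" unfolding a_def by (rule ballk_avg(2)[OF f f0 r])
 have "ennreal (mz * (a * m)) = NB (%w. ennreal (a * m) * indicator Z w)"
 proof -
  have "NB (%w. ennreal (a * m) * indicator Z w) = ennreal (a * m) * emeasure lborel Z"
   by (rule nn_integral_cmult_indicator) simp
  also have "... = ennreal (a * m * mz)" unfolding mz using a0 m mz(2) by (intro ennreal_mult[symmetric]) auto
  finally show ?thesis by (simp only: mult.commute)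
 qed
 also have "... <= dosc f B"
 proof (rule nn_integral_mono, goal_cases)
  case (1 w)
  show ?case
  proof (cases "w \<in> Z")
   case True
   then have "f w = 0" "w \<in> B" by (auto simp: Z_def)
   then show ?thesis using ballk_avg_diff[OF f r, of x 0] a0 True by (simp add: a_def m_def B_def)
  qed simp
 qed
 also have "... <= ennreal (\<Delta> * m\<^sup>2)" using osc by (simp add: B_def m_def)
 finally have "mz * (a * m) <= \<Delta> * m\<^sup>2" using \<Delta> by (subst (asm) ennreal_le_iff) auto
 then have "mz * a <= \<Delta> * m" using m by (simp add: power2_eq_square)
 then have "2 * (mz * a) <= 2 * (\<Delta> * m)" by simp
 moreover have "m * a <= 2 * mz * a" using mz2 a0 by (rule mult_right_mono)
 ultimately have "m * a <= m * (2 * \<Delta>)" by (simp only: mult_ac)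
 then show ?thesis using m by (simp add: a_def)
qed

text \<open>Symmetry of \<open>dist x y < r\<close> and Fubini. In \<open>level_poincare\<close>
  this gives every scale of averaging the same total energy.\<close>

lemma nn_integral_conv_ballk:
 fixes P :: "'a::euclidean_space => real"
 assumes P: "integrable lborel P" "!!y. 0 <= P y" and r: "0 < r"
 shows "IB (%x. conv (ballk r) P x) = IB (%x. P x)"
proof -
 define m where "m = vol (ball (0::'a) r)"
 have m: "m > 0" using r by (simp add: m_def content_ball_pos)
 have [measurable]: "P \<in> borel_measurable borel" using P by auto
 have em: "emeasure lborel (ball x r) = ennreal m" for x :: 'a by (simp add: emeasure_ball_eq m_def measure_ball_translate[of x])
 have "ennreal (conv (ballk r) P x) = NB (%y. ennreal (1 / m) * (ennreal (P y) * indicator (ball y r) x))" for x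
 proof -
  have "NB (%y. ennreal (1 / m) * (ennreal (P y) * indicator (ball y r) x)) = NB (%y. ennreal (1 / m) * (ennreal (P y) * indicator (ball x r) y))"
   by (rule nn_integral_cong) (auto simp: indicator_def dist_commute)
  also have "... = ennreal (1 / m) * iB (ball x r) (%y. P y)"
  proof (rule nn_integral_cmult)
   have [measurable]: "ball x r \<in> sets borel" by simp
   show "(%y. ennreal (P y) * indicator (ball x r) y) \<in> borel_measurable lborel" by measurable
  qed
  also have "... = ennreal (1 / m) * ennreal (conv (ballk r) P x * m)"
   using ballk_avg(1)[OF P r, of x] by (simp add: m_def measure_ball_translate[of x])
  also have "... = ennreal (conv (ballk r) P x)"
   using m ballk_avg(2)[OF P r, of x] by (simp flip: ennreal_mult)
  finally show ?thesis by simp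
 qed
 then have "IB (%x. conv (ballk r) P x) = NB (%x. NB (%y. ennreal (1 / m) * (ennreal (P y) * indicator {p. dist (fst p) (snd p) < r} (y, x))))"
  by (simp add: indicator_def)
 also have "... = NB (%y. NB (%x. ennreal (1 / m) * (ennreal (P y) * indicator {p. dist (fst p) (snd p) < r} (y, x))))"
 proof (rule lborel_pair.Fubini')
  have "open {p :: 'a \<times> 'a. dist (fst p) (snd p) < r}" by (intro open_Collect_less continuous_intros)
  then have [measurable]: "{p :: 'a \<times> 'a. dist (fst p) (snd p) < r} \<in> sets (borel \<Otimes>\<^sub>M borel)"
   unfolding borel_prod by (rule borel_open)
  show "(%(y, x). ennreal (1 / m) * (ennreal (P y) * indicator {p. dist (fst p) (snd p) < r} (y, x))) \<in> borel_measurable (lborel \<Otimes>\<^sub>M lborel)"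
   by measurable
 qed
 also have "... = IB (%y. P y)"
 proof (rule nn_integral_cong, goal_cases)
  case (1 y)
  have "NB (%x. ennreal (1 / m) * (ennreal (P y) * indicator {p. dist (fst p) (snd p) < r} (y, x)))
   = NB (%x. (ennreal (1 / m) * ennreal (P y)) * indicator (ball y r) x)"
   by (rule nn_integral_cong) (auto simp: indicator_def)
  also have "... = ennreal (1 / m) * ennreal (P y) * ennreal m"
   by (subst nn_integral_cmult_indicator) (auto simp: em)
  also have "... = ennreal (P y)" using m P(2)[of y] by (simp flip: ennreal_mult)
  finally show ?case .
 qed
 finally show ?thesis .
qed

text \<open>If every term were below S/4 times (3/4)^i, the sum would be below S; the ratio 2/3 is
  (1/2)/(3/4). A single scale replaces the sum, as \<open>\<phi>\<close> cannot be applied to long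
  sums without loss, and the surplus (2/3)^i later makes a sum over all scales converge.\<close>

lemma geometric_pigeonhole:
 fixes \<tau> :: "nat => real"
 assumes S: "0 < S" "S <= (\<Sum>i<N. (1/2) ^ i * \<tau> i)"
 shows "\<exists>i. S <= 4 * ((2/3) ^ i * \<tau> i)"
proof (rule ccontr)
 assume "\<not> ?thesis"
 then have *: "4 * ((2/3) ^ i * \<tau> i) < S" for i by (simp add: not_le)
 have N: "N > 0" using S by (cases N) auto
 have lt: "(1/2) ^ i * \<tau> i < S / 4 * (3/4) ^ i" for i
 proof -
  have "(1/2) ^ i * \<tau> i = (3/4) ^ i * ((2/3) ^ i * \<tau> i)"
   by (simp flip: power_mult_distrib mult.assoc)
  also have "... < (3/4) ^ i * (S / 4)" using *[of i] by (intro mult_strict_left_mono) auto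
  finally show ?thesis by (simp add: mult.commute)
 qed
 have "(\<Sum>i<N. (1/2) ^ i * \<tau> i) < (\<Sum>i<N. S / 4 * (3/4) ^ i)"
  by (rule sum_strict_mono) (use lt N in auto)
 also have "... = S / 4 * (\<Sum>i<N. (3/4) ^ i)" by (simp add: sum_distrib_left)
 also have "(\<Sum>i<N. (3/4::real) ^ i) <= 4" by (subst sum_gp_strict) (simp add: field_simps)
 also have "S / 4 * 4 = S" by simp
 finally show False using S by (simp add: mult_left_mono)
qed

section \<open>Poincare's inequality in modular form on level sets\<close>

context local_qm_osc
begin

lemma W_local_pos_part:
 assumes r: "0 < \<rho>"
 obtains f g where "W f g" "!!x. 0 <= f x" "!!x. x \<in> ball z \<rho> ==> f x = max (U x - k) 0"
  "!!x. x \<in> ball z \<rho> ==> g x = (if k < U x then G x else 0)"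
proof -
 have r2: "\<rho> < 2 * \<rho>" using r by simp
 obtain \<eta> D\<eta> where e: "smooth_fun \<eta>" "C1c \<eta> D\<eta>" "!!x. 0 <= \<eta> x" "!!x. \<eta> x <= 1" "!!x. dist z x <= \<rho> ==> \<eta> x = 1"
  by (rule ball_cutoff[OF r r2, of z], rule that)
 have D0: "D\<eta> x = 0" if x: "x \<in> ball z \<rho>" for x
 proof -
  have "(\<eta> has_derivative (%h. 0)) (at x)"
   by (rule has_derivative_transform_within_open[OF has_derivative_const open_ball x, of 1]) (use e(5) in auto)
  then have "(%h. D\<eta> x \<bullet> h) = (%h. 0 \<bullet> h)" using has_derivative_unique[OF C1cD(1)[OF e(2)]] by fastforce
  then show ?thesis by (rule inner_fun_eqD)
 qed
 show thesis
 proof (rule that[OF W_cutoff_pos_part[OF UG e(2,3), of k]])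
  show "0 <= \<eta> x * max (U x - k) 0" for x using e(3)[of x] by simp
  fix x assume x: "x \<in> ball z \<rho>"
  then have "\<eta> x = 1" using e(5)[of x] by simp
  then show "\<eta> x * max (U x - k) 0 = max (U x - k) 0"
   "(if 0 < \<eta> x * max (U x - k) 0 then \<eta> x *\<^sub>R G x + (U x - k) *\<^sub>R D\<eta> x else 0) = (if k < U x then G x else 0)"
   using D0[OF x] by (auto simp: max_def)
 qed
qed

text \<open>The 3 is the sum of (2/3)^i; the power of 2 collects the pigeonhole factor and the
  volume ratios in the telescoping of means.\<close>

definition mp_const :: "real => real" where
 "mp_const K = 3 * (L * (2 ^ (DIM('a) + 4)) powr q * L) * (L + jen_const K (2 ^ (DIM('a) + 1)))"

lemma mp_const_nonneg: "1 <= K ==> 0 <= mp_const K"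
 using L1 jen_const_nonneg[of K] by (simp add: mp_const_def)

text \<open>The value at \<open>x\<close> is the limit of means over halved balls. The first mean is
  small since the level set fills at most half of a ball of radius \<open>r\<close>, and each step
  costs a mean oscillation, hence a mean gradient. The scale that dominates is fed to
  \<open>ph_jensen\<close>; integrating the bounds over all scales restores the energy.\<close>

lemma level_poincare:
 assumes t: "0 < t" and r: "0 < r" "r <= 1" and BV: "ball z (t + r) \<subseteq> V" and K: "1 <= K"
  and osc: "!!x \<rho>. x \<in> ball z t ==> 0 < \<rho> ==> \<rho> <= r ==>
   dosc U (ball x \<rho>)
    <= ennreal (K * \<rho> powr (1 - real DIM('a) / s) * (vol (ball x \<rho>))\<^sup>2)"
  and small: "2 * emeasure lborel (lev z (t + r) k) <= ennreal (vol (ball (0::'a) r))"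
 shows "phU (lev z t k) k r <=
  ennreal (mp_const K) * (phL (lev z (t + r) k) G + emeasure lborel (lev z t k))"
proof -
 have tr: "0 < t + r" using t r by simp
 obtain f g where w: "W f g" and f0: "!!x. 0 <= f x" and fB: "!!x. x \<in> ball z (t + r) ==> f x = max (U x - k) 0"
  and gB: "!!x. x \<in> ball z (t + r) ==> g x = (if k < U x then G x else 0)"
  by (rule W_local_pos_part[OF tr, of z k], rule that)
 note [measurable] = W_measurable[OF w]
 note fi = W_integrable(1)[OF w]
 define \<rho> where "\<rho> i = r / 2 ^ i" for i :: nat
 have \<rho>: "0 < \<rho> i" "\<rho> i <= r" "\<rho> i <= 1" for i
 proof -
  have "r / 2 ^ i <= r / 1" using r by (intro divide_left_mono) auto
  then show le: "\<rho> i <= r" by (simp add: \<rho>_def)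
  show "0 < \<rho> i" using r by (simp add: \<rho>_def)
  show "\<rho> i <= 1" using le r(2) by (rule order_trans)
 qed
 have \<rho>S: "\<rho> (Suc i) = \<rho> i / 2" for i by (simp add: \<rho>_def)
 have \<rho>l: "\<rho> \<longlonglongrightarrow> 0"
 proof -
  have "(%i. r * (1/2) ^ i) \<longlonglongrightarrow> r * 0" by (intro tendsto_intros LIMSEQ_realpow_zero) auto
  moreover have "\<rho> = (%i. r * (1/2) ^ i)" by (rule ext) (simp add: \<rho>_def power_one_over)
  ultimately show ?thesis by simp
 qed
 define A where "A = lev z (t + r) k"
 have Am[measurable]: "A \<in> sets borel" by (simp add: A_def)
 have AV: "A \<subseteq> V" using lev_subset(1)[of z "t+r" k] BV by (auto simp: A_def)
 have phA: "(%x. ph x (norm (G x)) * indicator A x) \<in> borel_measurable lebesgue"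
 proof -
  have 1: "(%x. ph x (norm (G x))) \<in> borel_measurable lebesgue" by (rule ph_measurable_borel) measurable
  have 2: "A \<in> sets lebesgue" by simp
  show ?thesis by (intro borel_measurable_times borel_measurable_indicator 1 2)
 qed
 have "integrable lebesgue (%x. ph x (norm (G x)) * indicator A x)"
 proof (rule integrableI_bounded[OF phA])
  have "IL (%x. norm (ph x (norm (G x)) * indicator A x)) = phL A G"
   by (rule nn_integral_cong) (auto simp: indicator_def)
  then show "IL (%x. norm (ph x (norm (G x)) * indicator A x)) < \<infinity>"
   using energy_finite[OF AV] by simp
 qed
 from lebesgue_borel_rep[OF this] obtain P' where P': "integrable lborel P'" "AE x in lborel. ph x (norm (G x)) * indicator A x = P' x" by metis
 define P where "P x = \<bar>P' x\<bar>" for x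
 have Pi: "integrable lborel P" unfolding P_def using P'(1) by (rule integrable_abs)
 have P0: "0 <= P x" for x by (simp add: P_def)
 have PA: "AE x in lborel. ph x (norm (G x)) * indicator A x = P x"
  using P'(2)
 proof eventually_elim
  case (elim x)
  moreover have "0 <= ph x (norm (G x)) * indicator A x" by simp
  ultimately show ?case by (simp add: P_def)
 qed
 have intP: "IB (%x. P x) = phL A G"
  unfolding nn_integral_completion
  by (rule nn_integral_cong_AE) (use PA in \<open>auto elim!: eventually_mono simp: indicator_def\<close>)
 define J where "J = jen_const K (2 ^ (DIM('a) + 1))"
 have J0: "0 <= J" unfolding J_def by (rule jen_const_nonneg[OF K])
 define AvP where "AvP i x = conv (ballk (\<rho> i)) P x" for i x
 have AvP0: "0 <= AvP i x" for i x unfolding AvP_def by (rule ballk_avg(2)[OF Pi P0 \<rho>(1)])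
 have fin: "integrable lborel (conv (ballk (\<rho> i)) f)" for i
 proof -
  have "IB (%x. norm (conv (ballk (\<rho> i)) f x)) = IB (%x. f x)"
   using nn_integral_conv_ballk[OF fi f0 \<rho>(1)] ballk_avg(2)[OF fi f0 \<rho>(1)] by simp
  also have "... < \<infinity>" using fi f0 by (simp add: integrable_iff_bounded)
  finally show ?thesis by (intro integrableI_bounded) auto
 qed
 obtain rr :: "nat => nat" where rr: "strict_mono rr" "AE x in lborel. (%i. conv (ballk (\<rho> (rr i))) f x) \<longlonglongrightarrow> f x"
  using L1d_AE_subseq[OF fin fi conv_ballk_LIMSEQ[OF fi \<rho>(1) \<rho>l]] by auto
 define c1 where "c1 = L * (2 ^ (DIM('a) + 4)) powr q * L"
 have c10: "0 <= c1" using L1 by (simp add: c1_def)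
 have point: "\<exists>i. ph x ((U x - k) / r) <= c1 * ((2/3) ^ i * (L + J * AvP i x))"
  if x: "x \<in> lev z t k" and cv: "(%i. conv (ballk (\<rho> (rr i))) f x) \<longlonglongrightarrow> f x" for x
 proof -
  have xt: "x \<in> ball z t" and xk: "k < U x" using x by (auto simp: lev_def)
  have Bs: "ball x (\<rho> i) \<subseteq> ball z (t + r)" for i
  proof
   fix y assume "y \<in> ball x (\<rho> i)"
   then show "y \<in> ball z (t + r)" using xt \<rho>(2)[of i] dist_triangle[of z y x] by simp
  qed
  have BO: "ball x (\<rho> i) \<subseteq> \<Omega>" for i using Bs BV V by blast
  have fx: "f x = U x - k" "f x > 0" using fB[of x] xt xk r by auto
  define m where "m i = vol (ball x (\<rho> i))" for i
  have m: "0 < m i" for i using \<rho>(1)[of i] by (simp add: m_def content_ball_pos)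
  define I where "I i = dosc f (ball x (\<rho> i))" for i
  have IK: "I i <= ennreal (K * \<rho> i powr (1 - real DIM('a) / s) * (m i)\<^sup>2)" for i
  proof -
   have "I i <= dosc U (ball x (\<rho> i))"
    unfolding I_def
   proof (rule nn_integral_mono, goal_cases)
    case (1 w)
    show ?case
    proof (cases "w \<in> ball x (\<rho> i)")
     case w: True
     have "iB (ball x (\<rho> i)) (%y. \<bar>f y - f w\<bar>) <= iB (ball x (\<rho> i)) (%y. \<bar>U y - U w\<bar>)"
     proof (rule nn_integral_mono, goal_cases)
      case (1 y)
      show ?case
      proof (cases "y \<in> ball x (\<rho> i)")
       case True
       then have "f y = max (U y - k) 0" "f w = max (U w - k) 0" using fB Bs w by blast+
       then have "\<bar>f y - f w\<bar> <= \<bar>U y - U w\<bar>" by (auto simp: max_def)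
       then show ?thesis by (intro mult_right_mono ennreal_leI) auto
      qed simp
     qed
     then show ?thesis by (rule mult_right_mono) simp
    qed simp
   qed
   also have "... <= ennreal (K * \<rho> i powr (1 - real DIM('a) / s) * (m i)\<^sup>2)"
    unfolding m_def by (rule osc[OF xt \<rho>(1,2)])
   finally show ?thesis .
  qed
  have "I i < \<infinity>" for i using IK[of i] by (rule le_less_trans) simp
  then have eI: "I i = ennreal (enn2real (I i))" for i by (simp add: less_top)
  \<comment> \<open>The normalised double oscillation at scale \<open>i\<close>; dividing it by the
    radius gives \<open>\<tau> i\<close>, a quantity of the size of a mean gradient and in the range
    of \<open>ph_jensen\<close> by \<open>\<tau>K\<close>.\<close>
  define \<Delta> where "\<Delta> i = enn2real (I i) / (m i)\<^sup>2" for i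
  have \<Delta>0: "0 <= \<Delta> i" for i by (simp add: \<Delta>_def)
  have I\<Delta>: "I i = ennreal (\<Delta> i * (m i)\<^sup>2)" for i using eI[of i] m[of i] by (simp add: \<Delta>_def)
  define \<tau> where "\<tau> i = \<Delta> i / \<rho> i" for i
  have \<tau>0: "0 <= \<tau> i" for i using \<Delta>0[of i] \<rho>(1)[of i] by (simp add: \<tau>_def)
  have \<tau>K: "\<tau> i <= K * \<rho> i powr (- (real DIM('a) / s))" for i
  proof -
   have "\<Delta> i * (m i)\<^sup>2 <= K * \<rho> i powr (1 - real DIM('a) / s) * (m i)\<^sup>2"
    using IK[of i] K unfolding I\<Delta> by (subst (asm) ennreal_le_iff) auto
   then have "\<Delta> i <= K * \<rho> i powr (1 - real DIM('a) / s)" using m[of i] by simp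
   also have "\<rho> i powr (1 - real DIM('a) / s) = \<rho> i * \<rho> i powr (- (real DIM('a) / s))"
    using \<rho>(1)[of i] by (simp add: powr_diff powr_minus field_simps)
   finally show ?thesis using \<rho>(1)[of i] by (simp add: \<tau>_def field_simps)
  qed
  have ph\<tau>: "ph x (\<tau> i) <= L + J * AvP i x" for i
  proof -
   have "ennreal (ph x (\<tau> i) * m i) <= ennreal (L * m i) + ennreal J * iL (ball x (\<rho> i)) (%y. ph y (norm (g y)))"
    unfolding J_def m_def
   proof (rule ph_jensen[OF K _ \<rho>(1,3) BO _ _ \<tau>0 \<tau>K])
    have mr: "vol (ball (0::'a) (2 * \<rho> i)) = 2 ^ DIM('a) * m i"
     using \<rho>(1)[of i] by (simp add: m_def content_ball power_mult_distrib)
    have "I i = dosc' f (ball x (\<rho> i))"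
     unfolding I_def by (simp add: abs_minus_commute)
    also have "... <= ennreal (2 * \<rho> i * (2 ^ DIM('a) * m i)) * iB (ball x (\<rho> i)) (%y. norm (g y))"
     using ball_poincare[OF w \<rho>(1), of x i] unfolding mr .
    finally have "ennreal (1 / (\<rho> i * m i)) * I i <= ennreal (1 / (\<rho> i * m i)) * (ennreal (2 * \<rho> i * (2 ^ DIM('a) * m i)) * iB (ball x (\<rho> i)) (%y. norm (g y)))"
     by (rule mult_left_mono) simp
    also have "... = ennreal (1 / (\<rho> i * m i) * (2 * \<rho> i * (2 ^ DIM('a) * m i))) * iB (ball x (\<rho> i)) (%y. norm (g y))"
     using \<rho>(1)[of i] m[of i] by (subst ennreal_mult) (auto simp: mult.assoc)
    also have "1 / (\<rho> i * m i) * (2 * \<rho> i * (2 ^ DIM('a) * m i)) = 2 ^ (DIM('a) + 1)"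
     using \<rho>(1)[of i] m[of i] by simp
    finally have "ennreal (1 / (\<rho> i * m i)) * I i <= ennreal (2 ^ (DIM('a) + 1)) * iB (ball x (\<rho> i)) (%y. norm (g y))" .
    moreover have "ennreal (1 / (\<rho> i * m i)) * I i = ennreal (1 / (\<rho> i * m i) * (\<Delta> i * (m i)\<^sup>2))"
     unfolding I\<Delta> using \<rho>(1)[of i] m[of i] \<Delta>0[of i] by (intro ennreal_mult[symmetric]) auto
    moreover have "1 / (\<rho> i * m i) * (\<Delta> i * (m i)\<^sup>2) = \<tau> i * m i"
     using \<rho>(1)[of i] m[of i] by (simp add: \<tau>_def power2_eq_square)
    ultimately show "ennreal (\<tau> i * vol (ball x (\<rho> i))) <= ennreal (2 ^ (DIM('a) + 1)) * iL (ball x (\<rho> i)) (%y. norm (g y))"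
     by (simp add: m_def nn_integral_completion)
    show "1 <= (2::real) ^ (DIM('a) + 1)" by (rule one_le_power) simp
   qed auto
   also have "iL (ball x (\<rho> i)) (%y. ph y (norm (g y))) = iB (ball x (\<rho> i)) (%y. P y)"
    unfolding nn_integral_completion
   proof (rule nn_integral_cong_AE)
    show "AE y in lborel. ennreal (ph y (norm (g y))) * indicator (ball x (\<rho> i)) y = ennreal (P y) * indicator (ball x (\<rho> i)) y"
     using PA
    proof eventually_elim
     case (elim y)
     show ?case
     proof (cases "y \<in> ball x (\<rho> i)")
      case True
      then have "y \<in> ball z (t + r)" using Bs by blast
      then have "ph y (norm (g y)) = ph y (norm (G y)) * indicator A y"
       using gB[of y] by (auto simp: A_def lev_def indicator_def)
      then show ?thesis using elim by simp
     qed simp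
    qed
   qed
   also have "... = ennreal (AvP i x * m i)" unfolding AvP_def m_def by (rule ballk_avg(1)[OF Pi P0 \<rho>(1), symmetric])
   also have "ennreal (L * m i) + ennreal J * ennreal (AvP i x * m i) = ennreal ((L + J * AvP i x) * m i)"
    using L1 m[of i] J0 AvP0[of i x] by (simp add: ennreal_mult distrib_right flip: ennreal_plus) (simp add: ennreal_mult[symmetric] mult_ac flip: ennreal_plus)
   finally show ?thesis using m[of i] J0 AvP0[of i x] L1 by (simp add: ennreal_le_iff)
  qed
  define av where "av i = conv (ballk (\<rho> i)) f x" for i
  \<comment> \<open>The only use of \<open>small\<close>: in the ball of radius
    \<open>\<rho> 0 = r\<close> around \<open>x\<close> the function vanishes on at least
    half.\<close>
  have av0: "av 0 <= 2 * \<Delta> 0"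
   unfolding av_def
  proof (rule ball_avg_half_zero[OF fi f0 \<rho>(1) \<Delta>0])
   show "dosc f (ball x (\<rho> 0)) <= ennreal (\<Delta> 0 * (vol (ball x (\<rho> 0)))\<^sup>2)"
    using I\<Delta>[of 0] by (simp add: I_def m_def)
   have "{y \<in> ball x (\<rho> 0). f y \<noteq> 0} \<subseteq> A" using fB Bs[of 0] by (auto simp: A_def lev_def max_def split: if_splits)
   then have "emeasure lborel {y \<in> ball x (\<rho> 0). f y \<noteq> 0} <= emeasure lborel A" by (intro emeasure_mono) auto
   then have "2 * emeasure lborel {y \<in> ball x (\<rho> 0). f y \<noteq> 0} <= 2 * emeasure lborel A" by (rule mult_left_mono) simp
   also have "... <= emeasure lborel (ball x (\<rho> 0))"
    using small by (simp add: A_def emeasure_ball_eq \<rho>_def measure_ball_translate[of x])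
   finally show "2 * emeasure lborel {y \<in> ball x (\<rho> 0). f y \<noteq> 0} <= emeasure lborel (ball x (\<rho> 0))" .
  qed
  have avS: "av (Suc i) <= av i + 2 ^ DIM('a) * \<Delta> i" for i
  proof -
   have "\<bar>av (Suc i) - av i\<bar> <= 2 ^ DIM('a) * \<Delta> i"
    unfolding av_def \<rho>S
    by (rule ball_avg_halving[OF fi \<rho>(1) \<Delta>0]) (use I\<Delta>[of i] in \<open>simp add: I_def m_def\<close>)
   then show ?thesis by simp
  qed
  define cn where "cn = (2::real) ^ (DIM('a) + 1)"
  have avN: "av N <= 2 * \<Delta> 0 + (\<Sum>i<N. 2 ^ DIM('a) * \<Delta> i)" for N
  proof (induction N)
   case (Suc N)
   then show ?case using avS[of N] by simp
  qed (use av0 in simp)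
  have avN2: "av N <= cn * r * (\<Sum>i<N. (1/2) ^ i * \<tau> i)" if N: "N > 0" for N
  proof -
   \<comment> \<open>The bound for the initial mean is absorbed into the term of index 0, which
     doubles the constant; \<open>N > 0\<close> ensures that this term is present.\<close>
   have 1: "2 ^ DIM('a) * \<Delta> 0 <= (\<Sum>i<N. 2 ^ DIM('a) * \<Delta> i)"
    using member_le_sum[of 0 "{..<N}" "%i. 2 ^ DIM('a) * \<Delta> i"] N \<Delta>0 by auto
   have "(2::real) ^ 1 <= 2 ^ DIM('a)" by (intro power_increasing) (auto simp: Suc_leI)
   then have "2 * \<Delta> 0 <= 2 ^ DIM('a) * \<Delta> 0" using \<Delta>0[of 0] by (intro mult_right_mono) auto
   then have "av N <= 2 * (\<Sum>i<N. 2 ^ DIM('a) * \<Delta> i)" using avN[of N] 1 by linarith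
   also have "... = cn * r * (\<Sum>i<N. (1/2) ^ i * \<tau> i)"
    unfolding sum_distrib_left
    by (rule sum.cong) (use r in \<open>auto simp: cn_def \<tau>_def \<rho>_def power_one_over field_simps\<close>)
   finally show ?thesis .
  qed
  have "\<forall>\<^sub>F i in sequentially. f x / 2 < conv (ballk (\<rho> (rr i))) f x \<and> 0 < rr i"
  proof (rule eventually_conj)
   show "\<forall>\<^sub>F i in sequentially. f x / 2 < conv (ballk (\<rho> (rr i))) f x"
    using order_tendstoD(1)[OF cv, of "f x / 2"] fx by simp
   show "\<forall>\<^sub>F i in sequentially. 0 < rr i"
    using seq_suble[OF rr(1)] by (intro eventually_sequentiallyI[of 1]) (metis One_nat_def Suc_le_eq less_le_trans)
  qed
  \<comment> \<open>A mean beyond half of the limit \<open>f x\<close>, with positive index, is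
    enough: the telescoped sum needs only finitely many scales.\<close>
  then obtain N where N: "f x / 2 < av N" "N > 0"
   using eventually_happens'[OF sequentially_bot] unfolding av_def by blast
  have cn: "cn > 0" by (simp add: cn_def)
  have "f x / (2 * cn * r) <= (\<Sum>i<N. (1/2) ^ i * \<tau> i)"
   using N avN2[OF N(2)] r cn by (simp add: field_simps)
  then obtain i where i: "f x / (2 * cn * r) <= 4 * ((2/3) ^ i * \<tau> i)"
   using geometric_pigeonhole[of "f x / (2 * cn * r)" \<tau> N] fx r cn by (auto simp: field_simps)
  have "ph x ((U x - k) / r) <= L * (2 ^ (DIM('a) + 4)) powr q * ph x ((2/3) ^ i * \<tau> i)"
  proof (rule ph_dec_bound)
   have "(U x - k) / r <= (8 * cn) * ((2/3) ^ i * \<tau> i)" using i r cn by (simp add: fx field_simps)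
   also have "8 * cn = 2 ^ (DIM('a) + 4)" by (simp add: cn_def power_add)
   finally show "\<bar>(U x - k) / r\<bar> <= 2 ^ (DIM('a) + 4) * \<bar>(2/3) ^ i * \<tau> i\<bar>"
    using xk r \<tau>0[of i] by simp
  qed simp
  also have "... <= L * (2 ^ (DIM('a) + 4)) powr q * (L * (2/3) ^ i * ph x (\<tau> i))"
   using L1 by (intro mult_left_mono ph_inc1) (auto simp: power_le_one)
  also have "... = c1 * ((2/3) ^ i * ph x (\<tau> i))" by (simp add: c1_def)
  also have "... <= c1 * ((2/3) ^ i * (L + J * AvP i x))"
   using c10 by (intro mult_left_mono ph\<tau>) auto
  finally show ?thesis by blast
 qed
 have AvPm[measurable]: "AvP i \<in> borel_measurable borel" for i
  unfolding AvP_def[abs_def] using Pi by measurable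
 have levm[measurable]: "lev z t k \<in> sets borel" by simp
 have "phU (lev z t k) k r = iB (lev z t k) (%x. ph x ((U x - k) / r))"
  by (rule nn_integral_completion)
 \<comment> \<open>The favourable scale depends on \<open>x\<close>; bounding by the sum over all
   scales removes this dependence without choosing it measurably.\<close>
 also have "... <= NB (%x. \<Sum>i. ennreal (c1 * (2/3) ^ i * L) * indicator (lev z t k) x + ennreal (c1 * (2/3) ^ i * J) * ennreal (AvP i x))"
 proof (rule nn_integral_mono_AE)
  show "AE x in lborel. ennreal (ph x ((U x - k) / r)) * indicator (lev z t k) x <= (\<Sum>i. ennreal (c1 * (2/3) ^ i * L) * indicator (lev z t k) x + ennreal (c1 * (2/3) ^ i * J) * ennreal (AvP i x))"
   using rr(2)
  proof eventually_elim
   case (elim x)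
   show ?case
   proof (cases "x \<in> lev z t k")
    case True
    from point[OF True elim] obtain i where "ph x ((U x - k) / r) <= c1 * ((2/3) ^ i * (L + J * AvP i x))" by blast
    also have "... = c1 * (2/3) ^ i * L + c1 * (2/3) ^ i * J * AvP i x" by (simp add: algebra_simps)
    finally have "ennreal (ph x ((U x - k) / r)) <= ennreal (c1 * (2/3) ^ i * L + c1 * (2/3) ^ i * J * AvP i x)" by (rule ennreal_leI)
    also have "... = ennreal (c1 * (2/3) ^ i * L) * indicator (lev z t k) x + ennreal (c1 * (2/3) ^ i * J) * ennreal (AvP i x)"
     using c10 L1 J0 AvP0[of i x] True by (subst ennreal_plus) (auto simp: ennreal_mult)
    also have "... <= (\<Sum>i. ennreal (c1 * (2/3) ^ i * L) * indicator (lev z t k) x + ennreal (c1 * (2/3) ^ i * J) * ennreal (AvP i x))"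
     using sum_le_suminf[of "%i. ennreal (c1 * (2/3) ^ i * L) * indicator (lev z t k) x + ennreal (c1 * (2/3) ^ i * J) * ennreal (AvP i x)" "{i}"] by simp
    finally show ?thesis using True by simp
   qed simp
  qed
 qed
 also have "... = (\<Sum>i. (NB (%x. ennreal (c1 * (2/3) ^ i * L) * indicator (lev z t k) x + ennreal (c1 * (2/3) ^ i * J) * ennreal (AvP i x))))"
  by (rule nn_integral_suminf) measurable
 also have "... = (\<Sum>i. ennreal ((2/3) ^ i) * (ennreal (c1 * L) * emeasure lborel (lev z t k) + ennreal (c1 * J) * phL A G))"
 proof (rule arg_cong[where f=suminf], rule ext)
  fix i
  have 1: "ennreal (c1 * (2/3) ^ i * L) = ennreal ((2/3) ^ i) * ennreal (c1 * L)" "ennreal (c1 * (2/3) ^ i * J) = ennreal ((2/3) ^ i) * ennreal (c1 * J)"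
   using c10 L1 J0 by (auto simp: mult_ac simp flip: ennreal_mult)
  have "NB (%x. ennreal (c1 * (2/3) ^ i * L) * indicator (lev z t k) x + ennreal (c1 * (2/3) ^ i * J) * ennreal (AvP i x))
   = ennreal (c1 * (2/3) ^ i * L) * emeasure lborel (lev z t k) + ennreal (c1 * (2/3) ^ i * J) * IB (%x. AvP i x)"
   by (simp add: nn_integral_add nn_integral_cmult)
  also have "IB (%x. AvP i x) = phL A G"
   unfolding AvP_def nn_integral_conv_ballk[OF Pi P0 \<rho>(1)] by (rule intP)
  finally show "NB (%x. ennreal (c1 * (2/3) ^ i * L) * indicator (lev z t k) x + ennreal (c1 * (2/3) ^ i * J) * ennreal (AvP i x))
   = ennreal ((2/3) ^ i) * (ennreal (c1 * L) * emeasure lborel (lev z t k) + ennreal (c1 * J) * phL A G)"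
   unfolding 1 by (simp add: distrib_left mult.assoc)
 qed
 also have "... = (\<Sum>i. ennreal ((2/3) ^ i)) * (ennreal (c1 * L) * emeasure lborel (lev z t k) + ennreal (c1 * J) * phL A G)"
  by (rule ennreal_suminf_multc)
 also have "(\<Sum>i. ennreal ((2/3) ^ i)) = ennreal 3"
  by (subst suminf_ennreal2) (auto simp: suminf_geometric)
 also have "ennreal 3 * (ennreal (c1 * L) * emeasure lborel (lev z t k) + ennreal (c1 * J) * phL A G)
  <= ennreal 3 * (ennreal (c1 * (L + J)) * emeasure lborel (lev z t k) + ennreal (c1 * (L + J)) * phL A G)"
  using c10 L1 J0 by (intro mult_left_mono add_mono mult_right_mono ennreal_leI) auto
 also have "... = ennreal (mp_const K) * (phL A G + emeasure lborel (lev z t k))"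
 proof -
  have "ennreal (mp_const K) = ennreal 3 * ennreal (c1 * (L + J))"
  proof -
   have "mp_const K = 3 * (c1 * (L + J))" by (simp add: mp_const_def c1_def J_def mult.assoc)
   then show ?thesis using c10 L1 J0 by (simp only:) (rule ennreal_mult, auto)
  qed
  then show ?thesis by (simp add: distrib_left mult.assoc add.commute)
 qed
 finally show ?thesis by (simp add: A_def)
qed

end

section \<open>De Giorgi's iteration for a local upper bound\<close>

context local_qm_osc
begin

lemma ph_pos:
 assumes "x \<in> \<Omega>" "t \<noteq> 0" shows "0 < ph x t"
proof (cases "\<bar>t\<bar> \<ge> 1")
 case True
 then have "1 / L <= ph x t" by (rule ph_ge[OF assms(1)])
 moreover have "0 < 1 / L" using L1 by simp
 ultimately show ?thesis by linarith
next
 case False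
 have "1 / L <= ph x (1 / \<bar>t\<bar> * t)" by (rule ph_ge[OF assms(1)]) (use assms(2) in \<open>simp add: abs_mult\<close>)
 also have "... <= L * (1 / \<bar>t\<bar>) powr q * ph x t" by (rule ph_dec) (use False assms(2) in auto)
 finally have "1 / L <= L * (1 / \<bar>t\<bar>) powr q * ph x t" .
 moreover have "0 < 1 / L" using L1 by simp
 ultimately have "0 < L * (1 / \<bar>t\<bar>) powr q * ph x t" by linarith
 then show ?thesis by (metis ph_nonneg less_le mult_zero_right)
qed

text \<open>The loss of one iteration step without its power of 2: the first summand is
  Caccioppoli's inequality across a gap of \<open>R / 8 * (1/2) ^ j\<close>, the second the measure
  of the level set by Chebyshev. \<open>\<epsilon>\<^sub>0\<close> is a lower bound for the actual
  value of \<open>\<phi>\<close>, so the constant does not depend on that value.\<close>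

definition sup_step :: "real => real => real" where
 "sup_step K \<epsilon>\<^sub>0 = L * mp_const K * (cac_const * L * 8 powr q + L * 2 powr q / \<epsilon>\<^sub>0)"
text \<open>Of the \<open>DIM('a) + 1\<close> factors 2^(-q), one compensates the factor 2^(jq) of
  Chebyshev's inequality; the rest match the shrinking volumes of the balls of Poincare's
  inequality.\<close>

definition sup_ratio :: real where "sup_ratio = (2 powr (- q)) ^ (DIM('a) + 1)"
text \<open>The bound 1/8 keeps the enlargement by the Poincare radius within half of the gap of
  consecutive radii; the other bound makes the step contract by \<open>sup_ratio\<close>.\<close>

definition sup_width :: "real => real => real" where
 "sup_width K \<epsilon>\<^sub>0 = min (1/8) (sup_ratio / (sup_step K \<epsilon>\<^sub>0 + 1))"
text \<open>Solves the condition that the level set fills at most half of the Poincare ball; the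
  power of \<open>R\<close> is left to the hypothesis of \<open>sup_bound\<close>.\<close>

definition sup_const :: "real => real => real" where
 "sup_const K \<epsilon>\<^sub>0 = unit_ball_vol (real DIM('a)) * sup_width K \<epsilon>\<^sub>0 ^ DIM('a) / (2 * (L * 2 powr q))"

lemma sup_pos:
 assumes "1 <= K" "0 < \<epsilon>\<^sub>0"
 shows "0 <= sup_step K \<epsilon>\<^sub>0" "0 < sup_width K \<epsilon>\<^sub>0" "sup_width K \<epsilon>\<^sub>0 <= 1/8" "sup_width K \<epsilon>\<^sub>0 * sup_step K \<epsilon>\<^sub>0 <= sup_ratio"
  "0 < sup_const K \<epsilon>\<^sub>0"
proof -
 show s: "0 <= sup_step K \<epsilon>\<^sub>0"
  using assms L1 mp_const_nonneg[OF assms(1)] cac_const_nonneg unfolding sup_step_def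
  by (intro mult_nonneg_nonneg add_nonneg_nonneg divide_nonneg_nonneg) auto
 have r: "0 < sup_ratio" by (simp add: sup_ratio_def)
 show w: "0 < sup_width K \<epsilon>\<^sub>0" using s r by (simp add: sup_width_def)
 show "sup_width K \<epsilon>\<^sub>0 <= 1/8" unfolding sup_width_def by (rule min.cobounded1)
 have "sup_width K \<epsilon>\<^sub>0 * sup_step K \<epsilon>\<^sub>0 <= sup_ratio / (sup_step K \<epsilon>\<^sub>0 + 1) * (sup_step K \<epsilon>\<^sub>0 + 1)"
  using s r w by (intro mult_mono) (auto simp: sup_width_def)
 then show "sup_width K \<epsilon>\<^sub>0 * sup_step K \<epsilon>\<^sub>0 <= sup_ratio" using s by simp
 show "0 < sup_const K \<epsilon>\<^sub>0" using w L1 by (simp add: sup_const_def)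
qed

text \<open>Levels rise to \<open>k + h\<close> while radii fall to \<open>R / 2\<close>.
  Caccioppoli's inequality followed by \<open>level_poincare\<close> returns the excess, measured at
  the much smaller radius \<open>rr j\<close>; going back to \<open>R\<close> by
  \<open>ph_inc1\<close> gains the ratio of the radii, which plays the part of Sobolev's
  gain.\<close>

lemma sup_bound:
 assumes R: "0 < R" "R <= 1" and c: "cball z R \<subseteq> V" and K: "1 <= K" and h: "0 < h"
  and osc: "!!x \<rho>. 0 < \<rho> ==> \<rho> <= R ==> ball x \<rho> \<subseteq> ball z R ==>
   dosc U (ball x \<rho>)
    <= ennreal (K * \<rho> powr (1 - real DIM('a) / s) * (vol (ball x \<rho>))\<^sup>2)"
  and e0: "0 < \<epsilon>\<^sub>0" "\<epsilon>\<^sub>0 <= \<phi>\<^sub>0" and phi0: "!!x. x \<in> ball z R ==> \<phi>\<^sub>0 <= ph x (h / R)"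
  and Y0: "phU (lev z R k) k R <= ennreal (sup_const K \<epsilon>\<^sub>0 * \<phi>\<^sub>0 * R ^ DIM('a))"
 shows "AE x in lborel. x \<in> ball z (R / 2) --> U x <= k + h"
proof -
 define \<sigma> \<nu> \<theta> \<tau> where "\<sigma> = sup_width K \<epsilon>\<^sub>0" and "\<nu> = sup_const K \<epsilon>\<^sub>0" and "\<theta> = sup_ratio" and "\<tau> = (2::real) powr (- q)"
 note sp = sup_pos[OF K e0(1)]
 have q1: "1 < q" using p1 pq by simp
 have \<tau>: "0 < \<tau>" "\<tau> <= 1/2"
 proof -
  show "0 < \<tau>" by (simp add: \<tau>_def)
  have "(2::real) powr (- q) <= 2 powr (- 1)" using q1 by (intro powr_mono) auto
  then show "\<tau> <= 1/2" by (simp add: \<tau>_def powr_minus_divide)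
 qed
 have \<sigma>: "0 < \<sigma>" "\<sigma> <= 1/8" using sp by (auto simp: \<sigma>_def)
 have \<phi>0: "0 < \<phi>\<^sub>0" using e0 by simp
 have \<nu>: "0 < \<nu>" using sp by (simp add: \<nu>_def)
 have \<theta>: "0 < \<theta>" "\<theta> < 1" "\<theta> = \<tau> ^ DIM('a) * \<tau>"
 proof -
  show e: "\<theta> = \<tau> ^ DIM('a) * \<tau>" by (simp add: \<theta>_def sup_ratio_def \<tau>_def)
  show "0 < \<theta>" using \<tau> e by simp
  have "\<tau> ^ DIM('a) <= 1" using \<tau> by (intro power_le_one) auto
  then have "\<tau> ^ DIM('a) * \<tau> <= 1 * (1/2)" using \<tau> by (intro mult_mono) auto
  then show "\<theta> < 1" using e by simp
 qed
 define kk where "kk j = k + h * (1 - (1/2) ^ j)" for j :: nat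
 define RR where "RR j = R / 2 * (1 + (1/2) ^ j)" for j :: nat
 \<comment> \<open>The decay \<open>\<tau> ^ j\<close> cancels exactly the factor
   \<open>(2 ^ j) powr q\<close> produced by the shrinking gaps of levels and radii.\<close>
 define rr where "rr j = \<sigma> * R * \<tau> ^ j" for j :: nat
 define Y where "Y j = phU (lev z (RR j) (kk j)) (kk j) R" for j
 have hj: "0 < (1/2::real) ^ j" "(1/2::real) ^ j <= 1" for j by (auto simp: power_le_one)
 have RR: "R / 2 < RR j" "RR j <= R" "RR j - RR (Suc j) = R / 4 * (1/2) ^ j" for j
 proof -
  show "R / 2 < RR j" using R hj[of j] by (simp add: RR_def)
  have "R / 2 * (1 + (1/2) ^ j) <= R / 2 * 2" using R hj[of j] by (intro mult_left_mono) auto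
  then show "RR j <= R" by (simp add: RR_def)
  show "RR j - RR (Suc j) = R / 4 * (1/2) ^ j" by (simp add: RR_def algebra_simps)
 qed
 have rr: "0 < rr j" "rr j <= R / 8 * (1/2) ^ j" for j
 proof -
  show "0 < rr j" using R \<sigma> \<tau> by (simp add: rr_def)
  have "\<tau> ^ j <= (1/2) ^ j" using \<tau> by (intro power_mono) auto
  then have "\<sigma> * R * \<tau> ^ j <= (1/8) * R * (1/2) ^ j" using R \<sigma> \<tau> by (intro mult_mono) auto
  then show "rr j <= R / 8 * (1/2) ^ j" by (simp add: rr_def)
 qed
 have kk: "kk j <= k + h" "kk (Suc j) - kk j = h * (1/2) ^ Suc j" for j
  using h hj[of j] by (auto simp: kk_def algebra_simps)
 have \<tau>q: "\<tau> ^ j * (2 ^ j) powr q = 1" for j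
 proof -
  have "(2 ^ j) powr q = (2 powr q) ^ j" by (simp add: powr_powr mult.commute flip: powr_realpow)
  moreover have "\<tau> * 2 powr q = 1" by (simp add: \<tau>_def powr_minus)
  ultimately show ?thesis by (simp flip: power_mult_distrib)
 qed
 have claim: "Y j <= ennreal (\<nu> * \<phi>\<^sub>0 * R ^ DIM('a) * \<theta> ^ j)" for j
 proof (induction j)
  case 0
  have "kk 0 = k" "RR 0 = R" by (auto simp: kk_def RR_def)
  then show ?case using Y0 by (simp add: Y_def \<nu>_def)
 next
  case (Suc j)
  define k' where "k' = kk (Suc j)"
  define R' where "R' = RR (Suc j) + rr j"
  have kle: "kk j <= k'"
  proof -
   have "0 <= h * (1/2) ^ Suc j" using h by (intro mult_nonneg_nonneg) auto
   then show ?thesis using kk(2)[of j] unfolding k'_def by linarith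
  qed
  have gap: "R / 8 * (1/2) ^ j <= RR j - R'" using RR(3)[of j] rr(2)[of j] by (simp add: R'_def field_simps)
  have gap0: "0 < RR j - R'" using gap R hj[of j] by (smt (verit) divide_pos_pos mult_pos_pos zero_less_numeral)
  have Rp: "0 < RR (Suc j)" "0 < R'" using RR(1)[of "Suc j"] rr(1)[of j] R by (auto simp: R'_def)
  have cj: "cball z (RR j) \<subseteq> V" using RR(2)[of j] c by (meson order_trans subset_cball)
  have R'R: "R' <= R" using gap0 RR(2)[of j] by simp
  obtain y where y: "Y j = ennreal y" "0 <= y" "y <= \<nu> * \<phi>\<^sub>0 * R ^ DIM('a) * \<theta> ^ j"
  proof -
   have "Y j < \<infinity>" using Suc by (rule le_less_trans) simp
   then obtain y where "Y j = ennreal y" "0 <= y" by (metis infinity_ennreal_def less_top_ennreal)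
   moreover then have "y <= \<nu> * \<phi>\<^sub>0 * R ^ DIM('a) * \<theta> ^ j" using Suc \<nu> \<phi>0 R \<theta> by (simp add: ennreal_le_iff)
   ultimately show ?thesis using that by blast
  qed
  have phm: "(%x. ennreal (ph x ((U x - kk') / c')) * indicator (lev z t kk'') x) \<in> borel_measurable lebesgue" for kk' c' t kk''
   by (rule lebesgue_indicator_measurable[OF phU_measurable lev_measurable])
  have mon: "ph x ((U x - k') / R) <= ph x ((U x - kk j) / R)" if "x \<in> lev z t k'" for x t
   by (rule ph_mono) (use that kle R in \<open>auto simp: lev_def abs_div_pos intro!: divide_right_mono\<close>)
  have inY: "phU (lev z (RR j) k') k' R <= ennreal y"
   unfolding y(1)[symmetric] Y_def
  proof (rule nn_integral_mono, goal_cases)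
   case (1 x)
   show ?case
    using mon[of x "RR j"] kle by (auto simp: indicator_def lev_def intro!: ennreal_leI)
  qed
  define mj where "mj = emeasure lborel (lev z (RR j) k')"
  \<comment> \<open>Chebyshev: above the next level, \<open>U x - kk j\<close> is at least
    \<open>h * (1/2) ^ Suc j\<close>, so (aDec) bounds its \<open>\<phi>\<close> value below by a
    multiple of the reference value.\<close>
  have mj: "mj <= ennreal (L * 2 powr q / \<phi>\<^sub>0 * ((2 ^ j) powr q * y))"
  proof -
   define w where "w = \<phi>\<^sub>0 / (L * (2 ^ Suc j) powr q)"
   have w: "0 < w" using \<phi>0 L1 by (simp add: w_def)
   have "ennreal w * mj = NL (%x. ennreal w * indicator (lev z (RR j) k') x)"
    unfolding mj_def nn_integral_completion by (rule nn_integral_cmult_indicator[symmetric]) simp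
   also have "... <= Y j" unfolding Y_def
   proof (rule nn_integral_mono, goal_cases)
    case (1 x)
    show ?case
    proof (cases "x \<in> lev z (RR j) k'")
     case True
     then have xB: "x \<in> ball z R" and xU: "k' < U x" using RR(2)[of j] by (auto simp: lev_def)
     have "\<phi>\<^sub>0 <= ph x (h / R)" by (rule phi0[OF xB])
     also have "... <= L * (2 ^ Suc j) powr q * ph x ((U x - kk j) / R)"
     proof (rule ph_dec_bound)
      have "h * (1/2) ^ Suc j <= U x - kk j" using xU kk(2)[of j] by (simp add: k'_def)
      then have "h <= 2 ^ Suc j * (U x - kk j)" by (simp add: power_one_over field_simps)
      then have "h / R <= 2 ^ Suc j * ((U x - kk j) / R)" using R by (simp add: divide_right_mono)
      moreover have "\<bar>(U x - kk j) / R\<bar> = (U x - kk j) / R" using xU kle R by (intro abs_of_nonneg divide_nonneg_nonneg) auto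
      moreover have "\<bar>h / R\<bar> = h / R" using h R by (intro abs_of_nonneg divide_nonneg_nonneg) auto
      ultimately show "\<bar>h / R\<bar> <= 2 ^ Suc j * \<bar>(U x - kk j) / R\<bar>" by simp
     qed (rule one_le_power, simp)
     finally have "w <= ph x ((U x - kk j) / R)" using L1 by (simp add: w_def divide_le_eq mult.commute)
     moreover have "x \<in> lev z (RR j) (kk j)" using True kle by (auto simp: lev_def)
     ultimately show ?thesis using True by (simp add: ennreal_leI)
    qed simp
   qed
   finally have "ennreal w * mj <= ennreal y" by (simp add: y(1))
   then have "ennreal (1 / w) * (ennreal w * mj) <= ennreal (1 / w) * ennreal y" by (rule mult_left_mono) simp
   moreover have "ennreal (1 / w) * (ennreal w * mj) = mj"
    using w by (simp add: mult.assoc[symmetric] flip: ennreal_mult)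
   moreover have "ennreal (1 / w) * ennreal y = ennreal (L * 2 powr q / \<phi>\<^sub>0 * ((2 ^ j) powr q * y))"
   proof -
    have "L * 2 powr q / \<phi>\<^sub>0 * ((2 ^ j) powr q * y) = 1 / w * y" by (simp add: w_def powr_mult)
    then show ?thesis using w y(2) by (simp only:) (rule ennreal_mult[symmetric], auto)
   qed
   ultimately show ?thesis by simp
  qed
  \<comment> \<open>The thinness needed by \<open>level_poincare\<close>: after the cancellation
    \<open>\<tau>q\<close> the bound on the level set shrinks exactly like the volume of the
    Poincare ball.\<close>
  have small: "2 * emeasure lborel (lev z (RR (Suc j) + rr j) k') <= ennreal (vol (ball (0::'a) (rr j)))"
  proof -
   have "emeasure lborel (lev z (RR (Suc j) + rr j) k') <= mj"
    unfolding mj_def by (intro emeasure_mono) (use gap0 lev_subset(2)[of R' "RR j" z k'] in \<open>auto simp: R'_def\<close>)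
   then have "2 * emeasure lborel (lev z (RR (Suc j) + rr j) k') <= 2 * ennreal (L * 2 powr q / \<phi>\<^sub>0 * ((2 ^ j) powr q * y))"
    using mj by (intro mult_left_mono) auto
   also have "... = ennreal (2 * (L * 2 powr q / \<phi>\<^sub>0 * ((2 ^ j) powr q * y)))"
    by (subst ennreal_mult'') (use L1 \<phi>0 y(2) in auto)
   also have "... <= ennreal (vol (ball (0::'a) (rr j)))"
   proof (rule ennreal_leI)
    have "(2 ^ j) powr q * y <= (2 ^ j) powr q * (\<nu> * \<phi>\<^sub>0 * R ^ DIM('a) * \<theta> ^ j)" by (intro mult_left_mono y) auto
    also have "... = (\<tau> ^ j * (2 ^ j) powr q) * (\<nu> * \<phi>\<^sub>0 * R ^ DIM('a) * (\<tau> ^ DIM('a)) ^ j)"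
     by (simp add: \<theta>(3) power_mult_distrib)
    finally have "(2 ^ j) powr q * y <= \<nu> * \<phi>\<^sub>0 * R ^ DIM('a) * (\<tau> ^ DIM('a)) ^ j" by (simp add: \<tau>q)
    then have "2 * (L * 2 powr q / \<phi>\<^sub>0 * ((2 ^ j) powr q * y)) <= 2 * (L * 2 powr q / \<phi>\<^sub>0 * (\<nu> * \<phi>\<^sub>0 * R ^ DIM('a) * (\<tau> ^ DIM('a)) ^ j))"
     using L1 \<phi>0 by (intro mult_left_mono) auto
    also have "... = (2 * (L * 2 powr q) * \<nu>) * (R ^ DIM('a) * (\<tau> ^ DIM('a)) ^ j)" using \<phi>0 by simp
    also have "2 * (L * 2 powr q) * \<nu> = unit_ball_vol (real DIM('a)) * \<sigma> ^ DIM('a)" using L1 by (simp add: \<nu>_def sup_const_def \<sigma>_def)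
    also have "unit_ball_vol (real DIM('a)) * \<sigma> ^ DIM('a) * (R ^ DIM('a) * (\<tau> ^ DIM('a)) ^ j) = vol (ball (0::'a) (rr j))"
     using rr(1)[of j] by (simp add: content_ball rr_def power_mult_distrib power_commutes flip: power_mult) (simp add: mult.commute power_mult)
    finally show "2 * (L * 2 powr q / \<phi>\<^sub>0 * ((2 ^ j) powr q * y)) <= vol (ball (0::'a) (rr j))" .
   qed
   finally show ?thesis .
  qed
  have cac: "phL (lev z R' k') G <= ennreal (cac_const * L * 8 powr q * ((2 ^ j) powr q * y))"
  proof -
   have "phL (lev z R' k') G <= ennreal cac_const * phU (lev z (RR j) k') k' (RR j - R')"
    by (rule caccioppoli[OF Rp(2) _ cj]) (use gap0 in simp)
   also have "phU (lev z (RR j) k') k' (RR j - R') <=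
    NL (%x. ennreal (L * (8 * 2 ^ j) powr q) * (ennreal (ph x ((U x - k') / R)) * indicator (lev z (RR j) k') x))"
   proof (rule nn_integral_mono, goal_cases)
    case (1 x)
    have "ph x ((U x - k') / (RR j - R')) <= L * (8 * 2 ^ j) powr q * ph x ((U x - k') / R)"
    proof (rule ph_dec_bound)
     have "(1::real) <= 2 ^ j" by simp
     then show "(1::real) <= 8 * 2 ^ j" by linarith
     have "1 / (RR j - R') <= 1 / (R / 8 * (1/2) ^ j)" using gap gap0 R hj[of j] by (intro divide_left_mono) auto
     also have "... = 8 * 2 ^ j / R" by (simp add: power_one_over)
     finally have "\<bar>U x - k'\<bar> * (1 / (RR j - R')) <= \<bar>U x - k'\<bar> * (8 * 2 ^ j / R)" by (rule mult_left_mono) simp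
     then show "\<bar>(U x - k') / (RR j - R')\<bar> <= 8 * 2 ^ j * \<bar>(U x - k') / R\<bar>" using gap0 R by (simp add: abs_divide mult.commute)
    qed
    then have "ennreal (ph x ((U x - k') / (RR j - R'))) <= ennreal (L * (8 * 2 ^ j) powr q) * ennreal (ph x ((U x - k') / R))"
     using L1 by (simp flip: ennreal_mult add: ennreal_leI)
    then show ?case
     by (auto simp: indicator_def)
   qed
   also have "... = ennreal (L * (8 * 2 ^ j) powr q) * phU (lev z (RR j) k') k' R"
    by (rule nn_integral_cmult[OF phm])
   also have "... <= ennreal (L * (8 * 2 ^ j) powr q) * ennreal y" by (intro mult_left_mono inY) auto
   also have "ennreal cac_const * (ennreal (L * (8 * 2 ^ j) powr q) * ennreal y) = ennreal (cac_const * L * 8 powr q * ((2 ^ j) powr q * y))"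
    using cac_const_nonneg L1 y(2) by (simp add: powr_mult mult.assoc flip: ennreal_mult)
   finally show ?thesis by (simp add: mult_left_mono)
  qed
  define X where "X = cac_const * L * 8 powr q * ((2 ^ j) powr q * y) + L * 2 powr q / \<phi>\<^sub>0 * ((2 ^ j) powr q * y)"
  have X0: "0 <= X" using cac_const_nonneg L1 y(2) \<phi>0 by (simp add: X_def)
  have mp: "iL (lev z (RR (Suc j)) k') (%x. ph x ((U x - k') / rr j)) <= ennreal (mp_const K * X)"
  proof -
   have "iL (lev z (RR (Suc j)) k') (%x. ph x ((U x - k') / rr j)) <=
    ennreal (mp_const K) * (iL (lev z (RR (Suc j) + rr j) k') (%x. ph x (norm (G x))) + emeasure lborel (lev z (RR (Suc j)) k'))"
   proof (rule level_poincare[OF Rp(1) rr(1) _ _ K _ small])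
    have "R / 8 * (1/2) ^ j <= 1 * 1" using R hj[of j] by (intro mult_mono) auto
    then show "rr j <= 1" using rr(2)[of j] by simp
    show "ball z (RR (Suc j) + rr j) \<subseteq> V" using R'R c unfolding R'_def by (meson ball_subset_cball order_trans subset_ball)
    fix x \<rho> assume a: "x \<in> ball z (RR (Suc j))" "0 < \<rho>" "\<rho> <= rr j"
    show "dosc U (ball x \<rho>) <= ennreal (K * \<rho> powr (1 - real DIM('a) / s) * (vol (ball x \<rho>))\<^sup>2)"
    proof (rule osc[OF a(2)])
     show "\<rho> <= R" using a(3) R'R Rp(1) by (simp add: R'_def)
     show "ball x \<rho> \<subseteq> ball z R"
     proof
      fix y assume "y \<in> ball x \<rho>"
      then show "y \<in> ball z R" using a R'R dist_triangle[of z y x] by (simp add: R'_def)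
     qed
    qed
   qed
   also have "... <= ennreal (mp_const K) * (ennreal (cac_const * L * 8 powr q * ((2 ^ j) powr q * y)) + ennreal (L * 2 powr q / \<phi>\<^sub>0 * ((2 ^ j) powr q * y)))"
   proof (intro mult_left_mono add_mono)
    show "iL (lev z (RR (Suc j) + rr j) k') (%x. ph x (norm (G x))) <= ennreal (cac_const * L * 8 powr q * ((2 ^ j) powr q * y))"
     using cac by (simp add: R'_def)
    have "emeasure lborel (lev z (RR (Suc j)) k') <= mj"
    proof -
    have "0 <= R / 4 * (1/2) ^ j" using R by (intro mult_nonneg_nonneg) auto
    then have "RR (Suc j) <= RR j" using RR(3)[of j] by linarith
    then show ?thesis unfolding mj_def by (intro emeasure_mono lev_subset(2)) auto
   qed
    then show "emeasure lborel (lev z (RR (Suc j)) k') <= ennreal (L * 2 powr q / \<phi>\<^sub>0 * ((2 ^ j) powr q * y))" using mj by (rule order_trans)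
   qed simp
   also have "... = ennreal (mp_const K) * ennreal X" unfolding X_def using cac_const_nonneg L1 y(2) \<phi>0 by (subst ennreal_plus) auto
   also have "... = ennreal (mp_const K * X)" using mp_const_nonneg[OF K] X0 by (intro ennreal_mult[symmetric]) auto
   finally show ?thesis .
  qed
  \<comment> \<open>The gain \<open>\<sigma> * \<tau> ^ j\<close> enters here, as the ratio of
    \<open>rr j\<close> to \<open>R\<close>.\<close>
  have "Y (Suc j) <= NL (%x. ennreal (L * (\<sigma> * \<tau> ^ j)) * (ennreal (ph x ((U x - k') / rr j)) * indicator (lev z (RR (Suc j)) k') x))"
   unfolding Y_def k'_def[symmetric]
  proof (rule nn_integral_mono, goal_cases)
   case (1 x)
   have "\<tau> ^ j <= 1" using \<tau> by (intro power_le_one) auto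
   then have "\<sigma> * \<tau> ^ j <= 1 * 1" using \<sigma> \<tau> by (intro mult_mono) auto
   then have "ph x ((\<sigma> * \<tau> ^ j) * ((U x - k') / rr j)) <= L * (\<sigma> * \<tau> ^ j) * ph x ((U x - k') / rr j)"
    using \<sigma> \<tau> by (intro ph_inc1) auto
   moreover have "(\<sigma> * \<tau> ^ j) * ((U x - k') / rr j) = (U x - k') / R" using \<sigma> \<tau> R by (simp add: rr_def)
   ultimately have "ennreal (ph x ((U x - k') / R)) <= ennreal (L * (\<sigma> * \<tau> ^ j)) * ennreal (ph x ((U x - k') / rr j))"
    using L1 \<sigma> \<tau> by (simp flip: ennreal_mult add: ennreal_leI)
   then show ?case
    by (auto simp: indicator_def)
  qed
  also have "... = ennreal (L * (\<sigma> * \<tau> ^ j)) * iL (lev z (RR (Suc j)) k') (%x. ph x ((U x - k') / rr j))"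
   by (rule nn_integral_cmult[OF phm])
  also have "... <= ennreal (L * (\<sigma> * \<tau> ^ j)) * ennreal (mp_const K * X)" by (intro mult_left_mono mp) auto
  also have "... = ennreal (L * (\<sigma> * \<tau> ^ j) * (mp_const K * X))"
   using L1 \<sigma> \<tau> mp_const_nonneg[OF K] X0 by (intro ennreal_mult[symmetric]) auto
  also have "... <= ennreal (\<nu> * \<phi>\<^sub>0 * R ^ DIM('a) * \<theta> ^ Suc j)"
  proof (rule ennreal_leI)
   have "X = (cac_const * L * 8 powr q + L * 2 powr q / \<phi>\<^sub>0) * ((2 ^ j) powr q * y)" by (simp add: X_def distrib_right)
   also have "... <= (cac_const * L * 8 powr q + L * 2 powr q / \<epsilon>\<^sub>0) * ((2 ^ j) powr q * y)"
    using e0 L1 y(2) by (intro mult_right_mono add_left_mono divide_left_mono) auto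
   finally have X: "X <= (cac_const * L * 8 powr q + L * 2 powr q / \<epsilon>\<^sub>0) * ((2 ^ j) powr q * y)" .
   have "L * (\<sigma> * \<tau> ^ j) * (mp_const K * X) <= L * (\<sigma> * \<tau> ^ j) * (mp_const K * ((cac_const * L * 8 powr q + L * 2 powr q / \<epsilon>\<^sub>0) * ((2 ^ j) powr q * y)))"
    using L1 \<sigma> \<tau> mp_const_nonneg[OF K] X by (intro mult_left_mono) auto
   also have "... = (\<sigma> * sup_step K \<epsilon>\<^sub>0) * ((\<tau> ^ j * (2 ^ j) powr q) * y)" by (simp add: sup_step_def)
   also have "... = (\<sigma> * sup_step K \<epsilon>\<^sub>0) * y" by (simp add: \<tau>q)
   also have "... <= \<theta> * y" using sp(4) y(2) by (intro mult_right_mono) (auto simp: \<sigma>_def \<theta>_def)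
   also have "... <= \<theta> * (\<nu> * \<phi>\<^sub>0 * R ^ DIM('a) * \<theta> ^ j)" using \<theta> by (intro mult_left_mono y) auto
   finally show "L * (\<sigma> * \<tau> ^ j) * (mp_const K * X) <= \<nu> * \<phi>\<^sub>0 * R ^ DIM('a) * \<theta> ^ Suc j" by (simp add: mult_ac)
  qed
  finally show ?case .
 qed
 \<comment> \<open>The limit level set is contained in all the others, so its excess is below every
   term of a null sequence; positivity of \<open>\<phi>\<close> then makes the set null.\<close>
 define A where "A = lev z (R / 2) (k + h)"
 define Z where "Z = phU A (k + h) R"
 have "Z <= ennreal (\<nu> * \<phi>\<^sub>0 * R ^ DIM('a) * \<theta> ^ j)" for j
 proof -
  have "Z <= Y j" unfolding Z_def Y_def
  proof (rule nn_integral_mono, goal_cases)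
   case (1 x)
   show ?case
   proof (cases "x \<in> A")
    case True
    then have "x \<in> lev z (RR j) (kk j)" using RR(1)[of j] kk(1)[of j] by (auto simp: A_def lev_def)
    moreover have "ph x ((U x - (k + h)) / R) <= ph x ((U x - kk j) / R)"
     by (rule ph_mono) (use True kk(1)[of j] R in \<open>auto simp: A_def lev_def abs_div_pos intro!: divide_right_mono\<close>)
    ultimately show ?thesis using True by (simp add: ennreal_leI)
   qed simp
  qed
  then show ?thesis using claim[of j] by (rule order_trans)
 qed
 moreover have "(%j. ennreal (\<nu> * \<phi>\<^sub>0 * R ^ DIM('a) * \<theta> ^ j)) \<longlonglongrightarrow> ennreal (\<nu> * \<phi>\<^sub>0 * R ^ DIM('a) * 0)"
  using \<theta> by (intro tendsto_intros tendsto_ennrealI LIMSEQ_realpow_zero) auto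
 ultimately have "Z <= ennreal (\<nu> * \<phi>\<^sub>0 * R ^ DIM('a) * 0)" by (intro LIMSEQ_le_const) auto
 then have "Z = 0" by simp
 moreover have "(%x. ennreal (ph x ((U x - (k + h)) / R)) * indicator A x) \<in> borel_measurable lebesgue"
  unfolding A_def by (rule lebesgue_indicator_measurable[OF phU_measurable lev_measurable])
 ultimately have "AE x in lebesgue. ennreal (ph x ((U x - (k + h)) / R)) * indicator A x = 0"
  unfolding Z_def by (subst (asm) nn_integral_0_iff_AE) auto
 then have "AE x in lborel. ennreal (ph x ((U x - (k + h)) / R)) * indicator A x = 0"
  by (simp add: AE_completion_iff)
 then show ?thesis
 proof eventually_elim
  case (elim x)
  show ?case
  proof (intro impI, rule ccontr)
   assume x: "x \<in> ball z (R / 2)" and "\<not> U x <= k + h"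
   then have "x \<in> A" by (simp add: A_def lev_def)
   then have z: "ph x ((U x - (k + h)) / R) = 0" using elim ph_nonneg[of x "(U x - (k + h)) / R"] by (auto simp: ennreal_eq_0_iff intro: antisym)
   have "x \<in> \<Omega>" using x R c V by (auto simp: subset_iff)
   then have "0 < ph x ((U x - (k + h)) / R)" using \<open>\<not> U x <= k + h\<close> R by (intro ph_pos) auto
   then show False using z by simp
  qed
 qed
qed

text \<open>For a high starting level the excess is as small as desired, since its total is finite.
  The rise \<open>h = R\<close> makes the reference argument equal to 1, where (A0) gives the lower
  bound \<open>1 / L\<close>.\<close>

lemma locally_bounded_above:
 assumes R: "0 < R" "R <= \<rho>\<^sub>0" and c: "cball z R \<subseteq> V"
 shows "\<exists>M. AE x in lborel. x \<in> ball z (R / 2) --> U x <= M"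
proof -
 have bV: "ball z R \<subseteq> V" using c by (meson ball_subset_cball order_trans)
 have eL: "0 < 1 / L" using L1 by simp
 define y where "y = sup_const K\<^sub>1 (1 / L) * (1 / L) * R ^ DIM('a)"
 have y: "y > 0" using sup_pos(5)[OF K1 eL] R L1 by (simp add: y_def)
 define h0 where "h0 x = ennreal (ph x ((U x - 0) / R)) * indicator (lev z R 0) x" for x
 have h0m: "h0 \<in> borel_measurable lebesgue" unfolding h0_def[abs_def]
  by (rule lebesgue_indicator_measurable[OF phU_measurable lev_measurable])
 have fin: "NL (%x. h0 x) < \<infinity>" unfolding h0_def
  by (rule phU_finite[OF bounded_subset[OF bounded_ball lev_subset(1)] order_trans[OF lev_subset(1) bV] lev_measurable R(1)])
 have "(%N. nnL (lev z R (real N)) (%x. h0 x)) \<longlonglongrightarrow> 0"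
 proof (rule nn_integral_vanishing[OF h0m _ fin])
  show "AE x in lebesgue. \<forall>\<^sub>F N in sequentially. x \<notin> lev z R (real N)"
  proof (rule AE_I2)
   fix x
   obtain N0 :: nat where "U x <= real N0" using real_arch_simple by blast
   then show "\<forall>\<^sub>F N in sequentially. x \<notin> lev z R (real N)"
    by (intro eventually_sequentiallyI[of N0]) (auto simp: lev_def)
  qed
 qed simp
 then have "\<forall>\<^sub>F N in sequentially. (nnL (lev z R (real N)) (%x. h0 x)) < ennreal y"
  using y by (intro order_tendstoD(2)) auto
 then obtain N where N: "nnL (lev z R (real N)) (%x. h0 x) < ennreal y"
  using eventually_happens'[OF sequentially_bot] by blast
 have "phU (lev z R (real N)) (real N) R <= nnL (lev z R (real N)) (%x. h0 x)"
 proof (rule nn_integral_mono, goal_cases)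
  case (1 x)
  show ?case
  proof (cases "x \<in> lev z R (real N)")
   case True
   then have "U x > real N" "x \<in> lev z R 0" by (auto simp: lev_def)
   moreover have "ph x ((U x - real N) / R) <= ph x ((U x - 0) / R)"
    by (rule ph_mono) (use \<open>U x > real N\<close> R in \<open>auto simp: abs_div_pos intro!: divide_right_mono\<close>)
   ultimately show ?thesis using True by (simp add: h0_def ennreal_leI)
  qed simp
 qed
 then have Y: "phU (lev z R (real N)) (real N) R <= ennreal (sup_const K\<^sub>1 (1 / L) * (1 / L) * R ^ DIM('a))"
  using N by (simp add: y_def)
 have "AE x in lborel. x \<in> ball z (R / 2) --> U x <= real N + R"
 proof (rule sup_bound[OF R(1) _ c K1 R(1) _ eL order_refl _ Y])
  show "R <= 1" using R rho0 by simp
  show "1 / L <= ph x (R / R)" if "x \<in> ball z R" for x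
  proof -
   have "x \<in> \<Omega>" using that bV V(2) by (meson subsetD)
   then show ?thesis using ph_one(1)[of x] R by simp
  qed
  fix x \<rho> assume "0 < \<rho>" "\<rho> <= R" "ball x \<rho> \<subseteq> ball z R"
  then show "dosc U (ball x \<rho>) <= ennreal (K\<^sub>1 * \<rho> powr (1 - real DIM('a) / s) * (vol (ball x \<rho>))\<^sup>2)"
   using R bV by (intro osc1) auto
 qed
 then show ?thesis by blast
qed

end

section \<open>Decay of oscillation\<close>

context local_qm_osc
begin

abbreviation "btw A a b \<equiv> AE x in lborel. x \<in> A --> a <= U x \<and> U x <= b"

text \<open>Comparison takes place on the ball of radius 2R, and an oscillation up to K gives
  difference quotients up to K/R = 2K/(2R); hence \<open>2 * K\<close>.\<close>

definition osc_cmp :: "real => real" where "osc_cmp K = cmp_const (2 * K)"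
definition osc_floor :: "real => real" where "osc_floor K = 1 / (L * (osc_cmp K * (L * 2 powr q)))"
text \<open>The fraction of the ball that the top level set may occupy so that its excess meets the
  hypothesis of \<open>sup_bound\<close>. One \<open>osc_cmp\<close> moves \<open>\<phi>\<close> to
  the centre, the other comes from the reference value used there.\<close>

definition osc_density :: "real => real" where
 "osc_density K = sup_const K (osc_floor K) / (unit_ball_vol (real DIM('a)) * (osc_cmp K * (osc_cmp K * (L * 2 powr q))))"
text \<open>The density left after \<open>N\<close> levels: \<open>S / N\<close> from gradients
  below the threshold, by disjointness of the level strips, and the power of \<open>S\<close> from
  gradients above it.\<close>

definition osc_bound :: "real => real => nat => real" where
 "osc_bound K S N = 8 * 2 ^ DIM('a) * (S / real N + L * L * osc_cmp K * osc_cmp K * cac_const * 2 ^ DIM('a) * S powr (1 - p))"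
definition osc_steps :: "real => nat" where
 "osc_steps K = (SOME N. 1 <= N \<and> (\<exists>S\<ge>1. osc_bound K S N <= osc_density K))"

lemma osc_pos:
 assumes K: "1 <= K"
 shows "1 <= osc_cmp K" "0 < osc_floor K" "0 < osc_density K"
proof -
 show c: "1 <= osc_cmp K" using cmp_const_ge1[of "2 * K"] K by (simp add: osc_cmp_def)
 show f: "0 < osc_floor K" using c L1 by (simp add: osc_floor_def)
 show "0 < osc_density K" using c L1 sup_pos(5)[OF K f] by (simp add: osc_density_def)
qed

text \<open>The order of choice matters: \<open>S\<close> is taken large to make the high-gradient
  part small, which uses \<open>p > 1\<close>, and \<open>N\<close> is taken large afterwards,
  depending on \<open>S\<close>.\<close>

lemma osc_steps:
 assumes K: "1 <= K"
 obtains S where "1 <= osc_steps K" "1 <= S" "osc_bound K S (osc_steps K) <= osc_density K"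
proof -
 define C where "C = 8 * 2 ^ DIM('a) * (L * L * osc_cmp K * osc_cmp K * cac_const * 2 ^ DIM('a))"
 have l: "((%S. C * S powr (1 - p)) \<longlongrightarrow> C * 0) at_top"
  by (intro tendsto_mult tendsto_const tendsto_neg_powr filterlim_ident) (use p1 in auto)
 have d: "0 < osc_density K / 2" using osc_pos(3)[OF K] by simp
 have "\<forall>\<^sub>F S in at_top. C * S powr (1 - p) < osc_density K / 2"
  by (rule order_tendstoD(2)[OF l]) (use d in simp)
 then have "\<forall>\<^sub>F S in at_top. C * S powr (1 - p) < osc_density K / 2 \<and> 1 <= S"
  by (intro eventually_conj eventually_ge_at_top)
 then obtain S where S: "C * S powr (1 - p) < osc_density K / 2" "1 <= S"
  using eventually_happens'[OF trivial_limit_at_top_linorder, of "%S::real. C * S powr (1 - p) < osc_density K / 2 \<and> 1 <= S"] by blast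
 have "(%n. (8 * 2 ^ DIM('a) * S) * inverse (real (Suc n))) \<longlonglongrightarrow> (8 * 2 ^ DIM('a) * S) * 0"
  by (intro tendsto_mult tendsto_const LIMSEQ_inverse_real_of_nat)
 then have "\<forall>\<^sub>F n in sequentially. (8 * 2 ^ DIM('a) * S) * inverse (real (Suc n)) < osc_density K / 2"
  by (rule order_tendstoD(2)) (use d in simp)
 then obtain n where n: "(8 * 2 ^ DIM('a) * S) * inverse (real (Suc n)) < osc_density K / 2"
  using eventually_happens'[OF sequentially_bot] by blast
 have "osc_bound K S (Suc n) = (8 * 2 ^ DIM('a) * S) * inverse (real (Suc n)) + C * S powr (1 - p)"
  by (simp add: osc_bound_def C_def distrib_left divide_inverse mult_ac)
 then have "osc_bound K S (Suc n) <= osc_density K" using n S by linarith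
 then have "\<exists>N. 1 <= N \<and> (\<exists>S\<ge>1. osc_bound K S N <= osc_density K)" using S by (intro exI[of _ "Suc n"]) auto
 from someI_ex[OF this] show ?thesis using that unfolding osc_steps_def by blast
qed

text \<open>One step of De Giorgi's chain of level sets: Poincare's inequality for the truncation between the levels
 \<open>k\<close> and \<open>k + h\<close>, whose gradient is supported on \<open>k < U <= k + h\<close>.\<close>

lemma level_jump:
 assumes R: "0 < R" and h: "0 < h"
  and half: "2 * vol (lev z R k) <= vol (ball z R)"
 shows "ennreal (h / R * vol (lev z R (k + h))) <= ennreal (4 * 2 ^ DIM('a)) *
  iB (lev z R k - lev z R (k + h)) (%x. norm (G x))"
proof -
 define B where "B = ball z R"
 define m where "m = vol B"
 have m0: "0 < m" using R by (simp add: m_def B_def content_ball)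
 have [measurable]: "B \<in> sets borel" by (simp add: B_def)
 obtain f1 g1 where w1: "W f1 g1" and f1: "!!x. x \<in> ball z R ==> f1 x = max (U x - k) 0"
  and g1: "!!x. x \<in> ball z R ==> g1 x = (if k < U x then G x else 0)"
  by (rule W_local_pos_part[OF R, of z k], rule that)
 obtain f2 g2 where w2: "W f2 g2" and f2: "!!x. x \<in> ball z R ==> f2 x = max (U x - (k + h)) 0"
  and g2: "!!x. x \<in> ball z R ==> g2 x = (if k + h < U x then G x else 0)"
  by (rule W_local_pos_part[OF R, of z "k + h"], rule that)
 \<comment> \<open>The difference of two positive parts is (U - k)_+ truncated at \<open>h\<close>:
   it equals \<open>h\<close> on \<open>A\<close> and 0 on \<open>E\<close>.\<close>
 define f g where "f x = f1 x - f2 x" and "g x = g1 x - g2 x" for x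
 have w: "W f g" unfolding f_def[abs_def] g_def[abs_def] by (rule W_diff[OF w1 w2])
 note [measurable] = W_measurable[OF w]
 define A where "A = lev z R (k + h)"
 define E where "E = B - lev z R k"
 have [measurable]: "A \<in> sets borel" "E \<in> sets borel" by (auto simp: A_def E_def)
 have AE_sub: "A \<subseteq> B" "E \<subseteq> B" using lev_subset(1) by (auto simp: A_def E_def B_def)
 have eA: "emeasure lborel A = ennreal (vol A)"
  by (rule emeasure_eq_ennreal_measure)
   (use emeasure_bounded_finite[OF bounded_subset[OF bounded_ball[of z R] AE_sub(1)[unfolded B_def]]] in auto)
 have eE: "emeasure lborel E = ennreal (vol E)"
  by (rule emeasure_eq_ennreal_measure)
   (use emeasure_bounded_finite[OF bounded_subset[OF bounded_ball[of z R] AE_sub(2)[unfolded B_def]]] in auto)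
 have mE: "m / 2 <= vol E"
 proof -
  have fm: "B \<in> fmeasurable lborel" unfolding B_def by (intro fmeasurableI) (auto simp: emeasure_ball_eq)
  have "vol E = m - vol (lev z R k)"
   unfolding E_def m_def by (rule measurable_measure_Diff[OF fm]) (use lev_subset(1) in \<open>auto simp: B_def\<close>)
  then show ?thesis using half by (simp add: m_def B_def)
 qed
 have "ennreal h * (ennreal (vol A) * ennreal (vol E)) =
  NB (%y. NB (%w. ennreal h * indicator A y * indicator E w))"
  by (simp add: nn_integral_cmult nn_integral_multc eA eE mult_ac)
 also have "... <= dosc' f B"
 proof (rule nn_integral_mono, goal_cases)
  case (1 y)
  show ?case
  proof (cases "y \<in> A")
   case True
   have yB: "y \<in> B" using True AE_sub by auto
   have fy: "f y = h" using True h by (auto simp: f_def f1 f2 A_def lev_def)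
   have "NB (%w. ennreal h * indicator A y * indicator E w) <= iB B (%w. \<bar>f y - f w\<bar>)"
   proof (rule nn_integral_mono, goal_cases)
    case (1 w)
    show ?case
    proof (cases "w \<in> E")
     case wE: True
     then have "w \<in> ball z R" "U w <= k" by (auto simp: E_def B_def lev_def)
     then have "f w = 0" using h by (simp add: f_def f1 f2)
     then show ?thesis using True wE AE_sub h fy by auto
    qed simp
   qed
   then show ?thesis using yB by simp
  qed simp
 qed
 also have "... <= ennreal (2 * R * vol (ball (0::'a) (2 * R))) * iB B (%x. norm (g x))"
  unfolding B_def by (rule ball_poincare[OF w R])
 also have "iB B (%x. norm (g x)) = iB (lev z R k - A) (%x. norm (G x))"
  by (rule nn_integral_cong) (use h in \<open>auto simp: B_def A_def lev_def indicator_def g_def g1 g2\<close>)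
 also have "vol (ball (0::'a) (2 * R)) = 2 ^ DIM('a) * m"
  using R by (simp add: m_def B_def content_ball power_mult_distrib)
 finally have main: "ennreal h * (ennreal (vol A) * ennreal (vol E)) <=
  ennreal (2 * R * (2 ^ DIM('a) * m)) * iB (lev z R k - A) (%x. norm (G x))" .
 have c0: "0 <= 2 / (R * m)" using R m0 by simp
 have "ennreal (h / R * vol A) <= ennreal (2 / (R * m)) * (ennreal h * (ennreal (vol A) * ennreal (vol E)))"
 proof -
  have "h / R * vol A = 2 / (R * m) * (h * (vol A * (m / 2)))" using R m0 by (simp add: field_simps)
  also have "... <= 2 / (R * m) * (h * (vol A * vol E))" using c0 h by (intro mult_left_mono mE) auto
  finally have "ennreal (h / R * vol A) <= ennreal (2 / (R * m) * (h * (vol A * vol E)))" by (rule ennreal_leI)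
  then show ?thesis using c0 h by (simp only: ennreal_mult measure_nonneg mult_nonneg_nonneg less_imp_le)
 qed
 also have "... <= ennreal (2 / (R * m)) * (ennreal (2 * R * (2 ^ DIM('a) * m)) * iB (lev z R k - A) (%x. norm (G x)))"
  by (rule mult_left_mono[OF main]) simp
 also have "... = ennreal (2 / (R * m)) * ennreal (2 * R * (2 ^ DIM('a) * m)) * iB (lev z R k - A) (%x. norm (G x))"
  by (rule mult.assoc[symmetric])
 also have "ennreal (2 / (R * m)) * ennreal (2 * R * (2 ^ DIM('a) * m)) = ennreal (2 / (R * m) * (2 * R * (2 ^ DIM('a) * m)))"
  by (rule ennreal_mult[symmetric]) (use R m0 in auto)
 also have "2 / (R * m) * (2 * R * (2 ^ DIM('a) * m)) = 4 * 2 ^ DIM('a)" using R m0 by (simp add: field_simps)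
 finally show ?thesis by (simp add: A_def)
qed

text \<open>Above the threshold \<open>S * t\<close>, (aInc) with exponent \<open>p\<close> compares
  \<open>t\<close> with \<open>S * t\<close>, and the linear version compares \<open>S * t\<close>
  with \<open>a\<close>. Splitting at a threshold takes the place of Hoelder's inequality in the
  chain of levels.\<close>

lemma grad_le_energy:
 assumes x: "x \<in> \<Omega>" and t: "0 < t" and S: "1 <= S" and a: "0 <= a"
 shows "a <= S * t + L * L * S powr (1 - p) * t / ph x t * ph x a"
proof (cases "a <= S * t")
 case True
 have "0 <= L * L * S powr (1 - p) * t / ph x t * ph x a"
  using t L1 by (intro mult_nonneg_nonneg divide_nonneg_nonneg) auto
 then show ?thesis using True by linarith
next
 case False
 have pt: "0 < ph x t" using ph_pos[OF x] t by simp
 have a0: "0 < a" using False t S by (smt (verit) mult_pos_pos)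
 have "ph x t = ph x (1 / S * (S * t))" using S by simp
 also have "... <= L * (1 / S) powr p * ph x (S * t)" by (rule ph_inc) (use S in auto)
 also have "(1 / S) powr p = S powr (- p)" using S by (simp add: powr_divide powr_minus_divide)
 finally have 1: "ph x t <= L * S powr (- p) * ph x (S * t)" .
 have "ph x (S * t) = ph x (S * t / a * a)" using a0 by simp
 also have "... <= L * (S * t / a) * ph x a" by (rule ph_inc1) (use False S t a0 in auto)
 finally have "ph x t <= L * S powr (- p) * (L * (S * t / a) * ph x a)"
  using 1 L1 by (smt (verit) mult_left_mono mult_nonneg_nonneg powr_ge_zero)
 then have "a * ph x t <= a * (L * S powr (- p) * (L * (S * t / a) * ph x a))" using a0 by (intro mult_left_mono) auto
 also have "... = L * L * (S powr (- p) * S) * t * ph x a" using a0 by simp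
 also have "S powr (- p) * S = S powr (1 - p)" using S by (simp add: powr_diff powr_minus_divide)
 finally have "a <= L * L * S powr (1 - p) * t / ph x t * ph x a" using pt by (simp add: field_simps)
 then show ?thesis using S t by (smt (verit) mult_nonneg_nonneg)
qed

text \<open>If the upper half of the range covers at most half of the ball, the chain of levels
  makes a higher level set thin, and \<open>sup_bound\<close> removes half of the range still above
  it. The lower bound on \<open>b - a\<close> keeps all difference quotients of the chain in the
  range of comparison.\<close>

lemma decay_above:
 assumes R: "0 < R" "2 * R <= 1" and c: "cball z (2 * R) \<subseteq> V" and K: "1 <= K"
  and U: "btw (ball z (2 * R)) a b"
  and ab: "a < b" "b - a <= K" and N: "2 ^ Suc (osc_steps K) * R <= b - a"
  and half: "2 * vol (lev z R (b - (b - a) / 2)) <= vol (ball z R)"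
 shows "AE x in lborel. x \<in> ball z (R / 2) --> U x <= b - (b - a) / 2 ^ (osc_steps K + 2)"
proof -
 define \<omega> where "\<omega> = b - a"
 define \<Lambda> where "\<Lambda> = osc_cmp K"
 define N where "N = osc_steps K"
 define m where "m = vol (ball z R)"
 have \<omega>: "0 < \<omega>" "\<omega> <= K" using ab by (auto simp: \<omega>_def)
 have \<Lambda>: "1 <= \<Lambda>" using osc_pos(1)[OF K] by (simp add: \<Lambda>_def)
 have m: "0 < m" "m = unit_ball_vol (real DIM('a)) * R ^ DIM('a)" using R by (auto simp: m_def content_ball)
 obtain S where S: "1 <= N" "1 <= S" "osc_bound K S N <= osc_density K"
  using osc_steps[OF K] unfolding N_def by blast
 have bV: "ball z (2 * R) \<subseteq> V" using c by (meson ball_subset_cball order_trans)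
 have b\<Omega>: "x \<in> \<Omega>" if "x \<in> ball z (2 * R)" for x using that bV V(2) by blast
 have bR: "x \<in> ball z (2 * R)" if "x \<in> ball z R" for x using that R by auto
 have z\<Omega>: "z \<in> \<Omega>" using b\<Omega>[of z] R by simp
 define h where "h i = \<omega> / 2 ^ i" for i :: nat
 define k where "k i = b - h i" for i
 define t where "t i = h i / R" for i
 define A where "A i = lev z R (k i)" for i
 have h: "0 < h i" "h (Suc i) = h i / 2" "h i <= \<omega>" "j <= i ==> h i <= h j" for i j
 proof -
  show "0 < h i" "h (Suc i) = h i / 2" using \<omega> by (auto simp: h_def)
  show mono: "j <= i ==> h i <= h j" for j unfolding h_def using \<omega> by (intro divide_left_mono power_increasing) auto
  show "h i <= \<omega>" using mono[of 0] by (simp add: h_def)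
 qed
 have t0: "0 < t i" for i using h(1)[of i] R by (simp add: t_def)
 \<comment> \<open>This is where the lower bound on the oscillation is used; with quotients below 1,
   (A1-s) would only give an additive bound.\<close>
 have t1: "1 <= t i" if "i <= Suc N" for i
 proof -
  have "R <= h (Suc N)" using assms(8) by (simp add: h_def N_def \<omega>_def field_simps)
  also have "... <= h i" by (rule h(4)[OF that])
  finally show ?thesis using R by (simp add: t_def)
 qed
 \<comment> \<open>A bounded oscillation gives quotients of order \<open>1 / R\<close>, which lies
   in the admissible range because \<open>s\<close> is at most the dimension and
   \<open>2 * R <= 1\<close>.\<close>
 have tK: "t i <= 2 * K * (2 * R) powr (- (real DIM('a) / s))" for i
 proof -
  have "t i <= K / R" unfolding t_def using h(3)[of i] \<omega> R by (intro divide_right_mono) auto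
  also have "... = 2 * K * (2 * R) powr (- 1)" using R by (simp add: powr_minus_divide)
  also have "... <= 2 * K * (2 * R) powr (- (real DIM('a) / s))"
   using K R ns by (intro mult_left_mono powr_mono') auto
  finally show ?thesis .
 qed
 have cmp: "ph x (t i) <= \<Lambda> * ph y (t i)" if "x \<in> ball z (2 * R)" "y \<in> ball z (2 * R)" "i <= Suc N" for x y i
  unfolding \<Lambda>_def osc_cmp_def
  by (rule ph_compare[OF _ _ R(2) that(1,2) b\<Omega>[OF that(2)] t1[OF that(3)] tK]) (use K R in auto)
 have zB: "z \<in> ball z (2 * R)" using R by simp
 have pz: "0 < ph z (t i)" for i using ph_pos[OF z\<Omega>] t0[of i] by simp
 have Ule: "AE x in lebesgue. x \<in> ball z (2 * R) --> U x <= b"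
  using U by (auto simp: AE_completion_iff)
 have energy: "phL (A i) G <= ennreal (cac_const * \<Lambda> * 2 ^ DIM('a) * m * ph z (t i))"
  if i: "i <= Suc N" for i
 proof -
  have "phL (A i) G <= ennreal cac_const * phU (lev z (2 * R) (k i)) (k i) (2 * R - R)"
   unfolding A_def by (rule caccioppoli[OF R(1) _ c]) (use R in simp)
  also have "phU (lev z (2 * R) (k i)) (k i) (2 * R - R) <= NL (%x. ennreal (\<Lambda> * ph z (t i)) * indicator (ball z (2 * R)) x)"
  proof (rule nn_integral_mono_AE)
   show "AE x in lebesgue. ennreal (ph x ((U x - k i) / (2 * R - R))) * indicator (lev z (2 * R) (k i)) x <= ennreal (\<Lambda> * ph z (t i)) * indicator (ball z (2 * R)) x"
    using Ule
   proof eventually_elim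
    case (elim x)
    show ?case
    proof (cases "x \<in> lev z (2 * R) (k i)")
     case True
     then have x: "x \<in> ball z (2 * R)" "k i < U x" by (auto simp: lev_def)
     have "ph x ((U x - k i) / (2 * R - R)) <= ph x (t i)"
     proof (rule ph_mono)
      have "U x - k i <= h i" using elim x by (simp add: k_def)
      then show "\<bar>(U x - k i) / (2 * R - R)\<bar> <= \<bar>t i\<bar>"
       using x R h(1)[of i] by (simp add: t_def divide_right_mono)
     qed
     also have "... <= \<Lambda> * ph z (t i)" by (rule cmp[OF x(1) zB i])
     finally show ?thesis using x True by (simp add: ennreal_leI)
    qed simp
   qed
  qed
  also have "... = ennreal (\<Lambda> * ph z (t i)) * emeasure lborel (ball z (2 * R))"
   by (subst nn_integral_cmult_indicator) auto
  also have "... = ennreal (\<Lambda> * ph z (t i)) * ennreal (2 ^ DIM('a) * m)"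
   using R by (simp add: emeasure_ball_eq m content_ball power_mult_distrib mult_ac)
  also have "ennreal cac_const * (ennreal (\<Lambda> * ph z (t i)) * ennreal (2 ^ DIM('a) * m)) = ennreal (cac_const * (\<Lambda> * ph z (t i) * (2 ^ DIM('a) * m)))"
   using cac_const_nonneg \<Lambda> m(1) by (simp only: ennreal_mult ph_nonneg mult_nonneg_nonneg less_imp_le zero_le_power zero_le_numeral)
  finally have "phL (A i) G <= ennreal (cac_const * (\<Lambda> * ph z (t i) * (2 ^ DIM('a) * m)))"
   by (simp add: mult_left_mono)
  then show ?thesis by (simp only: mult_ac)
 qed
 have eA: "emeasure lborel X = ennreal (vol X)" if "X \<subseteq> A i" for X i
 proof (rule emeasure_eq_ennreal_measure)
  have "bounded X" using that lev_subset(1) bounded_ball unfolding A_def by (meson bounded_subset)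
  from emeasure_bounded_finite[OF this] show "emeasure lborel X \<noteq> top" by simp
 qed
 have Am[measurable]: "A i \<in> sets borel" for i by (simp add: A_def)
 have mA: "vol (A j) <= vol (A i)" if "i <= j" for i j
 proof -
  have "A j \<subseteq> A i" using h(4)[OF that] by (auto simp: A_def lev_def k_def)
  then have "emeasure lborel (A j) <= emeasure lborel (A i)" by (rule emeasure_mono) simp
  then show ?thesis using eA[OF order_refl] by simp
 qed
 define C where "C = L * L * \<Lambda> * \<Lambda> * cac_const * 2 ^ DIM('a) * S powr (1 - p)"
 have C0: "0 <= C" using L1 \<Lambda> cac_const_nonneg by (simp add: C_def)
 have step: "vol (A (Suc i)) <= 8 * 2 ^ DIM('a) * (S * (vol (A i) - vol (A (Suc i))) + C * m)"
  if i: "1 <= i" "i <= N" for i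
 proof -
  have kS: "k (Suc i) = k i + h i / 2" using h(2)[of i] by (simp add: k_def)
  have sub: "A (Suc i) \<subseteq> A i" using h(1)[of i] by (auto simp: A_def lev_def kS)
  define D where "D = A i - A (Suc i)"
  have [measurable]: "D \<in> sets borel" by (simp add: D_def)
  have mD: "vol D = vol (A i) - vol (A (Suc i))"
   unfolding D_def by (rule measurable_measure_Diff[OF _ _ sub]) (auto intro!: fmeasurableI simp: eA[OF order_refl])
  \<comment> \<open>The weight of the energy in \<open>grad_le_energy\<close>, with
    \<open>ph x (t i)\<close> replaced by its lower bound at the centre so that it is constant in
    \<open>x\<close>.\<close>
  define c1 where "c1 = L * L * S powr (1 - p) * t i / (ph z (t i) / \<Lambda>)"
  have c1: "0 <= c1" using L1 t0[of i] \<Lambda> pz[of i] by (simp add: c1_def)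
  have "2 * vol (lev z R (k i)) <= vol (ball z R)"
   using mA[OF i(1)] assms(9) by (simp add: A_def k_def h_def \<omega>_def)
  then have "ennreal (h i / 2 / R * vol (lev z R (k i + h i / 2))) <= ennreal (4 * 2 ^ DIM('a)) *
   iB (lev z R (k i) - lev z R (k i + h i / 2)) (%x. norm (G x))"
   by (intro level_jump R(1)) (use h(1)[of i] in simp)
  then have "ennreal (t i / 2 * vol (A (Suc i))) <= ennreal (4 * 2 ^ DIM('a)) * iB D (%x. norm (G x))"
   by (simp add: D_def A_def kS t_def mult_ac)
  also have "iB D (%x. norm (G x)) = iL D (%x. norm (G x))" by (simp add: nn_integral_completion)
  also have "... <= NL (%x. ennreal (S * t i) * indicator D x + ennreal c1 * (ennreal (ph x (norm (G x))) * indicator (A i) x))"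
  proof (rule nn_integral_mono, goal_cases)
   case (1 x)
   show ?case
   proof (cases "x \<in> D")
    case True
    then have x: "x \<in> A i" "x \<in> ball z (2 * R)" using bR by (auto simp: D_def A_def lev_def)
    have "norm (G x) <= S * t i + L * L * S powr (1 - p) * t i / ph x (t i) * ph x (norm (G x))"
     by (rule grad_le_energy[OF b\<Omega>[OF x(2)] t0 S(2)]) simp
    also have "L * L * S powr (1 - p) * t i / ph x (t i) <= c1"
     unfolding c1_def
    proof (rule divide_left_mono)
     show "ph z (t i) / \<Lambda> <= ph x (t i)" using cmp[OF zB x(2), of i] i \<Lambda> by (simp add: field_simps)
     show "0 <= L * L * S powr (1 - p) * t i" using L1 t0[of i] by simp
     show "0 < ph x (t i) * (ph z (t i) / \<Lambda>)" using ph_pos[OF b\<Omega>[OF x(2)], of "t i"] t0[of i] pz[of i] \<Lambda> by simp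
    qed
    finally have "norm (G x) <= S * t i + c1 * ph x (norm (G x))" by (simp add: mult_right_mono)
    then have "ennreal (norm (G x)) <= ennreal (S * t i + c1 * ph x (norm (G x)))" by (rule ennreal_leI)
    also have "... = ennreal (S * t i) + ennreal (c1 * ph x (norm (G x)))"
     by (rule ennreal_plus) (use c1 S t0[of i] in auto)
    also have "ennreal (c1 * ph x (norm (G x))) = ennreal c1 * ennreal (ph x (norm (G x)))" by (rule ennreal_mult) (use c1 in auto)
    finally show ?thesis using True x by simp
   qed simp
  qed
  also have "... = ennreal (S * t i) * emeasure lebesgue D + ennreal c1 * phL (A i) G"
  proof -
   have m1: "(%x. ennreal (ph x (norm (G x))) * indicator (A i) x) \<in> borel_measurable lebesgue"
    by (rule lebesgue_indicator_measurable[OF phG_measurable Am])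
   have m2: "(%x. ennreal (S * t i) * indicator D x) \<in> borel_measurable lebesgue"
    by (rule lebesgue_indicator_measurable) auto
   show ?thesis
    by (subst nn_integral_add[OF m2 borel_measurable_times_ennreal[OF borel_measurable_const m1]])
     (simp add: nn_integral_cmult[OF m1] nn_integral_cmult_indicator)
  qed
  also have "... <= ennreal (S * t i) * ennreal (vol D) + ennreal c1 * ennreal (cac_const * \<Lambda> * 2 ^ DIM('a) * m * ph z (t i))"
  proof (intro add_mono mult_left_mono energy)
   show "emeasure lebesgue D <= ennreal (vol D)" using eA[of D i] by (simp add: D_def)
  qed (use i in auto)
  also have "... = ennreal (S * t i * vol D + c1 * (cac_const * \<Lambda> * 2 ^ DIM('a) * m * ph z (t i)))"
  proof -
   have "0 <= cac_const * \<Lambda> * 2 ^ DIM('a) * m * ph z (t i)" using cac_const_nonneg \<Lambda> m by simp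
   then show ?thesis using c1 S t0[of i]
    by (subst ennreal_plus) (auto simp only: ennreal_mult measure_nonneg mult_nonneg_nonneg less_imp_le intro!: mult_nonneg_nonneg)
  qed
  also have "c1 * (cac_const * \<Lambda> * 2 ^ DIM('a) * m * ph z (t i)) = t i * (C * m)"
   using pz[of i] \<Lambda> by (simp add: c1_def C_def)
  also have "S * t i * vol D + t i * (C * m) = t i * (S * vol D + C * m)" by (simp add: algebra_simps)
  also have "ennreal (4 * 2 ^ DIM('a)) * ennreal (t i * (S * vol D + C * m)) = ennreal (4 * 2 ^ DIM('a) * (t i * (S * vol D + C * m)))"
   by (rule ennreal_mult[symmetric]) (use t0[of i] S C0 m in auto)
  finally have "ennreal (t i / 2 * vol (A (Suc i))) <= ennreal (4 * 2 ^ DIM('a) * (t i * (S * vol D + C * m)))"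
   by (simp add: mult_left_mono)
  moreover have "0 <= 4 * 2 ^ DIM('a) * (t i * (S * vol D + C * m))"
   using t0[of i] S C0 m(1) by (intro mult_nonneg_nonneg add_nonneg_nonneg) auto
  ultimately have "t i / 2 * vol (A (Suc i)) <= 4 * 2 ^ DIM('a) * (t i * (S * vol D + C * m))"
   by (simp only: ennreal_le_iff)
  then have "t i * vol (A (Suc i)) <= t i * (8 * 2 ^ DIM('a) * (S * vol D + C * m))" by (simp add: algebra_simps)
  then show ?thesis using t0[of i] by (simp add: mD)
 qed
 have mA1: "vol (A 1) <= m" using assms(9) measure_nonneg[of lborel "lev z R (b - (b - a) / 2)"]
  unfolding A_def k_def h_def \<omega>_def m_def power_one_right by linarith
 \<comment> \<open>Summing over the levels telescopes the measures of the strips, whose total is at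
   most \<open>m\<close>, while the last level set is contained in all the earlier ones.\<close>
 have small: "vol (A (Suc N)) <= osc_density K * m"
 proof -
  have sum: "real n * vol (A (Suc N)) <= 8 * 2 ^ DIM('a) * (S * (vol (A 1) - vol (A (Suc n))) + real n * (C * m))" if "n <= N" for n
   using that
  proof (induction n)
   case (Suc n)
   have "vol (A (Suc N)) <= vol (A (Suc (Suc n)))" by (rule mA) (use Suc in simp)
   also have "... <= 8 * 2 ^ DIM('a) * (S * (vol (A (Suc n)) - vol (A (Suc (Suc n)))) + C * m)"
    by (rule step) (use Suc in auto)
   finally show ?case using Suc by (simp add: algebra_simps)
  qed simp
  have "real N * vol (A (Suc N)) <= 8 * 2 ^ DIM('a) * (S * (vol (A 1) - vol (A (Suc N))) + real N * (C * m))" by (rule sum) simp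
  also have "... <= 8 * 2 ^ DIM('a) * (S * m + real N * (C * m))"
   using S mA1 by (intro mult_left_mono add_right_mono) (auto intro: order_trans[OF _ mA1])
  also have "... = real N * (osc_bound K S N * m)"
   using S by (simp add: osc_bound_def C_def \<Lambda>_def field_simps)
  finally have "vol (A (Suc N)) <= osc_bound K S N * m" using S(1) by simp
  also have "... <= osc_density K * m" by (rule mult_right_mono[OF S(3)]) (use m in simp)
  finally show ?thesis .
 qed
 define \<phi>\<^sub>0 where "\<phi>\<^sub>0 = ph z (t (Suc N)) / (\<Lambda> * (L * 2 powr q))"
 \<comment> \<open>Starting from the thin level \<open>k (Suc N)\<close>, half of the remaining
   height is kept as the rise; this gives the exponent \<open>osc_steps K + 2\<close> in the
   conclusion.\<close>
 have "AE x in lborel. x \<in> ball z (R / 2) --> U x <= k (Suc N) + h (Suc N) / 2"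
 proof (rule sup_bound[OF R(1) _ _ K _ _ osc_pos(2)[OF K]])
  show "R <= 1" using R by simp
  show "cball z R \<subseteq> V" using c subset_cball[of R "2 * R" z] R by simp
  show "0 < h (Suc N) / 2" using h(1) by simp
  show "osc_floor K <= \<phi>\<^sub>0"
  proof -
   have "1 / L <= ph z (t (Suc N))" by (rule ph_ge[OF z\<Omega>]) (use t1[of "Suc N"] in simp)
   then have "1 / L / (\<Lambda> * (L * 2 powr q)) <= \<phi>\<^sub>0" unfolding \<phi>\<^sub>0_def using \<Lambda> L1 by (intro divide_right_mono) auto
   then show ?thesis by (simp add: osc_floor_def \<Lambda>_def)
  qed
  show "\<phi>\<^sub>0 <= ph x (h (Suc N) / 2 / R)" if x: "x \<in> ball z R" for x
  proof -
   have "ph x (t (Suc N)) <= L * 2 powr q * ph x (h (Suc N) / 2 / R)" by (rule ph_dec_bound) (auto simp: t_def abs_mult)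
   then have "\<Lambda> * ph x (t (Suc N)) <= \<Lambda> * (L * 2 powr q * ph x (h (Suc N) / 2 / R))" using \<Lambda> by (intro mult_left_mono) auto
   then have "ph z (t (Suc N)) <= \<Lambda> * (L * 2 powr q) * ph x (h (Suc N) / 2 / R)"
    using cmp[OF zB bR[OF x], of "Suc N"] by (simp add: mult.assoc)
   then show ?thesis unfolding \<phi>\<^sub>0_def using \<Lambda> L1 by (simp add: divide_le_eq mult_ac)
  qed
  show "iL (lev z R (k (Suc N))) (%x. ph x ((U x - k (Suc N)) / R)) <= ennreal (sup_const K (osc_floor K) * \<phi>\<^sub>0 * R ^ DIM('a))"
  proof -
   have "iL (lev z R (k (Suc N))) (%x. ph x ((U x - k (Suc N)) / R)) <= NL (%x. ennreal (\<Lambda> * ph z (t (Suc N))) * indicator (A (Suc N)) x)"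
   proof (rule nn_integral_mono_AE)
    show "AE x in lebesgue. ennreal (ph x ((U x - k (Suc N)) / R)) * indicator (lev z R (k (Suc N))) x <= ennreal (\<Lambda> * ph z (t (Suc N))) * indicator (A (Suc N)) x"
     using Ule
    proof eventually_elim
     case (elim x)
     show ?case
     proof (cases "x \<in> A (Suc N)")
      case True
      then have x: "x \<in> ball z R" "k (Suc N) < U x" by (auto simp: A_def lev_def)
      have "ph x ((U x - k (Suc N)) / R) <= ph x (t (Suc N))"
      proof (rule ph_mono)
       have "U x - k (Suc N) <= h (Suc N)" using elim bR[OF x(1)] by (simp add: k_def)
       then show "\<bar>(U x - k (Suc N)) / R\<bar> <= \<bar>t (Suc N)\<bar>"
        using x R h(1)[of "Suc N"] by (simp add: t_def divide_right_mono)
      qed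
      also have "... <= \<Lambda> * ph z (t (Suc N))" by (rule cmp[OF bR[OF x(1)] zB]) simp
      finally show ?thesis using True by (simp add: A_def ennreal_leI)
     qed (simp add: A_def)
    qed
   qed
   also have "... = ennreal (\<Lambda> * ph z (t (Suc N))) * emeasure lborel (A (Suc N))"
    by (subst nn_integral_cmult_indicator) auto
   also have "... = ennreal (\<Lambda> * ph z (t (Suc N)) * vol (A (Suc N)))"
    unfolding eA[OF order_refl] by (rule ennreal_mult[symmetric]) (use \<Lambda> in auto)
   also have "... <= ennreal (\<Lambda> * ph z (t (Suc N)) * (osc_density K * m))"
    using \<Lambda> small by (intro ennreal_leI mult_left_mono) auto
   also have "\<Lambda> * ph z (t (Suc N)) * (osc_density K * m) = sup_const K (osc_floor K) * \<phi>\<^sub>0 * R ^ DIM('a)"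
    using \<Lambda> L1 R unit_ball_vol_pos[of "real DIM('a)"] by (simp add: osc_density_def \<phi>\<^sub>0_def m(2) \<Lambda>_def[symmetric] del: unit_ball_vol_pos)
   finally show ?thesis .
  qed
  \<comment> \<open>Boundedness of the range alone yields the oscillation hypothesis with constant
    \<open>K\<close>, as the exponent of \<open>\<rho>\<close> is not positive. So
    \<open>K\<^sub>1\<close> does not enter the decay.\<close>
  fix x \<rho> assume \<rho>: "0 < \<rho>" "\<rho> <= R" "ball x \<rho> \<subseteq> ball z R"
  have Ub: "btw (ball x \<rho>) a b"
   using U by eventually_elim (use \<rho>(3) bR in blast)
  have "dosc U (ball x \<rho>) <= NB (%w. ennreal (K * vol (ball x \<rho>)) * indicator (ball x \<rho>) w)"
  proof (rule nn_integral_mono_AE)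
   show "AE w in lborel. (iB (ball x \<rho>) (%y. \<bar>U y - U w\<bar>)) * indicator (ball x \<rho>) w <= ennreal (K * vol (ball x \<rho>)) * indicator (ball x \<rho>) w"
    using Ub
   proof eventually_elim
    case (elim w)
    show ?case
    proof (cases "w \<in> ball x \<rho>")
     case True
     have "iB (ball x \<rho>) (%y. \<bar>U y - U w\<bar>) <= NB (%y. ennreal K * indicator (ball x \<rho>) y)"
     proof (rule nn_integral_mono_AE)
      show "AE y in lborel. ennreal \<bar>U y - U w\<bar> * indicator (ball x \<rho>) y <= ennreal K * indicator (ball x \<rho>) y"
       using Ub by eventually_elim (use elim True ab in \<open>auto simp: indicator_def intro!: ennreal_leI\<close>)
     qed
     also have "... = ennreal (K * vol (ball x \<rho>))"
      using K by (simp add: nn_integral_cmult_indicator emeasure_ball_eq ennreal_mult)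
     finally show ?thesis using True by simp
    qed simp
   qed
  qed
  also have "... = ennreal (K * 1 * (vol (ball x \<rho>))\<^sup>2)"
   using K by (simp add: nn_integral_cmult_indicator emeasure_ball_eq power2_eq_square mult.assoc flip: ennreal_mult)
  also have "... <= ennreal (K * \<rho> powr (1 - real DIM('a) / s) * (vol (ball x \<rho>))\<^sup>2)"
  proof (intro ennreal_leI mult_right_mono mult_left_mono)
   have "\<rho> powr 0 <= \<rho> powr (1 - real DIM('a) / s)" using \<rho> R ns by (intro powr_mono') auto
   then show "1 <= \<rho> powr (1 - real DIM('a) / s)" using \<rho> by simp
  qed (use K in auto)
  finally show "dosc U (ball x \<rho>) <= ennreal (K * \<rho> powr (1 - real DIM('a) / s) * (vol (ball x \<rho>))\<^sup>2)" .
 qed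
 moreover have "k (Suc N) + h (Suc N) / 2 = b - (b - a) / 2 ^ (osc_steps K + 2)"
  by (simp add: k_def h_def \<omega>_def N_def field_simps)
 ultimately show ?thesis by simp
qed

end

section \<open>The Hoelder exponent and iteration of the decay\<close>

definition osc_ratio :: "nat => real" where "osc_ratio N = 1 - 1 / 2 ^ (N + 2)"
text \<open>Base 4 because one reduction passes from radius \<open>2 * R\<close> to
  \<open>R / 2\<close>. The exponent is below 1 as the reduction factor is at least 3/4, above
  1/4.\<close>

definition holder_exp :: "nat => real" where "holder_exp N = - log 4 (osc_ratio N)"

lemma osc_ratio: "3 / 4 <= osc_ratio N" "osc_ratio N < 1"
proof -
 have "(1::real) / 2 ^ (N + 2) <= 1 / 2 ^ 2" by (intro divide_left_mono power_increasing) auto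
 then show "3 / 4 <= osc_ratio N" by (simp add: osc_ratio_def)
qed (simp add: osc_ratio_def)

lemma holder_exp: "0 < holder_exp N" "holder_exp N < 1" "4 powr (- holder_exp N) = osc_ratio N"
proof -
 note o = osc_ratio[of N]
 show "0 < holder_exp N" using o by (simp add: holder_exp_def)
 have "log 4 (1 / 4) < log 4 (osc_ratio N)" by (subst log_less_cancel_iff) (use o in auto)
 then show "holder_exp N < 1" by (simp add: holder_exp_def log_divide)
 show "4 powr (- holder_exp N) = osc_ratio N" using o by (simp add: holder_exp_def)
qed

context local_qm_osc
begin

text \<open>All assumptions are invariant under change of sign, with the same constants; this turns
  upper bounds into lower ones.\<close>

lemma mirror: "local_qm_osc \<phi> \<Omega> p q L s L\<omega> (%x. - U x) (%x. - G x) V Q K\<^sub>1 \<rho>\<^sub>0"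
proof (intro local_qm_osc.intro local_qm.intro local_qm_axioms.intro local_qm_osc_axioms.intro phi_A1_axioms)
 have ph_minus: "ph x (- t) = ph x t" for x t by (metis ph_abs abs_minus_cancel)
 show "W (%x. - U x) (%x. - G x)" using W_cmult[OF UG, of "-1"] by simp
 show "iL V (%x. ph x (- U x)) < \<infinity>" using finU by (simp add: ph_minus)
 show "phL V (%x. - G x) < \<infinity>" using finG by simp
 fix F H K assume a: "W F H" "compact K" "K \<subseteq> V" "!!x. x \<notin> K ==> F x = 0" "\<exists>M. \<forall>x. \<bar>F x\<bar> <= M"
  "IL (%x. ph x (norm (H x))) < \<infinity>"
 have "phL (closure {x. - F x \<noteq> 0}) G
    <= ennreal Q * phL (closure {x. - F x \<noteq> 0}) (%x. G x - - H x)"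
  using W_cmult[OF a(1), of "-1"] a by (intro qm[OF _ a(2,3)]) auto
 moreover have "norm (- G x - H x) = norm (G x - - H x)" for x
  by (metis add_uminus_conv_diff diff_minus_eq_add minus_add_distrib norm_minus_cancel)
 ultimately show "phL (closure {x. F x \<noteq> 0}) (%x. - G x)
    <= ennreal Q * phL (closure {x. F x \<noteq> 0}) (%x. - G x - H x)"
  by simp
next
 fix x :: 'a and \<rho> :: real assume a: "0 < \<rho>" "\<rho> <= \<rho>\<^sub>0" "ball x \<rho> \<subseteq> V"
 have "\<bar>- U y - - U w\<bar> = \<bar>U y - U w\<bar>" for y w by simp
 then show "nnB (ball x \<rho>) (%w. iB (ball x \<rho>) (%y. \<bar>- U y - - U w\<bar>))
    <= ennreal (K\<^sub>1 * \<rho> powr (1 - real DIM('a) / s) * (vol (ball x \<rho>))\<^sup>2)"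
  using osc1[OF a] by (simp only:)
 show "iB (ball x \<rho>) (%w. \<bar>- U w\<bar>) <= ennreal (K\<^sub>1 * \<rho> powr (- (real DIM('a) / s)) * vol (ball x \<rho>))"
  using avg1[OF a] by simp
qed (use V Q1 K1 rho0 in auto)

lemma decay:
 assumes R: "0 < R" "2 * R <= 1" and c: "cball z (2 * R) \<subseteq> V" and K: "1 <= K"
  and U: "btw (ball z (2 * R)) a b" and ab: "b - a <= K"
 obtains a' b' where "btw (ball z (R / 2)) a' b'" "a <= a'" "b' <= b"
  "b' - a' <= max (osc_ratio (osc_steps K) * (b - a)) (2 ^ Suc (osc_steps K) * R)"
proof (cases "2 ^ Suc (osc_steps K) * R <= b - a")
 case True
 define \<delta> where "\<delta> = (b - a) / 2 ^ (osc_steps K + 2)"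
 have "0 < 2 ^ Suc (osc_steps K) * R" using R by simp
 then have ab0: "a < b" using True by linarith
 then have \<delta>: "0 <= \<delta>" by (simp add: \<delta>_def)
 have e: "b - a - \<delta> = osc_ratio (osc_steps K) * (b - a)" by (simp add: \<delta>_def osc_ratio_def left_diff_distrib)
 have U': "btw (ball z (R / 2)) a b"
  using U by eventually_elim (use R in auto)
 show ?thesis
 proof (cases "2 * vol (lev z R (b - (b - a) / 2)) <= vol (ball z R)")
  case half: True
  have "AE x in lborel. x \<in> ball z (R / 2) --> U x <= b - \<delta>"
   unfolding \<delta>_def by (rule decay_above[OF R c K U ab0 ab True half])
  then have "AE x in lborel. x \<in> ball z (R / 2) --> a <= U x \<and> U x <= b - \<delta>" using U' by eventually_elim auto
  then show ?thesis by (rule that) (use \<delta> e in auto)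
 next
  case False
  define B where "B = ball z R"
  define E where "E = lev z R (b - (b - a) / 2)"
  \<comment> \<open>The level set of \<open>-U\<close> above the midpoint of its range. It is
    disjoint from \<open>E\<close>, so if \<open>E\<close> fills more than half of the ball,
    \<open>E'\<close> fills less.\<close>
  define E' where "E' = local_qm_osc.lev (%x. - U x) z R (- a - (- a - - b) / 2)"
  have E': "E' = {x \<in> B. U x < b - (b - a) / 2}"
  proof -
   have "- a - (- a - - b) / 2 < - U x \<longleftrightarrow> U x < b - (b - a) / 2" for x by argo
   then show ?thesis by (simp add: E'_def local_qm_osc.lev_def[OF mirror] B_def)
  qed
  have [measurable]: "E' \<in> sets borel" unfolding E'_def by (rule local_qm_osc.lev_measurable[OF mirror])
  have [measurable]: "E \<in> sets borel" by (simp add: E_def)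
  have fm: "B \<in> fmeasurable lborel" by (intro fmeasurableI) (auto simp: emeasure_ball_eq B_def)
  have sub: "E \<subseteq> B" "E' \<subseteq> B" "E \<inter> E' = {}" using lev_subset(1) by (auto simp: E_def E' B_def lev_def)
  have fE: "E \<in> fmeasurable lborel" "E' \<in> fmeasurable lborel" by (rule fmeasurableI2[OF fm]; use sub in auto)+
  have "vol E + vol E' = vol (E \<union> E')"
   by (rule measure_Union[symmetric]) (use sub fE in \<open>auto simp: fmeasurable_def\<close>)
  also have "... <= vol B" by (rule measure_mono_fmeasurable) (use sub fm in auto)
  finally have half: "2 * vol E' <= vol (ball z R)" using False by (simp add: E_def B_def)
  have Um: "AE x in lborel. x \<in> ball z (2 * R) --> - b <= - U x \<and> - U x <= - a"
   using U by eventually_elim auto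
  have "AE x in lborel. x \<in> ball z (R / 2) --> - U x <= - a - (- a - - b) / 2 ^ (osc_steps K + 2)"
   by (rule local_qm_osc.decay_above[OF mirror R c K Um]) (use ab0 ab True half in \<open>auto simp: E'_def\<close>)
  then have "AE x in lborel. x \<in> ball z (R / 2) --> a + \<delta> <= U x \<and> U x <= b"
   using U' by eventually_elim (auto simp: \<delta>_def)
  then show ?thesis by (rule that) (use \<delta> e in auto)
 qed
next
 case False
 have "btw (ball z (R / 2)) a b"
  using U by eventually_elim (use R in auto)
 then show ?thesis by (rule that) (use False in auto)
qed

text \<open>\<open>A\<close> dominates both the initial oscillation and the error proportional to
  the radius. The errors fall like (1/4)^j, faster than the power of the reduction factor, so the
  maximum in \<open>decay\<close> never obstructs the rate.\<close>

lemma decay_iterated: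
 assumes r: "0 < r" "r <= 1" and c: "cball z r \<subseteq> V" and K: "1 <= K"
  and U: "btw (ball z r) a b" and ab: "b - a <= K"
  and A: "b - a <= A" "2 ^ osc_steps K * r <= osc_ratio (osc_steps K) * A"
 shows "\<exists>a' b'. btw (ball z (r / 4 ^ j)) a' b' \<and> a <= a' \<and> b' <= b \<and>
  b' - a' <= A * osc_ratio (osc_steps K) ^ j"
proof (induction j)
 case 0
 show ?case using U A(1) by (intro exI[of _ a] exI[of _ b]) simp
next
 case (Suc j)
 define \<theta> where "\<theta> = osc_ratio (osc_steps K)"
 have \<theta>: "3 / 4 <= \<theta>" "\<theta> < 1" using osc_ratio by (auto simp: \<theta>_def)
 define R where "R = r / 4 ^ j / 2"
 have R0: "0 < R" using r by (simp add: R_def)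
 have "r / 4 ^ j <= r / 1" using r by (intro divide_left_mono) auto
 then have R: "2 * R <= r" by (simp add: R_def)
 obtain a1 b1 where 1: "btw (ball z (2 * R)) a1 b1" "a <= a1" "b1 <= b" "b1 - a1 <= A * \<theta> ^ j"
  using Suc by (auto simp: R_def \<theta>_def)
 obtain a2 b2 where 2: "btw (ball z (R / 2)) a2 b2" "a1 <= a2" "b2 <= b1"
  "b2 - a2 <= max (\<theta> * (b1 - a1)) (2 ^ Suc (osc_steps K) * R)"
 proof (rule decay[OF R0 _ _ K 1(1), unfolded \<theta>_def[symmetric]])
  show "2 * R <= 1" using R r by simp
  show "cball z (2 * R) \<subseteq> V" using c subset_cball[OF R] by (rule order_trans[rotated])
  show "b1 - a1 <= K" using 1 ab by simp
 qed (rule that)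
 have "\<theta> * (b1 - a1) <= A * \<theta> ^ Suc j" using mult_left_mono[OF 1(4), of \<theta>] \<theta> by (simp add: mult_ac)
 moreover have "2 ^ Suc (osc_steps K) * R <= A * \<theta> ^ Suc j"
 proof -
  have A0: "0 <= \<theta> * A" by (rule order_trans[OF _ A(2)[folded \<theta>_def]]) (use r in simp)
  have "2 ^ Suc (osc_steps K) * R = 2 ^ osc_steps K * r * (1 / 4) ^ j" by (simp add: R_def power_one_over)
  also have "... <= \<theta> * A * \<theta> ^ j"
   by (rule mult_mono[OF A(2)[folded \<theta>_def] power_mono]) (use A0 \<theta> in auto)
  finally show ?thesis by (simp add: mult_ac)
 qed
 ultimately have "b2 - a2 <= A * \<theta> ^ Suc j" using 2(4) by simp
 moreover have "R / 2 = r / 4 ^ Suc j" by (simp add: R_def)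
 ultimately show ?case using 1 2 by (intro exI[of _ a2] exI[of _ b2]) (auto simp: \<theta>_def)
qed

text \<open>The rate of \<open>decay_iterated\<close> depends on the oscillation. Once the oscillation is below 1,
 the iteration is restarted with the universal rate.\<close>

lemma local_osc_bound:
 assumes z0: "z\<^sub>0 \<in> V"
 obtains \<rho> C M where "0 < \<rho>" "0 <= C" "!!z r. z \<in> ball z\<^sub>0 \<rho> ==> 0 < r ==> r <= \<rho> ==>
  \<exists>a b. btw (ball z r) a b \<and> b - a <= C * r powr holder_exp (osc_steps 1) \<and> - M <= a \<and> b <= M"
proof -
 obtain e where e: "0 < e" "cball z\<^sub>0 e \<subseteq> V" using V(1) z0 open_contains_cball by blast
 define R where "R = min e \<rho>\<^sub>0"
 have R: "0 < R" "R <= \<rho>\<^sub>0" "R <= 1" using e rho0 by (auto simp: R_def)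
 have cR: "cball z\<^sub>0 R \<subseteq> V" using e(2) subset_cball[of R e z\<^sub>0] by (auto simp: R_def)
 obtain M1 where M1: "AE x in lborel. x \<in> ball z\<^sub>0 (R / 2) --> U x <= M1" using locally_bounded_above[OF R(1,2) cR] by blast
 obtain M2 where M2: "AE x in lborel. x \<in> ball z\<^sub>0 (R / 2) --> - U x <= M2"
  using local_qm_osc.locally_bounded_above[OF mirror R(1,2) cR] by blast
 define M where "M = max (max M1 M2) 1"
 have M: "btw (ball z\<^sub>0 (R / 2)) (- M) M"
  using M1 M2 by eventually_elim (auto simp: M_def)
 define K where "K = 2 * M"
 have K: "1 <= K" by (simp add: K_def M_def)
 define \<theta> where "\<theta> = osc_ratio (osc_steps K)"
 have \<theta>: "3 / 4 <= \<theta>" "\<theta> < 1" using osc_ratio by (auto simp: \<theta>_def)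
 define r1 where "r1 = R / 4"
 have r1: "0 < r1" "r1 <= 1" using R by (auto simp: r1_def)
 \<comment> \<open>The two entries are the two requirements on \<open>A\<close> in
   \<open>decay_iterated\<close>.\<close>
 define A where "A = max (2 * M) (2 ^ osc_steps K * r1 / \<theta>)"
 have A: "M - - M <= A" "2 ^ osc_steps K * r1 <= \<theta> * A"
 proof -
  have "2 ^ osc_steps K * r1 / \<theta> <= A" by (simp add: A_def)
  then show "2 ^ osc_steps K * r1 <= \<theta> * A" using \<theta> by (simp add: divide_le_eq mult.commute)
 qed (simp add: A_def)
 have "(%j. A * \<theta> ^ j) \<longlonglongrightarrow> A * 0" by (intro tendsto_intros LIMSEQ_realpow_zero) (use \<theta> in auto)
 then have "\<forall>\<^sub>F j in sequentially. A * \<theta> ^ j < 1" by (rule order_tendstoD) simp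
 then obtain j0 where j0: "A * \<theta> ^ j0 < 1" using eventually_happens'[OF sequentially_bot] by blast
 define \<rho> where "\<rho> = r1 / 4 ^ j0"
 have \<rho>: "0 < \<rho>" "\<rho> <= r1"
 proof -
  have "r1 / 4 ^ j0 <= r1 / 1" using r1 by (intro divide_left_mono) auto
  then show "0 < \<rho>" "\<rho> <= r1" using r1 by (auto simp: \<rho>_def)
 qed
 define N where "N = osc_steps 1"
 define \<theta>1 where "\<theta>1 = osc_ratio N"
 have \<theta>1: "3 / 4 <= \<theta>1" "\<theta>1 < 1" using osc_ratio by (auto simp: \<theta>1_def)
 \<comment> \<open>After the restart the radius and the oscillation are at most 1, so this amplitude
   depends on \<open>N\<close> alone.\<close>
 define A1 where "A1 = 2 ^ N / \<theta>1"
 have A1: "1 <= A1" "2 ^ N * \<rho> <= \<theta>1 * A1"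
 proof -
  have "\<theta>1 <= 2 ^ N" using \<theta>1 one_le_power[of "2::real" N] by linarith
  then show "1 <= A1" using \<theta>1 by (simp add: A1_def)
  show "2 ^ N * \<rho> <= \<theta>1 * A1" using \<theta>1 \<rho> r1 by (simp add: A1_def)
 qed
 define \<gamma> where "\<gamma> = holder_exp N"
 have \<gamma>: "0 < \<gamma>" using holder_exp(1) by (simp add: \<gamma>_def)
 define C where "C = A1 * (4 / \<rho>) powr \<gamma>"
 have sub: "x \<in> ball z\<^sub>0 (R / 2)" "x \<in> V" if "z \<in> ball z\<^sub>0 \<rho>" "dist z x <= r1" for x z
 proof -
  have "dist z\<^sub>0 x <= dist z\<^sub>0 z + dist z x" by (rule dist_triangle)
  then have "dist z\<^sub>0 x < R / 2" using that \<rho> by (simp add: r1_def)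
  then show "x \<in> ball z\<^sub>0 (R / 2)" by simp
  have "x \<in> cball z\<^sub>0 R" using \<open>dist z\<^sub>0 x < R / 2\<close> R by simp
  then show "x \<in> V" using cR by blast
 qed
 show thesis
 proof (rule that[OF \<rho>(1), of C M])
  show "0 <= C" using A1 by (simp add: C_def)
  fix z r assume z: "z \<in> ball z\<^sub>0 \<rho>" and r: "0 < r" "r <= \<rho>"
  have c1: "cball z r1 \<subseteq> V" using sub(2)[OF z] by auto
  have U1: "btw (ball z r1) (- M) M"
   using M by eventually_elim (use sub(1)[OF z] in auto)
  obtain a1 b1 where 1: "btw (ball z \<rho>) a1 b1" "- M <= a1" "b1 <= M" "b1 - a1 <= A * \<theta> ^ j0"
   using decay_iterated[OF r1 c1 K U1 _ A[unfolded \<theta>_def], of j0] by (auto simp: \<rho>_def \<theta>_def K_def)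
  have b1: "b1 - a1 <= 1" using 1(4) j0 by simp
  have "\<exists>n. \<not> r <= \<rho> / 4 ^ n"
  proof -
   obtain n where "\<rho> / r < 4 ^ n" using real_arch_pow[of 4 "\<rho> / r"] by auto
   then show ?thesis using r by (intro exI[of _ n]) (simp add: field_simps not_le)
  qed
  \<comment> \<open>The least index at which the condition fails, written one step back, brackets
    \<open>r\<close> between consecutive scales.\<close>
  then have "\<exists>n. \<not> \<not> r <= \<rho> / 4 ^ n \<and> \<not> r <= \<rho> / 4 ^ Suc n" by (rule exists_least_lemma[rotated]) (use r in simp)
  then obtain j where j0: "r <= \<rho> / 4 ^ j" "\<not> r <= \<rho> / 4 ^ Suc j" by blast
  then have j: "r <= \<rho> / 4 ^ j" "\<rho> / 4 ^ Suc j < r" by linarith+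
  have c2: "cball z \<rho> \<subseteq> V" using c1 subset_cball[OF \<rho>(2)] by (rule order_trans[rotated])
  obtain a2 b2 where 2: "btw (ball z (\<rho> / 4 ^ j)) a2 b2" "a1 <= a2" "b2 <= b1" "b2 - a2 <= A1 * \<theta>1 ^ j"
   using decay_iterated[OF \<rho>(1) _ c2 _ 1(1) b1, of A1 j] \<rho> r1 b1 A1 by (auto simp: N_def \<theta>1_def)
  have "\<theta>1 ^ j = (1 / 4 ^ j) powr \<gamma>"
  proof -
   have "(1 / 4 ^ j) powr \<gamma> = 1 / (4 powr \<gamma>) ^ j"
    by (simp add: powr_divide powr_powr mult.commute flip: powr_realpow)
   also have "... = \<theta>1 ^ j" using holder_exp(3)[of N] by (simp add: \<theta>1_def \<gamma>_def powr_minus_divide power_one_over[symmetric])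
   finally show ?thesis by simp
  qed
  also have "... <= (4 / \<rho> * r) powr \<gamma>"
   using j(2) \<rho> r \<gamma> by (intro powr_mono2) (auto simp: field_simps)
  also have "... = (4 / \<rho>) powr \<gamma> * r powr \<gamma>" using \<rho> r by (intro powr_mult)
  finally have "A1 * \<theta>1 ^ j <= C * r powr \<gamma>" using A1(1) by (simp add: C_def mult.assoc mult_left_mono)
  moreover have "btw (ball z r) a2 b2"
   using 2(1) by eventually_elim (use j(1) in auto)
  ultimately show "\<exists>a b. btw (ball z r) a b \<and> b - a <= C * r powr holder_exp (osc_steps 1) \<and> - M <= a \<and> b <= M"
   using 1 2 by (intro exI[of _ a2] exI[of _ b2]) (auto simp: \<gamma>_def N_def)
 qed
qed

text \<open>The precise representative. It is determined by \<open>U\<close> alone and not by the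
  neighbourhood in which it is estimated, so local estimates fit together without gluing.\<close>

definition ball_rep :: "'a => real" where
 "ball_rep x = lim (%k. conv (ballk (1 / real (Suc k))) U x)"

lemma conv_ballk_between:
 assumes r: "0 < r" and U: "btw (ball x r) a b"
 shows "a <= conv (ballk r) U x" "conv (ballk r) U x <= b"
proof -
 define m where "m = vol (ball (0::'a) r)"
 have m: "0 < m" using r by (simp add: m_def content_ball_pos)
 have mx: "vol (ball x r) = m" by (simp add: m_def measure_ball_translate[of x])
 have e: "conv (ballk r) U x = LB (%y. indicator (ball x r) y * U y) / m"
 proof -
  have "ballk r (x - y) * U y = indicator (ball x r) y * U y / m" for y
   by (auto simp: ballk_def indicator_def dist_norm norm_minus_commute m_def)
  then show ?thesis by (simp add: conv_def)
 qed
 have i: "integrable lborel (%y. indicator (ball x r) y * U y)"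
  by (rule Bochner_Integration.integrable_bound[OF W_integrable(1)[OF UG]]) (auto simp: indicator_def)
 have ic: "integrable lborel (%y. indicator (ball x r) y * c)" for c :: real
  using emeasure_lborel_ball_finite[of x r] by (intro integrable_mult_left) (simp add: integrable_indicator_iff)
 have v: "LB (%y. indicator (ball x r) y * c) = c * m" for c :: real by (simp add: mx)
 have "LB (%y. indicator (ball x r) y * a) <= LB (%y. indicator (ball x r) y * U y)"
  by (rule integral_mono_AE[OF ic i]) (use U in eventually_elim, auto simp: indicator_def)
 then show "a <= conv (ballk r) U x" unfolding e v using m by (simp add: le_divide_eq)
 have "LB (%y. indicator (ball x r) y * U y) <= LB (%y. indicator (ball x r) y * b)"
  by (rule integral_mono_AE[OF i ic]) (use U in eventually_elim, auto simp: indicator_def)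
 then show "conv (ballk r) U x <= b" unfolding e v using m by (simp add: divide_le_eq)
qed

text \<open>The means over small balls around \<open>x\<close> eventually lie in the essential range
  of \<open>U\<close> on any larger ball, whose length is a power of the radius; hence they form a
  Cauchy sequence and the limit inherits the oscillation bound.\<close>

lemma local_holder:
 assumes z0: "z\<^sub>0 \<in> V"
 obtains \<rho> C where "0 < \<rho>" "0 <= C" "!!x. x \<in> ball z\<^sub>0 \<rho> ==> \<bar>ball_rep x\<bar> <= C"
  "!!x y. x \<in> ball z\<^sub>0 \<rho> ==> y \<in> ball z\<^sub>0 \<rho> ==> \<bar>ball_rep x - ball_rep y\<bar> <= C * dist x y powr holder_exp (osc_steps 1)"
  "!!x. x \<in> ball z\<^sub>0 \<rho> ==> (%k. conv (ballk (1 / real (Suc k))) U x) \<longlonglongrightarrow> ball_rep x"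
proof -
 define \<gamma> where "\<gamma> = holder_exp (osc_steps 1)"
 have \<gamma>: "0 < \<gamma>" using holder_exp(1) by (simp add: \<gamma>_def)
 obtain R C M where R: "0 < R" and C: "0 <= C" and osc: "!!z r. z \<in> ball z\<^sub>0 R ==> 0 < r ==> r <= R ==>
  \<exists>a b. btw (ball z r) a b \<and> b - a <= C * r powr \<gamma> \<and> - M <= a \<and> b <= M"
  by (rule local_osc_bound[OF z0, folded \<gamma>_def], rule that)
 define av where "av k x = conv (ballk (1 / real (Suc k))) U x" for k x
 have Ek: "\<forall>\<^sub>F k in sequentially. 1 / real (Suc k) < d" if "0 < d" for d
  by (rule order_tendstoD(2)[OF LIMSEQ_Suc[OF lim_1_over_n] that])
 have av: "\<forall>\<^sub>F k in sequentially. a <= av k y \<and> av k y <= b"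
  if a: "btw (ball z r) a b" and y: "dist z y < r" for a b z y r
 proof -
  have "0 < r - dist z y" using y by simp
  from Ek[OF this] show ?thesis
  proof eventually_elim
   case (elim k)
   have s: "x \<in> ball z r" if "x \<in> ball y (1 / real (Suc k))" for x
    using dist_triangle[of z x y] that elim by simp
   have "btw (ball y (1 / real (Suc k))) (a) (b)"
    using a by eventually_elim (use s in blast)
   then show ?case unfolding av_def by (intro conjI conv_ballk_between) auto
  qed
 qed
 have lim: "(%k. av k x) \<longlonglongrightarrow> ball_rep x" if x: "x \<in> ball z\<^sub>0 R" for x
 proof -
  have "Cauchy (%k. av k x)"
  proof (rule metric_CauchyI)
   fix e :: real assume e: "0 < e"
   have "((%r. C * r powr \<gamma>) \<longlongrightarrow> C * 0) (at_right 0)"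
    by (intro tendsto_mult tendsto_const tendsto_eq_rhs[OF tendsto_powr'[OF tendsto_ident_at tendsto_const]])
     (use \<gamma> in \<open>auto simp: eventually_at_filter\<close>)
   then have "\<forall>\<^sub>F r in at_right 0. C * r powr \<gamma> < e" by (rule order_tendstoD) (use e in simp)
   moreover have "\<forall>\<^sub>F r in at_right 0. r < R" using R by (simp add: eventually_at_right_less order_tendstoD(2)[OF tendsto_ident_at])
   moreover have "\<forall>\<^sub>F r in at_right 0. (0::real) < r" by (rule eventually_at_right_less)
   ultimately have "\<forall>\<^sub>F r in at_right 0. C * r powr \<gamma> < e \<and> r < R \<and> 0 < r" by eventually_elim auto
   then obtain r where r: "C * r powr \<gamma> < e" "r < R" "0 < r"
    using eventually_happens'[OF trivial_limit_at_right_real, of "%r. C * r powr \<gamma> < e \<and> r < R \<and> 0 < r" 0] by blast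
   obtain a b where ab: "btw (ball x r) a b" "b - a <= C * r powr \<gamma>"
    using osc[OF x r(3)] r(2) by force
   obtain k0 where "!!k. k \<ge> k0 ==> a <= av k x \<and> av k x <= b"
    using av[OF ab(1), of x] r(3) by (auto simp: eventually_sequentially)
   then have "\<bar>av m x - av n x\<bar> < e" if "m \<ge> k0" "n \<ge> k0" for m n
    using that ab(2) r(1) by (smt (verit))
   then show "\<exists>k0. \<forall>m\<ge>k0. \<forall>n\<ge>k0. dist (av m x) (av n x) < e" by (auto simp: dist_real_def)
  qed
  then have "convergent (%k. av k x)" by (rule Cauchy_convergent)
  then show ?thesis unfolding ball_rep_def av_def[symmetric] by (simp add: convergent_LIMSEQ_iff)
 qed
 have rep: "a <= ball_rep y \<and> ball_rep y <= b"
  if a: "btw (ball z r) a b" and y: "dist z y < r" "y \<in> ball z\<^sub>0 R" for a b z y r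
  using tendsto_lowerbound[OF lim[OF y(2)]] tendsto_upperbound[OF lim[OF y(2)]] av[OF a y(1)]
  by (auto simp: eventually_conj_iff)
 define \<rho> where "\<rho> = R / 4"
 have \<rho>: "0 < \<rho>" using R by (simp add: \<rho>_def)
 have sub: "x \<in> ball z\<^sub>0 R" if "x \<in> ball z\<^sub>0 \<rho>" for x using that R by (simp add: \<rho>_def)
 define C' where "C' = max (C * 2 powr \<gamma>) \<bar>M\<bar>"
 show thesis
 proof (rule that[of \<rho> C', folded \<gamma>_def])
  show "0 < \<rho>" by (rule \<rho>)
  show C': "0 <= C'" by (simp add: C'_def)
  fix x assume x: "x \<in> ball z\<^sub>0 \<rho>"
  obtain a b where "btw (ball x R) a b" "- M <= a" "b <= M"
   using osc[OF sub[OF x] R order_refl] by blast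
  with rep[of x R a b x] sub[OF x] R show "\<bar>ball_rep x\<bar> <= C'" by (auto simp: C'_def)
  show "(%k. conv (ballk (1 / real (Suc k))) U x) \<longlonglongrightarrow> ball_rep x" using lim[OF sub[OF x]] by (simp add: av_def)
  fix y assume y: "y \<in> ball z\<^sub>0 \<rho>"
  show "\<bar>ball_rep x - ball_rep y\<bar> <= C' * dist x y powr \<gamma>"
  proof (cases "x = y")
   case False
   then have d: "0 < dist x y" by simp
   have "dist x y < 2 * \<rho>" using dist_triangle3[of x y z\<^sub>0] x y by simp
   then have "2 * dist x y <= R" by (simp add: \<rho>_def)
   \<comment> \<open>The ball around \<open>x\<close> of twice the distance contains
     \<open>y\<close> in its interior, so both limits lie in one range.\<close>
   then obtain a b where ab: "btw (ball x (2 * dist x y)) a b" "b - a <= C * (2 * dist x y) powr \<gamma>"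
    using osc[OF sub[OF x], of "2 * dist x y"] d by auto
   have "\<bar>ball_rep x - ball_rep y\<bar> <= b - a"
    using rep[OF ab(1), of x] rep[OF ab(1), of y] d sub[OF x] sub[OF y] by auto
   also have "... <= C * (2 * dist x y) powr \<gamma>" by (rule ab(2))
   also have "... = C * 2 powr \<gamma> * dist x y powr \<gamma>" by (simp add: powr_mult)
   also have "... <= C' * dist x y powr \<gamma>" by (intro mult_right_mono) (auto simp: C'_def)
   finally show ?thesis .
  qed simp
 qed
qed

text \<open>Convergence of the means in L^1 identifies the limit along a subsequence almost
  everywhere, and on \<open>V\<close> the whole sequence is already known to converge.\<close>

lemma ball_rep_AE: "AE x in lborel. x \<in> V --> ball_rep x = U x"
proof -
 note i = W_integrable(1)[OF UG]
 define av where "av k = conv (ballk (1 / real (Suc k))) U" for k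
 have l: "(%k. L1d (av k) U) \<longlonglongrightarrow> 0" unfolding av_def
  by (rule conv_ballk_LIMSEQ[OF i]) (use LIMSEQ_Suc[OF lim_1_over_n] in auto)
 have avm[measurable]: "av k \<in> borel_measurable borel" for k unfolding av_def by (rule conv_measurable) auto
 have "\<forall>\<^sub>F k in sequentially. L1d (av k) U < 1" by (rule order_tendstoD(2)[OF l]) simp
 then obtain k0 where k0: "!!k. k \<ge> k0 ==> L1d (av k) U < 1" by (auto simp: eventually_sequentially)
 have ia: "integrable lborel (av (k + k0))" for k
 proof -
  have "integrable lborel (%x. av (k + k0) x - U x)"
  proof (rule integrableI_bounded)
   have "IB (%x. norm (av (k + k0) x - U x)) < 1" using k0[of "k + k0"] by (simp add: L1d_def)
   then show "IB (%x. norm (av (k + k0) x - U x)) < \<infinity>" by (rule less_trans) simp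
  qed measurable
  from Bochner_Integration.integrable_add[OF this i] show ?thesis by simp
 qed
 obtain r :: "nat => nat" where r: "strict_mono r" "AE x in lborel. (%k. av (r k + k0) x) \<longlonglongrightarrow> U x"
  using L1d_AE_subseq[OF ia i LIMSEQ_ignore_initial_segment[OF l, of k0]] by auto
 from r(2) show ?thesis
 proof eventually_elim
  case (elim x)
  show ?case
  proof
   assume "x \<in> V"
   then obtain \<rho> where "0 < \<rho>" "!!y. y \<in> ball x \<rho> ==> (%k. av k y) \<longlonglongrightarrow> ball_rep y"
    by (rule local_holder) (auto simp: av_def)
   then have "(%k. av k x) \<longlonglongrightarrow> ball_rep x" by simp
   then have "(%k. av (k + k0) x) \<longlonglongrightarrow> ball_rep x" by (rule LIMSEQ_ignore_initial_segment)
   then have "(%k. av (r k + k0) x) \<longlonglongrightarrow> ball_rep x" using LIMSEQ_subseq_LIMSEQ[OF _ r(1)] by (fastforce simp: o_def)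
   then show "ball_rep x = U x" using elim LIMSEQ_unique by blast
  qed
 qed
qed

end

section \<open>From local estimates to compact sets, and from the domain to the local
  setting\<close>

lemma holder_on_compact:
 fixes w :: "'a::euclidean_space => real"
 assumes K: "compact K" "S \<subseteq> K" and g: "0 <= \<gamma>"
  and loc: "!!z. z \<in> K ==> \<exists>\<rho>>0. \<exists>C\<ge>0. (\<forall>x\<in>ball z \<rho>. \<bar>w x\<bar> <= C) \<and>
   (\<forall>x\<in>ball z \<rho>. \<forall>y\<in>ball z \<rho>. \<bar>w x - w y\<bar> <= C * dist x y powr \<gamma>)"
 shows "holder_on \<gamma> S w"
proof -
 obtain \<rho> C where l: "!!z. z \<in> K ==> \<rho> z > 0" "!!z. z \<in> K ==> 0 <= C z"
  "!!z x. z \<in> K ==> x \<in> ball z (\<rho> z) ==> \<bar>w x\<bar> <= C z"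
  "!!z x y. z \<in> K ==> x \<in> ball z (\<rho> z) ==> y \<in> ball z (\<rho> z) ==> \<bar>w x - w y\<bar> <= C z * dist x y powr \<gamma>"
  using loc by metis
 have cov: "K \<subseteq> (\<Union>z\<in>K. ball z (\<rho> z / 2))" using l(1) by force
 obtain T where T: "T \<subseteq> K" "finite T" "K \<subseteq> (\<Union>z\<in>T. ball z (\<rho> z / 2))"
  by (rule compactE_image[OF K(1) _ cov]) auto
 define M where "M = sum C T"
 have CM: "C z <= M" if "z \<in> T" for z
  unfolding M_def by (rule member_le_sum[OF that _ T(2)]) (use T(1) l(2) in auto)
 have M0: "0 <= M" unfolding M_def by (rule sum_nonneg) (use T(1) l(2) in auto)
 \<comment> \<open>A Lebesgue number of the cover by half balls; the inserted 1 keeps the minimum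
   defined if the cover is empty.\<close>
 define d where "d = Min (insert 1 ((%z. \<rho> z / 2) ` T))"
 have d: "0 < d" using T(1,2) l(1) by (auto simp: d_def)
 have dT: "d <= \<rho> z / 2" if "z \<in> T" for z unfolding d_def by (rule Min_le) (use that T(2) in auto)
 have cover: "\<exists>z\<in>T. dist z x < \<rho> z / 2" if "x \<in> S" for x using that T(3) K(2) by force
 have bd: "\<bar>w x\<bar> <= M" if x: "x \<in> S" for x
 proof -
  obtain z where z: "z \<in> T" "dist z x < \<rho> z / 2" using cover[OF x] by blast
  then have "\<bar>w x\<bar> <= C z" using T(1) l(1)[of z] by (intro l(3)) auto
  then show ?thesis using CM[OF z(1)] by simp
 qed
 \<comment> \<open>The first summand serves points closer than \<open>d\<close>, which share a ball
   of the cover; the second serves distant points, where boundedness suffices.\<close>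
 define C' where "C' = M + 2 * M * d powr (- \<gamma>)"
 have "\<bar>w x - w y\<bar> <= C' * dist x y powr \<gamma>" if x: "x \<in> S" and y: "y \<in> S" for x y
 proof (cases "dist x y < d")
  case True
  obtain z where z: "z \<in> T" "dist z x < \<rho> z / 2" using cover[OF x] by blast
  have "dist z y < \<rho> z" using dist_triangle[of z y x] z True dT[OF z(1)] by simp
  then have "\<bar>w x - w y\<bar> <= C z * dist x y powr \<gamma>" using z T(1) l(1)[of z] by (intro l(4)) auto
  also have "... <= C' * dist x y powr \<gamma>"
   using CM[OF z(1)] M0 by (intro mult_right_mono) (auto simp: C'_def intro: order_trans[OF CM[OF z(1)]])
  finally show ?thesis .
 next
  case False
  have "\<bar>w x - w y\<bar> <= 2 * M * 1" using bd[OF x] bd[OF y] by simp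
  also have "... <= 2 * M * (dist x y / d) powr \<gamma>"
   using M0 d False g by (intro mult_left_mono ge_one_powr_ge_zero) auto
  also have "... = 2 * M * d powr (- \<gamma>) * dist x y powr \<gamma>" using d by (simp add: powr_divide powr_minus_divide)
  also have "... <= C' * dist x y powr \<gamma>" using M0 by (intro mult_right_mono) (auto simp: C'_def)
  finally show ?thesis .
 qed
 moreover have "bounded (w ` S)" unfolding bounded_iff using bd by auto
 ultimately show ?thesis unfolding holder_on_def by blast
qed

text \<open>The cut-off is 1 on the open set \<open>V\<close>, so its gradient vanishes there and
  the product-rule term disappears.\<close>

lemma weak_grad_local_rep:
 assumes w: "weak_grad \<Omega> u gu" and O: "open \<Omega>" and V: "open V" "V \<Subset> \<Omega>"
 obtains U G where "W U G" "AE x in lborel. x \<in> V --> U x = u x" "AE x in lborel. x \<in> V --> G x = gu x"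
proof -
 have c: "compact (closure V)" "closure V \<subseteq> \<Omega>" using V(2) by (auto simp: cpt_sub_def)
 obtain \<eta> D\<eta> where e: "test_fun \<Omega> \<eta>" "C1c \<eta> D\<eta>" "!!x. x \<in> closure V ==> \<eta> x = 1"
  by (rule compact_cutoff[OF c(1) O c(2)], rule that)
 have e1: "\<eta> x = 1" if "x \<in> V" for x using that closure_subset[of V] by (intro e(3)) auto
 have D0: "D\<eta> x = 0" if x: "x \<in> V" for x
 proof -
  have "(\<eta> has_derivative (%h. 0)) (at x)"
   by (rule has_derivative_transform_within_open[OF has_derivative_const V(1) x, of 1]) (use e1 in auto)
  then have "(%h. D\<eta> x \<bullet> h) = (%h. 0 \<bullet> h)" using has_derivative_unique[OF C1cD(1)[OF e(2)]] by fastforce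
  then show ?thesis by (rule inner_fun_eqD)
 qed
 obtain U G where U: "W U G" "AE x in lborel. U x = \<eta> x * u x" "AE x in lborel. G x = \<eta> x *\<^sub>R gu x + u x *\<^sub>R D\<eta> x"
  by (rule weak_grad_borel_integral[OF w e(1,2)], rule that)
 show thesis
 proof (rule that[OF U(1)])
  show "AE x in lborel. x \<in> V --> U x = u x" using U(2) by eventually_elim (simp add: e1)
  show "AE x in lborel. x \<in> V --> G x = gu x" using U(3) by eventually_elim (simp add: e1 D0)
 qed
qed

context phi_growth
begin

lemma ph_diff_finite:
 fixes a b :: "'a => 'b::euclidean_space"
 assumes [measurable]: "a \<in> borel_measurable borel" "b \<in> borel_measurable borel" and A: "A \<in> sets borel"
  and f: "phL A a < \<infinity>" "phL A b < \<infinity>"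
 shows "phL A (%x. a x - b x) < \<infinity>"
proof -
 have m: "(%x. ennreal (ph x (norm (c x))) * indicator A x) \<in> borel_measurable lebesgue"
  if "c \<in> borel_measurable borel" for c :: "'a => 'b"
 proof (intro borel_measurable_times_ennreal borel_measurable_indicator)
  show "(%x. ennreal (ph x (norm (c x)))) \<in> borel_measurable lebesgue"
   by (intro measurable_compose[OF ph_measurable_borel measurable_ennreal] measurable_compose[OF that]) measurable
 qed (use A in simp)
 note ma = m[OF assms(1)] and mb = m[OF assms(2)]
 define D where "D = L * 2 powr q"
 have D: "0 <= D" using L1 by (simp add: D_def)
 have "phL A (%x. a x - b x) <=
  NL (%x. ennreal D * (ennreal (ph x (norm (a x))) * indicator A x + ennreal (ph x (norm (b x))) * indicator A x))"
 proof (rule nn_integral_mono, goal_cases)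
  case (1 x)
  have "ennreal (ph x (norm (a x - b x))) <= ennreal (D * (ph x (norm (a x)) + ph x (norm (b x))))"
   unfolding D_def by (intro ennreal_leI ph_norm_diff)
  also have "... = ennreal D * ennreal (ph x (norm (a x)) + ph x (norm (b x)))" by (rule ennreal_mult) (use D in auto)
  also have "ennreal (ph x (norm (a x)) + ph x (norm (b x))) = ennreal (ph x (norm (a x))) + ennreal (ph x (norm (b x)))" by (rule ennreal_plus) auto
  finally show ?case
   by (auto simp: indicator_def)
 qed
 also have "... = ennreal D * (phL A a + phL A b)"
  by (subst nn_integral_cmult[OF borel_measurable_add[OF ma mb]], subst nn_integral_add[OF ma mb]) simp
 also have "... < \<infinity>" using f by (simp add: ennreal_mult_less_top)
 finally show ?thesis .
qed

lemma ph_integral_cong: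
 fixes f g :: "'a => 'b::real_normed_vector"
 assumes "AE x in lborel. x \<in> A --> f x = g x"
 shows "phL A f = phL A g"
 by (rule nn_integral_cong_AE, rule AE_completion) (use assms in \<open>auto elim!: eventually_mono simp: indicator_def\<close>)

text \<open>Makes \<open>u - F\<close> an admissible competitor. Boundedness of \<open>F\<close>
  puts it into the Orlicz space over bounded sets; the gradients are handled by
  \<open>ph_norm_diff\<close> through finite modulars.\<close>

lemma W1phi_loc_minus:
 assumes w: "weak_grad \<Omega> u gu"
  and fin: "!!U. open U ==> U \<Subset> \<Omega> ==> in_Lphi \<phi> U u \<and> in_Lphi \<phi> U (%x. norm (gu x))"
  and F: "W F H" "!!x. \<bar>F x\<bar> <= M" "IL (%x. ph x (norm (H x))) < \<infinity>"
 shows "in_W1phi_loc \<phi> \<Omega> (%x. u x - F x)"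
 unfolding in_W1phi_loc_def
proof (intro allI impI)
 fix A :: "'a set" assume A: "open A \<and> A \<Subset> \<Omega>"
 then have oA: "open A" and AO: "A \<subseteq> \<Omega>" and bA: "bounded A"
  using closure_subset[of A] by (auto simp: cpt_sub_def intro: bounded_subset[OF compact_imp_bounded])
 obtain U G where U: "W U G" "AE x in lborel. x \<in> A --> U x = u x" "AE x in lborel. x \<in> A --> G x = gu x"
  by (rule weak_grad_local_rep[OF w open_Omega], use A in auto)
 note [measurable] = W_measurable[OF U(1)] W_measurable[OF F(1)]
 note d = W_diff[OF U(1) F(1)]
 have ae: "AE x in lborel. x \<in> A --> U x - F x = u x - F x" using U(2) by eventually_elim simp
 have aeg: "AE x in lborel. x \<in> A --> norm (G x - H x) = norm (gu x - H x)" using U(3) by eventually_elim simp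
 have si: "set_integrable lebesgue A f" if "integrable lborel f" for f :: "'a => real"
 proof -
  have "integrable lebesgue f" using that by (simp add: integrable_completion)
  then show ?thesis unfolding set_integrable_def using oA by (intro integrable_mult_indicator) auto
 qed
 have finA: "phL A U < \<infinity>" "phL A G < \<infinity>"
  unfolding ph_integral_cong[OF U(2)] ph_integral_cong[OF U(3)]
  using fin[of A] A in_Lphi_iff[OF oA AO, of u] in_Lphi_iff[OF oA AO, of "%x. norm (gu x)"] by simp_all
 have finF: "phL A F < \<infinity>"
 proof -
  define c where "c = L * (max 1 M) powr q * L"
  have "phL A F <= NL (%x. ennreal c * indicator A x)"
  proof (rule nn_integral_mono, goal_cases)
   case (1 x)
   have "ph x (norm (F x)) <= c" unfolding c_def by (rule ph_le_const) (use F(2)[of x] in auto)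
   then show ?case by (auto simp: indicator_def ennreal_leI)
  qed
  also have "... = ennreal c * emeasure lborel A" using oA by (simp add: nn_integral_cmult_indicator)
  also have "... < \<infinity>" using emeasure_bounded_finite[OF bA] by (simp add: ennreal_mult_less_top)
  finally show ?thesis .
 qed
 have finH: "phL A H < \<infinity>"
  by (rule le_less_trans[OF nn_integral_mono F(3)]) (auto simp: indicator_def)
 have inL: "in_Lphi \<phi> A f" if "f \<in> borel_measurable borel" "iL A (%x. ph x (f x)) < \<infinity>" for f
  unfolding in_Lphi_iff[OF oA AO] using that by (auto intro!: measurable_restrict_space1 measurable_completion)
 show "in_W1phi \<phi> A (%x. u x - F x)" unfolding in_W1phi_def
 proof (intro exI[of _ "%x. gu x - H x"] conjI)
  show "weak_grad A (%x. u x - F x) (%x. gu x - H x)"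
   by (rule weak_grad_diff[OF weak_grad_subset[OF w AO] W_weak_grad[OF F(1)]])
  show "set_integrable lebesgue A (%x. u x - F x)"
   by (rule set_integrable_lebesgue_cong_AE[OF si[OF W_integrable(1)[OF d]] ae])
  show "set_integrable lebesgue A (%x. norm (gu x - H x))"
   by (rule set_integrable_lebesgue_cong_AE[OF si aeg]) (use W_integrable(2)[OF d] in auto)
  show "in_Lphi \<phi> A (%x. u x - F x)"
   by (rule in_Lphi_cong_AE[OF _ inL ae]) (use oA ph_diff_finite[OF _ _ _ finA(1) finF] in auto)
  show "in_Lphi \<phi> A (%x. norm (gu x - H x))"
   by (rule in_Lphi_cong_AE[OF _ inL aeg]) (use oA ph_diff_finite[OF _ _ _ finA(2) finH] in auto)
 qed
qed

end

context phi_A1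
begin

text \<open>The competitor differs from \<open>u\<close> exactly where \<open>F\<close> is nonzero.
  All integrals then run over a subset of \<open>V\<close>, where \<open>U\<close> and
  \<open>G\<close> agree almost everywhere with \<open>u\<close> and \<open>gu\<close>.\<close>

lemma quasiminimizer_local_qm:
 assumes qm: "quasiminimizer \<phi> \<Omega> Q u" and Q: "1 <= Q" and w: "weak_grad \<Omega> u gu"
  and fin: "!!U. open U ==> U \<Subset> \<Omega> ==> in_Lphi \<phi> U u \<and> in_Lphi \<phi> U (%x. norm (gu x))"
  and V: "open V" "V \<Subset> \<Omega>" and U: "W U G"
  and ae: "AE x in lborel. x \<in> V --> U x = u x" "AE x in lborel. x \<in> V --> G x = gu x"
 shows "local_qm \<phi> \<Omega> p q L s L\<omega> U G V Q"
proof (intro local_qm.intro local_qm_axioms.intro phi_A1_axioms U V(1) Q)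
 show VO: "V \<subseteq> \<Omega>" using V(2) closure_subset[of V] by (auto simp: cpt_sub_def)
 have "phL V U < \<infinity>" "phL V G < \<infinity>"
  unfolding ph_integral_cong[OF ae(1)] ph_integral_cong[OF ae(2)]
  using fin[OF V] in_Lphi_iff[OF V(1) VO, of u] in_Lphi_iff[OF V(1) VO, of "%x. norm (gu x)"] by simp_all
 then show "iL V (%x. ph x (U x)) < \<infinity>" "phL V G < \<infinity>"
  by simp_all
 fix F H K assume F: "W F H" "compact K" "K \<subseteq> V" "!!x. x \<notin> K ==> F x = 0" "\<exists>M. \<forall>x. \<bar>F x\<bar> <= M"
  "IL (%x. ph x (norm (H x))) < \<infinity>"
 define S where "S = closure {x. F x \<noteq> 0}"
 have SK: "S \<subseteq> K" unfolding S_def by (rule closure_minimal) (use F in \<open>auto intro: compact_imp_closed\<close>)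
 have S: "closure {x \<in> \<Omega>. F x \<noteq> 0} = S"
 proof -
  have "{x \<in> \<Omega>. F x \<noteq> 0} = {x. F x \<noteq> 0}" using F(3,4) VO by auto
  then show ?thesis by (simp add: S_def)
 qed
 have clS: "closed S" by (simp add: S_def)
 then have "compact S" using compact_Int_closed[OF F(2), of S] SK by (simp add: Int_absorb1)
 then have Sc: "S \<Subset> \<Omega>" unfolding cpt_sub_def using SK F(3) VO clS by auto
 obtain M where M: "!!x. \<bar>F x\<bar> <= M" using F(5) by blast
 have "iL S (%x. \<phi> x (norm (gu x))) <= ennreal Q * iL S (%x. \<phi> x (norm (gu x - H x)))"
  using qm[unfolded quasiminimizer_def, THEN conjunct2, rule_format, of "%x. u x - F x" gu "%x. gu x - H x"]
   W1phi_loc_minus[OF w fin F(1) M F(6)] w weak_grad_diff[OF w W_weak_grad[OF F(1)]] Sc by (simp add: S)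
 moreover have "iL S (%x. \<phi> x (norm (f x))) = phL S f" for f :: "'a => 'a"
  by (rule nn_integral_cong) (use SK F(3) VO in \<open>auto simp: ph_def indicator_def\<close>)
 moreover have "phL S G = phL S gu"
  "phL S (%x. G x - H x) = phL S (%x. gu x - H x)"
  by (rule ph_integral_cong; use ae(2) in eventually_elim; use SK F(3) in auto)+
 ultimately show "phL (closure {x. F x \<noteq> 0}) G
    <= ennreal Q * phL (closure {x. F x \<noteq> 0}) (%x. G x - H x)"
  by (simp add: S_def)
qed

end

section \<open>Oscillation and growth of means for BMO and Lebesgue functions\<close>

lemma double_osc_le:
 fixes U :: "'a::euclidean_space => real"
 assumes [measurable]: "U \<in> borel_measurable borel" and C: "0 <= C"
  and h: "iB (ball x r) (%y. \<bar>U y - c\<bar>) <= ennreal (C * vol (ball x r))"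
 shows "dosc U (ball x r) <= ennreal (2 * C * (vol (ball x r))\<^sup>2)"
proof -
 define B where "B = ball x r"
 define m where "m = vol B"
 have [measurable]: "B \<in> sets borel" by (simp add: B_def)
 have eB: "emeasure lborel B = ennreal m" by (simp add: B_def m_def emeasure_ball_eq)
 have inner: "iB B (%y. \<bar>U y - U w\<bar>) <= ennreal (C * m) + ennreal m * ennreal \<bar>U w - c\<bar>" for w
 proof -
  have "iB B (%y. \<bar>U y - U w\<bar>) <= NB (%y. ennreal \<bar>U y - c\<bar> * indicator B y + ennreal \<bar>U w - c\<bar> * indicator B y)"
  proof (rule nn_integral_mono, goal_cases)
   case (1 y)
   have "ennreal \<bar>U y - U w\<bar> <= ennreal (\<bar>U y - c\<bar> + \<bar>U w - c\<bar>)" by (rule ennreal_leI) simp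
   also have "... = ennreal \<bar>U y - c\<bar> + ennreal \<bar>U w - c\<bar>" by (rule ennreal_plus) auto
   finally show ?case
    by (auto simp: indicator_def)
  qed
  also have "... = iB B (%y. \<bar>U y - c\<bar>) + ennreal \<bar>U w - c\<bar> * ennreal m"
   by (subst nn_integral_add) (auto simp: nn_integral_cmult_indicator eB)
  also have "... <= ennreal (C * m) + ennreal m * ennreal \<bar>U w - c\<bar>"
   using h by (intro add_mono) (auto simp: B_def m_def mult.commute)
  finally show ?thesis .
 qed
 have "dosc U B <= NB (%w. ennreal (C * m) * indicator B w + ennreal m * (ennreal \<bar>U w - c\<bar> * indicator B w))"
  by (rule nn_integral_mono) (use inner in \<open>auto simp: indicator_def\<close>)
 also have "... = ennreal (C * m) * ennreal m + ennreal m * iB B (%w. \<bar>U w - c\<bar>)"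
  by (subst nn_integral_add) (auto simp: nn_integral_cmult_indicator nn_integral_cmult eB)
 also have "... <= ennreal (C * m) * ennreal m + ennreal m * ennreal (C * m)"
  using h by (intro add_mono mult_left_mono) (auto simp: B_def m_def)
 also have "... = ennreal (2 * (C * m * m))"
 proof -
  have Cm: "0 <= C * m" using C by (simp add: m_def)
  have "ennreal (C * m) * ennreal m + ennreal m * ennreal (C * m) = ennreal (C * m * m) + ennreal (C * m * m)"
   using Cm by (subst ennreal_mult[OF Cm, symmetric]) (auto simp: m_def mult.commute[of "ennreal m"] simp flip: ennreal_mult)
  also have "... = ennreal (C * m * m + C * m * m)" by (rule ennreal_plus[symmetric]) (use Cm in \<open>auto simp: m_def\<close>)
  also have "C * m * m + C * m * m = 2 * (C * m * m)" by simp
  finally show ?thesis .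
 qed
 also have "2 * (C * m * m) = 2 * C * m\<^sup>2" by (simp add: power2_eq_square)
 finally show ?thesis by (simp add: B_def m_def)
qed

text \<open>Instead of Hoelder's inequality: \<open>|U| <= l + l powr (1 - r) * |U| powr r\<close> with \<open>l = \<rho> powr (- n / r)\<close>.\<close>

lemma Lp_average_bound:
 fixes U :: "'a::euclidean_space => real"
 assumes [measurable]: "U \<in> borel_measurable borel" and r: "1 <= r" and J: "0 <= J"
  and h: "iB (ball x \<rho>) (%y. \<bar>U y\<bar> powr r) <= ennreal J" and \<rho>: "0 < \<rho>"
 shows "iB (ball x \<rho>) (%y. \<bar>U y\<bar>) <=
  ennreal ((1 + J / unit_ball_vol (real DIM('a))) * \<rho> powr (- (real DIM('a) / r)) * vol (ball x \<rho>))"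
proof -
 define B where "B = ball x \<rho>"
 define l where "l = \<rho> powr (- (real DIM('a) / r))"
 define v where "v = unit_ball_vol (real DIM('a))"
 have v: "0 < v" by (simp add: v_def)
 have l: "0 < l" using \<rho> by (simp add: l_def)
 have [measurable]: "B \<in> sets borel" by (simp add: B_def)
 have mB: "vol B = v * \<rho> ^ DIM('a)" using \<rho> by (simp add: B_def v_def content_ball)
 have "iB B (%y. \<bar>U y\<bar>) <= NB (%y. ennreal l * indicator B y + ennreal (l powr (1 - r)) * (ennreal (\<bar>U y\<bar> powr r) * indicator B y))"
 proof (rule nn_integral_mono, goal_cases)
  case (1 y)
  have "\<bar>U y\<bar> <= l + l powr (1 - r) * \<bar>U y\<bar> powr r"
  proof (cases "\<bar>U y\<bar> <= l")
   case False
   then have u: "0 < \<bar>U y\<bar>" "l <= \<bar>U y\<bar>" using l by auto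
   have "\<bar>U y\<bar> = \<bar>U y\<bar> powr (1 - r) * \<bar>U y\<bar> powr r" using u by (simp flip: powr_add)
   also have "... <= l powr (1 - r) * \<bar>U y\<bar> powr r" using u l r by (intro mult_right_mono powr_mono2') auto
   finally show ?thesis using l by linarith
  qed (auto intro: add_increasing2)
  then have "ennreal \<bar>U y\<bar> <= ennreal (l + l powr (1 - r) * \<bar>U y\<bar> powr r)" by (rule ennreal_leI)
  also have "... = ennreal l + ennreal (l powr (1 - r) * \<bar>U y\<bar> powr r)" by (rule ennreal_plus) (use l in auto)
  also have "ennreal (l powr (1 - r) * \<bar>U y\<bar> powr r) = ennreal (l powr (1 - r)) * ennreal (\<bar>U y\<bar> powr r)" by (rule ennreal_mult) auto
  finally show ?case
   by (auto simp: indicator_def)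
 qed
 also have "... = ennreal l * emeasure lborel B + ennreal (l powr (1 - r)) * iB B (%y. \<bar>U y\<bar> powr r)"
  by (subst nn_integral_add) (auto simp: nn_integral_cmult_indicator nn_integral_cmult)
 also have "... <= ennreal l * ennreal (vol B) + ennreal (l powr (1 - r)) * ennreal J"
  using h by (intro add_mono mult_left_mono) (auto simp: B_def emeasure_ball_eq)
 also have "... = ennreal (l * vol B + l powr (1 - r) * J)"
 proof -
  have "ennreal (l * vol B + l powr (1 - r) * J) = ennreal (l * vol B) + ennreal (l powr (1 - r) * J)"
   by (rule ennreal_plus) (use l J in auto)
  also have "ennreal (l * vol B) = ennreal l * ennreal (vol B)" by (rule ennreal_mult) (use l in auto)
  also have "ennreal (l powr (1 - r) * J) = ennreal (l powr (1 - r)) * ennreal J" by (rule ennreal_mult) (use J in auto)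
  finally show ?thesis by simp
 qed
 also have "l * vol B + l powr (1 - r) * J = (1 + J / v) * l * vol B"
 proof -
  have "l powr (1 - r) = l * l powr (- r)" using l by (simp add: powr_diff powr_minus_divide)
  also have "l powr (- r) = \<rho> ^ DIM('a)" using \<rho> r by (simp add: l_def powr_powr powr_realpow)
  finally show ?thesis using v by (simp add: mB field_simps)
 qed
 finally show ?thesis by (simp add: B_def l_def v_def)
qed

text \<open>Bounded mean oscillation says nothing about the means themselves. Halving the radius
  raises a mean by at most a constant, so they grow logarithmically; the cruder rate 1/\<rho> is all
  that \<open>avg1\<close> asks for when \<open>s\<close> is the dimension.\<close>

lemma osc_average_growth:
 fixes U :: "'a::euclidean_space => real"
 assumes i: "integrable lborel U" and K: "0 <= K" and d: "0 < d" "d <= 1"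
 shows "\<exists>M. \<forall>x \<rho>. (\<forall>t. 0 < t --> t <= d -->
   dosc U (ball x t) <= ennreal (K * (vol (ball x t))\<^sup>2)) -->
  0 < \<rho> --> \<rho> <= d --> (iB (ball x \<rho>) (%w. \<bar>U w\<bar>)) <= ennreal (M / \<rho> * vol (ball x \<rho>))"
proof -
 have [measurable]: "U \<in> borel_measurable borel" using i by auto
 have [measurable]: "ball x t \<in> sets borel" for x :: 'a and t by simp
 define J where "J = LB (%x. \<bar>U x\<bar>)"
 define v where "v = unit_ball_vol (real DIM('a))"
 have v: "0 < v" by (simp add: v_def)
 have J: "0 <= J" unfolding J_def by (rule Bochner_Integration.integral_nonneg) simp
 have m: "vol (ball x t) = v * t ^ DIM('a)" if "0 < t" for x :: 'a and t using that by (simp add: v_def content_ball)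
 \<comment> \<open>The first entry covers radii at least \<open>d / 2\<close>. The second makes half
   of \<open>M\<close> pay for one doubling, while the factor \<open>t\<close> halves the
   contribution of the larger ball.\<close>
 define M where "M = max (J / (v * (d / 2) ^ DIM('a))) (2 * (2 ^ DIM('a) * K))"
 have M0: "0 <= M" using K by (simp add: M_def le_max_iff_disj)
 show ?thesis
 proof (intro exI[of _ M] allI impI)
  fix x \<rho> assume osc: "\<forall>t. 0 < t --> t <= d -->
   dosc U (ball x t) <= ennreal (K * (vol (ball x t))\<^sup>2)"
  assume \<rho>: "0 < \<rho>" "\<rho> <= d"
  define I where "I t = LB (%w. indicator (ball x t) w * \<bar>U w\<bar>)" for t
  have iI: "integrable lborel (%w. indicator (ball x t) w * \<bar>U w\<bar>)" for t
   by (rule Bochner_Integration.integrable_bound[OF i]) (auto simp: indicator_def)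
  have nI: "iB (ball x t) (%w. \<bar>U w\<bar>) = ennreal (I t)" for t
  proof -
   have "iB (ball x t) (%w. \<bar>U w\<bar>) = IB (%w. indicator (ball x t) w * \<bar>U w\<bar>)"
    by (rule nn_integral_cong) (auto simp: indicator_def)
   then show ?thesis unfolding I_def using nn_integral_eq_integral[OF iI] by simp
  qed
  have I0: "0 <= I t" for t unfolding I_def by (rule Bochner_Integration.integral_nonneg) simp
  have IJ: "I t <= J" for t unfolding I_def J_def
   by (rule Bochner_Integration.integral_mono[OF iI]) (use i in \<open>auto simp: indicator_def\<close>)
  have doubling: "I t <= 2 ^ DIM('a) * K * vol (ball x t) + I (2 * t) / 2 ^ DIM('a)" if t: "0 < t" "2 * t <= d" for t
  proof -
   define b where "b = vol (ball x t)"
   have b: "0 < b" "vol (ball x (2 * t)) = 2 ^ DIM('a) * b"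
    using t v by (auto simp: b_def m power_mult_distrib)
   have "ennreal (2 ^ DIM('a) * b * I t) = nnB (ball x (2 * t)) (%w. iB (ball x t) (%y. \<bar>U y\<bar>))"
    using b I0[of t] by (simp add: nI nn_integral_cmult_indicator emeasure_ball_eq ennreal_mult mult.commute)
   also have "... <= NB (%w. (iB (ball x (2 * t)) (%y. \<bar>U y - U w\<bar>)) * indicator (ball x (2 * t)) w + ennreal b * (ennreal \<bar>U w\<bar> * indicator (ball x (2 * t)) w))"
   proof (rule nn_integral_mono)
    fix w :: 'a
    have "iB (ball x t) (%y. \<bar>U y\<bar>) <= NB (%y. ennreal \<bar>U y - U w\<bar> * indicator (ball x (2 * t)) y + ennreal \<bar>U w\<bar> * indicator (ball x t) y)"
    proof (rule nn_integral_mono, goal_cases)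
     case (1 y)
     have "ennreal \<bar>U y\<bar> <= ennreal (\<bar>U y - U w\<bar> + \<bar>U w\<bar>)" by (rule ennreal_leI) simp
     also have "... = ennreal \<bar>U y - U w\<bar> + ennreal \<bar>U w\<bar>" by (rule ennreal_plus) auto
     finally show ?case
      using t by (auto simp: indicator_def)
    qed
    also have "... = iB (ball x (2 * t)) (%y. \<bar>U y - U w\<bar>) + ennreal b * ennreal \<bar>U w\<bar>"
     by (subst nn_integral_add) (auto simp: nn_integral_cmult_indicator emeasure_ball_eq b_def mult.commute)
    finally show "iB (ball x t) (%y. \<bar>U y\<bar>) * indicator (ball x (2 * t)) w <=
     iB (ball x (2 * t)) (%y. \<bar>U y - U w\<bar>) * indicator (ball x (2 * t)) w + ennreal b * (ennreal \<bar>U w\<bar> * indicator (ball x (2 * t)) w)"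
     by (auto simp: indicator_def)
   qed
   also have "... = dosc U (ball x (2 * t)) + ennreal b * ennreal (I (2 * t))"
   proof -
    have "(%w. (iB (ball x (2 * t)) (%y. \<bar>U y - U w\<bar>)) * indicator (ball x (2 * t)) w) \<in> borel_measurable lborel"
     by measurable
    then show ?thesis by (subst nn_integral_add) (auto simp: nn_integral_cmult nI)
   qed
   also have "... <= ennreal (K * (2 ^ DIM('a) * b)\<^sup>2) + ennreal b * ennreal (I (2 * t))"
    using osc[rule_format, of "2 * t"] t b by (intro add_right_mono) simp
   also have "... = ennreal (K * (2 ^ DIM('a) * b)\<^sup>2 + b * I (2 * t))"
   proof -
    have "ennreal (K * (2 ^ DIM('a) * b)\<^sup>2 + b * I (2 * t)) = ennreal (K * (2 ^ DIM('a) * b)\<^sup>2) + ennreal (b * I (2 * t))"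
     by (rule ennreal_plus) (use K b I0 in auto)
    also have "ennreal (b * I (2 * t)) = ennreal b * ennreal (I (2 * t))" by (rule ennreal_mult) (use b I0 in auto)
    finally show ?thesis by simp
   qed
   finally have "2 ^ DIM('a) * b * I t <= K * (2 ^ DIM('a) * b)\<^sup>2 + b * I (2 * t)"
    using K b I0 by (subst (asm) ennreal_le_iff) auto
   then have "b * (2 ^ DIM('a) * I t) <= b * (2 ^ DIM('a) * (2 ^ DIM('a) * K * b) + I (2 * t))"
    by (simp add: power2_eq_square algebra_simps)
   then have "2 ^ DIM('a) * I t <= 2 ^ DIM('a) * (2 ^ DIM('a) * K * b) + I (2 * t)"
    using b(1) by (simp only: mult_le_cancel_left_pos)
   then show ?thesis by (simp add: b_def field_simps)
  qed
  have main: "t * I t <= M * vol (ball x t)" if "0 < t" "t <= d" "d / 2 ^ Suc j <= t" for t and j :: nat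
   using that
  proof (induction j arbitrary: t)
   case 0
   have "J / (v * (d / 2) ^ DIM('a)) <= M" by (simp add: M_def)
   then have "J <= M * (v * (d / 2) ^ DIM('a))" using v d by (simp add: divide_le_eq)
   also have "... <= M * (v * t ^ DIM('a))" using M0 v d 0 by (intro mult_left_mono power_mono) auto
   finally have "I t <= M * vol (ball x t)" using IJ[of t] 0 by (simp add: m)
   moreover have "t * I t <= 1 * I t" using 0 d I0 by (intro mult_right_mono) auto
   ultimately show ?case by simp
  next
   case (Suc j)
   show ?case
   proof (cases "d / 2 ^ Suc j <= t")
    case True
    then show ?thesis using Suc by auto
   next
    case False
    have "d / 2 ^ Suc j <= d / 2" using d by (intro divide_left_mono) auto
    then have t2: "2 * t <= d" using False by simp
    define b where "b = vol (ball x t)"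
    have b: "0 < b" "vol (ball x (2 * t)) = 2 ^ DIM('a) * b"
     using Suc v by (auto simp: b_def m power_mult_distrib)
    have IH: "2 * t * I (2 * t) <= M * (2 ^ DIM('a) * b)" unfolding b(2)[symmetric] by (rule Suc.IH) (use Suc t2 in \<open>auto simp: field_simps\<close>)
    have "t * I t <= t * (2 ^ DIM('a) * K * b + I (2 * t) / 2 ^ DIM('a))"
     using doubling[OF Suc.prems(1) t2] Suc.prems(1) by (intro mult_left_mono) (auto simp: b_def)
    also have "... = t * (2 ^ DIM('a) * K) * b + (2 * t * I (2 * t)) / (2 * 2 ^ DIM('a))" by (simp add: field_simps)
    also have "... <= 1 * (M / 2) * b + M * (2 ^ DIM('a) * b) / (2 * 2 ^ DIM('a))"
    proof (intro add_mono mult_right_mono divide_right_mono IH mult_mono)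
     show "2 ^ DIM('a) * K <= M / 2" by (simp add: M_def)
    qed (use b K M0 Suc.prems d in auto)
    also have "... = M * b" by (simp add: field_simps)
    finally show ?thesis by (simp add: b_def)
   qed
  qed
  have "\<exists>j. d / 2 ^ Suc j <= \<rho>"
  proof -
   obtain j where "d / \<rho> < 2 ^ j" using real_arch_pow[of 2 "d / \<rho>"] by auto
   moreover have "(2::real) ^ j <= 2 ^ Suc j" by simp
   ultimately have "d / \<rho> <= 2 ^ Suc j" by linarith
   then show ?thesis using \<rho> by (intro exI[of _ j]) (simp add: field_simps)
  qed
  then obtain j where "d / 2 ^ Suc j <= \<rho>" by blast
  from main[OF \<rho> this] have "I \<rho> <= M / \<rho> * vol (ball x \<rho>)" using \<rho> by (simp add: field_simps)
  then show "iB (ball x \<rho>) (%w. \<bar>U w\<bar>) <= ennreal (M / \<rho> * vol (ball x \<rho>))"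
   by (simp add: nI ennreal_leI)
 qed
qed

text \<open>Carries a bound on \<open>u\<close>, stated by Bochner integrals over
  \<open>lebesgue\<close>, to the representative \<open>U\<close> as an extended integral.
  Integrability of the oscillation comes from \<open>U\<close>, so the given integral is a true one
  and not a default value.\<close>

lemma mean_oscillation_rep:
 fixes U u :: "'a::euclidean_space => real"
 assumes i: "integrable lborel U" and ae: "AE y in lborel. y \<in> ball x r --> U y = u y" and r: "0 < r"
  and osc: "ball_avg (%y. \<bar>u y - c\<bar>) (ball x r) <= C"
 shows "iB (ball x r) (%y. \<bar>U y - c\<bar>) <= ennreal (C * vol (ball x r))"
proof -
 have [measurable]: "U \<in> borel_measurable borel" using i by auto
 define f where "f y = indicator (ball x r) y *\<^sub>R \<bar>U y - c\<bar>" for y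
 define g where "g y = indicator (ball x r) y *\<^sub>R \<bar>u y - c\<bar>" for y
 have ic: "integrable lborel (%y. indicator (ball x r) y * c)"
  using emeasure_lborel_ball_finite[of x r] by (intro integrable_mult_left) (simp add: integrable_indicator_iff)
 have [measurable]: "ball x r \<in> sets borel" by simp
 have [measurable]: "f \<in> borel_measurable borel" unfolding f_def[abs_def] by measurable
 have fi: "integrable lborel f"
 proof (rule Bochner_Integration.integrable_bound)
  show "integrable lborel (%y. \<bar>U y\<bar> + \<bar>indicator (ball x r) y * c\<bar>)" using i ic by auto
  show "AE y in lborel. norm (f y) <= norm (\<bar>U y\<bar> + \<bar>indicator (ball x r) y * c\<bar>)" by (auto simp: f_def indicator_def)
 qed measurable
 have fl: "f \<in> borel_measurable lebesgue" using fi by (intro measurable_completion) auto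
 have aefg: "AE y in lebesgue. f y = g y"
  by (rule AE_completion) (use ae in \<open>auto elim!: eventually_mono simp: f_def g_def indicator_def\<close>)
 have m0: "0 < vol (ball x r)" using r by (simp add: content_ball_pos)
 have "LL (%y. g y) / measure lebesgue (ball x r) <= C"
  using osc by (simp add: ball_avg_def set_lebesgue_integral_def g_def)
 then have "LL (%y. g y) <= C * vol (ball x r)" using m0 by (simp add: divide_le_eq)
 also have "LL (%y. g y) = LL (%y. f y)"
  by (rule integral_cong_AE[OF lebesgue_measurable_AE[OF fl aefg] fl]) (use aefg in \<open>auto elim!: eventually_mono\<close>)
 also have "... = LB (%y. f y)" using fi by (intro integral_completion) auto
 finally have "ennreal (LB (%y. f y)) <= ennreal (C * vol (ball x r))" by (rule ennreal_leI)
 moreover have "iB (ball x r) (%y. \<bar>U y - c\<bar>) = IB (%y. f y)"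
  by (rule nn_integral_cong) (auto simp: f_def indicator_def)
 moreover have "... = ennreal (LB (%y. f y))" by (rule nn_integral_eq_integral[OF fi]) (auto simp: f_def)
 ultimately show ?thesis by simp
qed

lemma (in phi_A1) quasiminimizer_holder:
 assumes qm: "quasiminimizer \<phi> \<Omega> Q u" and Q: "1 <= Q" and cs: "\<Omega>' \<Subset> \<Omega>"
  and alt: "s = real DIM('a) \<and> BMO \<Omega> u \<or> s < real DIM('a) \<and> in_Lp (real DIM('a) * s / (real DIM('a) - s)) \<Omega> u"
 shows "\<exists>w. (AE x in lebesgue. x \<in> \<Omega> --> u x = w x) \<and>
  holder_on (holder_exp (local_qm_osc.osc_steps TYPE('a) p q L L\<omega> Q 1)) \<Omega>' w"
proof -
 have uW: "in_W1phi_loc \<phi> \<Omega> u" using qm by (simp add: quasiminimizer_def)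
 obtain gu where gu: "weak_grad \<Omega> u gu" "!!U. open U ==> U \<Subset> \<Omega> ==> set_integrable lebesgue U u \<and>
   set_integrable lebesgue U (%x. norm (gu x)) \<and> in_Lphi \<phi> U u \<and> in_Lphi \<phi> U (%x. norm (gu x))"
  by (rule W1phi_loc_gradient[OF open_Omega uW], rule that)
 obtain C :: "nat => 'a set" where C: "!!n. compact (C n)" "!!n. C n \<subseteq> \<Omega>"
  "!!n. C n \<subseteq> interior (C (Suc n))" "!!K. compact K ==> K \<subseteq> \<Omega> ==> \<exists>N. \<forall>n\<ge>N. K \<subseteq> C n"
  by (rule open_Union_compact_subsets[OF open_Omega], rule that)
 define K where "K = closure \<Omega>'"
 have K: "compact K" "K \<subseteq> \<Omega>" using cs by (auto simp: cpt_sub_def K_def)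
 obtain N where N: "K \<subseteq> C N" using C(4)[OF K] by blast
 \<comment> \<open>Two nested neighbourhoods: the BMO growth estimate for a ball in \<open>V\<close>
   also looks at concentric balls up to radius \<open>d\<close>, which may leave \<open>V\<close>
   but stay in \<open>V2\<close>.\<close>
 define V V2 where "V = interior (C (Suc N))" and "V2 = interior (C (Suc (Suc N)))"
 have cl: "closure (interior (C n)) \<subseteq> C n" for n
  by (rule closure_minimal[OF interior_subset]) (rule compact_imp_closed[OF C(1)])
 have cpt: "interior (C n) \<Subset> \<Omega>" for n unfolding cpt_sub_def
  using cl[of n] C(1,2)[of n] compact_closure bounded_subset[OF compact_imp_bounded[OF C(1)] interior_subset] by blast
 have V: "open V" "V \<Subset> \<Omega>" "K \<subseteq> V" and V2: "open V2" "V2 \<Subset> \<Omega>" "V \<subseteq> V2"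
  using cpt N C(3) interior_subset unfolding V_def V2_def by blast+
 have V2O: "V2 \<subseteq> \<Omega>" using C(2) interior_subset unfolding V2_def by blast
 have "C (Suc N) \<inter> - V2 = {}" "closed (- V2)" using C(3)[of "Suc N"] V2(1) by (auto simp: V2_def)
 from separate_compact_closed[OF C(1) this(2,1)]
 obtain d0 where d0: "0 < d0" "!!x y. x \<in> C (Suc N) ==> y \<in> - V2 ==> d0 <= dist x y" by blast
 define d where "d = min d0 1"
 have d: "0 < d" "d <= 1" using d0 by (auto simp: d_def)
 have dV: "ball x t \<subseteq> V2" if x: "x \<in> V" and t: "t <= d" for x t
 proof
  fix y assume "y \<in> ball x t"
  then have "dist x y < d0" using t by (simp add: d_def)
  moreover have "x \<in> C (Suc N)" using x interior_subset by (auto simp: V_def)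
  ultimately show "y \<in> V2" using d0(2)[of x y] by force
 qed
 obtain U G where U: "W U G" "AE x in lborel. x \<in> V2 --> U x = u x" "AE x in lborel. x \<in> V2 --> G x = gu x"
  by (rule weak_grad_local_rep[OF gu(1) open_Omega V2(1,2)], rule that)
 note [measurable] = W_measurable[OF U(1)]
 note iU = W_integrable(1)[OF U(1)]
 have aeV: "AE x in lborel. x \<in> V --> U x = u x" "AE x in lborel. x \<in> V --> G x = gu x"
  by (rule eventually_mono[OF U(2)], use V2(3) in blast) (rule eventually_mono[OF U(3)], use V2(3) in blast)
 have lq: "local_qm \<phi> \<Omega> p q L s L\<omega> U G V Q"
  by (rule quasiminimizer_local_qm[OF qm Q gu(1) _ V(1,2) U(1) aeV]) (use gu(2) in auto)
 have "\<exists>M\<ge>1. \<forall>x \<rho>. 0 < \<rho> --> \<rho> <= d --> ball x \<rho> \<subseteq> V -->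
   dosc U (ball x \<rho>) <= ennreal (M * \<rho> powr (1 - real DIM('a) / s) * (vol (ball x \<rho>))\<^sup>2) \<and>
   (iB (ball x \<rho>) (%w. \<bar>U w\<bar>)) <= ennreal (M * \<rho> powr (- (real DIM('a) / s)) * vol (ball x \<rho>))"
  using alt
 proof
  assume a: "s = real DIM('a) \<and> BMO \<Omega> u"
  then obtain c where c: "!!z r. 0 < r ==> ball z r \<subseteq> \<Omega> ==> ball_avg (%x. \<bar>u x - ball_avg u (ball z r)\<bar>) (ball z r) <= c"
   unfolding BMO_def by blast
  define c' where "c' = max c 0"
  have osc: "dosc U (ball x t) <= ennreal (2 * c' * (vol (ball x t))\<^sup>2)"
   if t: "0 < t" "ball x t \<subseteq> V2" for x t
  proof (rule double_osc_le)
   have "ball x t \<subseteq> \<Omega>" using t V2O by blast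
   from c[OF t(1) this] have "ball_avg (%y. \<bar>u y - ball_avg u (ball x t)\<bar>) (ball x t) <= c'" by (simp add: c'_def)
   then show "iB (ball x t) (%y. \<bar>U y - ball_avg u (ball x t)\<bar>) <= ennreal (c' * vol (ball x t))"
    by (intro mean_oscillation_rep[OF iU _ t(1)]) (use U(2) t(2) in \<open>auto elim!: eventually_mono\<close>)
  qed (auto simp: c'_def)
  have c0: "0 <= 2 * c'" by (simp add: c'_def)
  obtain M where M: "!!x \<rho>. (!!t. 0 < t ==> t <= d ==>
   dosc U (ball x t) <= ennreal (2 * c' * (vol (ball x t))\<^sup>2)) ==>
   0 < \<rho> ==> \<rho> <= d ==> (iB (ball x \<rho>) (%w. \<bar>U w\<bar>)) <= ennreal (M / \<rho> * vol (ball x \<rho>))"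
   using osc_average_growth[OF iU c0 d] by auto
  define M1 where "M1 = max 1 (max (2 * c') M)"
  have ns: "real DIM('a) / s = 1" using a s1 by simp
  show ?thesis
  proof (intro exI[of _ M1] conjI allI impI)
   show "1 <= M1" by (simp add: M1_def)
   fix x \<rho> assume \<rho>: "0 < \<rho>" "\<rho> <= d" "ball x \<rho> \<subseteq> V"
   have xV: "x \<in> V" using \<rho> by auto
   have "2 * c' * (vol (ball x \<rho>))\<^sup>2 <= M1 * \<rho> powr (1 - real DIM('a) / s) * (vol (ball x \<rho>))\<^sup>2"
    using \<rho>(1) unfolding ns by (intro mult_right_mono) (auto simp: M1_def)
   then show "dosc U (ball x \<rho>) <= ennreal (M1 * \<rho> powr (1 - real DIM('a) / s) * (vol (ball x \<rho>))\<^sup>2)"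
    using osc[OF \<rho>(1) dV[OF xV \<rho>(2)]] by (meson ennreal_leI order_trans)
   have "M / \<rho> * vol (ball x \<rho>) <= M1 * \<rho> powr (- (real DIM('a) / s)) * vol (ball x \<rho>)"
    using \<rho>(1) unfolding ns by (intro mult_right_mono) (auto simp: M1_def powr_minus_divide divide_right_mono)
   moreover have "iB (ball x \<rho>) (%w. \<bar>U w\<bar>) <= ennreal (M / \<rho> * vol (ball x \<rho>))"
    by (rule M[OF osc \<rho>(1,2)]) (use dV[OF xV] in auto)
   ultimately show "iB (ball x \<rho>) (%w. \<bar>U w\<bar>) <= ennreal (M1 * \<rho> powr (- (real DIM('a) / s)) * vol (ball x \<rho>))"
    by (meson ennreal_leI order_trans)
  qed
 next
  assume a: "s < real DIM('a) \<and> in_Lp (real DIM('a) * s / (real DIM('a) - s)) \<Omega> u"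
  define r where "r = real DIM('a) * s / (real DIM('a) - s)"
  have sn': "0 < real DIM('a) - s" using a by simp
  \<comment> \<open>The critical exponent is exactly the one for which
    \<open>Lp_average_bound\<close> produces the power \<open>1 - real DIM('a) / s\<close> demanded
    by \<open>osc1\<close>.\<close>
  have r: "1 <= r" "real DIM('a) / r = real DIM('a) / s - 1"
  proof -
   have "real DIM('a) * 1 <= real DIM('a) * s" using s1 by (intro mult_left_mono) auto
   then have "real DIM('a) - s <= real DIM('a) * s" using s1 by linarith
   then show "1 <= r" using sn' by (simp add: r_def)
   show "real DIM('a) / r = real DIM('a) / s - 1" using sn' s1 by (simp add: r_def field_simps)
  qed
  have "iB V2 (%y. \<bar>U y\<bar> powr r) = iL V2 (%y. \<bar>U y\<bar> powr r)"
   by (simp add: nn_integral_completion)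
  also have "... = iL V2 (%y. \<bar>u y\<bar> powr r)"
   by (rule nn_integral_cong_AE, rule AE_completion) (use U(2) in \<open>auto elim!: eventually_mono simp: indicator_def\<close>)
  also have "... <= iL \<Omega> (%y. \<bar>u y\<bar> powr r)"
   by (rule nn_integral_mono) (use V2O in \<open>auto simp: indicator_def\<close>)
  also have "... < \<infinity>" using a by (simp add: in_Lp_def r_def)
  finally obtain J where J: "0 <= J" "iB V2 (%y. \<bar>U y\<bar> powr r) = ennreal J"
   by (metis infinity_ennreal_def less_top_ennreal)
  define c where "c = 1 + J / unit_ball_vol (real DIM('a))"
  have c: "1 <= c" using J by (simp add: c_def)
  have avg: "iB (ball x \<rho>) (%y. \<bar>U y\<bar>) <= ennreal (c * \<rho> powr (1 - real DIM('a) / s) * vol (ball x \<rho>))"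
   if \<rho>: "0 < \<rho>" "ball x \<rho> \<subseteq> V" for x \<rho>
  proof -
   have "iB (ball x \<rho>) (%y. \<bar>U y\<bar> powr r) <= ennreal J"
    unfolding J(2)[symmetric] by (rule nn_integral_mono) (use \<rho>(2) V2(3) in \<open>auto simp: indicator_def\<close>)
   from Lp_average_bound[OF _ r(1) J(1) this \<rho>(1)] show ?thesis by (simp add: r(2) c_def)
  qed
  show ?thesis
  proof (intro exI[of _ "2 * c"] conjI allI impI)
   show "1 <= 2 * c" using c by simp
   fix x \<rho> assume \<rho>: "0 < \<rho>" "\<rho> <= d" "ball x \<rho> \<subseteq> V"
   have "dosc U (ball x \<rho>) <= ennreal (2 * (c * \<rho> powr (1 - real DIM('a) / s)) * (vol (ball x \<rho>))\<^sup>2)"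
    by (rule double_osc_le[where c = 0]) (use avg[OF \<rho>(1,3)] c in auto)
   then show "dosc U (ball x \<rho>) <= ennreal (2 * c * \<rho> powr (1 - real DIM('a) / s) * (vol (ball x \<rho>))\<^sup>2)"
    by (simp add: mult.assoc)
   have "\<rho> powr (1 - real DIM('a) / s) <= \<rho> powr (- (real DIM('a) / s))"
    using \<rho> d by (intro powr_mono') auto
   then have "c * \<rho> powr (1 - real DIM('a) / s) * vol (ball x \<rho>) <= 2 * c * \<rho> powr (- (real DIM('a) / s)) * vol (ball x \<rho>)"
    using c by (intro mult_right_mono mult_mono) auto
   then show "iB (ball x \<rho>) (%w. \<bar>U w\<bar>) <= ennreal (2 * c * \<rho> powr (- (real DIM('a) / s)) * vol (ball x \<rho>))"
    using avg[OF \<rho>(1,3)] by (meson ennreal_leI order_trans)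
  qed
 qed
 then obtain M where M: "local_qm_osc \<phi> \<Omega> p q L s L\<omega> U G V Q M d"
  using lq d by (auto intro!: local_qm_osc.intro local_qm_osc_axioms.intro)
 define \<gamma> where "\<gamma> = holder_exp (local_qm_osc.osc_steps TYPE('a) p q L L\<omega> Q 1)"
 define rep where "rep = local_qm_osc.ball_rep U"
 \<comment> \<open>The representative is changed only on \<open>V\<close>, where it agrees with
   \<open>u\<close> almost everywhere; \<open>V\<close> contains the closure of the target
   set.\<close>
 define w where "w x = (if x \<in> V then rep x else u x)" for x
 have "AE x in lborel. x \<in> V --> rep x = U x" unfolding rep_def by (rule local_qm_osc.ball_rep_AE[OF M])
 then have "AE x in lborel. u x = w x" using aeV(1) by eventually_elim (simp add: w_def)
 then have "AE x in lebesgue. x \<in> \<Omega> --> u x = w x" by (intro AE_completion) (auto elim!: eventually_mono)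
 moreover have "holder_on \<gamma> \<Omega>' w"
 proof (rule holder_on_compact[OF K(1)])
  show "\<Omega>' \<subseteq> K" unfolding K_def by (rule closure_subset)
  show "0 <= \<gamma>" using holder_exp(1) less_imp_le unfolding \<gamma>_def by blast
  fix z assume z: "z \<in> K"
  then have zV: "z \<in> V" using V(3) by blast
  obtain \<rho> C where l: "0 < \<rho>" "0 <= C" "!!x. x \<in> ball z \<rho> ==> \<bar>rep x\<bar> <= C"
   "!!x y. x \<in> ball z \<rho> ==> y \<in> ball z \<rho> ==> \<bar>rep x - rep y\<bar> <= C * dist x y powr \<gamma>"
   by (rule local_qm_osc.local_holder[OF M zV, folded rep_def \<gamma>_def], rule that)
  obtain e where e: "0 < e" "ball z e \<subseteq> V" using V(1) zV open_contains_ball by blast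
  have wr: "w x = rep x" if "x \<in> ball z (min \<rho> e)" for x using that e(2) by (auto simp: w_def)
  show "\<exists>\<rho>>0. \<exists>C\<ge>0. (\<forall>x\<in>ball z \<rho>. \<bar>w x\<bar> <= C) \<and> (\<forall>x\<in>ball z \<rho>. \<forall>y\<in>ball z \<rho>. \<bar>w x - w y\<bar> <= C * dist x y powr \<gamma>)"
   by (intro exI[of _ "min \<rho> e"] exI[of _ C] conjI ballI) (use l e wr in auto)
 qed
 ultimately show ?thesis unfolding \<gamma>_def by blast
qed

theorem theorem3p10:
  fixes p q L L\<omega> Q :: real and \<Omega>' :: "'a::euclidean_space set"
  assumes "DIM('a) \<ge> 2" and "1 < p" and "p \<le> q" and "L \<ge> 1" and "L\<omega> > 0" and "Q \<ge> 1"
    and "open \<Omega>'"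
  shows "\<exists>\<gamma>. 0 < \<gamma> \<and> \<gamma> < 1 \<and>
    (\<forall>(\<Omega>::'a set) \<phi> s u.
       open \<Omega> \<and> connected \<Omega> \<and> bounded \<Omega> \<and> \<Omega>' \<Subset> \<Omega> \<and>
       Phi_w \<Omega> \<phi> \<and> A0 L \<Omega> \<phi> \<and> aInc p L \<Omega> \<phi> \<and> aDec q L \<Omega> \<phi> \<and>
       1 < s \<and> s \<le> real DIM('a) \<and> A1s s L\<omega> \<Omega> \<phi> \<and>
       quasiminimizer \<phi> \<Omega> Q u \<and>
       ((s = real DIM('a) \<and> BMO \<Omega> u) \<or>
        (real DIM('a) * (1 - p / q) < s \<and> s < real DIM('a) \<and>
         in_Lp (real DIM('a) * s / (real DIM('a) - s)) \<Omega> u))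
       \<longrightarrow> (\<exists>w. (AE x in lebesgue. x \<in> \<Omega> \<longrightarrow> u x = w x) \<and> holder_on \<gamma> \<Omega>' w))"
proof (intro exI[of _ "holder_exp (local_qm_osc.osc_steps TYPE('a) p q L L\<omega> Q 1)"] conjI holder_exp allI impI; elim conjE)
 \<comment> \<open>Outside its locale \<open>osc_steps\<close> takes only the dimension (through the
   type), \<open>p\<close>, \<open>q\<close>, \<open>L\<close>, \<open>L\<omega>\<close>,
   \<open>Q\<close> and the oscillation bound 1, so the witness could be given before the domain,
   \<open>\<phi>\<close>, \<open>s\<close> and \<open>u\<close>.\<close>
 fix \<Omega> :: "'a set" and \<phi> s u
 assume h: "open \<Omega>" "\<Omega>' \<Subset> \<Omega>" "Phi_w \<Omega> \<phi>" "A0 L \<Omega> \<phi>" "aInc p L \<Omega> \<phi>" "aDec q L \<Omega> \<phi>"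
  "1 < s" "s <= real DIM('a)" "A1s s L\<omega> \<Omega> \<phi>" "quasiminimizer \<phi> \<Omega> Q u"
  and alt: "(s = real DIM('a) \<and> BMO \<Omega> u) \<or>
    (real DIM('a) * (1 - p / q) < s \<and> s < real DIM('a) \<and>
    in_Lp (real DIM('a) * s / (real DIM('a) - s)) \<Omega> u)"
 have "phi_A1 \<phi> \<Omega> p q L s L\<omega>"
  using h assms by (intro phi_A1.intro phi_growth.intro phi_A1_axioms.intro)
 from phi_A1.quasiminimizer_holder[OF this h(10) assms(6) h(2)]
 show "\<exists>w. (AE x in lebesgue. x \<in> \<Omega> --> u x = w x) \<and>
  holder_on (holder_exp (local_qm_osc.osc_steps TYPE('a) p q L L\<omega> Q 1)) \<Omega>' w"
  using alt by blast
qed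

end
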